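(* Let $\varphi\in L^2(0,1)$, regarded as a $2$-periodic odd function on $\mathbb{R}$, let $\varphi_n(x)=\varphi(nx)$ for $n\in\mathbb{N}$, and set $D=S\varphi$ and $f=\mathfrak{B}^{-1}(D)$. The following statements are equivalent. (i) The system $\{\varphi_n\}_n$ is a Riesz sequence in $L^2(0,1)$. (ii) The function $f$ belongs to $H^\infty(\mathbb{T}^\infty)$ and there exist $\varepsilon>0$ and a set $B\subseteq\mathbb{T}^\infty$ of total measure such that $|f(z)|\ge\varepsilon$ for all $z\in B$. (iii) The Dirichlet series $D$ belongs to $\mathcal{H}^\infty$ and there exists $\varepsilon>0$ such that for almost all $(\gamma,t)\in\Xi\times\mathbb{R}$ we have $|D^\gamma(it)|\ge\varepsilon$. In this case (with $\varepsilon$ as in (ii) or (iii)), $$\varepsilon\Big(\sum|b_n|^2\Big)^{1/2}\le\Big\|\sum b_n\varphi_n\Big\|_{L^2(0,1)}\le\|D\|_{\mathcal{H}^\infty}\Big(\sum|b_n|^2\Big)^{1/2}$$ for every finite sequence of scalars $(b_n)$.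
   Context: All spaces are over $\mathbb{C}$. Let $e_n(x)=\sqrt2\sin(\pi nx)$, an orthonormal basis of $L^2(0,1)$. $\mathcal{H}^2$ is the Hilbert space of Dirichlet series $\sum_{n\ge1} a_n n^{-s}$ with $\|\cdot\|_{\mathcal{H}^2}=(\sum_n|a_n|^2)^{1/2}<\infty$, and $S:L^2(0,1)\to\mathcal{H}^2$ is the isometric isomorphism $S(\sum c_n e_n)=\sum c_n n^{-s}$. With $\mathbb{C}_0=\{s\in\mathbb{C}:\operatorname{Re}s>0\}$, $\mathcal{H}^\infty$ is the Banach space of Dirichlet series that define a bounded holomorphic function on $\mathbb{C}_0$, with norm $\|D\|_{\mathcal{H}^\infty}=\sup_{\operatorname{Re}s>0}|D(s)|$. A sequence $\{\varphi_n\}$ in a Hilbert space is a Riesz sequence if there are constants $0<A\le B$ with $A(\sum|c_n|^2)^{1/2}\le\|\sum c_n\varphi_n\|\le B(\sum|c_n|^2)^{1/2}$ for all finite scalar sequences $(c_n)$. $\mathbb{T}^\infty$ is the countably infinite product of the unit circle, with normalized Haar measure; "total measure" means measure $1$. For $g\in L^1(\mathbb{T}^\infty)$ and a finitely supported integer multi-index $\alpha$, $\widehat g(\alpha)=\int_{\mathbb{T}^\infty}g(w)w^{-\alpha}\,dw$. For $p=2,\infty$, $H^p(\mathbb{T}^\infty)=\{g\in L^p(\mathbb{T}^\infty):\widehat g(\alpha)=0\text{ unless all }\alpha_j\ge0\}$. Let $p_1<p_2<\cdots$ be the primes; for $n=p_1^{\alpha_1}\cdots p_m^{\alpha_m}$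 write $\alpha(n)=(\alpha_1,\dots,\alpha_m,0,\dots)$. The Bohr transform $\mathfrak{B}:H^2(\mathbb{T}^\infty)\to\mathcal{H}^2$ is the isometric isomorphism sending $g$ to $\sum_n\widehat g(\alpha(n))\,n^{-s}$; it restricts to an isometric isomorphism of $H^\infty(\mathbb{T}^\infty)$ onto $\mathcal{H}^\infty$. $\Xi$ is the set of characters, i.e. maps $\gamma:\mathbb{N}\to\mathbb{C}$ with $\gamma(mn)=\gamma(m)\gamma(n)$ and $|\gamma(n)|=1$ for all $m,n$; it is identified with $\mathbb{T}^\infty$ (hence carries Haar measure) through $\gamma\mapsto(\gamma(p_1),\gamma(p_2),\dots)$. For $D=\sum a_nn^{-s}$ and $\gamma\in\Xi$, $D^\gamma(s)=\sum a_n\gamma(n)n^{-s}$; if $D\in\mathcal{H}^\infty$ then $D^\gamma\in\mathcal{H}^\infty$ for all $\gamma$. For $t\in\mathbb{R}$, $D^\gamma(it):=\lim_{\sigma\to0^+}D^\gamma(\sigma+it)$; for $D\in\mathcal{H}^\infty$ and every $\gamma$ this limit exists for almost all $t$. When $f\in H^\infty(\mathbb{T}^\infty)$, the representative of $f$ is the one given by $f(w)=\lim_{\sigma\to0^+}D^w(\sigma)$ if the limit exists (it does for almost every $w$) and $f(w)=0$ otherwise. *)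

theory Defs
  imports "HOL-Analysis.Analysis" "HOL-Computational_Algebra.Primes" "HOL-Library.Infinite_Set"
begin

text \<open>
  Elements of \<open>L\<^sup>2\<close> and \<open>L\<^sup>\<infinity>\<close> are given by representing functions; every notion below that
  takes such a function depends only on its class modulo null sets.
\<close>

definition L2_space :: "'a measure \<Rightarrow> ('a \<Rightarrow> complex) set" where
  "L2_space M = {g \<in> borel_measurable M. integrable M (\<lambda>x. (cmod (g x))\<^sup>2)}"

definition L2_seminorm :: "'a measure \<Rightarrow> ('a \<Rightarrow> complex) \<Rightarrow> real" where
  "L2_seminorm M g = sqrt (LINT x|M. (cmod (g x))\<^sup>2)"

definition Linf_space :: "'a measure \<Rightarrow> ('a \<Rightarrow> complex) set" where
  "Linf_space M = {g \<in> borel_measurable M. \<exists>C. AE x in M. cmod (g x) \<le> C}"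

text \<open>Sequences are indexed by the positive integers; the member at index \<open>0\<close> is ignored.\<close>

definition riesz_sequence :: "'a measure \<Rightarrow> (nat \<Rightarrow> 'a \<Rightarrow> complex) \<Rightarrow> bool" where
  "riesz_sequence M \<phi> \<longleftrightarrow>
     (\<forall>n\<ge>1. \<phi> n \<in> L2_space M) \<and>
     (\<exists>A B. 0 < A \<and> A \<le> B \<and>
        (\<forall>(N::nat) (c :: nat \<Rightarrow> complex).
           A * sqrt (\<Sum>n=1..N. (cmod (c n))\<^sup>2) \<le> L2_seminorm M (\<lambda>x. \<Sum>n=1..N. c n * \<phi> n x) \<and>
           L2_seminorm M (\<lambda>x. \<Sum>n=1..N. c n * \<phi> n x) \<le> B * sqrt (\<Sum>n=1..N. (cmod (c n))\<^sup>2)))"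


subsection \<open>Dirichlet series\<close>

text \<open>
  The Dirichlet series with coefficients \<open>a\<^sub>n\<close>, \<open>n \<ge> 1\<close>, is represented by its coefficient
  sequence \<open>a\<close>, with \<open>a 0 = 0\<close>. The term at \<open>n = 0\<close> of \<open>dirichlet_sum a s\<close> vanishes, as
  \<open>0 powr z = 0\<close>.
\<close>

definition dirichlet_sum :: "(nat \<Rightarrow> complex) \<Rightarrow> complex \<Rightarrow> complex" where
  "dirichlet_sum a s = (\<Sum>n. a n * of_nat n powr (- s))"

definition Hinf :: "(nat \<Rightarrow> complex) set" where
  "Hinf = {a. a 0 = 0 \<and>
              (\<forall>s. Re s > 0 \<longrightarrow> summable (\<lambda>n. a n * of_nat n powr (- s))) \<and>
              dirichlet_sum a holomorphic_on {s. Re s > 0} \<and>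
              bounded (dirichlet_sum a ` {s. Re s > 0})}"

definition Hinf_norm :: "(nat \<Rightarrow> complex) \<Rightarrow> real" where
  "Hinf_norm a = (SUP s\<in>{s. Re s > 0}. cmod (dirichlet_sum a s))"

definition sine_basis :: "nat \<Rightarrow> real \<Rightarrow> real" where
  "sine_basis n x = sqrt 2 * sin (pi * real n * x)"

text \<open>
  The \<open>n\<close>-th coefficient of \<open>S \<phi>\<close> is the coefficient of \<open>\<phi>\<close> with respect to the orthonormal
  basis \<open>sine_basis n\<close>, \<open>n \<ge> 1\<close>; it is \<open>0\<close> for \<open>n = 0\<close> because \<open>sine_basis 0 = 0\<close>.
\<close>

definition sine_transform :: "(real \<Rightarrow> complex) \<Rightarrow> nat \<Rightarrow> complex" where
  "sine_transform \<phi> n = (LINT x|lebesgue_on {0<..<1}. \<phi> x * of_real (sine_basis n x))"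


subsection \<open>The infinite torus\<close>

definition circle_measure :: "complex measure" where
  "circle_measure =
     distr (uniform_measure lborel {0..1}) (restrict_space borel (sphere 0 1)) (\<lambda>t. cis (2 * pi * t))"

text \<open>The product of the normalized Haar measures on the circles is the normalized Haar measure.\<close>

definition torus :: "(nat \<Rightarrow> complex) measure" where
  "torus = (\<Pi>\<^sub>M j\<in>UNIV. circle_measure)"

definition torus_fourier :: "((nat \<Rightarrow> complex) \<Rightarrow> complex) \<Rightarrow> (nat \<Rightarrow> int) \<Rightarrow> complex" where
  "torus_fourier g \<alpha> = (LINT w|torus. g w * (\<Prod>j\<in>{j. \<alpha> j \<noteq> 0}. w j powi (- \<alpha> j)))"

definition analytic_spectrum :: "((nat \<Rightarrow> complex) \<Rightarrow> complex) \<Rightarrow> bool" where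
  "analytic_spectrum g \<longleftrightarrow>
     (\<forall>\<alpha>. finite {j. \<alpha> j \<noteq> 0} \<and> \<not> (\<forall>j. \<alpha> j \<ge> 0) \<longrightarrow> torus_fourier g \<alpha> = 0)"

definition hardy2_torus :: "((nat \<Rightarrow> complex) \<Rightarrow> complex) set" where
  "hardy2_torus = {g \<in> L2_space torus. analytic_spectrum g}"

definition hardy_inf_torus :: "((nat \<Rightarrow> complex) \<Rightarrow> complex) set" where
  "hardy_inf_torus = {g \<in> Linf_space torus. analytic_spectrum g}"


subsection \<open>The Bohr transform\<close>

text \<open>Primes are enumerated from index \<open>0\<close>, so \<open>nth_prime 0 = 2\<close>.\<close>

definition nth_prime :: "nat \<Rightarrow> nat" where
  "nth_prime = enumerate {p. prime p}"

definition prime_exponents :: "nat \<Rightarrow> nat \<Rightarrow> int" where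
  "prime_exponents n j = int (multiplicity (nth_prime j) n)"

definition bohr_transform :: "((nat \<Rightarrow> complex) \<Rightarrow> complex) \<Rightarrow> nat \<Rightarrow> complex" where
  "bohr_transform g n = (if n = 0 then 0 else torus_fourier g (prime_exponents n))"


subsection \<open>Characters and vertical limit functions\<close>

text \<open>
  Characters live on the positive integers; the value at \<open>0\<close> is fixed to be \<open>0\<close>, so that a
  character is determined by its values at positive arguments.
\<close>

definition characters :: "(nat \<Rightarrow> complex) set" where
  "characters = {\<gamma>. \<gamma> 0 = 0 \<and> (\<forall>m>0. \<forall>n>0. \<gamma> (m * n) = \<gamma> m * \<gamma> n) \<and> (\<forall>n>0. cmod (\<gamma> n) = 1)}"

definition character_coords :: "(nat \<Rightarrow> complex) \<Rightarrow> nat \<Rightarrow> complex" where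
  "character_coords \<gamma> j = \<gamma> (nth_prime j)"

text \<open>
  Haar measure is carried over from the torus along the inverse of the bijection
  \<open>character_coords\<close> from \<open>characters\<close> onto \<open>space torus\<close>.
\<close>

definition character_measure :: "(nat \<Rightarrow> complex) measure" where
  "character_measure = embed_measure torus (the_inv_into characters character_coords)"

definition twist :: "(nat \<Rightarrow> complex) \<Rightarrow> (nat \<Rightarrow> complex) \<Rightarrow> nat \<Rightarrow> complex" where
  "twist a \<gamma> n = a n * \<gamma> n"

text \<open>\<open>has_boundary_value a t L\<close>: the limit defining the value of \<open>a\<close> at \<open>\<i> t\<close> exists and is \<open>L\<close>.\<close>

definition has_boundary_value :: "(nat \<Rightarrow> complex) \<Rightarrow> real \<Rightarrow> complex \<Rightarrow> bool" where
  "has_boundary_value a t L \<longleftrightarrow>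
     ((\<lambda>\<sigma>::real. dirichlet_sum a (of_real \<sigma> + \<i> * of_real t)) \<longlongrightarrow> L) (at_right 0)"

end

(* By density of polynomials in cosines, the sine functions form an orthonormal basis of L^2(0,1).
   For odd 2-periodic functions the dilation x |-> nx is, up to a sign, composition with the
   measure-preserving folding of nx into [0,1]. Hence the linear map that sends sqrt 2 sin(pi k x)
   to the k-th Bohr character preserves norms and turns phi_n into f times the n-th Bohr character,
   so that ||sum b_n phi_n|| = ||f P|| for the analytic polynomial P = sum b_n w^alpha(n).
   Every trigonometric polynomial has the same modulus as an analytic one, so a bound
   A ||P|| <= ||f P|| <= B ||P|| for all analytic P amounts to A <= |f| <= B almost everywhere;
   this gives the equivalence of (i) and (ii).

   The Kronecker flow w |-> (p_j^(-it) w_j) on the torus links f to D: along a flow line, f has the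
   Poisson extension D^w(sigma + it). If f is bounded, a truncation kernel whose Fourier transform
   is 1 at ln 1, ..., ln N and 0 at the later logarithms bounds the partial sums, and the Poisson
   kernel bounds D. Conversely, if D is bounded by C, Fejer means of |D P|^2 on vertical lines
   compute norms on the torus, which yields ||f P|| <= C ||P||. Finally, Lebesgue differentiation
   along almost every flow line identifies the boundary values of D^w with the values of f. *)

theory Submission
  imports Defs "HOL-Probability.Probability" "HOL-Complex_Analysis.Complex_Analysis" "HOL-Real_Asymp.Real_Asymp"
begin

subsection \<open>Square-integrable functions\<close>

text \<open>Two obstacles shape the analytic half. A single flow line is a null set of the torus, so
  an almost everywhere statement cannot be used on it directly. Identities are therefore obtained
  from Fourier coefficients on the whole torus; continuity in w and the full support of Haar measure
  turn almost everywhere bounds into bounds everywhere, and Fubini with rotation invariance carries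
  null sets over to almost every flow line. The other obstacle is that, when only D is known to be
  bounded, no boundary function is at hand and the partial sums of D are not under uniform control.
  The way from D to f leads through Riesz means: divided by k they are bounded by the norm of D, and
  being finite sums they can be evaluated on Re s = 0. There the logarithms of distinct integers up
  to X are at least 1 / X apart, so one Fejer average computes a torus norm exactly. In the other
  direction the partial sums grow at most like log N, which Abel summation in Re s > 0 tolerates.
  All kernels come from (1 - cos t) / t^2, whose integral enters as a constant that is never
  evaluated.\<close>

definition L2_inner :: "'a measure \<Rightarrow> ('a \<Rightarrow> complex) \<Rightarrow> ('a \<Rightarrow> complex) \<Rightarrow> complex" where
  "L2_inner M f g = (LINT x|M. f x * cnj (g x))"

lemma measurable_cnj [measurable]: "cnj \<in> borel_measurable borel"
  by (intro borel_measurable_continuous_onI continuous_intros)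

lemma L2_spaceD [dest]:
  assumes "f \<in> L2_space M"
  shows "f \<in> borel_measurable M" "integrable M (\<lambda>x. (cmod (f x))\<^sup>2)"
  using assms by (auto simp: L2_space_def)

lemma L2_space_measurable [measurable_dest]: "f \<in> L2_space M \<Longrightarrow> f \<in> borel_measurable M"
  by (rule L2_spaceD)

lemma L2_space_dominated:
  assumes "f \<in> borel_measurable M" "integrable M g" "AE x in M. (cmod (f x))\<^sup>2 \<le> g x"
  shows "f \<in> L2_space M"
  unfolding L2_space_def
  using assms by (auto intro!: Bochner_Integration.integrable_bound[OF assms(2)])

lemma L2_space_cong_AE:
  assumes "f \<in> L2_space M" "g \<in> borel_measurable M" "AE x in M. f x = g x"
  shows "g \<in> L2_space M"
  using assms by (intro L2_space_dominated[where g = "\<lambda>x. (cmod (f x))\<^sup>2"]) auto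

text \<open>The weight s stays free: s = 1 gives closure of L2 under addition, and optimising s
  after integration gives the triangle inequality of the norm.\<close>

lemma cmod_add_square_le:
  fixes a b :: complex
  assumes "s > 0"
  shows "(cmod (a + b))\<^sup>2 \<le> (1 + s) * (cmod a)\<^sup>2 + (1 + 1 / s) * (cmod b)\<^sup>2"
proof -
  have "(cmod (a + b))\<^sup>2 \<le> (cmod a + cmod b)\<^sup>2"
    by (intro power_mono norm_triangle_ineq) auto
  also have "\<dots> \<le> (1 + s) * (cmod a)\<^sup>2 + (1 + 1 / s) * (cmod b)\<^sup>2"
  proof -
    have "0 \<le> (s * cmod a - cmod b)\<^sup>2 / s"
      using assms by simp
    also have "(s * cmod a - cmod b)\<^sup>2 / s = s * (cmod a)\<^sup>2 + (cmod b)\<^sup>2 / s - 2 * cmod a * cmod b"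
      using assms by (simp add: power2_eq_square field_simps)
    finally show ?thesis
      by (simp add: power2_eq_square algebra_simps)
  qed
  finally show ?thesis .
qed

lemma L2_space_add [intro]:
  assumes "f \<in> L2_space M" "g \<in> L2_space M"
  shows "(\<lambda>x. f x + g x) \<in> L2_space M"
proof (rule L2_space_dominated)
  show "AE x in M. (cmod (f x + g x))\<^sup>2 \<le> 2 * (cmod (f x))\<^sup>2 + 2 * (cmod (g x))\<^sup>2"
    using cmod_add_square_le[of 1] by auto
qed (use assms in \<open>auto simp: L2_space_def\<close>)

lemma L2_space_cmult [intro]: "f \<in> L2_space M \<Longrightarrow> (\<lambda>x. c * f x) \<in> L2_space M"
  unfolding L2_space_def by (auto simp: norm_mult power_mult_distrib)

lemma L2_space_uminus [intro]: "f \<in> L2_space M \<Longrightarrow> (\<lambda>x. - f x) \<in> L2_space M"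
  using L2_space_cmult[of f M "-1"] by simp

lemma L2_space_diff [intro]:
  assumes "f \<in> L2_space M" "g \<in> L2_space M"
  shows "(\<lambda>x. f x - g x) \<in> L2_space M"
  using L2_space_add[OF assms(1) L2_space_uminus[OF assms(2)]] by simp

lemma L2_space_zero [simp]: "(\<lambda>x. 0) \<in> L2_space M"
  unfolding L2_space_def by simp

lemma L2_space_sum [intro]:
  assumes "\<And>i. i \<in> I \<Longrightarrow> f i \<in> L2_space M"
  shows "(\<lambda>x. \<Sum>i\<in>I. f i x) \<in> L2_space M"
  using assms by (induction I rule: infinite_finite_induct) auto

lemma L2_space_bounded_mult:
  assumes "f \<in> L2_space M" "g \<in> borel_measurable M" "AE x in M. cmod (g x) \<le> C"
  shows "(\<lambda>x. f x * g x) \<in> L2_space M"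
proof (rule L2_space_dominated)
  show "AE x in M. (cmod (f x * g x))\<^sup>2 \<le> C\<^sup>2 * (cmod (f x))\<^sup>2"
    using assms(3)
  proof eventually_elim
    case (elim x)
    then have "(cmod (g x))\<^sup>2 \<le> C\<^sup>2" by (intro power_mono) auto
    then have "(cmod (f x))\<^sup>2 * (cmod (g x))\<^sup>2 \<le> (cmod (f x))\<^sup>2 * C\<^sup>2"
      by (intro mult_left_mono) auto
    then show ?case by (simp add: norm_mult power_mult_distrib mult.commute)
  qed
qed (use assms in \<open>auto simp: L2_space_def\<close>)

lemma (in finite_measure) L2_space_bounded:
  assumes "g \<in> borel_measurable M" "AE x in M. cmod (g x) \<le> C"
  shows "g \<in> L2_space M"
proof -
  have "(\<lambda>x. 1) \<in> L2_space M" unfolding L2_space_def by simp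
  from L2_space_bounded_mult[OF this assms] show ?thesis by simp
qed

lemma L2_seminorm_power2: "(L2_seminorm M f)\<^sup>2 = (LINT x|M. (cmod (f x))\<^sup>2)"
  unfolding L2_seminorm_def by simp

lemma L2_seminorm_nonneg [simp]: "0 \<le> L2_seminorm M f"
  unfolding L2_seminorm_def by simp

lemma L2_seminorm_cong_AE:
  assumes "f \<in> borel_measurable M" "g \<in> borel_measurable M" "AE x in M. cmod (f x) = cmod (g x)"
  shows "L2_seminorm M f = L2_seminorm M g"
  unfolding L2_seminorm_def using assms by (intro arg_cong[where f = sqrt] integral_cong_AE) auto

lemma L2_seminorm_cmult: "L2_seminorm M (\<lambda>x. c * f x) = cmod c * L2_seminorm M f"
  unfolding L2_seminorm_def by (simp add: norm_mult power_mult_distrib real_sqrt_mult)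

lemma L2_seminorm_minus_commute:
  "L2_seminorm M (\<lambda>x. f x - g x) = L2_seminorm M (\<lambda>x. g x - f x)"
  unfolding L2_seminorm_def by (simp add: norm_minus_commute)

lemma L2_seminorm_le_bounded_mult:
  assumes "f \<in> L2_space M" "g \<in> borel_measurable M" "AE x in M. cmod (g x) \<le> C" "0 \<le> C"
  shows "L2_seminorm M (\<lambda>x. g x * f x) \<le> C * L2_seminorm M f"
proof (rule power2_le_imp_le)
  have "(LINT x|M. (cmod (f x * g x))\<^sup>2) \<le> (LINT x|M. C\<^sup>2 * (cmod (f x))\<^sup>2)"
  proof (rule integral_mono_AE)
    show "AE x in M. (cmod (f x * g x))\<^sup>2 \<le> C\<^sup>2 * (cmod (f x))\<^sup>2"
      using assms(3)
    proof eventually_elim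
      case (elim x)
      then have "(cmod (g x))\<^sup>2 \<le> C\<^sup>2" by (intro power_mono) auto
      then have "(cmod (f x))\<^sup>2 * (cmod (g x))\<^sup>2 \<le> (cmod (f x))\<^sup>2 * C\<^sup>2"
        by (intro mult_left_mono) auto
      then show ?case by (simp add: norm_mult power_mult_distrib mult.commute)
    qed
  qed (use assms L2_space_bounded_mult[OF assms(1-3)] in auto)
  then show "(L2_seminorm M (\<lambda>x. g x * f x))\<^sup>2 \<le> (C * L2_seminorm M f)\<^sup>2"
    by (simp add: L2_seminorm_power2 power_mult_distrib mult.commute)
qed (use assms in auto)

text \<open>Integrating the weighted inequality bounds the squared norm of the sum by (1 + s) a^2 +
  (1 + 1/s) b^2 for every s > 0; the infimum over s is (a + b)^2.\<close>

lemma L2_seminorm_triangle: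
  assumes "f \<in> L2_space M" "g \<in> L2_space M"
  shows "L2_seminorm M (\<lambda>x. f x + g x) \<le> L2_seminorm M f + L2_seminorm M g"
proof -
  define a where "a = L2_seminorm M f"
  define b where "b = L2_seminorm M g"
  have ab: "a \<ge> 0" "b \<ge> 0" by (auto simp: a_def b_def)
  have weighted: "(L2_seminorm M (\<lambda>x. f x + g x))\<^sup>2 \<le> (1 + s) * a\<^sup>2 + (1 + 1 / s) * b\<^sup>2" if "s > 0" for s
  proof -
    have "(LINT x|M. (cmod (f x + g x))\<^sup>2)
        \<le> (LINT x|M. (1 + s) * (cmod (f x))\<^sup>2 + (1 + 1 / s) * (cmod (g x))\<^sup>2)"
      using L2_spaceD(2)[OF assms(1)] L2_spaceD(2)[OF assms(2)] L2_spaceD(2)[OF L2_space_add[OF assms]]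
        cmod_add_square_le[OF that]
      by (intro integral_mono Bochner_Integration.integrable_add integrable_mult_right) auto
    also have "\<dots> = (1 + s) * a\<^sup>2 + (1 + 1 / s) * b\<^sup>2"
      using assms by (subst Bochner_Integration.integral_add) (auto simp: a_def b_def L2_seminorm_power2)
    finally show ?thesis by (simp add: L2_seminorm_power2)
  qed
  have "L2_seminorm M (\<lambda>x. f x + g x) \<le> a + b + \<delta>" if "\<delta> > 0" for \<delta>
  proof (rule power2_le_imp_le)
    \<comment> \<open>The optimal weight is b / a; the shifts by \<delta> / 2 keep numerator and
      denominator positive when one of the norms is zero.\<close>
    define s where "s = (b + \<delta> / 2) / (a + \<delta> / 2)"
    have pos: "a + \<delta> / 2 > 0" "b + \<delta> / 2 > 0" using ab that by auto
    have s: "s > 0" using pos by (simp add: s_def)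
    have "(1 + s) * a\<^sup>2 + (1 + 1 / s) * b\<^sup>2
        \<le> (1 + s) * (a + \<delta> / 2)\<^sup>2 + (1 + 1 / s) * (b + \<delta> / 2)\<^sup>2"
      using ab that s by (intro add_mono mult_left_mono power_mono) auto
    also have "\<dots> = (a + b + \<delta>)\<^sup>2"
    proof -
      have *: "(1 + v / u) * u\<^sup>2 + (1 + 1 / (v / u)) * v\<^sup>2 = (u + v)\<^sup>2" if "u > 0" "v > 0" for u v :: real
        using that by (simp add: power2_eq_square field_simps)
      show ?thesis
        unfolding s_def by (subst *[OF pos]) (simp add: algebra_simps)
    qed
    finally show "(L2_seminorm M (\<lambda>x. f x + g x))\<^sup>2 \<le> (a + b + \<delta>)\<^sup>2"
      using weighted[OF s] by linarith
  qed (use ab that in auto)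
  then show ?thesis
    unfolding a_def[symmetric] b_def[symmetric] by (rule field_le_epsilon)
qed

lemma L2_seminorm_triangle_diff:
  assumes "f \<in> L2_space M" "g \<in> L2_space M"
  shows "\<bar>L2_seminorm M f - L2_seminorm M g\<bar> \<le> L2_seminorm M (\<lambda>x. f x - g x)"
  using L2_seminorm_triangle[OF L2_space_diff[OF assms] assms(2)]
    L2_seminorm_triangle[OF L2_space_diff[OF assms(2,1)] assms(1)]
  by (simp add: L2_seminorm_minus_commute[of M g f])

lemma L2_seminorm_triangle3:
  assumes "f \<in> L2_space M" "g \<in> L2_space M" "h \<in> L2_space M"
  shows "L2_seminorm M (\<lambda>x. f x - h x)
       \<le> L2_seminorm M (\<lambda>x. f x - g x) + L2_seminorm M (\<lambda>x. g x - h x)"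
  using L2_seminorm_triangle[OF L2_space_diff[OF assms(1,2)] L2_space_diff[OF assms(2,3)]] by simp

lemma L2_seminorm_tendsto:
  assumes "\<And>n. g n \<in> L2_space M" "f \<in> L2_space M"
    and "((\<lambda>n. L2_seminorm M (\<lambda>x. g n x - f x)) \<longlongrightarrow> 0) F"
  shows "((\<lambda>n. L2_seminorm M (g n)) \<longlongrightarrow> L2_seminorm M f) F"
proof (rule LIM_zero_cancel, rule tendsto_rabs_zero_cancel)
  show "((\<lambda>n. \<bar>L2_seminorm M (g n) - L2_seminorm M f\<bar>) \<longlongrightarrow> 0) F"
    by (rule tendsto_sandwich[OF _ _ tendsto_const assms(3)])
      (use L2_seminorm_triangle_diff[OF assms(1,2)] in auto)
qed

section \<open>The inner product\<close>

lemma L2_inner_integrable: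
  assumes "f \<in> L2_space M" "g \<in> L2_space M"
  shows "integrable M (\<lambda>x. f x * cnj (g x))"
proof (rule Bochner_Integration.integrable_bound)
  show "integrable M (\<lambda>x. (cmod (f x))\<^sup>2 + (cmod (g x))\<^sup>2)"
    using assms by auto
  show "AE x in M. norm (f x * cnj (g x)) \<le> norm ((cmod (f x))\<^sup>2 + (cmod (g x))\<^sup>2)"
  proof (rule AE_I2)
    fix x
    have "2 * cmod (f x) * cmod (g x) \<le> (cmod (f x))\<^sup>2 + (cmod (g x))\<^sup>2"
      by (rule sum_squares_bound)
    moreover have "0 \<le> cmod (f x) * cmod (g x)" by simp
    moreover have "norm (f x * cnj (g x)) = cmod (f x) * cmod (g x)" by (simp add: norm_mult)
    moreover have "norm ((cmod (f x))\<^sup>2 + (cmod (g x))\<^sup>2) = (cmod (f x))\<^sup>2 + (cmod (g x))\<^sup>2" by simp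
    ultimately show "norm (f x * cnj (g x)) \<le> norm ((cmod (f x))\<^sup>2 + (cmod (g x))\<^sup>2)"
      by linarith
  qed
qed (use assms in measurable)

lemma L2_inner_self: "L2_inner M f f = of_real ((L2_seminorm M f)\<^sup>2)"
  unfolding L2_inner_def L2_seminorm_power2
  by (simp add: complex_norm_square[symmetric] del: of_real_power)

lemma L2_inner_commute: "L2_inner M f g = cnj (L2_inner M g f)"
  unfolding L2_inner_def by (subst Bochner_Integration.integral_cnj[symmetric]) (simp add: mult.commute)

lemma L2_inner_diff_left:
  assumes "f \<in> L2_space M" "g \<in> L2_space M" "h \<in> L2_space M"
  shows "L2_inner M (\<lambda>x. f x - g x) h = L2_inner M f h - L2_inner M g h"
  unfolding L2_inner_def using assms
  by (simp add: left_diff_distrib L2_inner_integrable)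

lemma L2_inner_cmult_left: "L2_inner M (\<lambda>x. c * f x) h = c * L2_inner M f h"
  unfolding L2_inner_def by (simp add: mult.assoc)

lemma L2_inner_cmult_right: "L2_inner M f (\<lambda>x. c * h x) = cnj c * L2_inner M f h"
  unfolding L2_inner_def by (simp add: mult_ac)

lemma L2_inner_sum_left:
  assumes "\<And>i. i \<in> I \<Longrightarrow> f i \<in> L2_space M" "h \<in> L2_space M"
  shows "L2_inner M (\<lambda>x. \<Sum>i\<in>I. f i x) h = (\<Sum>i\<in>I. L2_inner M (f i) h)"
  unfolding L2_inner_def using assms
  by (simp add: sum_distrib_right L2_inner_integrable)

lemma L2_inner_sum_right:
  assumes "\<And>i. i \<in> I \<Longrightarrow> f i \<in> L2_space M" "h \<in> L2_space M"
  shows "L2_inner M h (\<lambda>x. \<Sum>i\<in>I. f i x) = (\<Sum>i\<in>I. L2_inner M h (f i))"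
  using assms by (subst (1 2) L2_inner_commute) (simp add: L2_inner_sum_left)

subsection \<open>Orthonormal families\<close>

definition orthonormal_on :: "'a measure \<Rightarrow> ('i \<Rightarrow> 'a \<Rightarrow> complex) \<Rightarrow> 'i set \<Rightarrow> bool" where
  "orthonormal_on M e I \<longleftrightarrow>
     (\<forall>i\<in>I. e i \<in> L2_space M) \<and> (\<forall>i\<in>I. \<forall>j\<in>I. L2_inner M (e i) (e j) = of_bool (i = j))"

text \<open>The map \<open>m\<close> may identify indices, as (k, n) |-> k * n does in a Dirichlet
  product. The right-hand side does not mention \<open>e\<close>, so a formal combination has the
  same norm in every orthonormal system; this is how sines are compared with Bohr characters and
  vertical lines with the torus.\<close>

lemma orthonormal_norm_reindex:
  assumes e: "orthonormal_on M e I" and m: "\<And>j. j \<in> J \<Longrightarrow> m j \<in> I"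
  shows "of_real ((L2_seminorm M (\<lambda>x. \<Sum>j\<in>J. c j * e (m j) x))\<^sup>2)
       = (\<Sum>j\<in>J. \<Sum>k\<in>J. c j * cnj (c k) * of_bool (m j = m k))"
proof -
  have [simp]: "j \<in> J \<Longrightarrow> e (m j) \<in> L2_space M" for j
    using e m unfolding orthonormal_on_def by auto
  have "of_real ((L2_seminorm M (\<lambda>x. \<Sum>j\<in>J. c j * e (m j) x))\<^sup>2)
      = (\<Sum>j\<in>J. c j * (\<Sum>k\<in>J. cnj (c k) * L2_inner M (e (m j)) (e (m k))))"
    unfolding L2_inner_self[symmetric]
    by (simp add: L2_inner_sum_left L2_inner_sum_right L2_inner_cmult_left L2_inner_cmult_right
        L2_space_sum L2_space_cmult)
  also have "\<dots> = (\<Sum>j\<in>J. \<Sum>k\<in>J. c j * cnj (c k) * of_bool (m j = m k))"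
    unfolding sum_distrib_left
    using e m unfolding orthonormal_on_def by (intro sum.cong) auto
  finally show ?thesis .
qed

lemma orthonormal_norm:
  assumes e: "orthonormal_on M e I" and F: "finite F" "F \<subseteq> I"
  shows "(L2_seminorm M (\<lambda>x. \<Sum>i\<in>F. c i * e i x))\<^sup>2 = (\<Sum>i\<in>F. (cmod (c i))\<^sup>2)"
proof -
  have "complex_of_real ((L2_seminorm M (\<lambda>x. \<Sum>i\<in>F. c i * e i x))\<^sup>2)
      = (\<Sum>i\<in>F. \<Sum>j\<in>F. c i * cnj (c j) * of_bool (i = j))"
    using orthonormal_norm_reindex[OF e, of F "\<lambda>i. i" c] F by auto
  also have "\<dots> = (\<Sum>i\<in>F. c i * cnj (c i))"
    using F by (intro sum.cong) (auto simp: of_bool_def if_distrib cong: if_cong)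
  also have "\<dots> = of_real (\<Sum>i\<in>F. (cmod (c i))\<^sup>2)"
    by (simp only: of_real_sum complex_norm_square)
  finally show ?thesis using of_real_eq_iff by blast
qed

text \<open>Pythagoras with arbitrary coefficients \<open>c\<close>: taking Fourier coefficients
  yields Bessel's inequality, and the last sum is the price of any other choice.\<close>

lemma orthonormal_distance:
  assumes e: "orthonormal_on M e I" and F: "finite F" "F \<subseteq> I" and g: "g \<in> L2_space M"
  shows "(L2_seminorm M (\<lambda>x. g x - (\<Sum>i\<in>F. c i * e i x)))\<^sup>2
       = (L2_seminorm M g)\<^sup>2 - (\<Sum>i\<in>F. (cmod (L2_inner M g (e i)))\<^sup>2)
         + (\<Sum>i\<in>F. (cmod (c i - L2_inner M g (e i)))\<^sup>2)"
proof -
  define a where "a i = L2_inner M g (e i)" for i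
  define p where "p = (\<lambda>x. \<Sum>i\<in>F. c i * e i x)"
  have E: "j \<in> I \<Longrightarrow> e j \<in> L2_space M" for j
    using e unfolding orthonormal_on_def by auto
  have p: "p \<in> L2_space M"
    unfolding p_def using F E by (intro L2_space_sum L2_space_cmult) auto
  have gp: "L2_inner M g p = (\<Sum>i\<in>F. cnj (c i) * a i)"
    unfolding p_def a_def using F E g
    by (subst L2_inner_sum_right) (auto simp: L2_inner_cmult_right subset_iff intro!: sum.cong)
  have pg: "L2_inner M p g = (\<Sum>i\<in>F. c i * cnj (a i))"
    by (subst L2_inner_commute) (simp add: gp)
  have pp: "L2_inner M p p = (\<Sum>i\<in>F. c i * cnj (c i))"
  proof -
    have "(L2_seminorm M p)\<^sup>2 = (\<Sum>i\<in>F. (cmod (c i))\<^sup>2)"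
      unfolding p_def by (rule orthonormal_norm[OF e F])
    then show ?thesis
      by (simp only: L2_inner_self of_real_sum complex_norm_square)
  qed
  have "of_real ((L2_seminorm M (\<lambda>x. g x - p x))\<^sup>2)
      = L2_inner M (\<lambda>x. g x - p x) (\<lambda>x. g x - p x)" by (rule L2_inner_self[symmetric])
  also have "\<dots> = L2_inner M g (\<lambda>x. g x - p x) - L2_inner M p (\<lambda>x. g x - p x)"
    using g p by (intro L2_inner_diff_left) auto
  also have "L2_inner M g (\<lambda>x. g x - p x) = L2_inner M g g - L2_inner M g p"
    using L2_inner_diff_left[OF g p g] L2_inner_commute[of M g] by (metis complex_cnj_diff)
  also have "L2_inner M p (\<lambda>x. g x - p x) = L2_inner M p g - L2_inner M p p"
    using L2_inner_diff_left[OF g p p] L2_inner_commute[of M p] by (metis complex_cnj_diff)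
  also have "L2_inner M g g - L2_inner M g p - (L2_inner M p g - L2_inner M p p)
    = of_real ((L2_seminorm M g)\<^sup>2) - (\<Sum>i\<in>F. a i * cnj (a i)) + (\<Sum>i\<in>F. (c i - a i) * cnj (c i - a i))"
    unfolding gp pg pp unfolding L2_inner_self
    by (simp add: algebra_simps sum.distrib sum_subtractf)
  also have "\<dots> = of_real ((L2_seminorm M g)\<^sup>2 - (\<Sum>i\<in>F. (cmod (a i))\<^sup>2) + (\<Sum>i\<in>F. (cmod (c i - a i))\<^sup>2))"
    by (simp only: of_real_add of_real_diff of_real_sum complex_norm_square)
  finally show ?thesis unfolding p_def a_def using of_real_eq_iff by blast
qed

lemma orthonormal_bessel:
  assumes e: "orthonormal_on M e I" and F: "finite F" "F \<subseteq> I" and g: "g \<in> L2_space M"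
  shows "(\<Sum>i\<in>F. (cmod (L2_inner M g (e i)))\<^sup>2) \<le> (L2_seminorm M g)\<^sup>2"
  using orthonormal_distance[OF e F g, of "\<lambda>i. L2_inner M g (e i)"]
    zero_le_power2[of "L2_seminorm M (\<lambda>x. g x - (\<Sum>i\<in>F. L2_inner M g (e i) * e i x))"]
  by simp

lemma orthonormal_best_approximation:
  assumes e: "orthonormal_on M e I" and F: "finite F" "F \<subseteq> F'" "finite F'" "F' \<subseteq> I"
    and g: "g \<in> L2_space M"
  shows "L2_seminorm M (\<lambda>x. g x - (\<Sum>i\<in>F'. L2_inner M g (e i) * e i x))
       \<le> L2_seminorm M (\<lambda>x. g x - (\<Sum>i\<in>F. c i * e i x))"
proof (rule power2_le_imp_le)
  have "(\<Sum>i\<in>F. (cmod (L2_inner M g (e i)))\<^sup>2) \<le> (\<Sum>i\<in>F'. (cmod (L2_inner M g (e i)))\<^sup>2)"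
    using F by (intro sum_mono2) auto
  moreover have "0 \<le> (\<Sum>i\<in>F. (cmod (c i - L2_inner M g (e i)))\<^sup>2)"
    by (intro sum_nonneg) auto
  moreover have "F \<subseteq> I" using F by auto
  ultimately show "(L2_seminorm M (\<lambda>x. g x - (\<Sum>i\<in>F'. L2_inner M g (e i) * e i x)))\<^sup>2
       \<le> (L2_seminorm M (\<lambda>x. g x - (\<Sum>i\<in>F. c i * e i x)))\<^sup>2"
    using orthonormal_distance[OF e F(3,4) g] orthonormal_distance[OF e F(1) _ g] by simp
qed simp

subsection \<open>Density in \<open>L\<^sup>2\<close>\<close>

locale L2_subspace =
  fixes M :: "'a measure" and V :: "('a \<Rightarrow> complex) set"
  assumes in_L2: "p \<in> V \<Longrightarrow> p \<in> L2_space M"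
    and zero_mem: "(\<lambda>x. 0) \<in> V"
    and add_mem: "p \<in> V \<Longrightarrow> q \<in> V \<Longrightarrow> (\<lambda>x. p x + q x) \<in> V"
    and cmult_mem: "p \<in> V \<Longrightarrow> (\<lambda>x. c * p x) \<in> V"
begin

definition approximable :: "('a \<Rightarrow> complex) \<Rightarrow> bool" where
  "approximable g \<longleftrightarrow>
     g \<in> L2_space M \<and> (\<forall>e>0. \<exists>p\<in>V. L2_seminorm M (\<lambda>x. g x - p x) < e)"

lemma approximable_L2: "approximable g \<Longrightarrow> g \<in> L2_space M"
  by (simp add: approximable_def)

lemma approximable_mem: "p \<in> V \<Longrightarrow> approximable p"
  using in_L2 by (auto simp: approximable_def L2_seminorm_def intro!: bexI[of _ p])

lemma approximable_cong:
  assumes "approximable f" "g \<in> borel_measurable M" "\<And>x. x \<in> space M \<Longrightarrow> g x = f x"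
  shows "approximable g"
proof -
  have "L2_seminorm M (\<lambda>x. g x - p x) = L2_seminorm M (\<lambda>x. f x - p x)" for p
    unfolding L2_seminorm_def by (intro arg_cong[where f = sqrt] Bochner_Integration.integral_cong) (auto simp: assms)
  moreover have "g \<in> L2_space M"
    using assms by (intro L2_space_cong_AE[OF approximable_L2[OF assms(1)]]) auto
  ultimately show ?thesis
    using assms(1) by (simp add: approximable_def)
qed

lemma approximable_add:
  assumes "approximable f" "approximable g"
  shows "approximable (\<lambda>x. f x + g x)"
  unfolding approximable_def
proof (intro conjI allI impI)
  show "(\<lambda>x. f x + g x) \<in> L2_space M" using assms by (auto simp: approximable_def)
  fix e :: real assume "e > 0"
  then obtain p q where p: "p \<in> V" "L2_seminorm M (\<lambda>x. f x - p x) < e / 2"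
    and q: "q \<in> V" "L2_seminorm M (\<lambda>x. g x - q x) < e / 2"
    using assms unfolding approximable_def by (meson half_gt_zero)
  have "L2_seminorm M (\<lambda>x. (f x - p x) + (g x - q x))
      \<le> L2_seminorm M (\<lambda>x. f x - p x) + L2_seminorm M (\<lambda>x. g x - q x)"
    using assms p(1) q(1) in_L2 by (intro L2_seminorm_triangle) (auto simp: approximable_def)
  also have "\<dots> < e" using p q by simp
  also have "(\<lambda>x. (f x - p x) + (g x - q x)) = (\<lambda>x. f x + g x - (p x + q x))" by (simp add: algebra_simps)
  finally show "\<exists>p\<in>V. L2_seminorm M (\<lambda>x. f x + g x - p x) < e"
    using add_mem[OF p(1) q(1)] by (intro bexI)
qed

lemma approximable_cmult:
  assumes "approximable f"
  shows "approximable (\<lambda>x. c * f x)"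
  unfolding approximable_def
proof (intro conjI allI impI)
  show "(\<lambda>x. c * f x) \<in> L2_space M" using assms by (auto simp: approximable_def)
  fix e :: real assume "e > 0"
  then have "e / (cmod c + 1) > 0" by (intro divide_pos_pos) (auto simp: add_nonneg_pos)
  then obtain p where p: "p \<in> V" "L2_seminorm M (\<lambda>x. f x - p x) < e / (cmod c + 1)"
    using assms unfolding approximable_def by blast
  have "L2_seminorm M (\<lambda>x. c * (f x - p x)) = cmod c * L2_seminorm M (\<lambda>x. f x - p x)"
    by (rule L2_seminorm_cmult)
  also have "\<dots> \<le> (cmod c + 1) * L2_seminorm M (\<lambda>x. f x - p x)"
    by (intro mult_right_mono) auto
  also have "\<dots> < (cmod c + 1) * (e / (cmod c + 1))"
    using p(2) by (intro mult_strict_left_mono) (auto simp: add_nonneg_pos)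
  also have "\<dots> = e" by (metis add_nonneg_pos less_irrefl mult.commute nonzero_eq_divide_eq norm_ge_zero zero_less_one)
  also have "(\<lambda>x. c * (f x - p x)) = (\<lambda>x. c * f x - c * p x)" by (simp add: algebra_simps)
  finally show "\<exists>p\<in>V. L2_seminorm M (\<lambda>x. c * f x - p x) < e"
    using cmult_mem[OF p(1)] by (intro bexI)
qed

lemma approximable_diff:
  assumes "approximable f" "approximable g"
  shows "approximable (\<lambda>x. f x - g x)"
  using approximable_add[OF assms(1) approximable_cmult[OF assms(2), of "-1"]] by simp

lemma approximable_sum:
  assumes "\<And>i. i \<in> I \<Longrightarrow> approximable (f i)"
  shows "approximable (\<lambda>x. \<Sum>i\<in>I. f i x)"
  using assms
  by (induction I rule: infinite_finite_induct)
    (auto intro: approximable_add approximable_mem[OF zero_mem])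

lemma approximable_limit:
  assumes "\<And>n::nat. approximable (f n)" "g \<in> L2_space M"
    and "(\<lambda>n. L2_seminorm M (\<lambda>x. f n x - g x)) \<longlonglongrightarrow> 0"
  shows "approximable g"
  unfolding approximable_def
proof (intro conjI allI impI)
  fix e :: real assume "e > 0"
  then have "\<forall>\<^sub>F n in sequentially. L2_seminorm M (\<lambda>x. f n x - g x) < e / 2"
    using assms(3) by (intro order_tendstoD) auto
  then obtain n where n: "L2_seminorm M (\<lambda>x. f n x - g x) < e / 2"
    using eventually_happens trivial_limit_sequentially by blast
  obtain p where p: "p \<in> V" "L2_seminorm M (\<lambda>x. f n x - p x) < e / 2"
    using assms(1)[of n] \<open>e > 0\<close> unfolding approximable_def by (meson half_gt_zero)
  have "L2_seminorm M (\<lambda>x. g x - p x)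
      \<le> L2_seminorm M (\<lambda>x. g x - f n x) + L2_seminorm M (\<lambda>x. f n x - p x)"
    using assms(2) approximable_L2[OF assms(1)[of n]] in_L2[OF p(1)] by (rule L2_seminorm_triangle3)
  then show "\<exists>p\<in>V. L2_seminorm M (\<lambda>x. g x - p x) < e"
    using n p by (intro bexI[of _ p]) (auto simp: L2_seminorm_minus_commute[of M g])
qed (use assms in auto)

end

lemma L2_dominated_convergence:
  fixes f :: "nat \<Rightarrow> 'a \<Rightarrow> complex"
  assumes f: "\<And>n. f n \<in> borel_measurable M" and g: "g \<in> borel_measurable M"
    and h: "h \<in> L2_space M"
    and lim: "AE x in M. (\<lambda>n. f n x) \<longlonglongrightarrow> g x"
    and dom: "\<And>n. AE x in M. cmod (f n x - g x) \<le> cmod (h x)"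
  shows "(\<lambda>n. L2_seminorm M (\<lambda>x. f n x - g x)) \<longlonglongrightarrow> 0"
proof -
  have "(\<lambda>n. LINT x|M. (cmod (f n x - g x))\<^sup>2) \<longlonglongrightarrow> (LINT x|M. 0)"
  proof (rule integral_dominated_convergence[where w = "\<lambda>x. (cmod (h x))\<^sup>2"])
    show "AE x in M. (\<lambda>n. (cmod (f n x - g x))\<^sup>2) \<longlonglongrightarrow> 0"
      using lim
    proof eventually_elim
      case (elim x)
      then have "(\<lambda>n. cmod (f n x - g x)) \<longlonglongrightarrow> 0"
        by (intro tendsto_norm_zero LIM_zero)
      from tendsto_power[OF this, of 2] show ?case by simp
    qed
    show "AE x in M. norm ((cmod (f n x - g x))\<^sup>2) \<le> (cmod (h x))\<^sup>2" for n
      using dom[of n] by eventually_elim (auto intro!: power_mono)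
  qed (use f g h in auto)
  then have "(\<lambda>n. sqrt (LINT x|M. (cmod (f n x - g x))\<^sup>2)) \<longlonglongrightarrow> sqrt 0"
    by (intro tendsto_real_sqrt) simp
  then show ?thesis by (simp add: L2_seminorm_def)
qed

context L2_subspace
begin

text \<open>\<open>g\<close> is a pointwise limit of simple functions of modulus at most 2|g|, so
  the differences are dominated by 3|g| and the convergence holds in L2 as well. Simple functions
  are combinations of indicators.\<close>

theorem approximable_of_indicators:
  assumes fin: "finite_measure M"
    and ind: "\<And>A. A \<in> sets M \<Longrightarrow> approximable (indicator A)"
    and g: "g \<in> L2_space M"
  shows "approximable g"
proof -
  have gm: "g \<in> borel_measurable M" using g by auto
  from borel_measurable_implies_sequence_metric[OF gm, of 0] obtain s where
    s: "\<And>i. simple_function M (s i)"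
    and lim: "\<And>x. x \<in> space M \<Longrightarrow> (\<lambda>i. s i x) \<longlonglongrightarrow> g x"
    and bound: "\<And>i x. x \<in> space M \<Longrightarrow> norm (s i x) \<le> 2 * norm (g x)"
    by simp metis
  have sm [measurable]: "s i \<in> borel_measurable M" for i
    using s by (rule borel_measurable_simple_function)
  have "approximable (s i)" for i
  proof (rule approximable_cong)
    show "approximable (\<lambda>x. \<Sum>y\<in>s i ` space M. y * indicator (s i -` {y} \<inter> space M) x)"
      by (intro approximable_sum approximable_cmult ind) (auto intro: simple_functionD s)
    show "s i x = (\<Sum>y\<in>s i ` space M. y * indicator (s i -` {y} \<inter> space M) x)" if "x \<in> space M" for x
      using that simple_functionD(1)[OF s, of i]
      by (subst sum.remove[of _ "s i x"]) (auto intro!: sum.neutral split: split_indicator)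
  qed auto
  then show ?thesis
  proof (rule approximable_limit[OF _ g])
    show "(\<lambda>n. L2_seminorm M (\<lambda>x. s n x - g x)) \<longlonglongrightarrow> 0"
    proof (rule L2_dominated_convergence[where h = "\<lambda>x. 3 * g x"])
      show "AE x in M. cmod (s n x - g x) \<le> cmod (3 * g x)" for n
      proof (rule AE_I2)
        fix x assume "x \<in> space M"
        then show "cmod (s n x - g x) \<le> cmod (3 * g x)"
          using bound[of x n] norm_triangle_ineq4[of "s n x" "g x"] by (simp add: norm_mult)
      qed
    qed (use g lim gm in auto)
  qed
qed

end

section \<open>Star algebras of continuous functions: density and determination of measures\<close>

lemma Int_stable_open: "Int_stable {S :: 'a::topological_space set. open S}"
  by (auto simp: Int_stable_def)

lemma open_subset_Pow: "{S :: 'a::topological_space set. open S} \<subseteq> Pow UNIV"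
  by auto

text \<open>The functions min 1 (k * distance to the complement) are continuous and are eventually 1
  at each point of the open set.\<close>

lemma open_indicator_limit:
  fixes U :: "'a::metric_space set"
  assumes "open U"
  obtains f :: "nat \<Rightarrow> 'a \<Rightarrow> real" where
    "\<And>k. continuous_on UNIV (f k)" "\<And>k x. 0 \<le> f k x" "\<And>k x. f k x \<le> 1"
    "\<And>x. (\<lambda>k. f k x) \<longlonglongrightarrow> indicator U x"
\<comment> \<open>With empty complement \<open>infdist\<close> takes its default value 0, and the
  formula would give the zero function.\<close>
proof (cases "U = UNIV")
  case True
  show ?thesis by (rule that[of "\<lambda>k x. 1"]) (auto simp: True)
next
  case False
  show ?thesis
  proof (rule that[of "\<lambda>k x. min 1 (real k * infdist x (- U))"])
    fix x
    show "(\<lambda>k. min 1 (real k * infdist x (- U))) \<longlonglongrightarrow> indicator U x"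
    proof (cases "x \<in> U")
      case True
      have "infdist x (- U) > 0"
        using assms False True infdist_pos_not_in_closed[of "- U" x] by (auto simp: closed_def)
      then obtain k0 :: nat where k0: "1 < real k0 * infdist x (- U)"
        using reals_Archimedean3 by blast
      have "\<forall>\<^sub>F k in sequentially. min 1 (real k * infdist x (- U)) = indicator U x"
        using eventually_ge_at_top[of k0]
      proof eventually_elim
        case (elim k)
        have "real k0 * infdist x (- U) \<le> real k * infdist x (- U)"
          using elim by (intro mult_right_mono) (auto simp: infdist_nonneg)
        then show ?case using k0 True by simp
      qed
      then show ?thesis by (rule tendsto_eventually)
    qed (simp add: infdist_zero)
  qed (auto intro!: continuous_intros simp: infdist_nonneg)
qed

text \<open>Algebraic identities are demanded on \<open>T\<close> only: the families used later are
  functions on an ambient space, where for instance conjugation inverts a coordinate only if it has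
  modulus 1.\<close>

locale star_algebra_on =
  fixes V :: "('a::metric_space \<Rightarrow> complex) set" and T :: "'a set"
  assumes compact_T: "compact T"
    and cont: "p \<in> V \<Longrightarrow> continuous_on T p"
    and one: "\<exists>p\<in>V. \<forall>x\<in>T. p x = 1"
    and add: "p \<in> V \<Longrightarrow> q \<in> V \<Longrightarrow> (\<lambda>x. p x + q x) \<in> V"
    and cmult: "p \<in> V \<Longrightarrow> (\<lambda>x. c * p x) \<in> V"
    and mult: "p \<in> V \<Longrightarrow> q \<in> V \<Longrightarrow> \<exists>r\<in>V. \<forall>x\<in>T. r x = p x * q x"
    and conj: "p \<in> V \<Longrightarrow> \<exists>q\<in>V. \<forall>x\<in>T. q x = cnj (p x)"
    and separates: "x \<in> T \<Longrightarrow> y \<in> T \<Longrightarrow> x \<noteq> y \<Longrightarrow> \<exists>p\<in>V. p x \<noteq> p y"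
begin

text \<open>The real Stone-Weierstrass theorem is applied to the real functions that agree on
  \<open>T\<close> with a member of \<open>V\<close>. Closure under conjugation puts Re p and Im p =
  Re (- i p) among them, and one of these separates any two points that p separates.\<close>

lemma uniform_approximation:
  fixes f :: "'a \<Rightarrow> real"
  assumes f: "continuous_on T f" and e: "e > 0"
  shows "\<exists>p\<in>V. \<forall>x\<in>T. cmod (of_real (f x) - p x) < e"
proof -
  define R where "R = {f :: 'a \<Rightarrow> real. \<exists>p\<in>V. \<forall>x\<in>T. p x = of_real (f x)}"
  have R_I: "f \<in> R" if "p \<in> V" "\<And>x. x \<in> T \<Longrightarrow> p x = of_real (f x)" for p f
    unfolding R_def using that by (intro CollectI bexI[of _ p]) auto
  have re: "(\<lambda>x. Re (p x)) \<in> R" if "p \<in> V" for p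
  proof -
    from conj[OF that] obtain q where q: "q \<in> V" "\<forall>x\<in>T. q x = cnj (p x)" by blast
    have "(\<lambda>x. (1 / 2) * (p x + q x)) \<in> V"
      by (intro cmult add that q)
    then show ?thesis
      by (rule R_I) (use q(2) in \<open>simp add: complex_add_cnj\<close>)
  qed
  interpret function_ring_on R T
  proof
    show "compact T" by (rule compact_T)
    show "continuous_on T f" if "f \<in> R" for f
    proof -
      from that obtain p where p: "p \<in> V" "\<forall>x\<in>T. p x = of_real (f x)" unfolding R_def by blast
      have "continuous_on T (\<lambda>x. Re (p x))" using cont[OF p(1)] by (rule continuous_on_Re)
      then show ?thesis by (rule continuous_on_eq) (use p in auto)
    qed
    show "(\<lambda>x. f x + g x) \<in> R" if "f \<in> R" "g \<in> R" for f g
    proof -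
      from that(1) obtain p where p: "p \<in> V" "\<forall>x\<in>T. p x = of_real (f x)"
        unfolding R_def by blast
      from that(2) obtain q where q: "q \<in> V" "\<forall>x\<in>T. q x = of_real (g x)"
        unfolding R_def by blast
      show ?thesis
        by (rule R_I[OF add[OF p(1) q(1)]]) (use p q in simp)
    qed
    show "(\<lambda>x. f x * g x) \<in> R" if "f \<in> R" "g \<in> R" for f g
    proof -
      from that(1) obtain p where p: "p \<in> V" "\<forall>x\<in>T. p x = of_real (f x)"
        unfolding R_def by blast
      from that(2) obtain q where q: "q \<in> V" "\<forall>x\<in>T. q x = of_real (g x)"
        unfolding R_def by blast
      from mult[OF p(1) q(1)] obtain r where "r \<in> V" "\<forall>x\<in>T. r x = p x * q x" by blast
      then show ?thesis
        using p q by (intro R_I[of r]) auto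
    qed
    show "(\<lambda>_. c) \<in> R" for c :: real
    proof -
      from one obtain p where p: "p \<in> V" "\<forall>x\<in>T. p x = 1" by blast
      show ?thesis by (rule R_I[OF cmult[OF p(1), of "of_real c"]]) (use p in simp)
    qed
    show "\<exists>f\<in>R. f x \<noteq> f y" if xy: "x \<in> T" "y \<in> T" "x \<noteq> y" for x y
    proof -
      from separates[OF xy] obtain p where p: "p \<in> V" "p x \<noteq> p y" by blast
      show ?thesis
      proof (cases "Re (p x) = Re (p y)")
        case False
        then show ?thesis by (intro bexI[OF _ re[OF p(1)]])
      next
        case True
        have "(\<lambda>z. - \<i> * p z) \<in> V" by (intro cmult p)
        from re[OF this] have *: "(\<lambda>x. Im (p x)) \<in> R" by simp
        have "Im (p x) \<noteq> Im (p y)" using True p(2) by (auto simp: complex_eq_iff)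
        then show ?thesis by (intro bexI[OF _ *])
      qed
    qed
  qed
  obtain g where g: "g \<in> R" "\<forall>x\<in>T. \<bar>f x - g x\<bar> < e"
    using Stone_Weierstrass_basic[OF f e] by blast
  from g(1) obtain p where p: "p \<in> V" "\<forall>x\<in>T. p x = of_real (g x)" unfolding R_def by blast
  have "cmod (of_real (f x) - p x) < e" if "x \<in> T" for x
  proof -
    have "cmod (of_real (f x) - p x) = cmod (of_real (f x - g x))" using p that by simp
    also have "\<dots> = \<bar>f x - g x\<bar>" by (rule norm_of_real)
    finally show ?thesis using g that by simp
  qed
  then show ?thesis using p by blast
qed

end

locale star_algebra_measure = star_algebra_on V T + finite_measure M
  for V :: "('a::metric_space \<Rightarrow> complex) set" and T and M :: "'a measure" +
  assumes sets_M: "sets M = sets (restrict_space borel T)"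
begin

lemma space_M: "space M = T"
  using sets_eq_imp_space_eq[OF sets_M] by (simp add: space_restrict_space)

lemma continuous_measurable:
  fixes f :: "'a \<Rightarrow> 'b::topological_space"
  assumes "continuous_on T f"
  shows "f \<in> borel_measurable M"
  using borel_measurable_continuous_on_restrict[OF assms] by (simp add: sets_M cong: measurable_cong_sets)

lemma continuous_bounded:
  fixes f :: "'a \<Rightarrow> complex"
  assumes "continuous_on T f"
  obtains C where "AE x in M. cmod (f x) \<le> C"
proof -
  have "bounded (f ` T)" using compact_T assms by (intro compact_imp_bounded compact_continuous_image)
  then obtain C where "\<forall>x\<in>T. cmod (f x) \<le> C" by (auto simp: bounded_iff)
  then show ?thesis using that space_M by (metis AE_I2)
qed

lemma borel_Int_sets: "B \<in> sets borel \<Longrightarrow> B \<inter> T \<in> sets M"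
  by (auto simp: sets_M sets_restrict_space)

sublocale L2: L2_subspace M V
proof
  show "p \<in> L2_space M" if "p \<in> V" for p
    by (rule continuous_bounded[OF cont[OF that]])
      (rule L2_space_bounded[OF continuous_measurable[OF cont[OF that]]])
  show "(\<lambda>x. 0) \<in> V" using one cmult[of _ 0] by auto
qed (auto intro: add cmult)

lemma approximable_continuous:
  fixes f :: "'a \<Rightarrow> real"
  assumes f: "continuous_on T f"
  shows "L2.approximable (\<lambda>x. of_real (f x))"
proof -
  have "\<exists>p\<in>V. \<forall>x\<in>T. cmod (of_real (f x) - p x) < 1 / real (Suc n)" for n
    by (rule uniform_approximation[OF f]) auto
  then obtain p where p: "\<And>n. p n \<in> V" "\<And>n x. x \<in> T \<Longrightarrow> cmod (of_real (f x) - p n x) < 1 / real (Suc n)"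
    by metis
  have fc: "continuous_on T (\<lambda>x. complex_of_real (f x))" using f by (intro continuous_intros)
  show ?thesis
  proof (rule L2.approximable_limit[OF L2.approximable_mem[OF p(1)]])
    show "(\<lambda>x. complex_of_real (f x)) \<in> L2_space M"
      by (rule continuous_bounded[OF fc]) (rule L2_space_bounded[OF continuous_measurable[OF fc]])
    show "(\<lambda>n. L2_seminorm M (\<lambda>x. p n x - complex_of_real (f x))) \<longlonglongrightarrow> 0"
    proof (rule L2_dominated_convergence)
      show "p n \<in> borel_measurable M" for n by (intro continuous_measurable cont p)
      show "(\<lambda>x. complex_of_real (f x)) \<in> borel_measurable M" by (rule continuous_measurable[OF fc])
      show "(\<lambda>x. 1) \<in> L2_space M" by (rule L2_space_bounded[of _ 1]) auto
      show "AE x in M. cmod (p n x - complex_of_real (f x)) \<le> cmod 1" for n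
      proof (rule AE_I2)
        fix x assume "x \<in> space M"
        then have "cmod (p n x - complex_of_real (f x)) \<le> 1 / real (Suc n)"
          using p(2)[of x n] space_M by (simp add: norm_minus_commute)
        also have "\<dots> \<le> 1" by simp
        finally show "cmod (p n x - complex_of_real (f x)) \<le> cmod 1" by simp
      qed
      show "AE x in M. (\<lambda>n. p n x) \<longlonglongrightarrow> complex_of_real (f x)"
      proof (rule AE_I2)
        fix x assume "x \<in> space M"
        then have "cmod (p n x - complex_of_real (f x)) \<le> 1 / real (Suc n)" for n
          using p(2)[of x n] space_M by (simp add: norm_minus_commute)
        then have "(\<lambda>n. p n x - complex_of_real (f x)) \<longlonglongrightarrow> 0"
          by (intro Lim_null_comparison[OF always_eventually lim_1_over_n[THEN LIMSEQ_Suc]] allI) simp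
        then show "(\<lambda>n. p n x) \<longlonglongrightarrow> complex_of_real (f x)" by (rule LIM_zero_cancel)
      qed
    qed
  qed
qed

text \<open>A Dynkin class argument. Open sets are intersection stable and their indicators are
  limits of continuous functions; complements are obtained by subtraction from 1 and disjoint unions
  by dominated convergence.\<close>

lemma approximable_indicator:
  assumes A: "A \<in> sets M"
  shows "L2.approximable (indicator A)"
proof -
  have ind_L2: "(indicator B :: 'a \<Rightarrow> complex) \<in> L2_space M" if "B \<inter> T \<in> sets M" for B
  proof (rule L2_space_bounded[of _ 1])
    have "(indicator (B \<inter> T) :: 'a \<Rightarrow> complex) \<in> borel_measurable M"
      using that by simp
    then show "(indicator B :: 'a \<Rightarrow> complex) \<in> borel_measurable M"
      by (rule measurable_cong[THEN iffD1, rotated]) (auto simp: space_M split: split_indicator)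
  qed (auto split: split_indicator)
  have one: "L2.approximable (\<lambda>x. 1)" using approximable_continuous[of "\<lambda>x. 1"] by simp
  have borel: "L2.approximable (indicator B)" if "B \<in> sets borel" for B
    using Int_stable_open open_subset_Pow that[unfolded sets_borel]
  proof (induction B rule: sigma_sets_induct_disjoint)
    case (basic U)
    then have U: "open U" by simp
    from open_indicator_limit[OF U] obtain f where f: "\<And>k. continuous_on UNIV (f k)"
      "\<And>k x. (0::real) \<le> f k x" "\<And>k x. f k x \<le> 1" "\<And>x. (\<lambda>k. f k x) \<longlonglongrightarrow> indicator U x"
      by metis
    have fT: "continuous_on T (f k)" for k using f(1) by (rule continuous_on_subset) auto
    show ?case
    proof (rule L2.approximable_limit[OF approximable_continuous[OF fT]])
      show "(indicator U :: 'a \<Rightarrow> complex) \<in> L2_space M"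
        using U by (intro ind_L2 borel_Int_sets) auto
      show "(\<lambda>n. L2_seminorm M (\<lambda>x. complex_of_real (f n x) - indicator U x)) \<longlonglongrightarrow> 0"
      proof (rule L2_dominated_convergence)
        show "(\<lambda>x. complex_of_real (f n x)) \<in> borel_measurable M" for n
          using continuous_measurable[OF fT[of n]] by simp
        show "(indicator U :: 'a \<Rightarrow> complex) \<in> borel_measurable M"
          using U by (intro L2_spaceD ind_L2 borel_Int_sets) auto
        show "(\<lambda>x. 1) \<in> L2_space M" by (rule L2_space_bounded[of _ 1]) auto
        show "AE x in M. cmod (complex_of_real (f n x) - indicator U x) \<le> cmod 1" for n
        proof (rule AE_I2)
          fix x
          have "cmod (complex_of_real (f n x) - indicator U x) = \<bar>f n x - indicator U x\<bar>"
            by (metis norm_of_real of_real_diff of_real_indicator)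
          also have "\<dots> \<le> 1" using f(2,3)[of n x] by (auto split: split_indicator)
          finally show "cmod (complex_of_real (f n x) - indicator U x) \<le> cmod 1" by simp
        qed
        show "AE x in M. (\<lambda>n. complex_of_real (f n x)) \<longlonglongrightarrow> indicator U x"
        proof (rule AE_I2)
          fix x
          have "(\<lambda>n. complex_of_real (f n x)) \<longlonglongrightarrow> complex_of_real (indicator U x)"
            by (intro tendsto_of_real f)
          then show "(\<lambda>n. complex_of_real (f n x)) \<longlonglongrightarrow> indicator U x"
            by (simp add: of_real_indicator)
        qed
      qed
    qed
  next
    case empty
    show ?case
      using L2.approximable_mem[OF L2.zero_mem] by (simp add: indicator_def[abs_def])
  next
    case (compl B)
    note B = compl
    have "(indicator (UNIV - B) :: 'a \<Rightarrow> complex) = (\<lambda>x. 1 - indicator B x)"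
      by (auto split: split_indicator)
    then show ?case
      using L2.approximable_diff[OF one B(2)] by simp
  next
    case (union B)
    note disj = union(1) and rng = union(2) and ap = union(3)
    have Bs: "B i \<in> sets borel" for i using rng unfolding sets_borel by auto
    show ?case
    proof (rule L2.approximable_limit)
      show "L2.approximable (\<lambda>x. \<Sum>i<n. indicator (B i) x)" for n :: nat
        by (intro L2.approximable_sum ap)
      have U: "(\<Union> (range B)) \<in> sets borel" using Bs by auto
      show UL: "(indicator (\<Union> (range B)) :: 'a \<Rightarrow> complex) \<in> L2_space M"
        by (intro ind_L2 borel_Int_sets U)
      have eq: "(\<Sum>i<n. indicator (B i) x :: complex) = indicator (\<Union>i<n. B i) x" for n x
        by (rule indicator_UN_disjoint[symmetric]) (use disj in \<open>auto simp: disjoint_family_on_def\<close>)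
      show "(\<lambda>n. L2_seminorm M (\<lambda>x. (\<Sum>i<n. indicator (B i) x) - indicator (\<Union> (range B)) x)) \<longlonglongrightarrow> 0"
        unfolding eq
      proof (rule L2_dominated_convergence)
        show "(indicator (\<Union>i<n. B i) :: 'a \<Rightarrow> complex) \<in> borel_measurable M" for n
          using Bs by (intro L2_spaceD ind_L2 borel_Int_sets) auto
        show "(indicator (\<Union> (range B)) :: 'a \<Rightarrow> complex) \<in> borel_measurable M" using UL by auto
        show "(\<lambda>x. 1) \<in> L2_space M" by (rule L2_space_bounded[of _ 1]) auto
        show "AE x in M. cmod (indicator (\<Union>i<n. B i) x - indicator (\<Union> (range B)) x) \<le> cmod 1" for n
          by (rule AE_I2) (auto split: split_indicator)
        show "AE x in M. (\<lambda>n. indicator (\<Union>i<n. B i) x :: complex) \<longlonglongrightarrow> indicator (\<Union> (range B)) x"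
          by (rule AE_I2) (rule LIMSEQ_indicator_UN)
      qed
    qed
  qed
  from A obtain B where B: "B \<in> sets borel" "A = T \<inter> B"
    by (auto simp: sets_M sets_restrict_space)
  show ?thesis
    by (rule L2.approximable_cong[OF borel[OF B(1)]]) (use A in \<open>auto simp: space_M B split: split_indicator\<close>)
qed

theorem dense:
  assumes "g \<in> L2_space M" "e > 0"
  shows "\<exists>p\<in>V. L2_seminorm M (\<lambda>x. g x - p x) < e"
  using L2.approximable_of_indicators[OF finite_measure_axioms approximable_indicator assms(1)] assms(2)
  unfolding L2.approximable_def by blast

lemma continuous_integrable:
  fixes f :: "'a \<Rightarrow> complex"
  assumes "continuous_on T f"
  shows "integrable M f"
  by (rule continuous_bounded[OF assms])
    (rule integrable_const_bound[OF _ continuous_measurable[OF assms]])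

end

text \<open>Integrals of members of \<open>V\<close> determine integrals of continuous functions,
  hence measures of open sets, hence by the Dynkin argument all Borel measures of sets. This reduces
  the invariance of a measure under a map to the computation of moments.\<close>

theorem star_algebra_measure_eqI:
  assumes M: "star_algebra_measure V T M" and N: "star_algebra_measure V T N"
    and eq: "\<And>p. p \<in> V \<Longrightarrow> (LINT x|M. p x) = (LINT x|N. p x)"
  shows "M = N"
proof -
  interpret M: star_algebra_measure V T M by (rule M)
  interpret N: star_algebra_measure V T N by (rule N)
  have cont_eq: "(LINT x|M. f x) = (LINT x|N. f x)" if f: "continuous_on T f" for f :: "'a \<Rightarrow> real"
  proof -
    have fc: "continuous_on T (\<lambda>x. complex_of_real (f x))" using f by (intro continuous_intros)
    \<comment> \<open>A uniform error \<delta> / K costs \<delta> / K times the total mass under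
      each measure; the summand 1 keeps K positive and the two errors together below
      \<delta>.\<close>
    define K where "K = measure M T + measure N T + 1"
    have K: "K > 0" unfolding K_def by (intro add_nonneg_pos) auto
    have "dist (LINT x|M. complex_of_real (f x)) (LINT x|N. complex_of_real (f x)) \<le> \<delta>" if "\<delta> > 0" for \<delta>
    proof -
      from M.uniform_approximation[OF f, of "\<delta> / K"] that K obtain p where
        p: "p \<in> V" "\<forall>x\<in>T. cmod (of_real (f x) - p x) < \<delta> / K" by auto
      have bM: "cmod ((LINT x|M. complex_of_real (f x)) - (LINT x|M. p x)) \<le> \<delta> / K * measure M T"
      proof -
        have "cmod (LINT x|M. complex_of_real (f x) - p x) \<le> (LINT x|M. \<delta> / K)"
          using p(2) M.continuous_integrable[OF fc] M.continuous_integrable[OF M.cont[OF p(1)]]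
          by (intro order_trans[OF integral_norm_bound] integral_mono) (auto simp: M.space_M less_imp_le)
        then show ?thesis
          using M.continuous_integrable[OF fc] M.continuous_integrable[OF M.cont[OF p(1)]]
          by (simp add: M.space_M mult.commute)
      qed
      have bN: "cmod ((LINT x|N. complex_of_real (f x)) - (LINT x|N. p x)) \<le> \<delta> / K * measure N T"
      proof -
        have "cmod (LINT x|N. complex_of_real (f x) - p x) \<le> (LINT x|N. \<delta> / K)"
          using p(2) N.continuous_integrable[OF fc] N.continuous_integrable[OF M.cont[OF p(1)]]
          by (intro order_trans[OF integral_norm_bound] integral_mono) (auto simp: N.space_M less_imp_le)
        then show ?thesis
          using N.continuous_integrable[OF fc] N.continuous_integrable[OF M.cont[OF p(1)]]
          by (simp add: N.space_M mult.commute)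
      qed
      have "dist (LINT x|M. complex_of_real (f x)) (LINT x|N. complex_of_real (f x))
          \<le> dist (LINT x|M. complex_of_real (f x)) (LINT x|M. p x) + dist (LINT x|N. complex_of_real (f x)) (LINT x|M. p x)"
        by (rule dist_triangle2)
      also have "\<dots> \<le> \<delta> / K * measure M T + \<delta> / K * measure N T"
        using bM bN by (simp add: eq[OF p(1)] dist_norm)
      also have "\<dots> = \<delta> * ((measure M T + measure N T) / K)" by (simp add: add_divide_distrib ring_distribs)
      also have "\<dots> = \<delta> * ((K - 1) / K)" by (simp add: K_def)
      also have "\<dots> \<le> \<delta> * 1" using K that by (intro mult_left_mono) (auto simp: field_simps)
      finally show ?thesis by simp
    qed
    then have "dist (LINT x|M. complex_of_real (f x)) (LINT x|N. complex_of_real (f x)) \<le> 0"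
      by (rule field_le_epsilon) simp
    then have "complex_of_real (LINT x|M. f x) = complex_of_real (LINT x|N. f x)" by simp
    then show ?thesis using of_real_eq_iff by blast
  qed
  have ind: "(LINT x|L. indicator B x) = measure L (B \<inter> T)"
    if "star_algebra_measure V T L" for L and B :: "'a set"
    using star_algebra_measure.space_M[OF that] by simp
  have borel: "measure M (B \<inter> T) = measure N (B \<inter> T)" if "B \<in> sets borel" for B
    using Int_stable_open open_subset_Pow that[unfolded sets_borel]
  proof (induction B rule: sigma_sets_induct_disjoint)
    case (basic U)
    then have U: "open U" by simp
    from open_indicator_limit[OF U] obtain f where f: "\<And>k. continuous_on UNIV (f k)"
      "\<And>k x. (0::real) \<le> f k x" "\<And>k x. f k x \<le> 1" "\<And>x. (\<lambda>k. f k x) \<longlonglongrightarrow> indicator U x"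
      by metis
    have fT: "continuous_on T (f k)" for k using f(1) by (rule continuous_on_subset) auto
    have lim: "(\<lambda>k. LINT x|L. f k x) \<longlonglongrightarrow> measure L (U \<inter> T)" if L: "star_algebra_measure V T L" for L
    proof -
      interpret L: star_algebra_measure V T L by (rule L)
      have fm: "f k \<in> borel_measurable L" for k by (rule L.continuous_measurable[OF fT])
      have "(\<lambda>k. LINT x|L. f k x) \<longlonglongrightarrow> (LINT x|L. indicator U x)"
      proof (rule integral_dominated_convergence[where w = "\<lambda>x. 1"])
        show "(indicator U :: 'a \<Rightarrow> real) \<in> borel_measurable L"
          using fm f(4) by (rule borel_measurable_LIMSEQ_real[rotated])
      qed (use fm f in auto)
      then show ?thesis using ind[OF L] by simp
    qed
    show ?case
      using lim[OF M] lim[OF N] by (simp add: cont_eq[OF fT] LIMSEQ_unique)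
  next
    case empty
    show ?case by simp
  next
    case (compl B)
    note B = compl
    have Bs: "B \<in> sets borel" using B by (simp add: sets_borel)
    have "measure L ((UNIV - B) \<inter> T) = measure L T - measure L (B \<inter> T)" if L: "star_algebra_measure V T L" for L
    proof -
      interpret L: star_algebra_measure V T L by (rule L)
      have "(UNIV - B) \<inter> T = space L - B \<inter> T" by (auto simp: L.space_M)
      then show ?thesis using L.finite_measure_compl[OF L.borel_Int_sets[OF Bs]] by (simp add: L.space_M)
    qed
    moreover have "measure M T = measure N T"
    proof -
      have "(LINT x|M. 1::real) = (LINT x|N. 1)" by (rule cont_eq) (rule continuous_on_const)
      then show ?thesis by (simp add: M.space_M N.space_M)
    qed
    ultimately show ?case
      using M N B(2) by simp
  next
    case (union B)
    note disj = union(1) and rng = union(2) and IH = union(3)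
    have Bs: "B i \<in> sets borel" for i using rng unfolding sets_borel by auto
    have "(\<lambda>i. measure L (B i \<inter> T)) sums measure L (\<Union> (range B) \<inter> T)" if L: "star_algebra_measure V T L" for L
    proof -
      interpret L: star_algebra_measure V T L by (rule L)
      have "(\<lambda>i. measure L (B i \<inter> T)) sums measure L (\<Union>i. B i \<inter> T)"
        using disj L.borel_Int_sets[OF Bs]
        by (intro L.finite_measure_UNION) (auto simp: disjoint_family_on_def)
      moreover have "(\<Union>i. B i \<inter> T) = \<Union> (range B) \<inter> T" by auto
      ultimately show ?thesis by simp
    qed
    from this[OF M] this[OF N] show ?case
      using IH by (simp add: sums_unique2)
  qed
  show ?thesis
  proof (rule measure_eqI)
    show "sets M = sets N" by (simp add: M.sets_M N.sets_M)
    fix A assume "A \<in> sets M"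
    then obtain B where B: "B \<in> sets borel" "A = B \<inter> T"
      by (auto simp: M.sets_M sets_restrict_space)
    show "emeasure M A = emeasure N A"
      unfolding B(2) M.emeasure_eq_measure N.emeasure_eq_measure borel[OF B(1)] ..
  qed
qed

section \<open>Linear spans and expansions in orthonormal families\<close>

definition lin_span :: "('i \<Rightarrow> 'a \<Rightarrow> complex) \<Rightarrow> 'i set \<Rightarrow> ('a \<Rightarrow> complex) set" where
  "lin_span e I = {p. \<exists>F c. finite F \<and> F \<subseteq> I \<and> p = (\<lambda>x. \<Sum>i\<in>F. c i * e i x)}"

lemma lin_spanI: "finite F \<Longrightarrow> F \<subseteq> I \<Longrightarrow> (\<lambda>x. \<Sum>i\<in>F. c i * e i x) \<in> lin_span e I"
  unfolding lin_span_def by blast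

lemma lin_spanE:
  assumes "p \<in> lin_span e I"
  obtains F c where "finite F" "F \<subseteq> I" "p = (\<lambda>x. \<Sum>i\<in>F. c i * e i x)"
  using assms unfolding lin_span_def by blast

lemma lin_span_zero: "(\<lambda>x. 0) \<in> lin_span e I"
  using lin_spanI[of "{}" I _ e] by simp

lemma lin_span_base: "i \<in> I \<Longrightarrow> e i \<in> lin_span e I"
  using lin_spanI[of "{i}" I "\<lambda>_. 1" e] by simp

lemma lin_span_cmult:
  assumes "p \<in> lin_span e I"
  shows "(\<lambda>x. c * p x) \<in> lin_span e I"
proof -
  from assms obtain F d where F: "finite F" "F \<subseteq> I" and p: "p = (\<lambda>x. \<Sum>i\<in>F. d i * e i x)"
    by (rule lin_spanE)
  have "(\<lambda>x. \<Sum>i\<in>F. (c * d i) * e i x) \<in> lin_span e I" using F by (rule lin_spanI)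
  then show ?thesis by (simp add: p sum_distrib_left mult.assoc)
qed

lemma lin_span_add:
  assumes "p \<in> lin_span e I" "q \<in> lin_span e I"
  shows "(\<lambda>x. p x + q x) \<in> lin_span e I"
proof -
  from assms(1) obtain F c where F: "finite F" "F \<subseteq> I" and p: "p = (\<lambda>x. \<Sum>i\<in>F. c i * e i x)"
    by (rule lin_spanE)
  from assms(2) obtain G d where G: "finite G" "G \<subseteq> I" and q: "q = (\<lambda>x. \<Sum>i\<in>G. d i * e i x)"
    by (rule lin_spanE)
  have "(\<lambda>x. \<Sum>i\<in>F \<union> G. ((if i \<in> F then c i else 0) + (if i \<in> G then d i else 0)) * e i x) \<in> lin_span e I"
    using F G by (intro lin_spanI) auto
  moreover have "(\<Sum>i\<in>F \<union> G. ((if i \<in> F then c i else 0) + (if i \<in> G then d i else 0)) * e i x) = p x + q x" for x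
  proof -
    have "(\<Sum>i\<in>F \<union> G. (if i \<in> F then c i else 0) * e i x) = p x"
      unfolding p using F G by (intro sum.mono_neutral_cong_right) auto
    moreover have "(\<Sum>i\<in>F \<union> G. (if i \<in> G then d i else 0) * e i x) = q x"
      unfolding q using F G by (intro sum.mono_neutral_cong_right) auto
    ultimately show ?thesis by (simp only: distrib_right sum.distrib)
  qed
  ultimately show ?thesis by simp
qed

lemma lin_span_sum:
  assumes "\<And>i. i \<in> J \<Longrightarrow> f i \<in> lin_span e I"
  shows "(\<lambda>x. \<Sum>i\<in>J. f i x) \<in> lin_span e I"
  using assms by (induction J rule: infinite_finite_induct) (auto intro: lin_span_zero lin_span_add)

text \<open>It suffices to check the generators. Their products are only required to lie in the
  span, since a product of two cosines is a sum of two cosines and not a cosine.\<close>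

lemma lin_span_star_algebra:
  fixes e :: "'i \<Rightarrow> 'a::metric_space \<Rightarrow> complex"
  assumes compact: "compact T" and cont: "\<And>i. i \<in> I \<Longrightarrow> continuous_on T (e i)"
    and one: "\<exists>i\<in>I. \<forall>x\<in>T. e i x = 1"
    and mult: "\<And>i j. i \<in> I \<Longrightarrow> j \<in> I \<Longrightarrow> \<exists>r\<in>lin_span e I. \<forall>x\<in>T. r x = e i x * e j x"
    and conj: "\<And>i. i \<in> I \<Longrightarrow> \<exists>k\<in>I. \<forall>x\<in>T. e k x = cnj (e i x)"
    and sep: "\<And>x y. x \<in> T \<Longrightarrow> y \<in> T \<Longrightarrow> x \<noteq> y \<Longrightarrow> \<exists>i\<in>I. e i x \<noteq> e i y"
  shows "star_algebra_on (lin_span e I) T"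
proof
  show "compact T" by fact
  show "continuous_on T p" if "p \<in> lin_span e I" for p
  proof -
    from that obtain F c where F: "finite F" "F \<subseteq> I" and p: "p = (\<lambda>x. \<Sum>i\<in>F. c i * e i x)"
      by (rule lin_spanE)
    show ?thesis unfolding p using F by (intro continuous_intros cont) auto
  qed
  show "\<exists>p\<in>lin_span e I. \<forall>x\<in>T. p x = 1"
  proof -
    from one obtain i where i: "i \<in> I" "\<forall>x\<in>T. e i x = 1" by blast
    then show ?thesis by (intro bexI[OF _ lin_span_base])
  qed
  show "(\<lambda>x. p x + q x) \<in> lin_span e I" if "p \<in> lin_span e I" "q \<in> lin_span e I" for p q
    using that by (rule lin_span_add)
  show "(\<lambda>x. c * p x) \<in> lin_span e I" if "p \<in> lin_span e I" for p c
    using that by (rule lin_span_cmult)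
  show "\<exists>r\<in>lin_span e I. \<forall>x\<in>T. r x = p x * q x" if pq: "p \<in> lin_span e I" "q \<in> lin_span e I" for p q
  proof -
    from pq(1) obtain F c where F: "finite F" "F \<subseteq> I" and p: "p = (\<lambda>x. \<Sum>i\<in>F. c i * e i x)"
      by (rule lin_spanE)
    from pq(2) obtain G d where G: "finite G" "G \<subseteq> I" and q: "q = (\<lambda>x. \<Sum>i\<in>G. d i * e i x)"
      by (rule lin_spanE)
    from mult obtain r where r: "\<And>i j. i \<in> I \<Longrightarrow> j \<in> I \<Longrightarrow> r i j \<in> lin_span e I"
      "\<And>i j x. i \<in> I \<Longrightarrow> j \<in> I \<Longrightarrow> x \<in> T \<Longrightarrow> r i j x = e i x * e j x" by metis
    have mem: "(\<lambda>x. \<Sum>i\<in>F. \<Sum>j\<in>G. (c i * d j) * r i j x) \<in> lin_span e I"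
      using F G by (intro lin_span_sum lin_span_cmult r) auto
    have "(\<Sum>i\<in>F. \<Sum>j\<in>G. (c i * d j) * r i j x) = p x * q x" if "x \<in> T" for x
      unfolding p q sum_product using F G that
      by (intro sum.cong refl) (auto simp: r(2) subset_iff)
    then show ?thesis by (intro bexI[OF _ mem]) auto
  qed
  show "\<exists>q\<in>lin_span e I. \<forall>x\<in>T. q x = cnj (p x)" if "p \<in> lin_span e I" for p
  proof -
    from that obtain F c where F: "finite F" "F \<subseteq> I" and p: "p = (\<lambda>x. \<Sum>i\<in>F. c i * e i x)"
      by (rule lin_spanE)
    from conj obtain k where k: "\<And>i. i \<in> I \<Longrightarrow> k i \<in> I"
      "\<And>i x. i \<in> I \<Longrightarrow> x \<in> T \<Longrightarrow> e (k i) x = cnj (e i x)" by metis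
    have mem: "(\<lambda>x. \<Sum>i\<in>F. cnj (c i) * e (k i) x) \<in> lin_span e I"
      using F by (intro lin_span_sum lin_span_cmult lin_span_base k) auto
    have "(\<Sum>i\<in>F. cnj (c i) * e (k i) x) = cnj (p x)" if "x \<in> T" for x
      unfolding p cnj_sum using F that by (intro sum.cong refl) (auto simp: k(2) subset_iff)
    then show ?thesis by (intro bexI[OF _ mem]) auto
  qed
  show "\<exists>p\<in>lin_span e I. p x \<noteq> p y" if "x \<in> T" "y \<in> T" "x \<noteq> y" for x y
  proof -
    from sep[OF that] obtain i where i: "i \<in> I" "e i x \<noteq> e i y" by blast
    then show ?thesis by (intro bexI[OF _ lin_span_base])
  qed
qed

text \<open>The convergence is unconditional: every finite index set beyond \<open>F\<close> does
  equally well. On the torus this allows the exponents to be ordered by the integers that they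
  factorise.\<close>

theorem orthonormal_dense_expansion:
  assumes e: "orthonormal_on M e I" and g: "g \<in> L2_space M"
    and dense: "\<And>\<epsilon>. \<epsilon> > 0 \<Longrightarrow> \<exists>p\<in>lin_span e I. L2_seminorm M (\<lambda>x. g x - p x) < \<epsilon>"
    and \<epsilon>: "\<epsilon> > 0"
  obtains F where "finite F" "F \<subseteq> I"
    "\<And>F'. finite F' \<Longrightarrow> F \<subseteq> F' \<Longrightarrow> F' \<subseteq> I \<Longrightarrow>
      L2_seminorm M (\<lambda>x. g x - (\<Sum>i\<in>F'. L2_inner M g (e i) * e i x)) < \<epsilon>"
proof -
  from dense[OF \<epsilon>] obtain p where p: "p \<in> lin_span e I" "L2_seminorm M (\<lambda>x. g x - p x) < \<epsilon>" by blast
  from p(1) obtain F c where F: "finite F" "F \<subseteq> I" "p = (\<lambda>x. \<Sum>i\<in>F. c i * e i x)" by (rule lin_spanE)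
  show ?thesis
    by (rule that[OF F(1,2)])
      (use orthonormal_best_approximation[OF e F(1) _ _ _ g, of _ c] p(2) F(3) in \<open>auto intro: le_less_trans\<close>)
qed

subsection \<open>The prime exponents of a positive integer\<close>

lemma prime_nth_prime: "prime (nth_prime j)"
  using enumerate_in_set[OF primes_infinite] unfolding nth_prime_def by auto

lemma nth_prime_inj: "nth_prime i = nth_prime j \<longleftrightarrow> i = j"
  using bij_enumerate[OF primes_infinite] unfolding nth_prime_def bij_betw_def
  by (auto dest: injD)

lemma prime_is_nth_prime: "prime p \<Longrightarrow> \<exists>j. nth_prime j = p"
  unfolding nth_prime_def by (rule enumerate_Ex[OF primes_infinite]) auto

lemma nth_prime_pos: "nth_prime j > 0"
  using prime_nth_prime by (rule prime_gt_0_nat)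

definition finite_exponents :: "(nat \<Rightarrow> int) set" where
  "finite_exponents = {\<alpha>. finite {j. \<alpha> j \<noteq> 0}}"

lemma prime_exponents_finite: "n > 0 \<Longrightarrow> prime_exponents n \<in> finite_exponents"
proof -
  assume n: "n > 0"
  have "nth_prime ` {j. prime_exponents n j \<noteq> 0} \<subseteq> prime_factors n"
    using n prime_nth_prime
    by (auto simp: prime_exponents_def prime_factors_multiplicity)
  then have "finite (nth_prime ` {j. prime_exponents n j \<noteq> 0})"
    by (rule finite_subset) simp
  then show ?thesis
    unfolding finite_exponents_def by (auto dest: finite_imageD simp: inj_on_def nth_prime_inj)
qed

lemma prime_exponents_mult:
  "m > 0 \<Longrightarrow> n > 0 \<Longrightarrow> prime_exponents (m * n) j = prime_exponents m j + prime_exponents n j"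
  using prime_nth_prime[of j]
  by (simp add: prime_exponents_def prime_elem_multiplicity_mult_distrib)

lemma prime_exponents_1: "prime_exponents 1 j = 0"
  by (simp add: prime_exponents_def)

lemma prime_exponents_nth_prime: "prime_exponents (nth_prime i) j = of_bool (i = j)"
  using prime_nth_prime[of i] prime_nth_prime[of j] nth_prime_inj[of j i]
  by (auto simp: prime_exponents_def prime_multiplicity_other)

lemma prime_exponents_inj:
  assumes "m > 0" "n > 0" "prime_exponents m = prime_exponents n"
  shows "m = n"
proof (rule multiplicity_eq_nat)
  fix p :: nat assume "prime p"
  then obtain j where "nth_prime j = p" using prime_is_nth_prime by blast
  then show "multiplicity p m = multiplicity p n"
    using fun_cong[OF assms(3), of j] by (simp add: prime_exponents_def)
qed (use assms in auto)

lemma prime_exponents_surj: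
  assumes "\<alpha> \<in> finite_exponents" "\<And>j. \<alpha> j \<ge> 0"
  shows "\<exists>n>0. prime_exponents n = \<alpha>"
proof -
  define S where "S = nth_prime ` {j. \<alpha> j \<noteq> 0}"
  define h where "h p = nat (\<alpha> (inv nth_prime p))" for p
  define n where "n = (\<Prod>p\<in>S. p ^ h p)"
  have inj: "inj nth_prime" by (auto simp: inj_def nth_prime_inj)
  have S: "finite S" "\<And>p. p \<in> S \<Longrightarrow> prime p"
    using assms(1) prime_nth_prime by (auto simp: S_def finite_exponents_def)
  have "n > 0" unfolding n_def using S by (intro prod_pos) (auto intro: prime_gt_0_nat)
  moreover have "prime_exponents n j = \<alpha> j" for j
  proof -
    have "multiplicity (nth_prime j) n = (if nth_prime j \<in> S then h (nth_prime j) else 0)"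
      unfolding n_def using S prime_nth_prime by (rule multiplicity_prod_prime_powers)
    also have "\<dots> = nat (\<alpha> j)"
      using inj by (auto simp: S_def h_def nth_prime_inj)
    finally show ?thesis using assms(2)[of j] by (simp add: prime_exponents_def)
  qed
  ultimately show ?thesis by (intro exI[of _ n]) auto
qed

subsection \<open>Haar measure and characters of the infinite torus\<close>

lemma space_circle: "space circle_measure = sphere 0 1"
  and sets_circle: "sets circle_measure = sets (restrict_space borel (sphere 0 1))"
  by (auto simp: circle_measure_def space_restrict_space)

lemma cis_measurable_circle: "(\<lambda>t. cis (2 * pi * t)) \<in> uniform_measure lborel {0..1} \<rightarrow>\<^sub>M restrict_space borel (sphere 0 1)"
proof (rule measurable_restrict_space2)
  have "(\<lambda>t. cis (2 * pi * t)) \<in> borel_measurable borel"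
    by (intro borel_measurable_continuous_onI continuous_intros)
  then show "(\<lambda>t. cis (2 * pi * t)) \<in> borel_measurable (uniform_measure lborel {0..1})"
    by (simp cong: measurable_cong_sets)
qed auto

interpretation circle: prob_space circle_measure
  unfolding circle_measure_def
  by (intro prob_space.prob_space_distr prob_space_uniform_measure cis_measurable_circle) auto

interpretation torus_prod: product_prob_space "\<lambda>_. circle_measure" "UNIV :: nat set"
  by unfold_locales

interpretation torus: prob_space torus
  unfolding torus_def by (rule torus_prod.P.prob_space_axioms)

lemma space_torus: "space torus = {w. \<forall>j. cmod (w j) = 1}"
  by (auto simp: torus_def space_PiM space_circle PiE_def Pi_def)

lemma torus_coordinate_nonzero: "w \<in> space torus \<Longrightarrow> w j \<noteq> 0"
  by (auto simp: space_torus dest: spec[of _ j])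

lemma compact_space_torus: "compact (space torus)"
proof -
  have "compactin (product_topology (\<lambda>_. euclidean) UNIV) (\<Pi>\<^sub>E j\<in>(UNIV :: nat set). sphere (0::complex) 1)"
    by (subst compactin_PiE) auto
  moreover have "(\<Pi>\<^sub>E j\<in>(UNIV :: nat set). sphere (0::complex) 1) = space torus"
    by (auto simp: space_torus PiE_def Pi_def)
  ultimately show ?thesis by (simp add: euclidean_product_topology)
qed

text \<open>With countably many coordinates the product \<sigma>-algebra is the Borel
  \<sigma>-algebra of the product topology. Haar measure thus lives on a compact metric space and
  the results on star algebras apply to it.\<close>

lemma sets_torus: "sets torus = sets (restrict_space borel (space torus))"
proof
  show "sets torus \<subseteq> sets (restrict_space borel (space torus))"
  proof -
    have "(\<lambda>w. w) \<in> restrict_space borel (space torus) \<rightarrow>\<^sub>M torus"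
      unfolding torus_def
    proof (rule measurable_PiM_single')
      fix i :: nat
      have "(\<lambda>w::nat \<Rightarrow> complex. w i) \<in> restrict_space borel (space torus) \<rightarrow>\<^sub>M restrict_space borel (sphere 0 1)"
        by (intro measurable_restrict_space2 measurable_restrict_space1)
          (auto simp: space_restrict_space space_torus)
      then show "(\<lambda>w. w i) \<in> restrict_space borel (space (\<Pi>\<^sub>M j\<in>UNIV. circle_measure)) \<rightarrow>\<^sub>M circle_measure"
        by (simp add: sets_circle torus_def cong: measurable_cong_sets)
    qed (auto simp: space_restrict_space space_PiM)
    from measurable_sets[OF this] show ?thesis
      using sets.sets_into_space[of _ torus]
      by (auto simp: space_restrict_space)
  qed
  show "sets (restrict_space borel (space torus)) \<subseteq> sets torus"
  proof -
    have "(\<lambda>w. w) \<in> torus \<rightarrow>\<^sub>M borel"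
    proof (subst measurable_cong_sets[OF refl sets_PiM_equal_borel[symmetric]])
      show "(\<lambda>w. w) \<in> torus \<rightarrow>\<^sub>M (\<Pi>\<^sub>M j\<in>UNIV. borel)"
      proof (rule measurable_PiM_single')
        fix i :: nat
        have "(\<lambda>z. z) \<in> circle_measure \<rightarrow>\<^sub>M (borel :: complex measure)"
          by (subst measurable_cong_sets[OF sets_circle refl]) (rule measurable_restrict_space1, simp)
        from measurable_compose[OF measurable_component_singleton[of i UNIV "\<lambda>_. circle_measure"] this]
        show "(\<lambda>w. w i) \<in> torus \<rightarrow>\<^sub>M (borel :: complex measure)" by (simp add: torus_def)
      qed auto
    qed
    from measurable_sets[OF this] show ?thesis
      by (auto simp: sets_restrict_space Int_commute)
  qed
qed

lemma torus_measurable_component [measurable]: "(\<lambda>w. w j) \<in> borel_measurable torus"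
  by (subst measurable_cong_sets[OF sets_torus refl]) (rule measurable_restrict_space1, simp)

definition torus_char :: "(nat \<Rightarrow> int) \<Rightarrow> (nat \<Rightarrow> complex) \<Rightarrow> complex" where
  "torus_char \<alpha> w = (\<Prod>j\<in>{j. \<alpha> j \<noteq> 0}. w j powi \<alpha> j)"

lemma torus_char_superset:
  assumes "finite J" "{j. \<alpha> j \<noteq> 0} \<subseteq> J"
  shows "torus_char \<alpha> w = (\<Prod>j\<in>J. w j powi \<alpha> j)"
  unfolding torus_char_def using assms by (intro prod.mono_neutral_left) auto

lemma torus_char_zero: "torus_char (\<lambda>_. 0) w = 1"
  by (simp add: torus_char_def)

lemma torus_char_add:
  assumes "\<alpha> \<in> finite_exponents" "\<beta> \<in> finite_exponents" "w \<in> space torus"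
  shows "torus_char (\<lambda>j. \<alpha> j + \<beta> j) w = torus_char \<alpha> w * torus_char \<beta> w"
proof -
  define J where "J = {j. \<alpha> j \<noteq> 0} \<union> {j. \<beta> j \<noteq> 0}"
  have J: "finite J" using assms by (auto simp: J_def finite_exponents_def)
  have "torus_char (\<lambda>j. \<alpha> j + \<beta> j) w = (\<Prod>j\<in>J. w j powi (\<alpha> j + \<beta> j))"
    by (rule torus_char_superset[OF J]) (auto simp: J_def)
  also have "\<dots> = (\<Prod>j\<in>J. w j powi \<alpha> j) * (\<Prod>j\<in>J. w j powi \<beta> j)"
    unfolding prod.distrib[symmetric]
    using torus_coordinate_nonzero[OF assms(3)] by (intro prod.cong refl power_int_add) auto
  also have "(\<Prod>j\<in>J. w j powi \<alpha> j) = torus_char \<alpha> w"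
    by (rule torus_char_superset[symmetric, OF J]) (auto simp: J_def)
  also have "(\<Prod>j\<in>J. w j powi \<beta> j) = torus_char \<beta> w"
    by (rule torus_char_superset[symmetric, OF J]) (auto simp: J_def)
  finally show ?thesis .
qed

lemma torus_char_mult_arg: "torus_char \<alpha> (\<lambda>j. v j * w j) = torus_char \<alpha> v * torus_char \<alpha> w"
  by (simp add: torus_char_def power_int_mult_distrib prod.distrib)

lemma cnj_powi_unit:
  assumes "cmod z = 1"
  shows "cnj z powi k = z powi (- k)"
proof -
  have "cnj z = inverse z"
    using assms complex_norm_square[of z] by (intro inverse_unique[symmetric]) simp
  then show ?thesis
    by (simp add: power_int_minus power_int_inverse)
qed

lemma torus_char_cnj: "w \<in> space torus \<Longrightarrow> cnj (torus_char \<alpha> w) = torus_char (\<lambda>j. - \<alpha> j) w"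
  unfolding torus_char_def cnj_prod
  by (intro prod.cong) (auto simp: cnj_powi_unit space_torus)

lemma norm_torus_char: "w \<in> space torus \<Longrightarrow> cmod (torus_char \<alpha> w) = 1"
  unfolding torus_char_def prod_norm[symmetric]
  by (intro prod.neutral) (auto simp: norm_power_int space_torus)

lemma torus_char_continuous: "continuous_on (space torus) (torus_char \<alpha>)"
proof -
  have "continuous_on (space torus) (\<lambda>w. w j)" for j :: nat
    by (rule continuous_on_subset[OF continuous_on_product_coordinates]) auto
  then show ?thesis
    unfolding torus_char_def[abs_def]
    by (intro continuous_on_prod continuous_on_power_int) (auto simp: torus_coordinate_nonzero)
qed

lemma torus_char_measurable [measurable]: "torus_char \<alpha> \<in> borel_measurable torus"
  using borel_measurable_continuous_on_restrict[OF torus_char_continuous]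
  by (simp add: sets_torus cong: measurable_cong_sets)

lemma finite_exponents_zero: "(\<lambda>_. 0) \<in> finite_exponents"
  by (simp add: finite_exponents_def)

lemma finite_exponents_add:
  "\<alpha> \<in> finite_exponents \<Longrightarrow> \<beta> \<in> finite_exponents \<Longrightarrow> (\<lambda>j. \<alpha> j + \<beta> j) \<in> finite_exponents"
  unfolding finite_exponents_def
  by (simp, rule finite_subset[of _ "{j. \<alpha> j \<noteq> 0} \<union> {j. \<beta> j \<noteq> 0}"]) auto

lemma finite_exponents_uminus: "\<alpha> \<in> finite_exponents \<Longrightarrow> (\<lambda>j. - \<alpha> j) \<in> finite_exponents"
  by (simp add: finite_exponents_def)

lemma torus_char_single: "torus_char (\<lambda>j. of_bool (i = j)) w = w i"
proof -
  have "{j. of_bool (i = j) \<noteq> (0::int)} = {i}" by auto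
  then show ?thesis by (simp add: torus_char_def)
qed

lemma torus_star_algebra: "star_algebra_on (lin_span torus_char finite_exponents) (space torus)"
proof (rule lin_span_star_algebra[OF compact_space_torus torus_char_continuous])
  show "\<exists>i\<in>finite_exponents. \<forall>x\<in>space torus. torus_char i x = 1"
    using finite_exponents_zero torus_char_zero by blast
  show "\<exists>r\<in>lin_span torus_char finite_exponents. \<forall>x\<in>space torus. r x = torus_char \<alpha> x * torus_char \<beta> x"
    if "\<alpha> \<in> finite_exponents" "\<beta> \<in> finite_exponents" for \<alpha> \<beta>
    by (rule bexI[OF _ lin_span_base[OF finite_exponents_add[OF that]]]) (simp add: torus_char_add that)
  show "\<exists>k\<in>finite_exponents. \<forall>x\<in>space torus. torus_char k x = cnj (torus_char \<alpha> x)"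
    if "\<alpha> \<in> finite_exponents" for \<alpha>
    by (rule bexI[OF _ finite_exponents_uminus[OF that]]) (simp add: torus_char_cnj)
  show "\<exists>i\<in>finite_exponents. torus_char i x \<noteq> torus_char i y" if "x \<noteq> y" for x y
  proof -
    from that obtain i where "x i \<noteq> y i" by auto
    then show ?thesis
      by (intro bexI[of _ "\<lambda>j. of_bool (i = j)"]) (auto simp: torus_char_single finite_exponents_def)
  qed
qed

lemma circle_moment:
  "k \<noteq> 0 \<Longrightarrow> (LINT z|circle_measure. z powi k) = 0"
proof -
  assume k: "k \<noteq> 0"
  define f where "f t = cis (2 * pi * of_int k * t)" for t :: real
  define F where "F t = f t / (2 * pi * of_int k * \<i>)" for t
  have f_powi: "cis (2 * pi * t) powi k = f t" for t
    by (simp add: f_def Complex.cis_power_int mult_ac)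
  have fm [measurable]: "f \<in> borel_measurable borel"
    unfolding f_def by (intro borel_measurable_continuous_onI continuous_intros)
  have powi_m: "(\<lambda>z. z powi k) \<in> borel_measurable (restrict_space borel (sphere (0::complex) 1))"
    by (intro borel_measurable_continuous_on_restrict continuous_intros) auto
  have "(LINT z|circle_measure. z powi k) = (LINT t|uniform_measure lborel {0..1}. f t)"
    unfolding circle_measure_def
    by (subst integral_distr[OF cis_measurable_circle powi_m]) (simp add: f_powi)
  also have "\<dots> = (LINT t|lborel. indicator {0..1} t *\<^sub>R f t)"
  proof -
    have "uniform_measure lborel {0..1} = density lborel (\<lambda>t. ennreal (indicator {0..1::real} t))"
      unfolding uniform_measure_def by (intro density_cong) (auto split: split_indicator)
    then show ?thesis by (simp add: integral_density)
  qed
  also have "\<dots> = F 1 - F 0"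
  proof (rule integral_FTC_atLeastAtMost)
    fix t :: real
    have "(f has_vector_derivative f t * (2 * pi * of_int k * \<i>)) (at t within {0..1})"
      unfolding f_def cis_conv_exp
      by (auto intro!: derivative_eq_intros has_vector_derivative_real_field simp: field_simps)
    then have "((\<lambda>t. f t * inverse (2 * pi * of_int k * \<i>)) has_vector_derivative
        f t * (2 * pi * of_int k * \<i>) * inverse (2 * pi * of_int k * \<i>)) (at t within {0..1})"
      by (rule has_vector_derivative_mult_left)
    then show "(F has_vector_derivative f t) (at t within {0..1})"
      unfolding F_def using k by (simp add: field_simps)
  next
    show "continuous_on {0..1} f" unfolding f_def by (intro continuous_intros)
  qed simp
  also have "F 1 = F 0"
    unfolding F_def f_def by (simp add: cis_multiple_2pi)
  finally show ?thesis by simp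
qed

lemma circle_star_algebra: "star_algebra_on (lin_span (\<lambda>k z. z powi k) UNIV) (sphere (0::complex) 1)"
proof (rule lin_span_star_algebra)
  show "\<exists>i\<in>UNIV. \<forall>z\<in>sphere (0::complex) 1. z powi i = 1" by (intro bexI[of _ 0]) auto
  show "\<exists>r\<in>lin_span (\<lambda>k z. z powi k) UNIV. \<forall>z\<in>sphere (0::complex) 1. r z = z powi i * z powi j" for i j
    by (rule bexI[OF _ lin_span_base[of "i + j"]]) (auto intro!: power_int_add)
  show "\<exists>k\<in>UNIV. \<forall>z\<in>sphere (0::complex) 1. z powi k = cnj (z powi i)" for i
    by (rule bexI[of _ "- i"]) (auto simp: cnj_powi_unit)
  show "\<exists>i\<in>UNIV. x powi i \<noteq> y powi i" if "x \<noteq> y" for x y :: complex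
    using that by (intro bexI[of _ 1]) auto
qed (auto intro!: continuous_intros)

lemma circle_mult_measurable:
  "cmod v = 1 \<Longrightarrow> (\<lambda>z. v * z) \<in> circle_measure \<rightarrow>\<^sub>M circle_measure"
  unfolding measurable_cong_sets[OF sets_circle sets_circle]
  by (intro measurable_restrict_space3) (auto simp: norm_mult)

text \<open>Rotation multiplies the k-th moment by v^k, and all moments with k \<noteq> 0 vanish, so
  the rotated measure has the same moments.\<close>

lemma circle_rotation_invariant:
  assumes v: "cmod v = 1"
  shows "distr circle_measure circle_measure (\<lambda>z. v * z) = circle_measure"
proof (rule star_algebra_measure_eqI)
  let ?V = "lin_span (\<lambda>k z. z powi k) UNIV"
  have sam: "star_algebra_measure ?V (sphere 0 1) M"
    if "prob_space M" "sets M = sets circle_measure" for M :: "complex measure"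
    using that circle_star_algebra
    by (simp add: star_algebra_measure_def star_algebra_measure_axioms_def sets_circle prob_space_def)
  show N: "star_algebra_measure ?V (sphere 0 1) circle_measure"
    by (rule sam) (auto intro: circle.prob_space_axioms)
  show M: "star_algebra_measure ?V (sphere 0 1) (distr circle_measure circle_measure (\<lambda>z. v * z))"
    by (rule sam) (auto intro!: circle.prob_space_distr circle_mult_measurable v)
  interpret N: star_algebra_measure ?V "sphere 0 1" circle_measure by (rule N)
  fix p assume "p \<in> ?V"
  then obtain F c where F: "finite F" "p = (\<lambda>z. \<Sum>k\<in>F. c k * z powi k)" by (rule lin_spanE)
  have powi_c: "continuous_on (sphere (0::complex) 1) (\<lambda>z. z powi k)" for k
    by (intro continuous_intros) auto
  have m: "(LINT z|circle_measure. (v * z) powi k) = (LINT z|circle_measure. z powi k)" for k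
    by (cases "k = 0") (auto simp: power_int_mult_distrib circle_moment)
  have "(LINT z|distr circle_measure circle_measure (\<lambda>z. v * z). p z) = (LINT z|circle_measure. p (v * z))"
    by (rule integral_distr[OF circle_mult_measurable[OF v]])
      (use N.continuous_measurable[OF N.cont[OF \<open>p \<in> ?V\<close>]] in auto)
  also have "\<dots> = (\<Sum>k\<in>F. c k * (LINT z|circle_measure. (v * z) powi k))"
    unfolding F(2) using N.continuous_integrable[OF powi_c]
    by (subst Bochner_Integration.integral_sum) (auto simp: power_int_mult_distrib)
  also have "\<dots> = (LINT z|circle_measure. p z)"
    unfolding F(2) m using N.continuous_integrable[OF powi_c]
    by (subst Bochner_Integration.integral_sum) auto
  finally show "(LINT z|distr circle_measure circle_measure (\<lambda>z. v * z). p z) = (LINT z|circle_measure. p z)" .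
qed

section \<open>Rotations of the torus and orthogonality of its characters\<close>

definition torus_mult :: "(nat \<Rightarrow> complex) \<Rightarrow> (nat \<Rightarrow> complex) \<Rightarrow> nat \<Rightarrow> complex" where
  "torus_mult v w = (\<lambda>j. v j * w j)"

lemma torus_mult_space: "v \<in> space torus \<Longrightarrow> w \<in> space torus \<Longrightarrow> torus_mult v w \<in> space torus"
  by (auto simp: torus_mult_def space_torus norm_mult)

lemma measurable_torusI:
  assumes "\<And>j. (\<lambda>x. f x j) \<in> borel_measurable N" "f \<in> space N \<rightarrow> space torus"
  shows "f \<in> N \<rightarrow>\<^sub>M torus"
proof -
  have "(\<lambda>x j. f x j) \<in> N \<rightarrow>\<^sub>M (\<Pi>\<^sub>M j\<in>UNIV. circle_measure)"
  proof (rule measurable_PiM_single')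
    fix j :: nat
    show "(\<lambda>x. f x j) \<in> N \<rightarrow>\<^sub>M circle_measure"
      unfolding measurable_cong_sets[OF refl sets_circle]
      using assms by (intro measurable_restrict_space2) (auto simp: space_torus Pi_def)
  qed (use assms(2) in \<open>auto simp: torus_def space_PiM\<close>)
  then show ?thesis by (simp add: torus_def)
qed

lemma torus_mult_measurable:
  assumes "v \<in> space torus"
  shows "torus_mult v \<in> torus \<rightarrow>\<^sub>M torus"
  by (rule measurable_torusI) (use assms in \<open>auto simp: torus_mult_def space_torus norm_mult\<close>)

text \<open>A product measure is determined by cylinder sets. The preimage of a cylinder under a
  rotation is the cylinder over the rotated sides, so invariance on the circle is enough.\<close>

lemma torus_rotation_invariant:
  assumes v: "v \<in> space torus"
  shows "distr torus torus (torus_mult v) = torus"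
proof -
  have "distr torus torus (torus_mult v) = (\<Pi>\<^sub>M j\<in>UNIV. circle_measure)"
  proof (rule measure_eqI_PiM_infinite[where I = UNIV and M = "\<lambda>_. circle_measure"])
    show "sets (distr torus torus (torus_mult v)) = sets (\<Pi>\<^sub>M j\<in>UNIV. circle_measure)"
      by (simp add: torus_def)
    interpret D: prob_space "distr torus torus (torus_mult v)"
      by (rule torus.prob_space_distr[OF torus_mult_measurable[OF v]])
    show "finite_measure (distr torus torus (torus_mult v))" by (rule D.finite_measure_axioms)
    fix A :: "nat \<Rightarrow> complex set" and J :: "nat set"
    assume J: "finite J" and A: "\<And>i. i \<in> J \<Longrightarrow> A i \<in> sets circle_measure"
    define A' where "A' j = (\<lambda>z. v j * z) -` A j \<inter> space circle_measure" for j
    have vj: "cmod (v j) = 1" for j using v by (auto simp: space_torus)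
    have A': "A' j \<in> sets circle_measure" if "j \<in> J" for j
      unfolding A'_def by (rule measurable_sets[OF circle_mult_measurable[OF vj] A[OF that]])
    have em: "emeasure circle_measure (A' j) = emeasure circle_measure (A j)" if "j \<in> J" for j
    proof -
      have "emeasure circle_measure (A j) = emeasure (distr circle_measure circle_measure (\<lambda>z. v j * z)) (A j)"
        by (simp add: circle_rotation_invariant[OF vj])
      also have "\<dots> = emeasure circle_measure (A' j)"
        unfolding A'_def by (rule emeasure_distr[OF circle_mult_measurable[OF vj] A[OF that]])
      finally show ?thesis ..
    qed
    have sub: "prod_emb UNIV (\<lambda>_. circle_measure) J (Pi\<^sub>E J A) \<in> sets torus"
      unfolding torus_def using J A by (intro sets_PiM_I) auto
    have "torus_mult v -` prod_emb UNIV (\<lambda>_. circle_measure) J (Pi\<^sub>E J A) \<inter> space torus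
        = prod_emb UNIV (\<lambda>_. circle_measure) J (Pi\<^sub>E J A')"
      using vj by (auto simp: prod_emb_def space_torus space_circle A'_def torus_mult_def PiE_def Pi_def
          extensional_def restrict_def norm_mult)
    then have "emeasure (distr torus torus (torus_mult v)) (prod_emb UNIV (\<lambda>_. circle_measure) J (Pi\<^sub>E J A))
        = emeasure torus (prod_emb UNIV (\<lambda>_. circle_measure) J (Pi\<^sub>E J A'))"
      by (subst emeasure_distr[OF torus_mult_measurable[OF v] sub]) simp
    also have "\<dots> = (\<Prod>j\<in>J. emeasure circle_measure (A' j))"
      unfolding torus_def using J A' by (intro torus_prod.emeasure_PiM_emb) auto
    also have "\<dots> = (\<Prod>j\<in>J. emeasure circle_measure (A j))"
      by (intro prod.cong refl em)
    also have "\<dots> = emeasure (\<Pi>\<^sub>M j\<in>UNIV. circle_measure) (prod_emb UNIV (\<lambda>_. circle_measure) J (Pi\<^sub>E J A))"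
      using J A by (intro torus_prod.emeasure_PiM_emb[symmetric]) auto
    finally show "emeasure (distr torus torus (torus_mult v)) (prod_emb UNIV (\<lambda>_. circle_measure) J (Pi\<^sub>E J A))
        = emeasure (\<Pi>\<^sub>M j\<in>UNIV. circle_measure) (prod_emb UNIV (\<lambda>_. circle_measure) J (Pi\<^sub>E J A))" .
  qed (rule refl)
  then show ?thesis by (simp add: torus_def)
qed

lemma torus_integral_rotation:
  fixes g :: "(nat \<Rightarrow> complex) \<Rightarrow> 'b::{banach, second_countable_topology}"
  assumes "v \<in> space torus" "g \<in> borel_measurable torus"
  shows "(LINT w|torus. g (torus_mult v w)) = (LINT w|torus. g w)"
  using integral_distr[OF torus_mult_measurable[OF assms(1)] assms(2)]
  by (simp add: torus_rotation_invariant[OF assms(1)])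

text \<open>If \<alpha> i \<noteq> 0, rotating the i-th coordinate by the angle pi / \<alpha> i
  changes the sign of the character, and by rotation invariance its integral equals its own
  negative.\<close>

lemma torus_char_integral:
  assumes \<alpha>: "\<alpha> \<in> finite_exponents"
  shows "(LINT w|torus. torus_char \<alpha> w) = of_bool (\<alpha> = (\<lambda>_. 0))"
proof (cases "\<alpha> = (\<lambda>_. 0)")
  case True
  then show ?thesis by (simp add: torus_char_zero torus.prob_space)
next
  case False
  then obtain i where i: "\<alpha> i \<noteq> 0" by auto
  define v where "v j = (if j = i then cis (pi / \<alpha> i) else 1)" for j
  have v: "v \<in> space torus" by (auto simp: v_def space_torus)
  have "torus_char \<alpha> v = (\<Prod>j\<in>{j. \<alpha> j \<noteq> 0}. if j = i then -1 else 1)"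
    unfolding torus_char_def v_def using i by (intro prod.cong) (auto simp: Complex.cis_power_int)
  also have "\<dots> = -1" using \<alpha> i by (simp add: finite_exponents_def)
  finally have "torus_char \<alpha> v = -1" .
  then have "(LINT w|torus. torus_char \<alpha> w) = (LINT w|torus. - torus_char \<alpha> w)"
    using torus_integral_rotation[OF v torus_char_measurable, of \<alpha>]
    by (simp add: torus_mult_def torus_char_mult_arg)
  then show ?thesis using False by simp
qed

lemma torus_char_L2: "torus_char \<alpha> \<in> L2_space torus"
  by (rule torus.L2_space_bounded[of _ 1]) (auto simp: norm_torus_char)

lemma torus_orthonormal: "orthonormal_on torus torus_char finite_exponents"
  unfolding orthonormal_on_def
proof (intro conjI ballI torus_char_L2)
  fix \<alpha> \<beta> assume \<alpha>: "\<alpha> \<in> finite_exponents" and \<beta>: "\<beta> \<in> finite_exponents"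
  have "L2_inner torus (torus_char \<alpha>) (torus_char \<beta>) = (LINT w|torus. torus_char (\<lambda>j. \<alpha> j + - \<beta> j) w)"
    unfolding L2_inner_def
    using \<alpha> \<beta>
    by (intro Bochner_Integration.integral_cong refl)
      (simp add: torus_char_add[OF \<alpha> finite_exponents_uminus[OF \<beta>], symmetric] torus_char_cnj)
  also have "\<dots> = of_bool (\<alpha> = \<beta>)"
    using \<alpha> \<beta> by (subst torus_char_integral[OF finite_exponents_add[OF \<alpha> finite_exponents_uminus[OF \<beta>]]])
      (auto simp: fun_eq_iff)
  finally show "L2_inner torus (torus_char \<alpha>) (torus_char \<beta>) = of_bool (\<alpha> = \<beta>)" .
qed

lemma torus_fourier_eq_inner: "torus_fourier g \<alpha> = L2_inner torus g (torus_char \<alpha>)"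
  unfolding torus_fourier_def L2_inner_def
proof (intro Bochner_Integration.integral_cong refl arg_cong2[where f = "(*)"])
  fix w assume "w \<in> space torus"
  then show "(\<Prod>j\<in>{j. \<alpha> j \<noteq> 0}. w j powi - \<alpha> j) = cnj (torus_char \<alpha> w)"
    by (subst torus_char_cnj) (auto simp: torus_char_def)
qed

text \<open>The density statement is needed for measures other than Haar measure, namely for
  \<open>(1 + |f|\<^sup>2) dw\<close>.\<close>

lemma torus_trig_dense:
  assumes "finite_measure M" "sets M = sets torus" "g \<in> L2_space M" "e > 0"
  shows "\<exists>p\<in>lin_span torus_char finite_exponents. L2_seminorm M (\<lambda>x. g x - p x) < e"
proof -
  interpret star_algebra_measure "lin_span torus_char finite_exponents" "space torus" M
    using assms torus_star_algebra
    by (simp add: star_algebra_measure_def star_algebra_measure_axioms_def sets_torus)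
  show ?thesis using assms(3,4) by (rule dense)
qed

subsection \<open>Analytic characters\<close>

text \<open>The monomial w^\<alpha>(n), regarded as a function of n completely multiplicative. The
  value 0 at n = 0 matches the convention of \<open>characters\<close> and lets sums start at
  0.\<close>

definition bohr_char :: "nat \<Rightarrow> (nat \<Rightarrow> complex) \<Rightarrow> complex" where
  "bohr_char n w = (if n = 0 then 0 else torus_char (prime_exponents n) w)"

lemma bohr_char_0 [simp]: "bohr_char 0 w = 0"
  by (simp add: bohr_char_def)

lemma bohr_char_mult:
  assumes "w \<in> space torus"
  shows "bohr_char (m * n) w = bohr_char m w * bohr_char n w"
proof (cases "m = 0 \<or> n = 0")
  case False
  then have "torus_char (prime_exponents (m * n)) w =
      torus_char (\<lambda>j. prime_exponents m j + prime_exponents n j) w"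
    by (intro arg_cong2[where f = torus_char] ext) (auto simp: prime_exponents_mult)
  then show ?thesis
    using False assms by (simp add: bohr_char_def torus_char_add prime_exponents_finite)
qed (auto simp: bohr_char_def)

lemma norm_bohr_char: "w \<in> space torus \<Longrightarrow> n > 0 \<Longrightarrow> cmod (bohr_char n w) = 1"
  by (simp add: bohr_char_def norm_torus_char)

lemma norm_bohr_char_le: "w \<in> space torus \<Longrightarrow> cmod (bohr_char n w) \<le> 1"
  by (cases "n = 0") (auto simp: norm_bohr_char)

lemma bohr_char_nth_prime: "bohr_char (nth_prime j) w = w j"
proof -
  have "prime_exponents (nth_prime j) = (\<lambda>i. of_bool (j = i))"
    by (auto simp: prime_exponents_nth_prime)
  then show ?thesis
    using nth_prime_pos[of j] by (simp add: bohr_char_def torus_char_single)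
qed

lemma bohr_char_torus_mult: "bohr_char n (torus_mult v w) = bohr_char n v * bohr_char n w"
  by (simp add: bohr_char_def torus_mult_def torus_char_mult_arg)

lemma bohr_char_continuous: "continuous_on (space torus) (bohr_char n)"
  by (cases "n = 0") (auto simp: bohr_char_def[abs_def] intro: torus_char_continuous)

lemma bohr_char_measurable [measurable]: "bohr_char n \<in> borel_measurable torus"
  by (cases "n = 0") (auto simp: bohr_char_def[abs_def])

lemma bohr_orthonormal: "orthonormal_on torus bohr_char {0<..}"
  using torus_orthonormal prime_exponents_finite prime_exponents_inj
  unfolding orthonormal_on_def bohr_char_def[abs_def] by (auto simp: torus_char_L2)

lemma bohr_char_L2: "bohr_char n \<in> L2_space torus"
  by (cases "n = 0") (auto simp: bohr_char_def[abs_def] torus_char_L2)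

lemma bohr_transform_eq_inner: "bohr_transform g n = L2_inner torus g (bohr_char n)"
  by (cases "n = 0") (auto simp: bohr_transform_def torus_fourier_eq_inner bohr_char_def[abs_def] L2_inner_def)

text \<open>The unconditional expansion over all exponents becomes a series over the integers
  because the coefficients at exponents with a negative entry vanish, while the exponents with
  nonnegative entries are exactly the factorisations of positive integers.\<close>

lemma hardy2_expansion:
  assumes f: "f \<in> hardy2_torus"
  shows "(\<lambda>N. L2_seminorm torus (\<lambda>w. (\<Sum>n=1..N. bohr_transform f n * bohr_char n w) - f w)) \<longlonglongrightarrow> 0"
proof (rule LIMSEQ_I)
  fix r :: real assume r: "r > 0"
  have fL: "f \<in> L2_space torus" and spec: "analytic_spectrum f"
    using f by (auto simp: hardy2_torus_def)
  obtain F where F: "finite F" "F \<subseteq> finite_exponents"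
    "\<And>F'. finite F' \<Longrightarrow> F \<subseteq> F' \<Longrightarrow> F' \<subseteq> finite_exponents \<Longrightarrow>
      L2_seminorm torus (\<lambda>x. f x - (\<Sum>\<alpha>\<in>F'. L2_inner torus f (torus_char \<alpha>) * torus_char \<alpha> x)) < r"
    by (rule orthonormal_dense_expansion[OF torus_orthonormal fL torus_trig_dense[OF torus.finite_measure_axioms refl fL] r])
      (assumption, rule that, assumption, assumption, blast)
  define P where "P = {\<alpha>\<in>F. \<forall>j. \<alpha> j \<ge> 0}"
  have "\<exists>n>0. prime_exponents n = \<alpha>" if "\<alpha> \<in> P" for \<alpha>
    using that F(2) by (intro prime_exponents_surj) (auto simp: P_def)
  then obtain m where m: "\<And>\<alpha>. \<alpha> \<in> P \<Longrightarrow> m \<alpha> > 0" "\<And>\<alpha>. \<alpha> \<in> P \<Longrightarrow> prime_exponents (m \<alpha>) = \<alpha>"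
    by metis
  have finP: "finite P" using F(1) by (simp add: P_def)
  \<comment> \<open>From \<open>N0\<close> on, the exponents of 1, ..., N contain all analytic
    exponents of \<open>F\<close>; the inserted 0 covers the case that there are none.\<close>
  define N0 where "N0 = Max (insert 0 (m ` P))"
  have N0: "m \<alpha> \<le> N0" if "\<alpha> \<in> P" for \<alpha>
    unfolding N0_def using that finP by (intro Max_ge) auto
  have "L2_seminorm torus (\<lambda>w. (\<Sum>n=1..N. bohr_transform f n * bohr_char n w) - f w) < r" if N: "N \<ge> N0" for N
  proof -
    let ?t = "\<lambda>\<alpha> x. L2_inner torus f (torus_char \<alpha>) * torus_char \<alpha> x"
    define E where "E = prime_exponents ` {1..N}"
    have E: "finite E" "E \<subseteq> finite_exponents" by (auto simp: E_def prime_exponents_finite)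
    \<comment> \<open>What \<open>F\<close> adds to \<open>E\<close> are exponents with a negative
      entry, whose coefficients are zero. So the sum over \<open>E\<close> inherits the estimate
      that is available for supersets of \<open>F\<close>.\<close>
    have "(\<Sum>\<alpha>\<in>F \<union> E. ?t \<alpha> x) = (\<Sum>\<alpha>\<in>E. ?t \<alpha> x)" for x
    proof (rule sum.mono_neutral_right)
      show "\<forall>\<alpha>\<in>F \<union> E - E. ?t \<alpha> x = 0"
      proof
        fix \<alpha> assume a: "\<alpha> \<in> F \<union> E - E"
        then have aF: "\<alpha> \<in> F" "\<alpha> \<notin> E" by auto
        have "\<alpha> \<notin> P"
        proof
          assume "\<alpha> \<in> P"
          then have "\<alpha> \<in> E" unfolding E_def using m[of \<alpha>] N0[of \<alpha>] N
            by (intro image_eqI[of _ _ "m \<alpha>"]) auto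
          then show False using aF by simp
        qed
        then have "\<not> (\<forall>j. \<alpha> j \<ge> 0)" using aF by (simp add: P_def)
        moreover have "finite {j. \<alpha> j \<noteq> 0}" using aF F(2) by (auto simp: finite_exponents_def)
        ultimately have "torus_fourier f \<alpha> = 0"
          using spec unfolding analytic_spectrum_def by blast
        then show "?t \<alpha> x = 0" by (simp add: torus_fourier_eq_inner)
      qed
    qed (use F E in auto)
    moreover have "(\<Sum>\<alpha>\<in>E. ?t \<alpha> x) = (\<Sum>n=1..N. bohr_transform f n * bohr_char n x)" for x
      unfolding E_def
      by (subst sum.reindex) (auto simp: inj_on_def bohr_transform_eq_inner bohr_char_def[abs_def] intro!: sum.cong prime_exponents_inj)
    ultimately have "(\<lambda>x. f x - (\<Sum>n=1..N. bohr_transform f n * bohr_char n x)) =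
        (\<lambda>x. f x - (\<Sum>\<alpha>\<in>F \<union> E. ?t \<alpha> x))" by simp
    moreover have "L2_seminorm torus (\<lambda>x. f x - (\<Sum>\<alpha>\<in>F \<union> E. ?t \<alpha> x)) < r"
      using F E by (intro F(3)) auto
    ultimately show ?thesis by (simp add: L2_seminorm_minus_commute[of torus _ f])
  qed
  then show "\<exists>no. \<forall>n\<ge>no. norm (L2_seminorm torus (\<lambda>w. (\<Sum>n=1..n. bohr_transform f n * bohr_char n w) - f w) - 0) < r"
    by (intro exI[of _ N0]) auto
qed

subsection \<open>Characters of the positive integers\<close>

lemma charactersD:
  assumes "\<gamma> \<in> characters"
  shows "\<gamma> 0 = 0" "m > 0 \<Longrightarrow> n > 0 \<Longrightarrow> \<gamma> (m * n) = \<gamma> m * \<gamma> n" "n > 0 \<Longrightarrow> cmod (\<gamma> n) = 1"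
  using assms unfolding characters_def by blast+

lemma characters_1:
  assumes "\<gamma> \<in> characters"
  shows "\<gamma> 1 = 1"
proof -
  have "\<gamma> 1 = \<gamma> 1 * \<gamma> 1" using charactersD(2)[OF assms, of 1 1] by simp
  moreover have "\<gamma> 1 \<noteq> 0" using charactersD(3)[OF assms, of 1] by auto
  ultimately show ?thesis by simp
qed

lemma characters_eqI:
  assumes "\<gamma> \<in> characters" "\<delta> \<in> characters" "\<And>p. prime p \<Longrightarrow> \<gamma> p = \<delta> p"
  shows "\<gamma> n = \<delta> n"
proof (induction n rule: less_induct)
  case (less n)
  consider "n = 0" | "n = 1" | "n > 1" by linarith
  then show ?case
  proof cases
    case 3
    then obtain p where p: "prime p" "p dvd n" using prime_factor_nat by (metis less_numeral_extra(4))
    then obtain m where m: "n = p * m" by (auto elim: dvdE)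
    have "m > 0" "m < n" using m 3 p prime_gt_1_nat[of p] by (auto intro: gr0I)
    moreover have "p > 0" using p prime_gt_0_nat by blast
    ultimately show ?thesis
      using less.IH[of m] assms(3)[OF p(1)] unfolding m
      by (simp add: charactersD(2)[OF assms(1)] charactersD(2)[OF assms(2)])
  next
    case 1
    then show ?thesis using charactersD(1)[OF assms(1)] charactersD(1)[OF assms(2)] by simp
  next
    case 2
    then show ?thesis using characters_1[OF assms(1)] characters_1[OF assms(2)] by simp
  qed
qed

lemma bohr_char_in_characters: "w \<in> space torus \<Longrightarrow> (\<lambda>n. bohr_char n w) \<in> characters"
  by (simp add: characters_def bohr_char_mult norm_bohr_char)

lemma character_coords_bohr_char: "character_coords (\<lambda>n. bohr_char n w) = w"
  by (rule ext) (simp add: character_coords_def bohr_char_nth_prime)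

lemma character_coords_space: "\<gamma> \<in> characters \<Longrightarrow> character_coords \<gamma> \<in> space torus"
  by (simp add: space_torus character_coords_def nth_prime_pos charactersD)

lemma bohr_char_character_coords:
  assumes "\<gamma> \<in> characters"
  shows "bohr_char n (character_coords \<gamma>) = \<gamma> n"
proof (rule characters_eqI[OF bohr_char_in_characters[OF character_coords_space[OF assms]] assms])
  fix p :: nat assume "prime p"
  then obtain j where "nth_prime j = p" using prime_is_nth_prime by blast
  then show "bohr_char p (character_coords \<gamma>) = \<gamma> p"
    using bohr_char_nth_prime[of j "character_coords \<gamma>"] by (simp add: character_coords_def)
qed

section \<open>The characters n |-> n^(-it) as points of the torus\<close>

definition prime_flow :: "real \<Rightarrow> nat \<Rightarrow> complex" where
  "prime_flow t j = of_nat (nth_prime j) powr (- \<i> * of_real t)"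

lemma norm_nat_powr_imaginary: "n > 0 \<Longrightarrow> cmod (of_nat n powr (- \<i> * of_real t)) = 1"
proof -
  assume "n > 0"
  then have "cmod (complex_of_real (real n) powr (- \<i> * of_real t)) = real n powr 0"
    by (subst norm_powr_real_powr) auto
  then show ?thesis using \<open>n > 0\<close> by simp
qed

lemma nat_powr_mult: "of_nat (m * n) powr s = (of_nat m powr s * of_nat n powr s :: complex)"
proof (cases "m = 0 \<or> n = 0")
  case False
  then show ?thesis
    using powr_times_real[of "of_nat m" "of_nat n" s] by simp
qed auto

lemma nat_powr_in_characters: "(\<lambda>n. of_nat n powr (- \<i> * of_real t)) \<in> characters"
  unfolding characters_def by (auto simp only: nat_powr_mult norm_nat_powr_imaginary) auto

lemma prime_flow_eq: "prime_flow t = character_coords (\<lambda>n. of_nat n powr (- \<i> * of_real t))"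
  by (simp add: prime_flow_def character_coords_def fun_eq_iff)

lemma prime_flow_space: "prime_flow t \<in> space torus"
  unfolding prime_flow_eq by (rule character_coords_space[OF nat_powr_in_characters])

lemma bohr_char_prime_flow: "bohr_char n (prime_flow t) = of_nat n powr (- \<i> * of_real t)"
  unfolding prime_flow_eq by (rule bohr_char_character_coords[OF nat_powr_in_characters])

lemma bohr_char_prime_flow': "n > 0 \<Longrightarrow> bohr_char n (prime_flow t) = cis (- t * ln n)"
  unfolding bohr_char_prime_flow by (simp add: powr_def cis_conv_exp mult_ac Ln_of_nat)

subsection \<open>Multiplication operators on analytic polynomials\<close>

text \<open>Multiplication by the monomial w^\<beta> with \<beta> j = \<Sum> |\<alpha> j| makes
  every exponent that occurs nonnegative, and this monomial has modulus 1 on the torus.\<close>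

lemma trig_poly_analytic:
  assumes "p \<in> lin_span torus_char finite_exponents"
  obtains N and b :: "nat \<Rightarrow> complex"
  where "\<And>w. w \<in> space torus \<Longrightarrow> cmod (p w) = cmod (\<Sum>n=1..N. b n * bohr_char n w)"
proof -
  from assms obtain F c where F: "finite F" "F \<subseteq> finite_exponents"
    and p: "p = (\<lambda>x. \<Sum>\<alpha>\<in>F. c \<alpha> * torus_char \<alpha> x)" by (rule lin_spanE)
  define \<beta> where "\<beta> j = (\<Sum>\<alpha>\<in>F. \<bar>\<alpha> j\<bar>)" for j
  have "{j. \<beta> j \<noteq> 0} \<subseteq> (\<Union>\<alpha>\<in>F. {j. \<alpha> j \<noteq> 0})"
    unfolding \<beta>_def by (auto elim!: sum.not_neutral_contains_not_neutral)
  then have \<beta>: "\<beta> \<in> finite_exponents"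
    using F by (auto simp: finite_exponents_def elim!: finite_subset)
  have "\<exists>n>0. prime_exponents n = (\<lambda>j. \<alpha> j + \<beta> j)" if "\<alpha> \<in> F" for \<alpha>
  proof (rule prime_exponents_surj)
    show "(\<lambda>j. \<alpha> j + \<beta> j) \<in> finite_exponents"
      using that F \<beta> by (intro finite_exponents_add) auto
    have "\<bar>\<alpha> j\<bar> \<le> \<beta> j" for j
      unfolding \<beta>_def using that F by (intro member_le_sum) auto
    then show "0 \<le> \<alpha> j + \<beta> j" for j by (smt (verit))
  qed
  then obtain m where m: "\<And>\<alpha>. \<alpha> \<in> F \<Longrightarrow> m \<alpha> > 0"
    "\<And>\<alpha>. \<alpha> \<in> F \<Longrightarrow> prime_exponents (m \<alpha>) = (\<lambda>j. \<alpha> j + \<beta> j)"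
    by metis
  define N where "N = Max (insert 0 (m ` F))"
  have N: "m \<alpha> \<in> {1..N}" if "\<alpha> \<in> F" for \<alpha>
    unfolding N_def using that F m(1)[OF that] by (auto intro!: Max_ge simp: Suc_le_eq)
  define b where "b n = (\<Sum>\<alpha>\<in>{\<alpha>\<in>F. m \<alpha> = n}. c \<alpha>)" for n
  have "cmod (p w) = cmod (\<Sum>n=1..N. b n * bohr_char n w)" if w: "w \<in> space torus" for w
  proof -
    have "(\<Sum>n=1..N. b n * bohr_char n w) = (\<Sum>n=1..N. \<Sum>\<alpha>\<in>{\<alpha>\<in>F. m \<alpha> = n}. c \<alpha> * bohr_char (m \<alpha>) w)"
      unfolding b_def sum_distrib_right by (intro sum.cong refl) auto
    also have "\<dots> = (\<Sum>\<alpha>\<in>F. c \<alpha> * bohr_char (m \<alpha>) w)"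
      using F N by (intro sum.group) auto
    also have "\<dots> = (\<Sum>\<alpha>\<in>F. c \<alpha> * (torus_char \<alpha> w * torus_char \<beta> w))"
    proof (intro sum.cong refl)
      fix \<alpha> assume a: "\<alpha> \<in> F"
      then have "bohr_char (m \<alpha>) w = torus_char (\<lambda>j. \<alpha> j + \<beta> j) w"
        using m(1)[OF a] m(2)[OF a] by (simp add: bohr_char_def)
      also have "\<dots> = torus_char \<alpha> w * torus_char \<beta> w"
        using a F \<beta> w by (intro torus_char_add) auto
      finally show "c \<alpha> * bohr_char (m \<alpha>) w = c \<alpha> * (torus_char \<alpha> w * torus_char \<beta> w)" by simp
    qed
    also have "\<dots> = p w * torus_char \<beta> w"
      unfolding p sum_distrib_right by (simp add: mult.assoc)
    finally show ?thesis by (simp add: norm_mult norm_torus_char w)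
  qed
  then show ?thesis by (rule that)
qed

lemma L2_seminorm_density:
  assumes "w \<in> borel_measurable M" "\<And>x. 0 \<le> w x" "u \<in> borel_measurable M"
  shows "L2_seminorm (density M (\<lambda>x. ennreal (w x))) u = L2_seminorm M (\<lambda>x. of_real (sqrt (w x)) * u x)"
  unfolding L2_seminorm_def using assms
  by (subst integral_density) (auto simp: norm_mult power_mult_distrib)

lemma lin_span_torus_bounded:
  assumes "p \<in> lin_span torus_char finite_exponents"
  shows "p \<in> borel_measurable torus" "\<exists>C. AE w in torus. cmod (p w) \<le> C"
proof -
  interpret star_algebra_measure "lin_span torus_char finite_exponents" "space torus" torus
    using torus_star_algebra torus.finite_measure_axioms
    by (simp add: star_algebra_measure_def star_algebra_measure_axioms_def sets_torus)
  show "p \<in> borel_measurable torus" by (rule continuous_measurable[OF cont[OF assms]])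
  show "\<exists>C. AE w in torus. cmod (p w) \<le> C" by (rule continuous_bounded[OF cont[OF assms]]) blast
qed

text \<open>The squares |p|^2 are enough test functions to detect the sign of \<open>h\<close>:
  trigonometric polynomials approximate the indicator of {h < 0} in L2 of the measure u dw, and in
  the limit the integral of \<open>h\<close> over that set is nonnegative. The measure u dw is
  forced by \<open>h\<close> being integrable but possibly unbounded, so that closeness in L2 of
  Haar measure would not control the integrals of h |p|^2.\<close>

lemma torus_weight_nonneg:
  fixes h u :: "(nat \<Rightarrow> complex) \<Rightarrow> real"
  assumes h: "h \<in> borel_measurable torus" and u: "integrable torus u"
    and hu: "\<And>w. \<bar>h w\<bar> \<le> u w"
    and pos: "\<And>p. p \<in> lin_span torus_char finite_exponents \<Longrightarrow> 0 \<le> (LINT w|torus. h w * (cmod (p w))\<^sup>2)"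
  shows "AE w in torus. 0 \<le> h w"
proof -
  let ?V = "lin_span torus_char finite_exponents"
  have um [measurable]: "u \<in> borel_measurable torus" using u by auto
  have hm [measurable]: "h \<in> borel_measurable torus" by fact
  have upos: "0 \<le> u w" for w using hu[of w] by simp
  define \<mu> where "\<mu> = density torus (\<lambda>w. ennreal (u w))"
  have \<mu>: "finite_measure \<mu>"
  proof
    have "emeasure \<mu> (space \<mu>) = (\<integral>\<^sup>+w. ennreal (u w) \<partial>torus)"
      unfolding \<mu>_def by (simp add: emeasure_density cong: nn_integral_cong)
    also have "\<dots> < \<infinity>" using u upos by (simp add: nn_integral_eq_integral)
    finally show "emeasure \<mu> (space \<mu>) \<noteq> \<infinity>" by simp
  qed
  have s\<mu> [measurable_cong]: "sets \<mu> = sets torus" by (simp add: \<mu>_def)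
  define E where "E = {w\<in>space torus. h w < 0}"
  have E [measurable]: "E \<in> sets torus" unfolding E_def by measurable
  define I where "I = (indicator E :: _ \<Rightarrow> complex)"
  have I_m [measurable]: "I \<in> borel_measurable torus" unfolding I_def by measurable
  have I_L2: "I \<in> L2_space \<mu>"
    by (rule finite_measure.L2_space_bounded[OF \<mu>, of _ 1]) (auto simp: I_def s\<mu> indicator_def)
  have "\<exists>p\<in>?V. L2_seminorm \<mu> (\<lambda>x. I x - p x) < 1 / real (Suc n)" for n
    by (rule torus_trig_dense[OF \<mu> s\<mu> I_L2]) simp
  then obtain p where p: "\<And>n. p n \<in> ?V" "\<And>n. L2_seminorm \<mu> (\<lambda>x. I x - p n x) < 1 / real (Suc n)"
    by metis
  have pm [measurable]: "p n \<in> borel_measurable torus" for n by (rule lin_span_torus_bounded[OF p(1)])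
  \<comment> \<open>For 0 <= g <= 2 u the map q |-> sqrt g * q is bounded from L2 of u dw to L2 of
    Haar measure, so the norms of sqrt g * p n converge.\<close>
  have weighted: "(\<lambda>n. LINT w|torus. g w * (cmod (p n w))\<^sup>2) \<longlonglongrightarrow> (LINT w|torus. g w * (cmod (I w))\<^sup>2)"
    and integ: "integrable torus (\<lambda>w. g w * (cmod (p n w))\<^sup>2)" "integrable torus (\<lambda>w. g w * (cmod (I w))\<^sup>2)"
    if g: "g \<in> borel_measurable torus" "\<And>w. 0 \<le> g w" "\<And>w. g w \<le> 2 * u w" for g n
  proof -
    note g(1) [measurable]
    have bnd: "(\<lambda>w. of_real (sqrt (g w)) * q w) \<in> L2_space torus"
      if q: "q \<in> borel_measurable torus" "\<exists>C. AE w in torus. cmod (q w) \<le> C" for q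
    proof -
      from q(2) obtain C where C: "AE w in torus. cmod (q w) \<le> C" by blast
      note q(1) [measurable]
      show ?thesis
      proof (rule L2_space_dominated[where g = "\<lambda>w. 2 * C\<^sup>2 * u w"])
        show "AE w in torus. (cmod (of_real (sqrt (g w)) * q w))\<^sup>2 \<le> 2 * C\<^sup>2 * u w"
          using C
        proof eventually_elim
          case (elim w)
          have "(cmod (of_real (sqrt (g w)) * q w))\<^sup>2 = g w * (cmod (q w))\<^sup>2"
            using g(2) by (simp add: norm_mult power_mult_distrib)
          also have "\<dots> \<le> (2 * u w) * C\<^sup>2"
            using g elim upos by (intro mult_mono power_mono) auto
          finally show ?case by (simp add: mult_ac)
        qed
      qed (use u in auto)
    qed
    have gp: "(\<lambda>w. of_real (sqrt (g w)) * p n w) \<in> L2_space torus" for n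
      by (rule bnd[OF lin_span_torus_bounded[OF p(1)]])
    have gI: "(\<lambda>w. of_real (sqrt (g w)) * I w) \<in> L2_space torus"
      by (rule bnd) (auto intro!: exI[of _ 1] simp: I_def indicator_def)
    have sq: "(cmod (of_real (sqrt (g w)) * q w))\<^sup>2 = g w * (cmod (q w))\<^sup>2" for q :: "_ \<Rightarrow> complex" and w
      using g(2) by (simp add: norm_mult power_mult_distrib)
    show "integrable torus (\<lambda>w. g w * (cmod (p n w))\<^sup>2)" "integrable torus (\<lambda>w. g w * (cmod (I w))\<^sup>2)"
      using L2_spaceD(2)[OF gp[of n]] L2_spaceD(2)[OF gI] by (simp_all only: sq)
    have "(\<lambda>n. L2_seminorm torus (\<lambda>w. of_real (sqrt (g w)) * p n w - of_real (sqrt (g w)) * I w)) \<longlonglongrightarrow> 0"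
    proof (rule Lim_null_comparison)
      have bound: "L2_seminorm torus (\<lambda>w. of_real (sqrt (g w)) * p n w - of_real (sqrt (g w)) * I w)
          \<le> sqrt 2 * (1 / real (Suc n))" for n
      proof -
        let ?d = "\<lambda>w. p n w - I w"
        have L: "?d \<in> L2_space \<mu>"
        proof (intro L2_space_diff I_L2)
          have "\<exists>C. AE w in torus. cmod (p n w) \<le> C" by (rule lin_span_torus_bounded[OF p(1)])
          then obtain C where "AE w in torus. cmod (p n w) \<le> C" by blast
          then have "AE w in \<mu>. cmod (p n w) \<le> C"
            unfolding \<mu>_def by (subst AE_density) auto
          then show "p n \<in> L2_space \<mu>"
            by (intro finite_measure.L2_space_bounded[OF \<mu>]) (auto simp: s\<mu> cong: measurable_cong_sets)
        qed
        have "integrable torus (\<lambda>w. u w *\<^sub>R (cmod (?d w))\<^sup>2)"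
          using L2_spaceD(2)[OF L] unfolding \<mu>_def
          by (subst (asm) integrable_density) (use upos in auto)
        then have iu: "integrable torus (\<lambda>w. u w * (cmod (?d w))\<^sup>2)" by simp
        have "(L2_seminorm torus (\<lambda>w. of_real (sqrt (g w)) * ?d w))\<^sup>2 = (LINT w|torus. g w * (cmod (?d w))\<^sup>2)"
          unfolding L2_seminorm_power2 by (simp only: sq[where q = ?d])
        also have "\<dots> \<le> (LINT w|torus. 2 * (u w * (cmod (?d w))\<^sup>2))"
        proof (rule integral_mono)
          show "integrable torus (\<lambda>w. 2 * (u w * (cmod (?d w))\<^sup>2))" using iu by simp
          show "g w * (cmod (?d w))\<^sup>2 \<le> 2 * (u w * (cmod (?d w))\<^sup>2)" for w
            using mult_right_mono[OF g(3)[of w], of "(cmod (?d w))\<^sup>2"] by (simp add: mult_ac)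
          show "integrable torus (\<lambda>w. g w * (cmod (?d w))\<^sup>2)"
          proof (rule Bochner_Integration.integrable_bound[OF _ _ AE_I2])
            show "integrable torus (\<lambda>w. 2 * (u w * (cmod (?d w))\<^sup>2))" using iu by simp
            show "norm (g w * (cmod (?d w))\<^sup>2) \<le> norm (2 * (u w * (cmod (?d w))\<^sup>2))" for w
              using mult_right_mono[OF g(3)[of w], of "(cmod (?d w))\<^sup>2"] g(2)[of w] upos[of w]
              by (simp add: abs_mult mult_ac)
          qed auto
        qed
        also have "\<dots> = 2 * (L2_seminorm torus (\<lambda>w. of_real (sqrt (u w)) * ?d w))\<^sup>2"
          unfolding L2_seminorm_power2 using upos by (simp add: norm_mult power_mult_distrib)
        also have "L2_seminorm torus (\<lambda>w. of_real (sqrt (u w)) * ?d w) = L2_seminorm \<mu> ?d"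
          unfolding \<mu>_def by (rule L2_seminorm_density[symmetric]) (use upos in auto)
        also have "2 * (L2_seminorm \<mu> ?d)\<^sup>2 \<le> 2 * (1 / real (Suc n))\<^sup>2"
          using p(2)[of n] by (intro mult_left_mono power_mono) (auto simp: L2_seminorm_minus_commute[of \<mu> I])
        also have "\<dots> = (sqrt 2 * (1 / real (Suc n)))\<^sup>2" by (simp add: power_mult_distrib power_divide)
        finally have "L2_seminorm torus (\<lambda>w. of_real (sqrt (g w)) * ?d w) \<le> sqrt 2 * (1 / real (Suc n))"
          by (rule power2_le_imp_le) simp
        then show ?thesis by (simp add: algebra_simps)
      qed
      then show "\<forall>\<^sub>F n in sequentially. norm (L2_seminorm torus (\<lambda>w. of_real (sqrt (g w)) * p n w - of_real (sqrt (g w)) * I w))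
          \<le> sqrt 2 * (1 / real (Suc n))" by simp
      show "(\<lambda>n. sqrt 2 * (1 / real (Suc n))) \<longlonglongrightarrow> 0"
        using tendsto_mult_right_zero[OF lim_1_over_n[THEN LIMSEQ_Suc], of "sqrt 2"] by simp
    qed
    from tendsto_power[OF L2_seminorm_tendsto[OF gp gI this], of 2]
    show "(\<lambda>n. LINT w|torus. g w * (cmod (p n w))\<^sup>2) \<longlonglongrightarrow> (LINT w|torus. g w * (cmod (I w))\<^sup>2)"
      unfolding L2_seminorm_power2 sq .
  qed
  \<comment> \<open>The signed weight is written as h = u - (u - h), a difference of two nonnegative
    weights below 2 u.\<close>
  have g1: "u \<in> borel_measurable torus" "\<And>w. 0 \<le> u w" "\<And>w. u w \<le> 2 * u w" using upos by auto
  have g2: "(\<lambda>w. u w - h w) \<in> borel_measurable torus" "\<And>w. 0 \<le> u w - h w" "\<And>w. u w - h w \<le> 2 * u w"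
    using abs_le_D1[OF hu] abs_le_D2[OF hu] by (auto simp: algebra_simps add_increasing2) (smt (verit))
  have split: "(LINT w|torus. h w * (cmod (q w))\<^sup>2)
      = (LINT w|torus. u w * (cmod (q w))\<^sup>2) - (LINT w|torus. (u w - h w) * (cmod (q w))\<^sup>2)"
    if "integrable torus (\<lambda>w. u w * (cmod (q w))\<^sup>2)" "integrable torus (\<lambda>w. (u w - h w) * (cmod (q w))\<^sup>2)"
    for q :: "_ \<Rightarrow> complex"
    by (subst Bochner_Integration.integral_diff[symmetric, OF that]) (simp add: algebra_simps)
  have "(\<lambda>n. LINT w|torus. h w * (cmod (p n w))\<^sup>2) \<longlonglongrightarrow> (LINT w|torus. h w * (cmod (I w))\<^sup>2)"
    unfolding split[OF integ(1)[OF g1] integ(1)[OF g2]] split[OF integ(2)[OF g1] integ(2)[OF g2]]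
    by (intro tendsto_diff weighted[OF g1] weighted[OF g2])
  then have "0 \<le> (LINT w|torus. h w * (cmod (I w))\<^sup>2)"
    by (rule tendsto_lowerbound) (auto intro!: always_eventually pos p)
  moreover have hI: "h w * (cmod (I w))\<^sup>2 = - (if w \<in> E then - h w else 0)" for w
    by (simp add: I_def indicator_def)
  ultimately have "(LINT w|torus. (if w \<in> E then - h w else 0)) \<le> 0"
    by simp
  moreover have nn: "0 \<le> (if w \<in> E then - h w else 0)" for w by (auto simp: E_def)
  moreover have "0 \<le> (LINT w|torus. (if w \<in> E then - h w else 0))" by (rule Bochner_Integration.integral_nonneg) (rule nn)
  moreover have "integrable torus (\<lambda>w. if w \<in> E then - h w else 0)"
    by (rule Bochner_Integration.integrable_bound[OF u]) (use hu upos in \<open>auto intro!: AE_I2\<close>)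
  ultimately have "AE w in torus. (if w \<in> E then - h w else 0) = 0"
    by (subst integral_nonneg_eq_0_iff_AE[symmetric]) auto
  then show ?thesis
    using AE_space by eventually_elim (auto simp: E_def split: if_splits)
qed

lemma bohr_poly_L2:
  assumes "f \<in> L2_space torus"
  shows "(\<lambda>w. f w * (\<Sum>n=1..N. b n * bohr_char n w)) \<in> L2_space torus"
proof (rule L2_space_bounded_mult[OF assms])
  show "AE w in torus. cmod (\<Sum>n=1..N. b n * bohr_char n w) \<le> (\<Sum>n=1..N. cmod (b n))"
    by (intro AE_I2 sum_norm_le) (auto simp: norm_mult norm_bohr_char)
qed auto

lemma bohr_poly_norm:
  "L2_seminorm torus (\<lambda>w. \<Sum>n=1..N. b n * bohr_char n w) = sqrt (\<Sum>n=1..N. (cmod (b n))\<^sup>2)"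
proof -
  have "(L2_seminorm torus (\<lambda>w. \<Sum>n=1..N. b n * bohr_char n w))\<^sup>2 = (\<Sum>n=1..N. (cmod (b n))\<^sup>2)"
    by (rule orthonormal_norm[OF bohr_orthonormal]) auto
  then show ?thesis by (intro real_sqrt_unique[symmetric]) auto
qed

lemma trig_poly_multiplier_integrable:
  assumes f: "f \<in> L2_space torus" and p: "p \<in> lin_span torus_char finite_exponents"
  shows "integrable torus (\<lambda>w. (cmod (f w))\<^sup>2 * (cmod (p w))\<^sup>2)" "integrable torus (\<lambda>w. (cmod (p w))\<^sup>2)"
proof -
  from lin_span_torus_bounded[OF p] obtain C where C: "p \<in> borel_measurable torus" "AE w in torus. cmod (p w) \<le> C"
    by blast
  show "integrable torus (\<lambda>w. (cmod (f w))\<^sup>2 * (cmod (p w))\<^sup>2)"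
    using L2_spaceD(2)[OF L2_space_bounded_mult[OF f C]] by (simp add: norm_mult power_mult_distrib)
  show "integrable torus (\<lambda>w. (cmod (p w))\<^sup>2)"
    using L2_spaceD(2)[OF torus.L2_space_bounded[OF C]] .
qed

text \<open>Squared, the hypothesis says that the weight |f|^2 - A^2 has nonnegative integral
  against |P|^2. The weight is merely integrable, whence the majorant |f|^2 + A^2.\<close>

lemma multiplier_lower_bound:
  assumes f: "f \<in> L2_space torus" and A: "0 \<le> A"
    and bound: "\<And>N b. A * sqrt (\<Sum>n=1..N. (cmod (b n))\<^sup>2)
      \<le> L2_seminorm torus (\<lambda>w. f w * (\<Sum>n=1..N. b n * bohr_char n w))"
  shows "AE w in torus. A \<le> cmod (f w)"
proof -
  have fm [measurable]: "f \<in> borel_measurable torus" using f by auto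
  have "AE w in torus. 0 \<le> (cmod (f w))\<^sup>2 - A\<^sup>2"
  proof (rule torus_weight_nonneg[where u = "\<lambda>w. (cmod (f w))\<^sup>2 + A\<^sup>2"])
    fix p assume p: "p \<in> lin_span torus_char finite_exponents"
    from trig_poly_analytic[OF p] obtain N b where
      b: "\<And>w. w \<in> space torus \<Longrightarrow> cmod (p w) = cmod (\<Sum>n=1..N. b n * bohr_char n w)" by metis
    have "A\<^sup>2 * (LINT w|torus. (cmod (p w))\<^sup>2) = (A * sqrt (\<Sum>n=1..N. (cmod (b n))\<^sup>2))\<^sup>2"
      unfolding bohr_poly_norm[symmetric] power_mult_distrib L2_seminorm_power2
      using b by (simp cong: Bochner_Integration.integral_cong)
    also have "\<dots> \<le> (L2_seminorm torus (\<lambda>w. f w * (\<Sum>n=1..N. b n * bohr_char n w)))\<^sup>2"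
      using A by (intro power_mono bound mult_nonneg_nonneg) (auto intro: sum_nonneg)
    also have "\<dots> = (LINT w|torus. (cmod (f w))\<^sup>2 * (cmod (p w))\<^sup>2)"
      unfolding L2_seminorm_power2
      using b by (simp add: norm_mult power_mult_distrib cong: Bochner_Integration.integral_cong)
    finally show "0 \<le> (LINT w|torus. ((cmod (f w))\<^sup>2 - A\<^sup>2) * (cmod (p w))\<^sup>2)"
      using trig_poly_multiplier_integrable[OF f p] by (simp add: left_diff_distrib)
  qed (use f in \<open>auto simp: abs_le_iff\<close>)
  then show ?thesis
  proof eventually_elim
    case (elim w)
    then show ?case by (simp add: power2_le_iff_abs_le A)
  qed
qed

lemma multiplier_upper_bound:
  assumes f: "f \<in> L2_space torus" and B: "0 \<le> B"
    and bound: "\<And>N b. L2_seminorm torus (\<lambda>w. f w * (\<Sum>n=1..N. b n * bohr_char n w))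
      \<le> B * sqrt (\<Sum>n=1..N. (cmod (b n))\<^sup>2)"
  shows "AE w in torus. cmod (f w) \<le> B"
proof -
  have fm [measurable]: "f \<in> borel_measurable torus" using f by auto
  have "AE w in torus. 0 \<le> B\<^sup>2 - (cmod (f w))\<^sup>2"
  proof (rule torus_weight_nonneg[where u = "\<lambda>w. (cmod (f w))\<^sup>2 + B\<^sup>2"])
    fix p assume p: "p \<in> lin_span torus_char finite_exponents"
    from trig_poly_analytic[OF p] obtain N b where
      b: "\<And>w. w \<in> space torus \<Longrightarrow> cmod (p w) = cmod (\<Sum>n=1..N. b n * bohr_char n w)" by metis
    have "(LINT w|torus. (cmod (f w))\<^sup>2 * (cmod (p w))\<^sup>2) = (L2_seminorm torus (\<lambda>w. f w * (\<Sum>n=1..N. b n * bohr_char n w)))\<^sup>2"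
      unfolding L2_seminorm_power2
      using b by (simp add: norm_mult power_mult_distrib cong: Bochner_Integration.integral_cong)
    also have "\<dots> \<le> (B * sqrt (\<Sum>n=1..N. (cmod (b n))\<^sup>2))\<^sup>2"
      by (intro power_mono bound) auto
    also have "\<dots> = B\<^sup>2 * (LINT w|torus. (cmod (p w))\<^sup>2)"
      unfolding bohr_poly_norm[symmetric] power_mult_distrib L2_seminorm_power2
      using b by (simp cong: Bochner_Integration.integral_cong)
    finally show "0 \<le> (LINT w|torus. (B\<^sup>2 - (cmod (f w))\<^sup>2) * (cmod (p w))\<^sup>2)"
      using trig_poly_multiplier_integrable[OF f p] by (simp add: left_diff_distrib)
  qed (use f in \<open>auto simp: abs_le_iff\<close>)
  then show ?thesis
  proof eventually_elim
    case (elim w)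
    then show ?case by (simp add: power2_le_iff_abs_le B)
  qed
qed

subsection \<open>Haar measure has full support\<close>

lemma circle_open_pos:
  assumes X: "open X" and v: "v \<in> X" "cmod v = 1"
  shows "emeasure circle_measure (X \<inter> sphere 0 1) > 0"
proof -
  define t0 where "t0 = Arg2pi v / (2 * pi)"
  have t0: "0 \<le> t0" "t0 < 1" using Arg2pi_ge_0[of v] Arg2pi_lt_2pi[of v] by (auto simp: t0_def)
  have "v = cis (2 * pi * t0)"
    using Arg2pi_eq[of v] v by (simp add: t0_def cis_conv_exp)
  define G where "G = (\<lambda>t. cis (2 * pi * t)) -` X"
  have G: "open G" unfolding G_def by (intro open_vimage X continuous_intros)
  have "t0 \<in> G" using v \<open>v = cis (2 * pi * t0)\<close> by (simp add: G_def)
  then obtain d where d: "d > 0" "ball t0 d \<subseteq> G" using G openE by blast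
  \<comment> \<open>The argument lies in [0, 2 pi), so t0 < 1 and there is always an interval to the
    right of t0 that stays inside [0, 1].\<close>
  define r where "r = min d (1 - t0)"
  have r: "r > 0" using d t0 by (simp add: r_def)
  have sub: "{t0<..<t0 + r} \<subseteq> {0..1} \<inter> G"
    using t0 d(2) by (auto simp: r_def subset_iff dist_real_def)
  have "0 < emeasure lborel {t0<..<t0 + r}" using r by simp
  also have "\<dots> \<le> emeasure lborel ({0..1} \<inter> G)"
    using G by (intro emeasure_mono sub) auto
  also have "\<dots> = emeasure (uniform_measure lborel {0..1}) G"
  proof -
    have Gs: "G \<in> sets lborel" using G by simp
    have "emeasure (uniform_measure lborel {0..1}) G = emeasure lborel ({0..1} \<inter> G) / emeasure lborel {0..1::real}"
      by (rule emeasure_uniform_measure[OF _ Gs]) simp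
    also have "emeasure lborel {0..1::real} = 1" by simp
    also have "emeasure lborel ({0..1} \<inter> G) / 1 = emeasure lborel ({0..1} \<inter> G)"
      unfolding divide_ennreal_def by (simp only: ennreal_inverse_1 mult_1_right)
    finally show ?thesis ..
  qed
  also have "\<dots> = emeasure circle_measure (X \<inter> sphere 0 1)"
  proof -
    have "X \<inter> sphere 0 1 \<in> sets (restrict_space borel (sphere (0::complex) 1))"
      unfolding sets_restrict_space using X by (intro image_eqI[of _ _ X]) (auto simp: Int_commute)
    note em = emeasure_distr[OF cis_measurable_circle this]
    have "(\<lambda>t. cis (2 * pi * t)) -` (X \<inter> sphere 0 1) \<inter> space (uniform_measure lborel {0..1}) = G"
      unfolding G_def by (rule set_eqI) simp
    with em show ?thesis by (simp only: circle_measure_def)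
  qed
  finally show ?thesis .
qed

text \<open>The set where a continuous function exceeds C is open. If it is nonempty it contains a
  basic box, which restricts only finitely many coordinates and therefore has positive measure,
  being a finite product of positive numbers.\<close>

lemma torus_AE_bound_everywhere:
  fixes q :: "(nat \<Rightarrow> complex) \<Rightarrow> complex"
  assumes q: "continuous_on (space torus) q" and ae: "AE w in torus. cmod (q w) \<le> C"
    and v: "v \<in> space torus"
  shows "cmod (q v) \<le> C"
proof (rule ccontr)
  assume "\<not> cmod (q v) \<le> C"
  then have v': "v \<in> space torus \<inter> (\<lambda>w. cmod (q w)) -` {C<..}" using v by simp
  have cq: "continuous_on (space torus) (\<lambda>w. cmod (q w))" by (intro continuous_intros q)
  obtain U where U: "open U" "U \<inter> space torus = (\<lambda>w. cmod (q w)) -` {C<..} \<inter> space torus"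
    using continuous_on_open_invariant[THEN iffD1, OF cq, rule_format, OF open_greaterThan[of C]] by blast
  have "openin (product_topology (\<lambda>i::nat. euclidean) UNIV) U" using U(1) by (simp add: open_fun_def)
  moreover have "v \<in> U" using v' U(2) by blast
  ultimately have "\<exists>X. v \<in> (\<Pi>\<^sub>E i\<in>UNIV. X i) \<and> (\<forall>i. openin euclidean (X i)) \<and>
      finite {i. X i \<noteq> topspace euclidean} \<and> (\<Pi>\<^sub>E i\<in>UNIV. X i) \<subseteq> U"
    by (rule product_topology_open_contains_basis)
  then obtain X where X: "v \<in> (\<Pi>\<^sub>E i\<in>UNIV. X i)" "\<And>i. openin euclidean (X i)"
    "finite {i. X i \<noteq> topspace euclidean}" "(\<Pi>\<^sub>E i\<in>UNIV. X i) \<subseteq> U"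
    by blast
  define J where "J = {i. X i \<noteq> UNIV}"
  have J: "finite J" using X(3) by (simp add: J_def)
  have Xo1: "open (X i)" for i using X(2)[of i] by (rule open_openin[THEN iffD2])
  have Xo2: "v i \<in> X i" for i using X(1) by (simp add: PiE_iff)
  have vi: "cmod (v i) = 1" for i using v by (simp add: space_torus)
  define W where "W = {w\<in>space torus. \<forall>i\<in>J. w i \<in> X i \<inter> sphere 0 1}"
  have Xs: "X i \<inter> sphere 0 1 \<in> sets circle_measure" for i
    unfolding sets_circle sets_restrict_space using borel_open[OF Xo1[of i]]
    by (intro image_eqI[of _ _ "X i"]) (simp_all add: Int_commute)
  have "emeasure torus W = (\<Prod>i\<in>J. emeasure circle_measure (X i \<inter> sphere 0 1))"
    unfolding W_def torus_def by (rule torus_prod.emeasure_PiM_Collect) (simp_all add: J Xs)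
  also have "\<dots> > 0"
    using J circle_open_pos[OF Xo1 Xo2 vi] by (simp add: zero_less_iff_neq_zero)
  finally have W_pos: "emeasure torus W > 0" .
  have "W \<subseteq> {w\<in>space torus. \<not> cmod (q w) \<le> C}"
  proof
    fix w assume w: "w \<in> W"
    then have "w i \<in> X i" for i by (cases "i \<in> J") (auto simp: W_def J_def)
    then have "w \<in> (\<Pi>\<^sub>E i\<in>UNIV. X i)" by (simp add: PiE_iff)
    then have "w \<in> U" using X(4) by (rule subsetD[rotated])
    then have "w \<in> U \<inter> space torus" using w by (simp add: W_def)
    then show "w \<in> {w\<in>space torus. \<not> cmod (q w) \<le> C}" using U(2) by auto
  qed
  moreover from ae obtain Z where Z: "{w\<in>space torus. \<not> cmod (q w) \<le> C} \<subseteq> Z" "emeasure torus Z = 0" "Z \<in> sets torus"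
    by (rule AE_E)
  ultimately have "emeasure torus W \<le> 0" using emeasure_mono[OF subset_trans Z(3), of W] Z(1,2) by simp
  then show False using W_pos by simp
qed

subsection \<open>Fejer and Poisson kernels on the line\<close>

lemma integrable_inverse_1_plus_square': "integrable lborel (\<lambda>x::real. inverse (1 + x\<^sup>2))"
  using integrable_inverse_1_plus_square by (simp add: set_integrable_def einterval_def)

lemma one_minus_cos_bounds:
  fixes t :: real
  shows "0 \<le> 1 - cos t" "1 - cos t \<le> 2" "1 - cos t \<le> t\<^sup>2 / 2"
proof -
  show "0 \<le> 1 - cos t" "1 - cos t \<le> 2" using cos_le_one[of t] cos_ge_minus_one[of t] by auto
  have "1 - cos t = 2 * (sin (t / 2))\<^sup>2"
    using cos_double_sin[of "t / 2"] by simp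
  also have "(sin (t / 2))\<^sup>2 \<le> (t / 2)\<^sup>2"
    using power_mono[OF abs_sin_x_le_abs_x[of "t / 2"], of 2] by (simp add: power_divide)
  finally show "1 - cos t \<le> t\<^sup>2 / 2" by (simp add: power_divide)
qed

lemma integrable_one_minus_cos: "integrable lborel (\<lambda>t::real. (1 - cos t) / t\<^sup>2)"
proof (rule Bochner_Integration.integrable_bound[where f = "\<lambda>x::real. 4 * inverse (1 + x\<^sup>2)"])
  show "integrable lborel (\<lambda>x::real. 4 * inverse (1 + x\<^sup>2))"
    using integrable_inverse_1_plus_square' by simp
  show "AE t::real in lborel. norm ((1 - cos t) / t\<^sup>2) \<le> norm (4 * inverse (1 + t\<^sup>2))"
  proof (rule AE_I2)
    fix t :: real
    have "(1 - cos t) / t\<^sup>2 \<le> 4 * inverse (1 + t\<^sup>2)"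
    proof (cases "t = 0")
      case False
      have "(1 - cos t) * (1 + t\<^sup>2) \<le> 4 * t\<^sup>2"
      proof (cases "t\<^sup>2 \<le> 1")
        case True
        have "(1 - cos t) * (1 + t\<^sup>2) \<le> (t\<^sup>2 / 2) * 2"
          using True one_minus_cos_bounds[of t] by (intro mult_mono) auto
        then show ?thesis using zero_le_power2[of t] by linarith
      next
        case False
        have "(1 - cos t) * (1 + t\<^sup>2) \<le> 2 * (t\<^sup>2 + t\<^sup>2)"
          using False one_minus_cos_bounds[of t] by (intro mult_mono) auto
        then show ?thesis by simp
      qed
      moreover have "t\<^sup>2 > 0" "1 + t\<^sup>2 > 0" using False by (auto intro: add_pos_nonneg)
      ultimately show ?thesis by (simp add: field_simps)
    qed simp
    then show "norm ((1 - cos t) / t\<^sup>2) \<le> norm (4 * inverse (1 + t\<^sup>2))"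
      using one_minus_cos_bounds[of t] by simp
  qed
qed auto

text \<open>The value of this integral is \<open>\<pi>\<close>, but only its positivity matters.\<close>

definition fejer_const :: real where
  "fejer_const = (LINT t|lborel. (1 - cos t) / t\<^sup>2)"

lemma fejer_const_pos: "fejer_const > 0"
proof -
  have pos: "(1 - cos t) / t\<^sup>2 \<ge> 0" for t :: real
    using one_minus_cos_bounds[of t] by simp
  have "fejer_const \<noteq> 0"
  proof
    assume "fejer_const = 0"
    then have "AE t in lborel. (1 - cos t) / t\<^sup>2 = (0::real)"
      unfolding fejer_const_def
      by (subst (asm) integral_nonneg_eq_0_iff_AE) (auto simp: pos integrable_one_minus_cos)
    then have "AE t in lborel. t \<notin> {1<..<2::real}"
    proof eventually_elim
      case (elim t)
      show ?case
      proof
        assume t: "t \<in> {1<..<2}"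
        then have "cos t < cos 0" using pi_ge_two by (intro cos_monotone_0_pi) auto
        then show False using elim t by auto
      qed
    qed
    then have "{1<..<2::real} \<in> null_sets lborel"
      by (subst AE_iff_null_sets) auto
    then have "emeasure lborel {1<..<2::real} = 0" by (rule null_setsD1)
    then show False by (subst (asm) emeasure_lborel_Ioo) auto
  qed
  moreover have "fejer_const \<ge> 0"
    unfolding fejer_const_def by (intro Bochner_Integration.integral_nonneg pos)
  ultimately show ?thesis by simp
qed

text \<open>Substitution of c t for t. The function |c| that appears is the source of all Fourier
  transforms below: the tent max 0 (R - |x|) is a second difference of it.\<close>

lemma one_minus_cos_scaled:
  fixes c :: real
  shows "integrable lborel (\<lambda>t. (1 - cos (c * t)) / t\<^sup>2)"
    and "(LINT t|lborel. (1 - cos (c * t)) / t\<^sup>2) = \<bar>c\<bar> * fejer_const"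
proof -
  show "integrable lborel (\<lambda>t. (1 - cos (c * t)) / t\<^sup>2)"
  proof (cases "c = 0")
    case False
    have "integrable lborel (\<lambda>t. c\<^sup>2 * ((1 - cos (0 + c * t)) / (0 + c * t)\<^sup>2))"
      using False integrable_one_minus_cos
      by (intro integrable_mult_right lborel_integrable_real_affine) auto
    then show ?thesis using False by (simp add: power_mult_distrib)
  qed simp
  show "(LINT t|lborel. (1 - cos (c * t)) / t\<^sup>2) = \<bar>c\<bar> * fejer_const"
  proof (cases "c = 0")
    case False
    have "fejer_const = \<bar>c\<bar> * (LINT t|lborel. (1 - cos (0 + c * t)) / (0 + c * t)\<^sup>2)"
      unfolding fejer_const_def
      using lborel_integral_real_affine[OF False, of "\<lambda>t. (1 - cos t) / t\<^sup>2" 0] by simp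
    also have "(LINT t|lborel. (1 - cos (0 + c * t)) / (0 + c * t)\<^sup>2) = (1 / c\<^sup>2) * (LINT t|lborel. (1 - cos (c * t)) / t\<^sup>2)"
      unfolding integral_mult_right_zero[symmetric]
      by (intro Bochner_Integration.integral_cong) (auto simp: power_mult_distrib)
    finally have "fejer_const = \<bar>c\<bar> / c\<^sup>2 * (LINT t|lborel. (1 - cos (c * t)) / t\<^sup>2)" by simp
    then have "\<bar>c\<bar> * fejer_const = \<bar>c\<bar> * (\<bar>c\<bar> / c\<^sup>2 * (LINT t|lborel. (1 - cos (c * t)) / t\<^sup>2))"
      by (simp only:)
    also have "\<dots> = (\<bar>c\<bar> * \<bar>c\<bar>) / c\<^sup>2 * (LINT t|lborel. (1 - cos (c * t)) / t\<^sup>2)"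
      by (simp only: mult.assoc times_divide_eq_right times_divide_eq_left)
    also have "\<bar>c\<bar> * \<bar>c\<bar> = c\<^sup>2" by (simp add: power2_eq_square)
    finally show ?thesis using False by simp
  qed simp
qed

text \<open>Normalised so that the Fourier transform is the tent max 0 (R - |x|); the total mass is
  R and not 1. At t = 0 division by zero returns 0, so for R \<noteq> 0 the function jumps there;
  \<open>fejer_sinc\<close> supplies a continuous version.\<close>

definition fejer :: "real \<Rightarrow> real \<Rightarrow> real" where
  "fejer R t = (1 - cos (R * t)) / (fejer_const * t\<^sup>2)"

lemma fejer_nonneg: "0 \<le> fejer R t"
  unfolding fejer_def using one_minus_cos_bounds fejer_const_pos by (intro divide_nonneg_nonneg) auto

lemma fejer_even [simp]: "fejer R (- t) = fejer R t"
  by (simp add: fejer_def)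

lemma fejer_alt: "fejer R t = (1 / fejer_const) * ((1 - cos (R * t)) / t\<^sup>2)"
  by (simp add: fejer_def)

lemma fejer_integrable: "integrable lborel (fejer R)"
  unfolding fejer_alt[abs_def] by (intro integrable_mult_right one_minus_cos_scaled)

lemma fejer_measurable [measurable]: "(\<lambda>p. fejer (fst p) (snd p)) \<in> borel_measurable (borel \<Otimes>\<^sub>M borel)"
  unfolding fejer_def by measurable

lemma fejer_measurable' [measurable]: "fejer R \<in> borel_measurable borel"
  unfolding fejer_def by measurable

lemma integral_odd_zero:
  fixes f :: "real \<Rightarrow> real"
  assumes "\<And>t. f (- t) = - f t"
  shows "(LINT t|lborel. f t) = 0"
  using lborel_integral_real_affine[of "-1" f 0] assms by simp

text \<open>The product formula for cosines splits (1 - cos (R t)) cos (t x) into three terms of the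
  form 1 - cos (c t). Their integrals add up to (|R + x| + |R - x|) / 2 - |x|, which is the tent.
  The sine part is odd.\<close>

lemma fejer_fourier:
  assumes "0 \<le> R"
  shows "(LINT t|lborel. fejer R t * cis (- t * x)) = of_real (max 0 (R - \<bar>x\<bar>))"
proof -
  have ic: "integrable lborel (\<lambda>t. fejer R t * cos (t * x))"
    by (rule Bochner_Integration.integrable_bound[OF fejer_integrable[of R]])
      (auto intro!: AE_I2 mult_left_le simp: abs_mult fejer_nonneg)
  have ism: "integrable lborel (\<lambda>t. fejer R t * sin (t * x))"
    by (rule Bochner_Integration.integrable_bound[OF fejer_integrable[of R]])
      (auto intro!: AE_I2 mult_left_le simp: abs_mult fejer_nonneg)
  have "(LINT t|lborel. fejer R t * cos (t * x))
      = (LINT t|lborel. (1 / fejer_const) * ((1 / 2) * ((1 - cos ((R + x) * t)) / t\<^sup>2)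
          + (1 / 2) * ((1 - cos ((R - x) * t)) / t\<^sup>2) - (1 - cos (x * t)) / t\<^sup>2))"
  proof (intro Bochner_Integration.integral_cong refl)
    fix t :: real
    have E: "(1 - cos (R * t)) * cos (t * x)
        = (1 / 2) * (1 - cos ((R + x) * t)) + (1 / 2) * (1 - cos ((R - x) * t)) - (1 - cos (x * t))"
    proof -
      have "cos ((R + x) * t) = cos (R * t) * cos (t * x) - sin (R * t) * sin (t * x)"
        unfolding distrib_right cos_add by (simp add: mult.commute)
      moreover have "cos ((R - x) * t) = cos (R * t) * cos (t * x) + sin (R * t) * sin (t * x)"
        unfolding left_diff_distrib cos_diff by (simp add: mult.commute)
      moreover have "cos (x * t) = cos (t * x)" by (simp add: mult.commute)
      ultimately show ?thesis by (simp add: algebra_simps)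
    qed
    have "fejer R t * cos (t * x) = (1 / fejer_const) * (((1 - cos (R * t)) * cos (t * x)) / t\<^sup>2)"
      unfolding fejer_alt by simp
    also have "\<dots> = (1 / fejer_const) * ((1 / 2) * ((1 - cos ((R + x) * t)) / t\<^sup>2)
          + (1 / 2) * ((1 - cos ((R - x) * t)) / t\<^sup>2) - (1 - cos (x * t)) / t\<^sup>2)"
      unfolding E by (simp add: add_divide_distrib diff_divide_distrib)
    finally show "fejer R t * cos (t * x) = (1 / fejer_const) * ((1 / 2) * ((1 - cos ((R + x) * t)) / t\<^sup>2)
          + (1 / 2) * ((1 - cos ((R - x) * t)) / t\<^sup>2) - (1 - cos (x * t)) / t\<^sup>2)" .
  qed
  also have "\<dots> = (1 / fejer_const) * ((1 / 2) * (\<bar>R + x\<bar> * fejer_const) + (1 / 2) * (\<bar>R - x\<bar> * fejer_const)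
      - \<bar>x\<bar> * fejer_const)"
    by (simp add: one_minus_cos_scaled del: times_divide_eq_left times_divide_eq_right divide_const_simps)
  also have "\<dots> = (\<bar>R + x\<bar> + \<bar>R - x\<bar>) / 2 - \<bar>x\<bar>"
    using fejer_const_pos by (simp add: field_simps)
  also have "\<dots> = max 0 (R - \<bar>x\<bar>)" using assms by (auto simp: max_def abs_if)
  finally have c: "(LINT t|lborel. fejer R t * cos (t * x)) = max 0 (R - \<bar>x\<bar>)" .
  have s: "(LINT t|lborel. fejer R t * sin (t * x)) = 0"
    by (rule integral_odd_zero) simp
  have "(LINT t|lborel. fejer R t * cis (- t * x))
      = (LINT t|lborel. complex_of_real (fejer R t * cos (t * x)) - \<i> * complex_of_real (fejer R t * sin (t * x)))"
    by (intro Bochner_Integration.integral_cong) (auto simp: complex_eq_iff)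
  also have "\<dots> = complex_of_real (LINT t|lborel. fejer R t * cos (t * x))
      - \<i> * complex_of_real (LINT t|lborel. fejer R t * sin (t * x))"
    using ic ism by (subst Bochner_Integration.integral_diff) (auto simp del: of_real_mult)
  finally show ?thesis by (simp add: c s)
qed

lemma fejer_integral: "0 \<le> R \<Longrightarrow> (LINT t|lborel. fejer R t) = R"
proof -
  assume R: "0 \<le> R"
  have "complex_of_real (LINT t|lborel. fejer R t) = (LINT t|lborel. fejer R t * cis (- t * 0))"
    by simp
  also have "\<dots> = of_real R" using R by (subst fejer_fourier[OF R]) simp
  finally show ?thesis using of_real_eq_iff by blast
qed

section \<open>The Poisson kernel\<close>

definition poisson :: "real \<Rightarrow> real \<Rightarrow> real" where
  "poisson \<sigma> t = \<sigma> / (fejer_const * (\<sigma>\<^sup>2 + t\<^sup>2))"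

lemma poisson_nonneg: "\<sigma> > 0 \<Longrightarrow> 0 \<le> poisson \<sigma> t"
  unfolding poisson_def using fejer_const_pos by simp

lemma poisson_measurable [measurable]: "poisson \<sigma> \<in> borel_measurable borel"
  unfolding poisson_def by measurable

text \<open>A decaying convex function is a mixture of tents with its second derivative as density;
  for exp (- \<sigma> x) this density is \<sigma>^2 exp (- \<sigma> R).\<close>

lemma exp_weight_integral:
  fixes \<sigma> x :: real
  assumes "\<sigma> > 0" "x \<ge> 0"
  shows "has_bochner_integral lborel (\<lambda>R. indicator {0..} R * (\<sigma>\<^sup>2 * exp (- \<sigma> * R) * max 0 (R - x))) (exp (- \<sigma> * x))"
proof (rule has_bochner_integral_nn_integral)
  define F where "F R = - (\<sigma> * (R - x) + 1) * exp (- \<sigma> * R)" for R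
  have "(\<integral>\<^sup>+R. ennreal (indicator {0..} R * (\<sigma>\<^sup>2 * exp (- \<sigma> * R) * max 0 (R - x))) \<partial>lborel)
      = (\<integral>\<^sup>+R. ennreal (\<sigma>\<^sup>2 * exp (- \<sigma> * R) * (R - x)) * indicator {x..} R \<partial>lborel)"
    using assms by (intro nn_integral_cong) (auto simp: max_def split: split_indicator)
  also have "\<dots> = ennreal (0 - F x)"
  proof (rule nn_integral_FTC_atLeast)
    show "(F has_real_derivative \<sigma>\<^sup>2 * exp (- \<sigma> * R) * (R - x)) (at R)" for R
      unfolding F_def by (auto intro!: derivative_eq_intros simp: power2_eq_square algebra_simps)
    show "(F \<longlongrightarrow> 0) at_top"
      unfolding F_def using assms by real_asymp
  qed (use assms in auto)
  also have "0 - F x = exp (- \<sigma> * x)" by (simp add: F_def)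
  finally show "(\<integral>\<^sup>+R. ennreal (indicator {0..} R * (\<sigma>\<^sup>2 * exp (- \<sigma> * R) * max 0 (R - x))) \<partial>lborel)
      = ennreal (exp (- \<sigma> * x))" .
qed (use assms in \<open>auto intro!: AE_I2\<close>)

text \<open>The Poisson kernel is a superposition of Fejer kernels, so its Fourier transform follows
  from that of the latter without any inversion theorem.\<close>

lemma poisson_superposition:
  assumes \<sigma>: "\<sigma> > 0" and t: "t \<noteq> 0"
  shows "(LINT R|lborel. indicator {0..} R * (\<sigma>\<^sup>2 * exp (- \<sigma> * R)) * fejer R t) = poisson \<sigma> t"
proof -
  define k where "k = 1 / (\<sigma>\<^sup>2 + t\<^sup>2)"
  \<comment> \<open>The antiderivative of exp (- \<sigma> R) (1 - cos (t R)) that vanishes at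
    infinity. The integral is then - F 0 = 1 / \<sigma> - \<sigma> / (\<sigma>^2 + t^2) = t^2 /
    (\<sigma> (\<sigma>^2 + t^2)).\<close>
  define F where "F R = - exp (- \<sigma> * R) / \<sigma>
      - exp (- \<sigma> * R) * (t * sin (t * R) - \<sigma> * cos (t * R)) * k" for R
  have pos: "\<sigma>\<^sup>2 + t\<^sup>2 > 0" using \<sigma> by (simp add: add_pos_nonneg)
  have "has_bochner_integral lborel (\<lambda>R. indicator {0..} R * (exp (- \<sigma> * R) * (1 - cos (t * R)))) (0 - F 0)"
  proof (rule has_bochner_integral_nn_integral)
    have "(\<integral>\<^sup>+R. ennreal (indicator {0..} R * (exp (- \<sigma> * R) * (1 - cos (t * R)))) \<partial>lborel)
        = (\<integral>\<^sup>+R. ennreal (exp (- \<sigma> * R) * (1 - cos (t * R))) * indicator {0..} R \<partial>lborel)"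
      by (intro nn_integral_cong) (auto split: split_indicator)
    also have "\<dots> = ennreal (0 - F 0)"
    proof (rule nn_integral_FTC_atLeast)
      show "(F has_real_derivative exp (- \<sigma> * R) * (1 - cos (t * R))) (at R)" for R
      proof -
        have "(F has_real_derivative exp (- \<sigma> * R)
            - (\<sigma>\<^sup>2 + t\<^sup>2) * k * (exp (- \<sigma> * R) * cos (t * R))) (at R)"
          unfolding F_def using \<sigma>
          by (auto intro!: derivative_eq_intros simp: algebra_simps power2_eq_square)
        moreover have "(\<sigma>\<^sup>2 + t\<^sup>2) * k = 1"
          using pos unfolding k_def by (simp only: times_divide_eq_right mult_1_right divide_self less_imp_neq[symmetric] not_False_eq_True)
        ultimately show ?thesis by (simp add: right_diff_distrib)
      qed
      show "(F \<longlongrightarrow> 0) at_top"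
      proof (rule Lim_null_comparison)
        show "\<forall>\<^sub>F R in at_top. norm (F R) \<le> exp (- \<sigma> * R) * (1 / \<sigma> + (\<bar>t\<bar> + \<sigma>) / (\<sigma>\<^sup>2 + t\<^sup>2))"
        proof (rule always_eventually, rule allI)
          fix R
          have a: "\<bar>t * sin (t * R) - \<sigma> * cos (t * R)\<bar> \<le> \<bar>t\<bar> * 1 + \<sigma> * 1"
            using \<sigma> by (intro order_trans[OF abs_triangle_ineq4] add_mono)
              (auto simp: abs_mult intro!: mult_left_le)
          have "norm (F R) \<le> \<bar>- exp (- \<sigma> * R) / \<sigma>\<bar> + \<bar>exp (- \<sigma> * R) * (t * sin (t * R) - \<sigma> * cos (t * R)) * k\<bar>"
            unfolding F_def real_norm_def by (rule abs_triangle_ineq4)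
          also have "\<dots> = exp (- \<sigma> * R) * (1 / \<sigma>) + exp (- \<sigma> * R) * (\<bar>t * sin (t * R) - \<sigma> * cos (t * R)\<bar> / (\<sigma>\<^sup>2 + t\<^sup>2))"
            using \<sigma> pos by (simp add: abs_mult k_def)
          also have "\<dots> \<le> exp (- \<sigma> * R) * (1 / \<sigma>) + exp (- \<sigma> * R) * ((\<bar>t\<bar> + \<sigma>) / (\<sigma>\<^sup>2 + t\<^sup>2))"
            using a pos \<sigma> by (intro add_mono mult_left_mono divide_right_mono) auto
          finally show "norm (F R) \<le> exp (- \<sigma> * R) * (1 / \<sigma> + (\<bar>t\<bar> + \<sigma>) / (\<sigma>\<^sup>2 + t\<^sup>2))"
            by (simp add: distrib_left)
        qed
        have "((\<lambda>R. exp (- \<sigma> * R)) \<longlongrightarrow> 0) at_top" using \<sigma> by real_asymp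
        then show "((\<lambda>R. exp (- \<sigma> * R) * (1 / \<sigma> + (\<bar>t\<bar> + \<sigma>) / (\<sigma>\<^sup>2 + t\<^sup>2))) \<longlongrightarrow> 0) at_top"
          by (rule tendsto_mult_left_zero)
      qed
    qed (use one_minus_cos_bounds in auto)
    finally show "(\<integral>\<^sup>+R. ennreal (indicator {0..} R * (exp (- \<sigma> * R) * (1 - cos (t * R)))) \<partial>lborel) = ennreal (0 - F 0)" .
    show "0 \<le> 0 - F 0"
    proof -
      have "0 - F 0 = t\<^sup>2 / (\<sigma> * (\<sigma>\<^sup>2 + t\<^sup>2))"
        unfolding F_def k_def using \<sigma> pos by (simp add: field_simps power2_eq_square)
      then show ?thesis using \<sigma> by simp
    qed
  qed (use one_minus_cos_bounds in \<open>auto intro!: AE_I2 mult_nonneg_nonneg\<close>)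
  then have I: "(LINT R|lborel. indicator {0..} R * (exp (- \<sigma> * R) * (1 - cos (t * R)))) = - F 0"
    using has_bochner_integral_integral_eq by fastforce
  have "(LINT R|lborel. indicator {0..} R * (\<sigma>\<^sup>2 * exp (- \<sigma> * R)) * fejer R t)
      = (LINT R|lborel. \<sigma>\<^sup>2 / (fejer_const * t\<^sup>2) * (indicator {0..} R * (exp (- \<sigma> * R) * (1 - cos (t * R)))))"
    by (intro Bochner_Integration.integral_cong) (auto simp: fejer_def mult_ac)
  also have "\<dots> = \<sigma>\<^sup>2 / (fejer_const * t\<^sup>2) * (- F 0)"
    by (simp only: integral_mult_right_zero I)
  also have "- F 0 = t\<^sup>2 / (\<sigma> * (\<sigma>\<^sup>2 + t\<^sup>2))"
    unfolding F_def k_def using \<sigma> pos by (simp add: field_simps power2_eq_square)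
  also have "\<sigma>\<^sup>2 / (fejer_const * t\<^sup>2) * (t\<^sup>2 / (\<sigma> * (\<sigma>\<^sup>2 + t\<^sup>2))) = poisson \<sigma> t"
    using \<sigma> t pos fejer_const_pos by (simp add: poisson_def power2_eq_square)
  finally show ?thesis .
qed

text \<open>Fubini for W(R) fejer R t exp (- i t x): integrating over R first produces the Poisson
  kernel, integrating over t first produces the mixture of tents. Absolute integrability is the
  mixture at x = 0, because the Fejer kernels are nonnegative.\<close>

lemma
  assumes \<sigma>: "\<sigma> > 0"
  shows poisson_integrable: "integrable lborel (poisson \<sigma>)"
    and poisson_fourier: "(LINT t|lborel. poisson \<sigma> t * cis (- t * x)) = of_real (exp (- \<sigma> * \<bar>x\<bar>))"
proof -
  have cis_m [measurable]: "(\<lambda>t. cis (- t * y)) \<in> borel_measurable borel" for y :: real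
    by (intro borel_measurable_continuous_onI continuous_intros)
  define W where "W R = indicator {0..} R * (\<sigma>\<^sup>2 * exp (- \<sigma> * R))" for R :: real
  have W [measurable]: "W \<in> borel_measurable borel" unfolding W_def by measurable
  have Wpos: "0 \<le> W R" for R by (simp add: W_def)
  have W_fejer: "W R * max 0 (R - y) = indicator {0..} R * (\<sigma>\<^sup>2 * exp (- \<sigma> * R) * max 0 (R - y))" for R y
    by (simp add: W_def mult.assoc)
  define H where "H y = (\<lambda>p. complex_of_real (W (fst p) * fejer (fst p) (snd p)) * cis (- snd p * y))" for y :: real
  have Hm [measurable]: "H y \<in> borel_measurable (lborel \<Otimes>\<^sub>M lborel)" for y
  proof -
    have [measurable]: "(\<lambda>p::real \<times> real. cis (- snd p * y)) \<in> borel_measurable (borel \<Otimes>\<^sub>M borel)"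
      by (rule measurable_compose[OF measurable_snd cis_m])
    show ?thesis unfolding H_def by measurable
  qed
  have Hn: "norm (H y (R, t)) = W R * fejer R t" for y R t
    using Wpos fejer_nonneg by (simp add: H_def norm_mult abs_mult)
  have HR: "integrable lborel (\<lambda>t. H y (R, t))" for y R
  proof (rule Bochner_Integration.integrable_bound[OF integrable_mult_right[OF fejer_integrable[of R], of "W R"]])
    show "(\<lambda>t. H y (R, t)) \<in> borel_measurable lborel" unfolding H_def fst_conv snd_conv by measurable
  qed (auto intro!: AE_I2 simp: Hn Wpos fejer_nonneg abs_mult)
  have intW: "(LINT t|lborel. W R * fejer R t) = W R * max 0 (R - 0)" for R
    by (cases "R \<ge> 0") (auto simp: fejer_integral W_def)
  have Hi: "integrable (lborel \<Otimes>\<^sub>M lborel) (H y)" for y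
  proof (rule lborel_pair.Fubini_integrable[OF Hm])
    show "AE R in lborel. integrable lborel (\<lambda>t. H y (R, t))" by (intro AE_I2 HR)
    show "integrable lborel (\<lambda>R. LINT t|lborel. norm (H y (R, t)))"
      unfolding Hn intW W_fejer by (rule integrable.intros[OF exp_weight_integral[OF \<sigma>]]) simp
  qed
  \<comment> \<open>At t = 0 every \<open>fejer R 0\<close> is 0 while the Poisson kernel is
    positive, so the two sides agree only off this null set.\<close>
  have slice: "(LINT R|lborel. H y (R, t)) = poisson \<sigma> t * cis (- t * y)" if "t \<noteq> 0" for t y
  proof -
    have "(LINT R|lborel. H y (R, t)) = (LINT R|lborel. complex_of_real (W R * fejer R t)) * cis (- t * y)"
      unfolding H_def by simp
    also have "(LINT R|lborel. complex_of_real (W R * fejer R t)) = complex_of_real (poisson \<sigma> t)"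
      unfolding integral_complex_of_real
      using poisson_superposition[OF \<sigma> that] by (simp add: W_def)
    finally show ?thesis .
  qed
  have ae0: "AE t in lborel. t \<noteq> (0::real)" by (rule AE_lborel_singleton)
  have slice_m: "(\<lambda>t. LINT R|lborel. H y (R, t)) \<in> borel_measurable lborel" for y
    using lborel_pair.integrable_snd[of "\<lambda>R t. H y (R, t)"] Hi[of y] by simp
  have pm: "(\<lambda>t. complex_of_real (poisson \<sigma> t) * cis (- t * y)) \<in> borel_measurable lborel" for y
    by measurable
  have slice_AE: "AE t in lborel. (LINT R|lborel. H y (R, t)) = complex_of_real (poisson \<sigma> t) * cis (- t * y)" for y
    using ae0 by eventually_elim (rule slice)
  have pc: "integrable lborel (\<lambda>t. complex_of_real (poisson \<sigma> t) * cis (- t * y))" for y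
  proof -
    have "integrable lborel (\<lambda>t. LINT R|lborel. H y (R, t))"
      using lborel_pair.integrable_snd[of "\<lambda>R t. H y (R, t)"] Hi[of y] by simp
    then show ?thesis
      by (rule integrable_cong_AE[OF slice_m pm slice_AE, THEN iffD1])
  qed
  have "integrable lborel (\<lambda>t. complex_of_real (poisson \<sigma> t))" using pc[of 0] by simp
  then show "integrable lborel (poisson \<sigma>)"
    using integrable_Re by fastforce
  have "(LINT t|lborel. poisson \<sigma> t * cis (- t * x)) = (LINT t|lborel. LINT R|lborel. H x (R, t))"
    by (rule integral_cong_AE[OF slice_m pm slice_AE, symmetric])
  also have "\<dots> = (LINT R|lborel. LINT t|lborel. H x (R, t))"
    using lborel_pair.Fubini_integral[of "\<lambda>R t. H x (R, t)"] Hi[of x] by simp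
  also have "\<dots> = (LINT R|lborel. complex_of_real (W R * max 0 (R - \<bar>x\<bar>)))"
  proof (intro Bochner_Integration.integral_cong refl)
    fix R :: real
    have "(LINT t|lborel. H x (R, t)) = complex_of_real (W R) * (LINT t|lborel. fejer R t * cis (- t * x))"
      unfolding H_def by (simp add: mult.assoc)
    also have "\<dots> = complex_of_real (W R * max 0 (R - \<bar>x\<bar>))"
      by (cases "R \<ge> 0") (simp_all only: fejer_fourier of_real_mult, simp add: W_def)
    finally show "(LINT t|lborel. H x (R, t)) = complex_of_real (W R * max 0 (R - \<bar>x\<bar>))" .
  qed
  also have "\<dots> = complex_of_real (exp (- \<sigma> * \<bar>x\<bar>))"
    unfolding integral_complex_of_real W_fejer
    using has_bochner_integral_integral_eq[OF exp_weight_integral[OF \<sigma>, of "\<bar>x\<bar>"]] by simp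
  finally show "(LINT t|lborel. poisson \<sigma> t * cis (- t * x)) = of_real (exp (- \<sigma> * \<bar>x\<bar>))" .
qed

lemma poisson_integral: "\<sigma> > 0 \<Longrightarrow> (LINT t|lborel. poisson \<sigma> t) = 1"
proof -
  assume s: "\<sigma> > 0"
  have "complex_of_real (LINT t|lborel. poisson \<sigma> t) = (LINT t|lborel. poisson \<sigma> t * cis (- t * 0))"
    by simp
  also have "\<dots> = of_real 1" by (subst poisson_fourier[OF s]) simp
  finally show ?thesis using of_real_eq_iff by blast
qed

section \<open>A kernel with trapezoidal Fourier transform\<close>

text \<open>Its Fourier transform is \<open>1\<close> at \<open>ln 1, \<dots>, ln N\<close> and \<open>0\<close> at \<open>ln (N + 1), ln (N + 2), \<dots>\<close>.\<close>

definition truncation_kernel :: "nat \<Rightarrow> real \<Rightarrow> real" where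
  "truncation_kernel N t = (fejer (ln (real N + 1)) t - fejer (ln N) t) / (ln (real N + 1) - ln N)"

lemma truncation_kernel_integrable: "integrable lborel (truncation_kernel N)"
  unfolding truncation_kernel_def by (intro integrable_divide Bochner_Integration.integrable_diff fejer_integrable)

text \<open>The difference quotient of the tents of widths ln (N + 1) and ln N is a trapezoid:
  constant 1 up to ln N, zero from ln (N + 1) on, and sloping in between, where no logarithm of an
  integer lies.\<close>

lemma truncation_kernel_fourier:
  fixes n N :: nat
  assumes N: "N \<ge> 1" and n: "n \<ge> 1"
  shows "(LINT t|lborel. truncation_kernel N t * cis (- t * ln n)) = (if n \<le> N then 1 else 0)"
proof -
  define a where "a = ln (real N)"
  define b where "b = ln (real N + 1)"
  have ab: "0 \<le> a" "a < b" using N by (auto simp: a_def b_def)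
  have ln_n: "0 \<le> ln (real n)" using n by simp
  have fi: "integrable lborel (\<lambda>t. complex_of_real (fejer R t) * cis (- t * ln n))" for R
  proof (rule Bochner_Integration.integrable_bound[OF fejer_integrable[of R]])
    have [measurable]: "(\<lambda>t. cis (- t * ln n)) \<in> borel_measurable borel"
      by (intro borel_measurable_continuous_onI continuous_intros)
    show "(\<lambda>t. complex_of_real (fejer R t) * cis (- t * ln n)) \<in> borel_measurable lborel" by measurable
  qed (auto simp: norm_mult)
  have "(LINT t|lborel. truncation_kernel N t * cis (- t * ln n))
      = (LINT t|lborel. (1 / (b - a)) * (fejer b t * cis (- t * ln n) - fejer a t * cis (- t * ln n)))"
    by (intro Bochner_Integration.integral_cong) (auto simp: truncation_kernel_def a_def b_def diff_divide_distrib left_diff_distrib)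
  also have "\<dots> = of_real ((1 / (b - a)) * (max 0 (b - ln n) - max 0 (a - ln n)))"
    using ab ln_n fi by (simp only: integral_mult_right_zero Bochner_Integration.integral_diff fejer_fourier[OF ab(1)]
      fejer_fourier[OF less_imp_le[OF le_less_trans[OF ab]]] abs_of_nonneg of_real_mult of_real_diff)
  also have "(1 / (b - a)) * (max 0 (b - ln n) - max 0 (a - ln n)) = (if n \<le> N then 1 else 0)"
  proof (cases "n \<le> N")
    case True
    then have "ln (real n) \<le> a" using n by (simp add: a_def)
    then show ?thesis using True ab by simp
  next
    case False
    then have "real N + 1 \<le> real n" by simp
    then have "b \<le> ln (real n)" using N unfolding b_def by (subst ln_le_cancel_iff) auto
    then show ?thesis using False ab by simp
  qed
  finally show ?thesis by simp
qed

text \<open>The difference is 2 sin ((x + y) / 2) sin ((x - y) / 2) up to sign. The two bounds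
  replace one or both sines by their arguments.\<close>

lemma cos_diff_abs_le: "\<bar>cos x - cos y\<bar> \<le> \<bar>x - y\<bar>" "\<bar>cos x - cos y\<bar> \<le> \<bar>x + y\<bar> * \<bar>x - y\<bar> / 2" for x y :: real
proof -
  have eq: "\<bar>cos x - cos y\<bar> = 2 * \<bar>sin ((x + y) / 2)\<bar> * \<bar>sin ((x - y) / 2)\<bar>"
  proof -
    have "sin ((y - x) / 2) = - sin ((x - y) / 2)"
      by (metis minus_diff_eq minus_divide_left sin_minus)
    then show ?thesis by (simp add: cos_diff_cos abs_mult)
  qed
  have s: "\<bar>sin ((x - y) / 2)\<bar> \<le> \<bar>x - y\<bar> / 2" "\<bar>sin ((x + y) / 2)\<bar> \<le> \<bar>x + y\<bar> / 2"
    using abs_sin_x_le_abs_x[of "(x - y) / 2"] abs_sin_x_le_abs_x[of "(x + y) / 2"] by auto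
  have "2 * \<bar>sin ((x + y) / 2)\<bar> * \<bar>sin ((x - y) / 2)\<bar> \<le> 2 * 1 * (\<bar>x - y\<bar> / 2)"
    using s by (intro mult_mono) auto
  then show "\<bar>cos x - cos y\<bar> \<le> \<bar>x - y\<bar>" unfolding eq by simp
  have "2 * \<bar>sin ((x + y) / 2)\<bar> * \<bar>sin ((x - y) / 2)\<bar> \<le> 2 * (\<bar>x + y\<bar> / 2) * (\<bar>x - y\<bar> / 2)"
    using s by (intro mult_mono) auto
  then show "\<bar>cos x - cos y\<bar> \<le> \<bar>x + y\<bar> * \<bar>x - y\<bar> / 2" unfolding eq by simp
qed

lemma truncation_kernel_even: "truncation_kernel N (- t) = truncation_kernel N t"
  by (simp add: truncation_kernel_def)

lemma nn_integral_even_le: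
  fixes f :: "real \<Rightarrow> real"
  assumes [measurable]: "f \<in> borel_measurable borel" and even: "\<And>t. f (- t) = f t"
  shows "(\<integral>\<^sup>+t. ennreal (f t) \<partial>lborel) \<le> 2 * (\<integral>\<^sup>+t. ennreal (f t) * indicator {0..} t \<partial>lborel)"
proof -
  have "(\<integral>\<^sup>+t. ennreal (f t) \<partial>lborel)
      \<le> (\<integral>\<^sup>+t. ennreal (f t) * indicator {0..} t + ennreal (f t) * indicator {..0} t \<partial>lborel)"
    by (intro nn_integral_mono) (auto split: split_indicator)
  also have "\<dots> = (\<integral>\<^sup>+t. ennreal (f t) * indicator {0..} t \<partial>lborel) + (\<integral>\<^sup>+t. ennreal (f t) * indicator {..0} t \<partial>lborel)"
    by (rule nn_integral_add) auto
  also have "(\<integral>\<^sup>+t. ennreal (f t) * indicator {..0} t \<partial>lborel) = (\<integral>\<^sup>+t. ennreal (f t) * indicator {0..} t \<partial>lborel)"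
    using nn_integral_real_affine[of "\<lambda>t. ennreal (f t) * indicator {..0} t" "-1" 0]
    by (simp add: even indicator_def cong: nn_integral_cong)
  finally show ?thesis by (simp add: mult_2)
qed

text \<open>The gap ln (N + 1) - ln N is of size 1 / N, so the masses of the two Fejer kernels alone
  would give a bound of order N log N. Cancellation between the cosines improves it to log N. On the
  half line, with X = N + 1 and up to the factor 1 / \<open>fejer_const\<close>, the kernel is at
  most X on [0, 1/X], 1 / t on [1/X, X] and 2 X / t^2 beyond X; the integrals are 1, 2 ln X and 2,
  and evenness doubles their sum.\<close>

lemma truncation_kernel_norm:
  assumes N: "N \<ge> 1"
  shows "(LINT t|lborel. \<bar>truncation_kernel N t\<bar>) \<le> (6 + 4 * ln (real N + 1)) / fejer_const"
proof -
  define X where "X = real N + 1"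
  define a where "a = ln (real N)"
  define b where "b = ln X"
  have X: "X \<ge> 2" using N by (simp add: X_def)
  have ab: "0 \<le> a" "a < b" using N by (auto simp: a_def b_def X_def)
  have b_le: "b \<le> X" using ln_le_minus_one[of X] X by (simp add: b_def)
  \<comment> \<open>From ln x <= x - 1 at x = N / (N + 1).\<close>
  have gap: "1 / X \<le> b - a"
  proof -
    have "ln (real N / X) \<le> real N / X - 1" using N X by (intro ln_le_minus_one) auto
    also have "\<dots> = - 1 / X" using X by (simp add: X_def field_simps)
    finally show ?thesis using N X by (simp add: ln_div a_def b_def)
  qed
  let ?c = fejer_const
  have c: "?c > 0" by (rule fejer_const_pos)
  define K where "K t = \<bar>truncation_kernel N t\<bar>" for t
  have K_eq: "K t = \<bar>cos (a * t) - cos (b * t)\<bar> / (?c * t\<^sup>2 * (b - a))" for t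
  proof -
    have "truncation_kernel N t = (cos (a * t) - cos (b * t)) / (?c * t\<^sup>2 * (b - a))"
      unfolding truncation_kernel_def fejer_def a_def b_def X_def
      by (simp add: diff_divide_distrib[symmetric] add.commute)
    then show ?thesis using ab c by (simp add: K_def abs_mult)
  qed
  have b1: "K t \<le> X / ?c" if "t > 0" for t
  proof -
    have "\<bar>cos (a * t) - cos (b * t)\<bar> \<le> \<bar>a * t + b * t\<bar> * \<bar>a * t - b * t\<bar> / 2" by (rule cos_diff_abs_le)
    also have "\<bar>a * t + b * t\<bar> = (a + b) * t" using that ab by (simp add: distrib_right)
    also have "\<bar>a * t - b * t\<bar> = (b - a) * t" using that ab by (simp add: left_diff_distrib[symmetric] abs_mult)
    also have "(a + b) * t * ((b - a) * t) / 2 = (a + b) / 2 * (t\<^sup>2 * (b - a))" by (simp add: power2_eq_square)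
    also have "\<dots> \<le> X * (t\<^sup>2 * (b - a))" using ab b_le by (intro mult_right_mono) auto
    finally have "K t \<le> X * (t\<^sup>2 * (b - a)) / (?c * t\<^sup>2 * (b - a))"
      unfolding K_eq using that ab c by (intro divide_right_mono) auto
    also have "\<dots> = X / ?c" using that ab c by simp
    finally show ?thesis .
  qed
  have b2: "K t \<le> 1 / (?c * t)" if "t > 0" for t
  proof -
    have "\<bar>cos (a * t) - cos (b * t)\<bar> \<le> \<bar>a * t - b * t\<bar>" by (rule cos_diff_abs_le)
    also have "\<dots> = (b - a) * t" using that ab by (simp add: left_diff_distrib[symmetric] abs_mult)
    finally have "K t \<le> ((b - a) * t) / (?c * t\<^sup>2 * (b - a))"
      unfolding K_eq using that ab c by (intro divide_right_mono) auto
    also have "\<dots> = 1 / (?c * t)" using that ab c by (simp add: power2_eq_square)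
    finally show ?thesis .
  qed
  have b3: "K t \<le> 2 * X / (?c * t\<^sup>2)" if "t > 0" for t
  proof -
    have "\<bar>cos (a * t) - cos (b * t)\<bar> \<le> 2"
      using abs_cos_le_one[of "a * t"] abs_cos_le_one[of "b * t"] by linarith
    then have "K t \<le> 2 / (?c * t\<^sup>2 * (b - a))"
      unfolding K_eq using that ab c by (intro divide_right_mono) auto
    also have "\<dots> = 2 / (?c * t\<^sup>2) * (1 / (b - a))" by simp
    also have "\<dots> \<le> 2 / (?c * t\<^sup>2) * X"
      using gap ab c X that by (intro mult_left_mono) (auto simp: field_simps)
    finally show ?thesis by simp
  qed
  have Km [measurable]: "K \<in> borel_measurable borel" unfolding K_def truncation_kernel_def by measurable
  have "(\<integral>\<^sup>+t. ennreal (K t) * indicator {0..} t \<partial>lborel)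
      \<le> (\<integral>\<^sup>+t. (ennreal (X / ?c) * indicator {0..1 / X} t + ennreal (1 / (?c * t)) * indicator {1 / X..X} t)
          + ennreal (2 * X / (?c * t\<^sup>2)) * indicator {X..} t \<partial>lborel)"
  proof (rule nn_integral_mono_AE)
    have "AE t in lborel. t \<noteq> (0::real)" by (rule AE_lborel_singleton)
    then show "AE t in lborel. ennreal (K t) * indicator {0..} t
        \<le> (ennreal (X / ?c) * indicator {0..1 / X} t + ennreal (1 / (?c * t)) * indicator {1 / X..X} t)
          + ennreal (2 * X / (?c * t\<^sup>2)) * indicator {X..} t"
    proof eventually_elim
      case (elim t)
      consider "t < 0" | "0 < t" "t \<le> 1 / X" | "1 / X < t" "t \<le> X" | "X < t" "0 < t" using elim X by linarith
      then show ?case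
      proof cases
        case 1
        then show ?thesis by simp
      next
        case 2
        then have "ennreal (K t) * indicator {0..} t \<le> ennreal (X / ?c) * indicator {0..1 / X} t"
          using b1[of t] by (auto intro: ennreal_leI)
        then show ?thesis by (simp add: add_increasing2)
      next
        case 3
        moreover have "t > 0" using 3 X by (smt (verit) divide_nonneg_nonneg)
        ultimately have "ennreal (K t) * indicator {0..} t \<le> ennreal (1 / (?c * t)) * indicator {1 / X..X} t"
          using b2[of t] by (auto intro: ennreal_leI)
        then show ?thesis by (simp add: add_increasing add_increasing2)
      next
        case 4
        then have "ennreal (K t) * indicator {0..} t \<le> ennreal (2 * X / (?c * t\<^sup>2)) * indicator {X..} t"
          using b3[of t] by (auto intro: ennreal_leI)
        then show ?thesis by (simp add: add_increasing)
      qed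
    qed
  qed
  also have "\<dots> = (\<integral>\<^sup>+t. ennreal (X / ?c) * indicator {0..1 / X} t \<partial>lborel)
      + (\<integral>\<^sup>+t. ennreal (1 / (?c * t)) * indicator {1 / X..X} t \<partial>lborel)
      + (\<integral>\<^sup>+t. ennreal (2 * X / (?c * t\<^sup>2)) * indicator {X..} t \<partial>lborel)"
    by (simp add: nn_integral_add)
  also have "(\<integral>\<^sup>+t. ennreal (X / ?c) * indicator {0..1 / X} t \<partial>lborel) = ennreal (1 / ?c)"
    using X c by (simp add: nn_integral_cmult_indicator ennreal_mult[symmetric])
  also have "(\<integral>\<^sup>+t. ennreal (1 / (?c * t)) * indicator {1 / X..X} t \<partial>lborel) = ennreal (ln X / ?c - ln (1 / X) / ?c)"
  proof (rule nn_integral_FTC_Icc[where F = "\<lambda>t. ln t / ?c"])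
    fix t assume t: "t \<in> {1 / X..X}"
    then have tp: "t > 0" using X by (smt (verit) atLeastAtMost_iff divide_pos_pos)
    show "((\<lambda>t. ln t / ?c) has_real_derivative 1 / (?c * t)) (at t)"
      using tp c by (auto intro!: derivative_eq_intros simp: field_simps)
    show "0 \<le> 1 / (?c * t)" using tp c by simp
  qed (use X in \<open>auto simp: field_simps power2_eq_square intro: order_trans[of _ "2 * X"]\<close>)
  also have "(\<integral>\<^sup>+t. ennreal (2 * X / (?c * t\<^sup>2)) * indicator {X..} t \<partial>lborel) = ennreal (0 - (- 2 * X / (?c * X)))"
  proof (rule nn_integral_FTC_atLeast[where F = "\<lambda>t. - 2 * X / (?c * t)" and T = 0])
    fix t assume t: "X \<le> t"
    then have tp: "t > 0" using X by simp
    show "((\<lambda>t. - 2 * X / (?c * t)) has_real_derivative 2 * X / (?c * t\<^sup>2)) (at t)"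
      using tp c by (auto intro!: derivative_eq_intros simp: field_simps power2_eq_square)
    show "0 \<le> 2 * X / (?c * t\<^sup>2)" using X c by simp
  next
    show "((\<lambda>t. - 2 * X / (?c * t)) \<longlongrightarrow> 0) at_top" using c by real_asymp
  qed auto
  also have "ennreal (1 / ?c) + ennreal (ln X / ?c - ln (1 / X) / ?c) + ennreal (0 - (- 2 * X / (?c * X)))
      = ennreal ((3 + 2 * ln X) / ?c)"
  proof -
    have "0 \<le> ln X / ?c - ln (1 / X) / ?c" using X c by (simp add: ln_div)
    moreover have "0 \<le> 0 - (- 2 * X / (?c * X))" using X c by simp
    ultimately have "ennreal (1 / ?c) + ennreal (ln X / ?c - ln (1 / X) / ?c) + ennreal (0 - (- 2 * X / (?c * X)))
        = ennreal (1 / ?c + (ln X / ?c - ln (1 / X) / ?c) + (0 - (- 2 * X / (?c * X))))"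
      using c by (simp only: ennreal_plus add_nonneg_nonneg divide_nonneg_nonneg zero_le_one less_imp_le)
    also have "1 / ?c + (ln X / ?c - ln (1 / X) / ?c) + (0 - (- 2 * X / (?c * X))) = (3 + 2 * ln X) / ?c"
      using X c by (simp add: ln_div field_simps)
    finally show ?thesis .
  qed
  finally have half: "(\<integral>\<^sup>+t. ennreal (K t) * indicator {0..} t \<partial>lborel) \<le> ennreal ((3 + 2 * ln X) / ?c)" .
  have "ennreal (LINT t|lborel. K t) = (\<integral>\<^sup>+t. ennreal (K t) \<partial>lborel)"
    using truncation_kernel_integrable[of N] unfolding K_def
    by (intro nn_integral_eq_integral[symmetric]) auto
  also have "\<dots> \<le> 2 * (\<integral>\<^sup>+t. ennreal (K t) * indicator {0..} t \<partial>lborel)"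
    by (rule nn_integral_even_le[OF Km]) (simp add: K_def truncation_kernel_even)
  also have "\<dots> \<le> 2 * ennreal ((3 + 2 * ln X) / ?c)" by (intro mult_left_mono half) auto
  also have "\<dots> = ennreal (2 * ((3 + 2 * ln X) / ?c))"
    using X c by (subst ennreal_mult) auto
  finally have "(LINT t|lborel. K t) \<le> 2 * ((3 + 2 * ln X) / ?c)"
    using X c by (subst (asm) ennreal_le_iff) auto
  also have "\<dots> = (6 + 4 * ln (real N + 1)) / ?c" by (simp add: X_def)
  finally show ?thesis by (simp add: K_def)
qed

subsection \<open>Abel summation of Dirichlet series\<close>

lemma norm_nat_powr: "n > 0 \<Longrightarrow> cmod (of_nat n powr s) = real n powr Re s"
  using norm_powr_real_powr[of "of_nat n" s] by simp

text \<open>Mean value estimate on the segment from n to n + 1, where the derivative - s z^(- s - 1)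
  has modulus at most |s| n^(- Re s - 1).\<close>

lemma nat_powr_diff_bound:
  assumes n: "n > 0" and s: "Re s > 0"
  shows "cmod (of_nat n powr (- s) - of_nat (Suc n) powr (- s)) \<le> cmod s * real n powr (- Re s - 1)"
proof -
  define S where "S = closed_segment (of_nat n :: complex) (of_nat (Suc n))"
  have S: "\<exists>x::real. z = of_real x \<and> real n \<le> x" if "z \<in> S" for z
  proof -
    from that obtain u where u: "0 \<le> u" "u \<le> 1" "z = (1 - u) *\<^sub>R of_nat n + u *\<^sub>R of_nat (Suc n)"
      unfolding S_def closed_segment_def by blast
    have "z = of_real (real n + u)"
      unfolding u(3) by (simp add: scaleR_conv_of_real algebra_simps)
    then show ?thesis using u(1) by (intro exI[of _ "real n + u"]) auto
  qed
  have "cmod (of_nat n powr (- s) - of_nat (Suc n) powr (- s))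
      \<le> (cmod s * real n powr (- Re s - 1)) * cmod (of_nat n - of_nat (Suc n))"
  proof (rule field_differentiable_bound[where S = S and f' = "\<lambda>z. - s * z powr (- s - 1)"])
    fix z assume "z \<in> S"
    then obtain x :: real where x: "z = of_real x" "real n \<le> x" using S by blast
    have xp: "x > 0" using x n by simp
    show "((\<lambda>z. z powr - s) has_field_derivative - s * z powr (- s - 1)) (at z within S)"
      by (rule has_field_derivative_at_within[OF has_field_derivative_powr])
        (use x xp in \<open>auto simp: complex_nonpos_Reals_iff\<close>)
    have "cmod (z powr (- s - 1)) = x powr (- Re s - 1)"
      unfolding x using xp by (subst norm_powr_real_powr) auto
    also have "\<dots> \<le> real n powr (- Re s - 1)"
      using x n s by (intro powr_mono2') auto
    finally show "cmod (- s * z powr (- s - 1)) \<le> cmod s * real n powr (- Re s - 1)"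
      by (simp add: norm_mult mult_left_mono)
  qed (auto simp: S_def)
  then show ?thesis by simp
qed

lemma log_powr_summable:
  fixes \<sigma> :: real
  assumes "\<sigma> > 0"
  shows "summable (\<lambda>n. (6 + 4 * ln (real n + 1)) * real n powr (- \<sigma> - 1))"
proof (rule summable_comparison_test_ev)
  show "\<forall>\<^sub>F n in sequentially. norm ((6 + 4 * ln (real n + 1)) * real n powr (- \<sigma> - 1)) \<le> real n powr (- 1 - \<sigma> / 2)"
  proof -
    have "\<forall>\<^sub>F n in sequentially. (6 + 4 * ln (real n + 1)) * real n powr (- \<sigma> - 1) \<le> real n powr (- 1 - \<sigma> / 2)"
      using assms by real_asymp
    then show ?thesis by eventually_elim (simp add: abs_mult)
  qed
  show "summable (\<lambda>n. real n powr (- 1 - \<sigma> / 2))"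
    using assms by (subst summable_real_powr_iff) auto
qed

lemma summation_by_parts:
  fixes c b :: "nat \<Rightarrow> 'a::comm_ring_1"
  shows "(\<Sum>n<N. c n * b n) = (\<Sum>n<N. (\<Sum>k\<le>n. c k) * (b n - b (Suc n))) + (\<Sum>k<N. c k) * b N"
  by (induction N) (simp_all add: algebra_simps lessThan_Suc_atMost[symmetric])

text \<open>Summation by parts. Logarithmic growth of the partial sums is harmless, since log n *
  n^(- \<sigma> - 1) is summable and the boundary term log N * N^(- \<sigma>) tends to 0. The
  termwise bound sees the coefficients through \<open>B\<close> only and so is uniform over all
  twists that share it. The shape 6 + 4 ln (N + 1) is that of the norm of the truncation
  kernel.\<close>

lemma abel_dirichlet:
  fixes c :: "nat \<Rightarrow> complex"
  assumes B: "\<And>N. cmod (\<Sum>n\<le>N. c n) \<le> B * (6 + 4 * ln (real N + 1))" and c0: "c 0 = 0" and s: "Re s > 0"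
  shows "(\<lambda>n. c n * of_nat n powr (- s)) sums
    (\<Sum>n. (\<Sum>k\<le>n. c k) * (of_nat n powr (- s) - of_nat (Suc n) powr (- s)))"
    and "cmod ((\<Sum>k\<le>n. c k) * (of_nat n powr (- s) - of_nat (Suc n) powr (- s)))
      \<le> B * cmod s * ((6 + 4 * ln (real n + 1)) * real n powr (- Re s - 1))"
proof -
  define b where "b n = (of_nat n :: complex) powr (- s)" for n
  have B0: "B \<ge> 0" using B[of 0] c0 by simp
  show bound: "cmod ((\<Sum>k\<le>n. c k) * (of_nat n powr (- s) - of_nat (Suc n) powr (- s)))
      \<le> B * cmod s * ((6 + 4 * ln (real n + 1)) * real n powr (- Re s - 1))" for n
  proof (cases "n = 0")
    case True
    then show ?thesis using c0 by simp
  next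
    case False
    have "cmod ((\<Sum>k\<le>n. c k) * (of_nat n powr (- s) - of_nat (Suc n) powr (- s)))
        \<le> (B * (6 + 4 * ln (real n + 1))) * (cmod s * real n powr (- Re s - 1))"
      unfolding norm_mult using False B B0 by (intro mult_mono nat_powr_diff_bound s) auto
    then show ?thesis by (simp add: mult_ac)
  qed
  have sm: "summable (\<lambda>n. (\<Sum>k\<le>n. c k) * (b n - b (Suc n)))"
    unfolding b_def
    by (rule summable_comparison_test'[OF summable_mult[OF log_powr_summable[OF s]] bound])
  have tail: "(\<lambda>N. (\<Sum>k<N. c k) * b N) \<longlonglongrightarrow> 0"
  proof (rule Lim_null_comparison)
    show "\<forall>\<^sub>F N in sequentially. norm ((\<Sum>k<N. c k) * b N) \<le> B * ((6 + 4 * ln (real N)) * real N powr (- Re s))"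
      using eventually_gt_at_top[of 0]
    proof eventually_elim
      case (elim N)
      then obtain M where M: "N = Suc M" by (cases N) auto
      have "cmod (\<Sum>k<N. c k) \<le> B * (6 + 4 * ln (real N))"
        using B[of M] unfolding M lessThan_Suc_atMost by (simp add: add.commute)
      then have "norm ((\<Sum>k<N. c k) * b N) \<le> (B * (6 + 4 * ln (real N))) * real N powr (- Re s)"
        unfolding norm_mult b_def using elim by (intro mult_mono) (auto simp: norm_nat_powr intro: order_trans[OF norm_ge_zero])
      then show ?case by (simp add: mult.assoc)
    qed
    have "(\<lambda>N. (6 + 4 * ln (real N)) * real N powr (- Re s)) \<longlonglongrightarrow> 0" using s by real_asymp
    then show "(\<lambda>N. B * ((6 + 4 * ln (real N)) * real N powr (- Re s))) \<longlonglongrightarrow> 0"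
      by (rule tendsto_mult_right_zero)
  qed
  have "(\<lambda>N. (\<Sum>n<N. (\<Sum>k\<le>n. c k) * (b n - b (Suc n))) + (\<Sum>k<N. c k) * b N)
      \<longlonglongrightarrow> (\<Sum>n. (\<Sum>k\<le>n. c k) * (b n - b (Suc n))) + 0"
    by (intro tendsto_add summable_LIMSEQ sm tail)
  then have "(\<lambda>n. c n * b n) sums (\<Sum>n. (\<Sum>k\<le>n. c k) * (b n - b (Suc n)))"
    unfolding sums_def summation_by_parts[of c b] by simp
  then show "(\<lambda>n. c n * of_nat n powr (- s)) sums
    (\<Sum>n. (\<Sum>k\<le>n. c k) * (of_nat n powr (- s) - of_nat (Suc n) powr (- s)))"
    unfolding b_def .
qed

text \<open>The series transformed by parts converges uniformly on the disc of radius Re s / 2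
  around s, with the summable majorant taken at half the abscissa.\<close>

lemma abel_dirichlet_holomorphic:
  fixes c :: "nat \<Rightarrow> complex"
  assumes B: "\<And>N. cmod (\<Sum>n\<le>N. c n) \<le> B * (6 + 4 * ln (real N + 1))" and c0: "c 0 = 0"
  shows "dirichlet_sum c holomorphic_on {s. Re s > 0}"
proof -
  have B0: "B \<ge> 0" using B[of 0] c0 by simp
  let ?t = "\<lambda>n s. (\<Sum>k\<le>n. c k) * (of_nat n powr (- s) - of_nat (Suc n) powr (- s))"
  have powr_hol: "(\<lambda>s. of_nat n powr - s) holomorphic_on {s. Re s > 0}" for n :: nat
    by (cases "n = 0") (auto simp: powr_def intro!: holomorphic_intros)
  have "(\<lambda>s. \<Sum>n. ?t n s) holomorphic_on {s. Re s > 0}"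
  proof (rule holomorphic_uniform_sequence)
    show "open {s. Re s > 0}" by (rule open_halfspace_Re_gt)
    show "(\<lambda>s. \<Sum>n<N. ?t n s) holomorphic_on {s. Re s > 0}" for N
      by (intro holomorphic_on_sum holomorphic_on_mult holomorphic_on_diff holomorphic_on_const powr_hol)
    fix s :: complex assume "s \<in> {s. Re s > 0}"
    then have s: "Re s > 0" by simp
    define d where "d = Re s / 2"
    have d: "d > 0" using s by (simp add: d_def)
    have near: "Re z \<ge> d \<and> cmod z \<le> cmod s + d" if "z \<in> cball s d" for z
    proof -
      have "cmod (s - z) \<le> d" using that by (simp add: dist_norm)
      moreover have "Re (s - z) \<le> cmod (s - z)" by (rule complex_Re_le_cmod)
      moreover have "cmod z \<le> cmod s + cmod (s - z)"
        by (metis norm_minus_commute norm_triangle_sub add.commute)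
      ultimately show ?thesis by (auto simp: d_def)
    qed
    have "uniform_limit (cball s d) (\<lambda>N z. \<Sum>n<N. ?t n z) (\<lambda>z. \<Sum>n. ?t n z) sequentially"
    proof (rule Weierstrass_m_test)
      fix n z assume z: "z \<in> cball s d"
      have Rz: "Re z > 0" using near[OF z] d by linarith
      have "cmod (?t n z) \<le> B * cmod z * ((6 + 4 * ln (real n + 1)) * real n powr (- Re z - 1))"
        by (rule abel_dirichlet(2)[OF B c0 Rz])
      also have "\<dots> \<le> B * (cmod s + d) * ((6 + 4 * ln (real n + 1)) * real n powr (- d - 1))"
      proof (cases "n = 0")
        case False
        then have "real n powr (- Re z - 1) \<le> real n powr (- d - 1)"
          using near[OF z] by (intro powr_mono) auto
        moreover have "0 \<le> B * (cmod s + d)" using B0 d by simp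
        ultimately show ?thesis using near[OF z] B0 by (intro mult_mono) auto
      qed simp
      finally show "norm (?t n z) \<le> B * (cmod s + d) * ((6 + 4 * ln (real n + 1)) * real n powr (- d - 1))" .
    next
      show "summable (\<lambda>n. B * (cmod s + d) * ((6 + 4 * ln (real n + 1)) * real n powr (- d - 1)))"
        by (intro summable_mult log_powr_summable d)
    qed
    moreover have "cball s d \<subseteq> {s. Re s > 0}"
      using near d by (metis (mono_tags, lifting) less_le_trans mem_Collect_eq subsetI)
    ultimately show "\<exists>d>0. cball s d \<subseteq> {s. Re s > 0} \<and>
        uniform_limit (cball s d) (\<lambda>N z. \<Sum>n<N. ?t n z) (\<lambda>z. \<Sum>n. ?t n z) sequentially"
      using d by blast
  qed
  moreover have "dirichlet_sum c s = (\<Sum>n. ?t n s)" if "s \<in> {s. Re s > 0}" for s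
    using abel_dirichlet(1)[OF B c0, of s] that by (simp add: dirichlet_sum_def sums_iff)
  ultimately show ?thesis by (subst holomorphic_cong[OF refl]) auto
qed

subsection \<open>Convolution along the flow \<open>w \<mapsto> (p\<^sub>j powr (- it) \<cdot> w\<^sub>j)\<close>\<close>

lemma prime_flow_cis: "prime_flow t j = cis (- t * ln (nth_prime j))"
  using bohr_char_prime_flow'[OF nth_prime_pos, of j t] by (simp add: bohr_char_nth_prime)

lemma flow_measurable [measurable]:
  "(\<lambda>p. torus_mult (prime_flow (snd p)) (fst p)) \<in> torus \<Otimes>\<^sub>M lborel \<rightarrow>\<^sub>M torus"
proof (rule measurable_torusI)
  fix j :: nat
  have [measurable]: "(\<lambda>t. cis (- t * ln (nth_prime j))) \<in> borel_measurable borel"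
    by (intro borel_measurable_continuous_onI continuous_intros)
  show "(\<lambda>p. torus_mult (prime_flow (snd p)) (fst p) j) \<in> borel_measurable (torus \<Otimes>\<^sub>M lborel)"
    unfolding torus_mult_def prime_flow_cis by measurable
qed (auto simp: space_pair_measure intro!: torus_mult_space prime_flow_space)

lemma flow_measurable_time [measurable]:
  "w \<in> space torus \<Longrightarrow> (\<lambda>t. torus_mult (prime_flow t) w) \<in> borel \<rightarrow>\<^sub>M torus"
proof -
  assume w: "w \<in> space torus"
  have "(\<lambda>t. torus_mult (prime_flow (snd (w, t))) (fst (w, t))) \<in> lborel \<rightarrow>\<^sub>M torus"
    by (rule measurable_compose[OF measurable_Pair1'[OF w] flow_measurable])
  then show ?thesis by simp
qed

interpretation torus_line: pair_sigma_finite torus "lborel :: real measure" ..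

definition flow_conv :: "((nat \<Rightarrow> complex) \<Rightarrow> complex) \<Rightarrow> (real \<Rightarrow> real) \<Rightarrow> (nat \<Rightarrow> complex) \<Rightarrow> complex" where
  "flow_conv f K w = (LINT t|lborel. of_real (K t) * f (torus_mult (prime_flow t) w))"

text \<open>The bound is required at every point: convolution along the flow evaluates
  \<open>f\<close> on individual flow lines, which are null sets, so an almost everywhere bound
  would say nothing about a given line.\<close>

locale bounded_torus_fun =
  fixes f :: "(nat \<Rightarrow> complex) \<Rightarrow> complex" and C :: real
  assumes f_measurable [measurable]: "f \<in> borel_measurable torus"
    and f_bound: "\<And>w. cmod (f w) \<le> C"
begin

lemma C_nonneg: "0 \<le> C"
  using order_trans[OF norm_ge_zero f_bound] by blast

context
  fixes K :: "real \<Rightarrow> real"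
  assumes K: "integrable lborel K"
begin

lemma K_measurable [measurable]: "K \<in> borel_measurable borel"
  using borel_measurable_integrable[OF K] by simp

lemma kernel_integrable:
  assumes [measurable]: "g \<in> borel_measurable torus" and g: "\<And>w. cmod (g w) \<le> C'"
  shows "integrable (torus \<Otimes>\<^sub>M lborel) (\<lambda>p. of_real (K (snd p)) * f (torus_mult (prime_flow (snd p)) (fst p)) * g (fst p))"
proof (rule torus_line.Fubini_integrable)
  let ?H = "\<lambda>p. of_real (K (snd p)) * f (torus_mult (prime_flow (snd p)) (fst p)) * g (fst p)"
  show m: "?H \<in> borel_measurable (torus \<Otimes>\<^sub>M lborel)" by measurable
  have C': "0 \<le> C'" using order_trans[OF norm_ge_zero g] by blast
  have bound: "norm (?H (w, t)) \<le> C * C' * \<bar>K t\<bar>" for w t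
  proof -
    have "norm (?H (w, t)) = \<bar>K t\<bar> * (cmod (f (torus_mult (prime_flow t) w)) * cmod (g w))"
      by (simp add: norm_mult)
    also have "\<dots> \<le> \<bar>K t\<bar> * (C * C')"
      using f_bound g C_nonneg by (intro mult_left_mono mult_mono) auto
    finally show ?thesis by (simp add: mult_ac)
  qed
  have sec: "integrable lborel (\<lambda>t. ?H (w, t))" if w: "w \<in> space torus" for w
  proof (rule Bochner_Integration.integrable_bound)
    show "integrable lborel (\<lambda>t. C * C' * \<bar>K t\<bar>)" using K by simp
    show "(\<lambda>t. ?H (w, t)) \<in> borel_measurable lborel"
      by (rule measurable_compose[OF measurable_Pair1'[OF w] m])
    show "AE t in lborel. norm (?H (w, t)) \<le> norm (C * C' * \<bar>K t\<bar>)"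
      using bound C' C_nonneg by (intro AE_I2) (simp add: abs_mult)
  qed
  then show "AE w in torus. integrable lborel (\<lambda>t. ?H (w, t))" by (rule AE_I2)
  show "integrable torus (\<lambda>w. LINT t|lborel. norm (?H (w, t)))"
  proof (rule torus.integrable_const_bound)
    show "(\<lambda>w. LINT t|lborel. norm (?H (w, t))) \<in> borel_measurable torus"
      by (rule lborel.borel_measurable_lebesgue_integral) (use m in measurable)
    show "AE w in torus. norm (LINT t|lborel. norm (?H (w, t))) \<le> (LINT t|lborel. C * C' * \<bar>K t\<bar>)"
    proof (rule AE_I2)
      fix w assume w: "w \<in> space torus"
      have "norm (LINT t|lborel. norm (?H (w, t))) = (LINT t|lborel. norm (?H (w, t)))"
        by (simp add: Bochner_Integration.integral_nonneg)
      also have "\<dots> \<le> (LINT t|lborel. C * C' * \<bar>K t\<bar>)"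
        using sec[OF w] K bound by (intro integral_mono) auto
      finally show "norm (LINT t|lborel. norm (?H (w, t))) \<le> (LINT t|lborel. C * C' * \<bar>K t\<bar>)" .
    qed
  qed
qed

lemma kernel_section_integrable:
  assumes w: "w \<in> space torus"
  shows "integrable lborel (\<lambda>t. of_real (K t) * f (torus_mult (prime_flow t) w))"
proof (rule Bochner_Integration.integrable_bound)
  show "integrable lborel (\<lambda>t. C * \<bar>K t\<bar>)" using K by simp
  have [measurable]: "(\<lambda>t. torus_mult (prime_flow t) w) \<in> borel \<rightarrow>\<^sub>M torus" by (rule flow_measurable_time[OF w])
  show "(\<lambda>t. of_real (K t) * f (torus_mult (prime_flow t) w)) \<in> borel_measurable lborel" by measurable
  show "AE t in lborel. norm (of_real (K t) * f (torus_mult (prime_flow t) w)) \<le> norm (C * \<bar>K t\<bar>)"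
  proof (rule AE_I2)
    fix t
    have "norm (of_real (K t) * f (torus_mult (prime_flow t) w)) = cmod (f (torus_mult (prime_flow t) w)) * \<bar>K t\<bar>"
      by (simp add: norm_mult)
    also have "\<dots> \<le> C * \<bar>K t\<bar>" by (intro mult_right_mono f_bound) auto
    finally show "norm (of_real (K t) * f (torus_mult (prime_flow t) w)) \<le> norm (C * \<bar>K t\<bar>)"
      using C_nonneg by (simp add: abs_mult)
  qed
qed

lemma flow_conv_measurable [measurable]: "flow_conv f K \<in> borel_measurable torus"
  unfolding flow_conv_def[abs_def]
  by (rule lborel.borel_measurable_lebesgue_integral) measurable

lemma flow_conv_bound:
  assumes "w \<in> space torus"
  shows "cmod (flow_conv f K w) \<le> C * (LINT t|lborel. \<bar>K t\<bar>)"
proof -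
  have "cmod (flow_conv f K w) \<le> (LINT t|lborel. C * \<bar>K t\<bar>)"
    unfolding flow_conv_def
  proof (rule order_trans[OF integral_norm_bound integral_mono])
    show "integrable lborel (\<lambda>t. norm (of_real (K t) * f (torus_mult (prime_flow t) w)))"
      by (rule integrable_norm[OF kernel_section_integrable[OF assms]])
    show "integrable lborel (\<lambda>t. C * \<bar>K t\<bar>)" using K by simp
    fix t
    have "norm (of_real (K t) * f (torus_mult (prime_flow t) w)) = cmod (f (torus_mult (prime_flow t) w)) * \<bar>K t\<bar>"
      by (simp add: norm_mult)
    also have "\<dots> \<le> C * \<bar>K t\<bar>" by (intro mult_right_mono f_bound) auto
    finally show "norm (of_real (K t) * f (torus_mult (prime_flow t) w)) \<le> C * \<bar>K t\<bar>" .
  qed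
  then show ?thesis by simp
qed

text \<open>After Fubini the inner integral over the torus is, for fixed t, a rotated Fourier
  integral; invariance pulls out the value of the character at \<open>prime_flow t\<close>.
  Convolution along the flow thus acts diagonally, multiplying the coefficient of n by the Fourier
  transform of \<open>K\<close> at ln n.\<close>

lemma flow_conv_fourier:
  assumes \<alpha>: "\<alpha> \<in> finite_exponents"
  shows "L2_inner torus (flow_conv f K) (torus_char \<alpha>)
    = L2_inner torus f (torus_char \<alpha>) * (LINT t|lborel. of_real (K t) * torus_char \<alpha> (prime_flow t))"
proof -
  \<comment> \<open>The cutoff outside the torus makes the bound by 1 hold at every w, as
    \<open>kernel_integrable\<close> demands.\<close>
  define g where "g w = (if w \<in> space torus then cnj (torus_char \<alpha> w) else 0)" for w
  have gm: "g \<in> borel_measurable torus"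
    using measurable_compose[OF torus_char_measurable[of \<alpha>] measurable_cnj]
    by (rule measurable_cong[THEN iffD1, rotated]) (simp add: g_def)
  note gm [measurable]
  have gb: "cmod (g w) \<le> 1" for w by (simp add: g_def norm_torus_char)
  let ?fl = "\<lambda>t w. torus_mult (prime_flow t) w"
  have i: "integrable (torus \<Otimes>\<^sub>M lborel) (\<lambda>(w, t). of_real (K t) * f (?fl t w) * g w)"
    using kernel_integrable[OF gm gb] by (simp add: case_prod_beta')
  have rot: "(LINT w|torus. f (?fl t w) * g w) = L2_inner torus f (torus_char \<alpha>) * torus_char \<alpha> (prime_flow t)" for t
  proof -
    have "(LINT w|torus. f (?fl t w) * g w)
        = (LINT w|torus. (f (?fl t w) * cnj (torus_char \<alpha> (?fl t w))) * torus_char \<alpha> (prime_flow t))"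
    proof (intro Bochner_Integration.integral_cong refl)
      fix w assume w: "w \<in> space torus"
      have "cnj (torus_char \<alpha> (prime_flow t)) * torus_char \<alpha> (prime_flow t) = 1"
        using norm_torus_char[OF prime_flow_space, of \<alpha> t] complex_norm_square[of "torus_char \<alpha> (prime_flow t)"]
        by (simp add: mult.commute)
      then show "f (?fl t w) * g w = (f (?fl t w) * cnj (torus_char \<alpha> (?fl t w))) * torus_char \<alpha> (prime_flow t)"
        using w by (simp add: g_def torus_mult_def torus_char_mult_arg)
    qed
    also have "\<dots> = (LINT w|torus. f (?fl t w) * cnj (torus_char \<alpha> (?fl t w))) * torus_char \<alpha> (prime_flow t)"
      by simp
    also have "(LINT w|torus. f (?fl t w) * cnj (torus_char \<alpha> (?fl t w))) = L2_inner torus f (torus_char \<alpha>)"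
      unfolding L2_inner_def
      by (rule torus_integral_rotation[OF prime_flow_space, where g = "\<lambda>w. f w * cnj (torus_char \<alpha> w)"]) measurable
    finally show ?thesis .
  qed
  have "L2_inner torus (flow_conv f K) (torus_char \<alpha>) = (LINT w|torus. LINT t|lborel. of_real (K t) * f (?fl t w) * g w)"
    unfolding L2_inner_def flow_conv_def
    by (intro Bochner_Integration.integral_cong refl) (simp add: g_def)
  also have "\<dots> = (LINT t|lborel. LINT w|torus. of_real (K t) * f (?fl t w) * g w)"
    using torus_line.Fubini_integral[OF i] by simp
  also have "\<dots> = (LINT t|lborel. L2_inner torus f (torus_char \<alpha>) * (of_real (K t) * torus_char \<alpha> (prime_flow t)))"
  proof (intro Bochner_Integration.integral_cong refl)
    fix t
    have "(LINT w|torus. of_real (K t) * f (?fl t w) * g w) = of_real (K t) * (LINT w|torus. f (?fl t w) * g w)"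
      by (simp only: mult.assoc integral_mult_right_zero)
    then show "(LINT w|torus. of_real (K t) * f (?fl t w) * g w)
        = L2_inner torus f (torus_char \<alpha>) * (of_real (K t) * torus_char \<alpha> (prime_flow t))"
      unfolding rot by (simp only: mult_ac)
  qed
  finally show ?thesis by simp
qed

lemma flow_conv_L2: "flow_conv f K \<in> L2_space torus"
  by (rule torus.L2_space_bounded[OF flow_conv_measurable AE_I2[OF flow_conv_bound]])

lemma flow_conv_bohr:
  assumes "n \<ge> 1"
  shows "bohr_transform (flow_conv f K) n = bohr_transform f n * (LINT t|lborel. of_real (K t) * cis (- t * ln n))"
proof -
  have n: "n > 0" using assms by simp
  have "bohr_char n = torus_char (prime_exponents n)" using n by (auto simp: bohr_char_def)
  moreover have "torus_char (prime_exponents n) (prime_flow t) = cis (- t * ln n)" for t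
    using bohr_char_prime_flow'[OF n, of t] n by (simp add: bohr_char_def)
  ultimately show ?thesis
    using flow_conv_fourier[OF prime_exponents_finite[OF n]] by (simp add: bohr_transform_eq_inner)
qed

lemma flow_conv_hardy2:
  assumes "f \<in> hardy2_torus"
  shows "flow_conv f K \<in> hardy2_torus"
  using assms flow_conv_L2 flow_conv_fourier
  unfolding hardy2_torus_def analytic_spectrum_def torus_fourier_eq_inner finite_exponents_def by auto

end

end

lemma L2_seminorm_zero_AE:
  assumes "u \<in> L2_space M" "L2_seminorm M u = 0"
  shows "AE x in M. u x = 0"
proof -
  have "(LINT x|M. (cmod (u x))\<^sup>2) = 0"
    using assms(2) L2_seminorm_power2[of M u] by simp
  then have "AE x in M. (cmod (u x))\<^sup>2 = 0"
    using assms(1) by (subst (asm) integral_nonneg_eq_0_iff_AE) auto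
  then show ?thesis by eventually_elim simp
qed

text \<open>A subsequence converges almost everywhere to the L2 limit, and the pointwise limit of
  the full sequence must agree with it.\<close>

lemma L2_limit_AE_eq:
  fixes h :: "nat \<Rightarrow> 'a \<Rightarrow> complex"
  assumes h: "\<And>n. h n \<in> L2_space M" and g: "g \<in> L2_space M"
    and L2: "(\<lambda>n. L2_seminorm M (\<lambda>x. h n x - g x)) \<longlonglongrightarrow> 0"
    and ptw: "AE x in M. (\<lambda>n. h n x) \<longlonglongrightarrow> S x"
  shows "AE x in M. S x = g x"
proof -
  let ?u = "\<lambda>n x. (cmod (h n x - g x))\<^sup>2"
  have "\<exists>r. strict_mono r \<and> (AE x in M. (\<lambda>n. ?u (r n) x) \<longlonglongrightarrow> 0)"
  proof (rule tendsto_L1_AE_subseq)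
    show "integrable M (?u n)" for n using L2_spaceD(2)[OF L2_space_diff[OF h g]] .
    show "(\<lambda>n. LINT x|M. norm (?u n x)) \<longlonglongrightarrow> 0"
      using tendsto_power[OF L2, of 2] by (simp add: L2_seminorm_power2)
  qed
  then obtain r where r: "strict_mono r" "AE x in M. (\<lambda>n. ?u (r n) x) \<longlonglongrightarrow> 0" by blast
  show ?thesis
    using r(2) ptw
  proof eventually_elim
    case (elim x)
    have "(\<lambda>n. sqrt (?u (r n) x)) \<longlonglongrightarrow> sqrt 0" by (intro tendsto_real_sqrt elim(1))
    then have "(\<lambda>n. h (r n) x - g x) \<longlonglongrightarrow> 0"
      by (simp add: tendsto_norm_zero_iff)
    then have "(\<lambda>n. h (r n) x) \<longlonglongrightarrow> g x" by (rule LIM_zero_cancel)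
    moreover have "(\<lambda>n. h (r n) x) \<longlonglongrightarrow> S x"
      using LIMSEQ_subseq_LIMSEQ[OF elim(2) r(1)] by (simp add: o_def)
    ultimately show ?case using LIMSEQ_unique by blast
  qed
qed

subsection \<open>Bounded functions in \<open>H\<^sup>2(\<T>\<^sup>\<infinity>)\<close> and their Dirichlet series\<close>

lemma sum_atMost_eq_from_1:
  fixes g :: "nat \<Rightarrow> 'a::comm_monoid_add"
  assumes "g 0 = 0"
  shows "(\<Sum>n\<le>N. g n) = (\<Sum>n=1..N. g n)"
  using assms by (intro sum.mono_neutral_right) (auto simp: Suc_le_eq)

lemma bohr_char_one: "n > 0 \<Longrightarrow> bohr_char n (\<lambda>_. 1) = 1"
  by (simp add: bohr_char_def torus_char_def)

lemma one_space_torus: "(\<lambda>_. 1) \<in> space torus"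
  by (simp add: space_torus)

lemma bohr_transform_0 [simp]: "bohr_transform f 0 = 0"
  by (simp add: bohr_transform_def)

text \<open>The factor n^(-it) is the value of the n-th Bohr character at
  \<open>prime_flow t\<close>. Moving vertically in the half plane is therefore the same as rotating
  the twist along the flow.\<close>

lemma bohr_twist_flow:
  "a n * bohr_char n w * of_nat n powr (- (s + \<i> * of_real t))
    = a n * bohr_char n (torus_mult (prime_flow t) w) * of_nat n powr (- s)"
proof (cases "n = 0")
  case False
  have "of_nat n powr (- (s + \<i> * of_real t)) = of_nat n powr (- s) * (of_nat n powr (- \<i> * of_real t) :: complex)"
    using powr_add[of "of_nat n :: complex" "- s" "- \<i> * of_real t"] by simp
  then show ?thesis by (simp add: bohr_char_torus_mult bohr_char_prime_flow)
qed simp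

lemma bohr_twist_flow_sum:
  "dirichlet_sum (\<lambda>n. a n * bohr_char n w) (s + \<i> * of_real t)
    = dirichlet_sum (\<lambda>n. a n * bohr_char n (torus_mult (prime_flow t) w)) s"
  unfolding dirichlet_sum_def bohr_twist_flow ..

locale bounded_hardy = bounded_torus_fun +
  assumes f_hardy: "f \<in> hardy2_torus"
begin

text \<open>The convolution of \<open>f\<close> with the truncation kernel has exactly the Fourier
  coefficients of the partial sum, hence equals it almost everywhere, and it is bounded by the L1
  norm of the kernel times C.\<close>

lemma truncated_sum_bound:
  assumes N: "N \<ge> 1" and w: "w \<in> space torus"
  shows "cmod (\<Sum>n=1..N. bohr_transform f n * bohr_char n w) \<le> C * (LINT t|lborel. \<bar>truncation_kernel N t\<bar>)"
proof -
  let ?P = "\<lambda>w. \<Sum>n=1..N. bohr_transform f n * bohr_char n w"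
  define g where "g = flow_conv f (truncation_kernel N)"
  have gL: "g \<in> L2_space torus" unfolding g_def by (rule flow_conv_L2[OF truncation_kernel_integrable])
  have coeff: "bohr_transform g n = (if n \<le> N then bohr_transform f n else 0)" if "n \<ge> 1" for n
    unfolding g_def flow_conv_bohr[OF truncation_kernel_integrable that] truncation_kernel_fourier[OF N that] by simp
  have part: "(\<Sum>n=1..M. bohr_transform g n * bohr_char n w) = ?P w" if "M \<ge> N" for M w
    using that by (intro sum.mono_neutral_cong_right) (auto simp: coeff)
  have PL: "?P \<in> L2_space torus" by (intro L2_space_sum L2_space_cmult bohr_char_L2)
  have "(\<lambda>M. L2_seminorm torus (\<lambda>w. (\<Sum>n=1..M. bohr_transform g n * bohr_char n w) - g w)) \<longlonglongrightarrow> 0"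
    by (rule hardy2_expansion) (simp add: g_def flow_conv_hardy2[OF truncation_kernel_integrable f_hardy])
  moreover have "\<forall>\<^sub>F M in sequentially. L2_seminorm torus (\<lambda>w. (\<Sum>n=1..M. bohr_transform g n * bohr_char n w) - g w)
      = L2_seminorm torus (\<lambda>w. ?P w - g w)"
    using eventually_ge_at_top[of N] by eventually_elim (simp only: part)
  ultimately have "(\<lambda>M. L2_seminorm torus (\<lambda>w. ?P w - g w)) \<longlonglongrightarrow> 0"
    by (rule Lim_transform_eventually)
  then have "L2_seminorm torus (\<lambda>w. ?P w - g w) = 0" by (simp add: LIMSEQ_const_iff)
  then have "AE w in torus. ?P w - g w = 0"
    by (intro L2_seminorm_zero_AE L2_space_diff PL gL)
  then have ae: "AE w in torus. cmod (?P w) \<le> C * (LINT t|lborel. \<bar>truncation_kernel N t\<bar>)"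
    using AE_space
  proof eventually_elim
    case (elim w)
    then show ?case
      using flow_conv_bound[OF truncation_kernel_integrable[of N] elim(2)] by (simp add: g_def)
  qed
  \<comment> \<open>The bound is needed for every w, in particular for the unit of the torus, which
    carries D itself; it spreads from almost every w because the partial sum is continuous.\<close>
  have "continuous_on (space torus) ?P"
    by (intro continuous_intros bohr_char_continuous)
  then show ?thesis using ae w by (rule torus_AE_bound_everywhere)
qed

lemma partial_sum_bound:
  assumes w: "w \<in> space torus"
  shows "cmod (\<Sum>n\<le>N. bohr_transform f n * bohr_char n w) \<le> (C / fejer_const) * (6 + 4 * ln (real N + 1))"
proof (cases "N = 0")
  case True
  then show ?thesis using C_nonneg fejer_const_pos by simp
next
  case False
  then have N: "N \<ge> 1" by simp
  have "cmod (\<Sum>n\<le>N. bohr_transform f n * bohr_char n w) = cmod (\<Sum>n=1..N. bohr_transform f n * bohr_char n w)"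
    by (subst sum_atMost_eq_from_1) auto
  also have "\<dots> \<le> C * (LINT t|lborel. \<bar>truncation_kernel N t\<bar>)"
    by (rule truncated_sum_bound[OF N w])
  also have "\<dots> \<le> C * ((6 + 4 * ln (real N + 1)) / fejer_const)"
    by (intro mult_left_mono truncation_kernel_norm N C_nonneg)
  finally show ?thesis by simp
qed

abbreviation vertical :: "(nat \<Rightarrow> complex) \<Rightarrow> complex \<Rightarrow> complex" where
  "vertical w \<equiv> dirichlet_sum (\<lambda>n. bohr_transform f n * bohr_char n w)"

lemma vertical_sums:
  assumes "w \<in> space torus" "Re s > 0"
  shows "(\<lambda>n. bohr_transform f n * bohr_char n w * of_nat n powr (- s)) sums vertical w s"
  using abel_dirichlet(1)[OF partial_sum_bound[OF assms(1)] _ assms(2)]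
  by (simp add: dirichlet_sum_def sums_iff)

lemma vertical_holomorphic:
  "w \<in> space torus \<Longrightarrow> vertical w holomorphic_on {s. Re s > 0}"
  by (rule abel_dirichlet_holomorphic[OF partial_sum_bound]) auto

text \<open>Both sides have the coefficients a_n n^(- \<sigma>): on the left they give a pointwise
  limit, on the right an L2 limit, and the two limits coincide almost everywhere. The exceptional
  set may depend on \<sigma>.\<close>

lemma vertical_poisson_AE:
  assumes \<sigma>: "\<sigma> > 0"
  shows "AE w in torus. vertical w (of_real \<sigma>) = flow_conv f (poisson \<sigma>) w"
proof -
  let ?g = "flow_conv f (poisson \<sigma>)"
  have coeff: "bohr_transform ?g n = bohr_transform f n * of_nat n powr (- of_real \<sigma>)" if "n \<ge> 1" for n
  proof -
    have "bohr_transform ?g n = bohr_transform f n * of_real (exp (- \<sigma> * \<bar>ln (real n)\<bar>))"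
      unfolding flow_conv_bohr[OF poisson_integrable[OF \<sigma>] that] poisson_fourier[OF \<sigma>] ..
    also have "exp (- \<sigma> * \<bar>ln (real n)\<bar>) = real n powr (- \<sigma>)"
      using that by (simp add: powr_def)
    also have "complex_of_real (real n powr (- \<sigma>)) = of_nat n powr (- of_real \<sigma>)"
      using powr_of_real[of "real n" "- \<sigma>"] by simp
    finally show ?thesis .
  qed
  show ?thesis
  proof (rule L2_limit_AE_eq[where h = "\<lambda>N w. \<Sum>n=1..N. bohr_transform ?g n * bohr_char n w"])
  show "?g \<in> L2_space torus" by (rule flow_conv_L2[OF poisson_integrable[OF \<sigma>]])
  show "(\<lambda>w. \<Sum>n=1..N. bohr_transform ?g n * bohr_char n w) \<in> L2_space torus" for N
    by (intro L2_space_sum L2_space_cmult bohr_char_L2)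
  show "(\<lambda>N. L2_seminorm torus (\<lambda>w. (\<Sum>n=1..N. bohr_transform ?g n * bohr_char n w) - ?g w)) \<longlonglongrightarrow> 0"
    by (intro hardy2_expansion flow_conv_hardy2 poisson_integrable \<sigma> f_hardy)
  show "AE w in torus. (\<lambda>N. \<Sum>n=1..N. bohr_transform ?g n * bohr_char n w) \<longlonglongrightarrow> vertical w (of_real \<sigma>)"
  proof (rule AE_I2)
    fix w assume w: "w \<in> space torus"
    have "(\<lambda>N. \<Sum>n\<le>N. bohr_transform f n * bohr_char n w * of_nat n powr (- of_real \<sigma>)) \<longlonglongrightarrow> vertical w (of_real \<sigma>)"
      using vertical_sums[OF w, of "of_real \<sigma>"] \<sigma> by (simp add: sums_def_le)
    moreover have "(\<Sum>n\<le>N. bohr_transform f n * bohr_char n w * of_nat n powr (- of_real \<sigma>))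
        = (\<Sum>n=1..N. bohr_transform ?g n * bohr_char n w)" for N
      by (subst sum_atMost_eq_from_1) (auto simp: coeff intro!: sum.cong)
    ultimately show "(\<lambda>N. \<Sum>n=1..N. bohr_transform ?g n * bohr_char n w) \<longlonglongrightarrow> vertical w (of_real \<sigma>)"
      by simp
  qed
  qed
qed

text \<open>The bound in the Abel summation does not depend on w, so the transformed series
  converges uniformly on the torus. Continuity serves to extend the Poisson bound from almost every
  w to every w.\<close>

lemma vertical_continuous_in_character:
  assumes s: "Re s > 0"
  shows "continuous_on (space torus) (\<lambda>w. vertical w s)"
proof -
  let ?t = "\<lambda>n w. (\<Sum>k\<le>n. bohr_transform f k * bohr_char k w) * (of_nat n powr (- s) - of_nat (Suc n) powr (- s))"
  have "uniform_limit (space torus) (\<lambda>N w. \<Sum>n<N. ?t n w) (\<lambda>w. \<Sum>n. ?t n w) sequentially"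
  proof (rule Weierstrass_m_test)
    show "norm (?t n w) \<le> C / fejer_const * cmod s * ((6 + 4 * ln (real n + 1)) * real n powr (- Re s - 1))"
      if "w \<in> space torus" for n w
      by (rule abel_dirichlet(2)[OF partial_sum_bound[OF that] _ s]) simp
    show "summable (\<lambda>n. C / fejer_const * cmod s * ((6 + 4 * ln (real n + 1)) * real n powr (- Re s - 1)))"
      by (intro summable_mult log_powr_summable s)
  qed
  then have "continuous_on (space torus) (\<lambda>w. \<Sum>n. ?t n w)"
    by (rule uniform_limit_theorem[rotated])
      (auto intro!: always_eventually continuous_intros bohr_char_continuous)
  moreover have "vertical w s = (\<Sum>n. ?t n w)" if w: "w \<in> space torus" for w
    using abel_dirichlet(1)[OF partial_sum_bound[OF w] _ s] by (simp add: dirichlet_sum_def sums_iff)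
  ultimately show ?thesis by (subst continuous_on_cong[OF refl]) auto
qed

lemma vertical_bound_real:
  assumes w: "w \<in> space torus" and \<sigma>: "\<sigma> > 0"
  shows "cmod (vertical w (of_real \<sigma>)) \<le> C"
proof (rule torus_AE_bound_everywhere[OF vertical_continuous_in_character _ w])
  show "Re (of_real \<sigma>) > 0" using \<sigma> by simp
  have p: "(LINT t|lborel. \<bar>poisson \<sigma> t\<bar>) = 1"
    using poisson_integral[OF \<sigma>] poisson_nonneg[OF \<sigma>] by simp
  show "AE w in torus. cmod (vertical w (of_real \<sigma>)) \<le> C"
    using vertical_poisson_AE[OF \<sigma>] AE_space
  proof eventually_elim
    case (elim w)
    then show ?case using flow_conv_bound[OF poisson_integrable[OF \<sigma>] elim(2)] p by simp
  qed
qed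

text \<open>D is the vertical series at the unit of the torus, and its value at \<sigma> + i t is
  the value at \<sigma> of the series twisted by \<open>prime_flow t\<close>. The bound on the real
  axis for all characters hence bounds D on the half plane.\<close>

lemma bohr_transform_Hinf: "bohr_transform f \<in> Hinf"
proof -
  have eq: "(\<lambda>n. bohr_transform f n * bohr_char n (\<lambda>_. 1)) = bohr_transform f"
  proof
    fix n show "bohr_transform f n * bohr_char n (\<lambda>_. 1) = bohr_transform f n"
      by (cases "n = 0") (auto simp: bohr_char_one)
  qed
  have "cmod (dirichlet_sum (bohr_transform f) s) \<le> C" if s: "Re s > 0" for s
  proof -
    have "s = of_real (Re s) + \<i> * of_real (Im s)" by (simp add: complex_eq)
    then have "dirichlet_sum (bohr_transform f) s = vertical (\<lambda>_. 1) (of_real (Re s) + \<i> * of_real (Im s))"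
      by (simp only: eq)
    also have "\<dots> = vertical (torus_mult (prime_flow (Im s)) (\<lambda>_. 1)) (of_real (Re s))"
      by (rule bohr_twist_flow_sum)
    also have "cmod \<dots> \<le> C"
      by (intro vertical_bound_real torus_mult_space prime_flow_space one_space_torus s)
    finally show ?thesis .
  qed
  then have "bounded (dirichlet_sum (bohr_transform f) ` {s. Re s > 0})"
    by (auto simp: bounded_iff)
  moreover have "summable (\<lambda>n. bohr_transform f n * of_nat n powr (- s))" if "Re s > 0" for s
    using vertical_sums[OF one_space_torus that] fun_cong[OF eq] by (simp add: sums_iff)
  moreover have "dirichlet_sum (bohr_transform f) holomorphic_on {s. Re s > 0}"
    using vertical_holomorphic[OF one_space_torus] by (simp only: eq)
  ultimately show ?thesis by (simp add: Hinf_def)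
qed

end

subsection \<open>Boundedness of \<open>f\<close> from boundedness of its Dirichlet series\<close>

lemma fejer_integrable_mult:
  fixes g :: "real \<Rightarrow> complex"
  assumes [measurable]: "g \<in> borel_measurable borel" and "\<And>t. cmod (g t) \<le> C"
  shows "integrable lborel (\<lambda>t. of_real (fejer R t) * g t)"
proof (rule Bochner_Integration.integrable_bound)
  show "integrable lborel (\<lambda>t. C * fejer R t)" by (intro integrable_mult_right fejer_integrable)
  show "(\<lambda>t. of_real (fejer R t) * g t) \<in> borel_measurable lborel" by measurable
  have C: "0 \<le> C" using order_trans[OF norm_ge_zero assms(2)] by blast
  show "AE t in lborel. norm (of_real (fejer R t) * g t) \<le> norm (C * fejer R t)"
    using mult_right_mono[OF assms(2) fejer_nonneg] C
    by (intro AE_I2) (simp add: norm_mult abs_mult fejer_nonneg mult.commute)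
qed

lemma cis_ln_measurable [measurable]: "(\<lambda>t. cis (- t * x)) \<in> borel_measurable borel"
  by (intro borel_measurable_continuous_onI continuous_intros)

text \<open>For m < n <= X, ln (n / m) >= 1 - m / n >= 1 / n >= 1 / X.\<close>

lemma ln_gap:
  fixes m n X :: nat
  assumes "1 \<le> m" "1 \<le> n" "m \<le> X" "n \<le> X" "m \<noteq> n"
  shows "1 / real X \<le> \<bar>ln (real m) - ln (real n)\<bar>"
proof -
  have *: "1 / real X \<le> ln (real n) - ln (real m)" if "1 \<le> m" "m < n" "n \<le> X" for m n :: nat
  proof -
    have "ln (real m / real n) \<le> real m / real n - 1" using that by (intro ln_le_minus_one) auto
    also have "\<dots> = (real m - real n) / real n" using that by (simp add: diff_divide_distrib)
    also have "\<dots> \<le> - 1 / real n" using that by (intro divide_right_mono) auto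
    also have "\<dots> = - (1 / real n)" by simp
    also have "\<dots> \<le> - (1 / real X)" using that by (simp add: frac_le)
    finally show ?thesis using that by (simp add: ln_div)
  qed
  show ?thesis
  proof (cases "m < n")
    case True
    then show ?thesis using *[of m n] assms by simp
  next
    case False
    then show ?thesis using *[of n m] assms by simp
  qed
qed

text \<open>If \<open>1 / X\<close> is below all gaps between the frequencies, averaging with the Fejer kernel
  reproduces the norm on the torus exactly.\<close>

lemma fejer_mean_square:
  fixes c :: "'j \<Rightarrow> complex" and m :: "'j \<Rightarrow> nat"
  assumes J: "finite J" "\<And>j. j \<in> J \<Longrightarrow> 1 \<le> m j" "\<And>j. j \<in> J \<Longrightarrow> m j \<le> X" and X: "X \<ge> 1"
  shows "(LINT t|lborel. fejer (1 / X) t * (cmod (\<Sum>j\<in>J. c j * cis (- t * ln (m j))))\<^sup>2)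
    = (1 / X) * (L2_seminorm torus (\<lambda>w. \<Sum>j\<in>J. c j * bohr_char (m j) w))\<^sup>2"
proof -
  define r where "r = 1 / real X"
  have r: "0 \<le> r" by (simp add: r_def)
  have term_int: "integrable lborel (\<lambda>t. of_real (fejer r t) * (c j * cnj (c k) * cis (- t * (ln (m j) - ln (m k)))))" for j k
    by (rule fejer_integrable_mult[where C = "cmod (c j * cnj (c k))"]) (measurable, simp add: norm_mult)
  have sq: "complex_of_real ((cmod (\<Sum>j\<in>J. c j * cis (- t * ln (m j))))\<^sup>2)
      = (\<Sum>j\<in>J. \<Sum>k\<in>J. c j * cnj (c k) * cis (- t * (ln (m j) - ln (m k))))" for t
  proof -
    have "complex_of_real ((cmod (\<Sum>j\<in>J. c j * cis (- t * ln (m j))))\<^sup>2)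
        = (\<Sum>j\<in>J. c j * cis (- t * ln (m j))) * (\<Sum>k\<in>J. cnj (c k) * cis (t * ln (m k)))"
      unfolding complex_norm_square cnj_sum by (simp add: cis_cnj)
    also have "\<dots> = (\<Sum>j\<in>J. \<Sum>k\<in>J. c j * cnj (c k) * (cis (- t * ln (m j)) * cis (t * ln (m k))))"
      unfolding sum_product by (intro sum.cong refl) (simp add: mult_ac)
    also have "\<dots> = (\<Sum>j\<in>J. \<Sum>k\<in>J. c j * cnj (c k) * cis (- t * (ln (m j) - ln (m k))))"
      unfolding cis_mult by (intro sum.cong refl) (simp add: algebra_simps)
    finally show ?thesis .
  qed
  have "complex_of_real (LINT t|lborel. fejer r t * (cmod (\<Sum>j\<in>J. c j * cis (- t * ln (m j))))\<^sup>2)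
      = (LINT t|lborel. complex_of_real (fejer r t * (cmod (\<Sum>j\<in>J. c j * cis (- t * ln (m j))))\<^sup>2))"
    by (rule integral_complex_of_real[symmetric])
  also have "\<dots> = (LINT t|lborel. (\<Sum>j\<in>J. \<Sum>k\<in>J. of_real (fejer r t) * (c j * cnj (c k) * cis (- t * (ln (m j) - ln (m k))))))"
    unfolding of_real_mult sq sum_distrib_left ..
  also have "\<dots> = (\<Sum>j\<in>J. \<Sum>k\<in>J. (LINT t|lborel. of_real (fejer r t) * (c j * cnj (c k) * cis (- t * (ln (m j) - ln (m k))))))"
    by (simp only: Bochner_Integration.integral_sum Bochner_Integration.integrable_sum term_int)
  also have "\<dots> = (\<Sum>j\<in>J. \<Sum>k\<in>J. of_real r * (c j * cnj (c k) * of_bool (m j = m k)))"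
  proof (intro sum.cong refl)
    fix j k assume j: "j \<in> J" and k: "k \<in> J"
    have "(LINT t|lborel. of_real (fejer r t) * (c j * cnj (c k) * cis (- t * (ln (m j) - ln (m k)))))
        = (LINT t|lborel. (c j * cnj (c k)) * (of_real (fejer r t) * cis (- t * (ln (m j) - ln (m k)))))"
      by (intro Bochner_Integration.integral_cong refl) (simp only: mult_ac)
    also have "\<dots> = (c j * cnj (c k)) * of_real (max 0 (r - \<bar>ln (m j) - ln (m k)\<bar>))"
      by (simp only: integral_mult_right_zero fejer_fourier[OF r])
    \<comment> \<open>A tent of width 1 / X sees equal frequencies only, since different ones are at
      least 1 / X apart. Coincidences m j = m k with j \<noteq> k survive here just as they do in
      the norm on the torus.\<close>
    also have "max 0 (r - \<bar>ln (m j) - ln (m k)\<bar>) = r * of_bool (m j = m k)"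
    proof (cases "m j = m k")
      case False
      then have "r \<le> \<bar>ln (m j) - ln (m k)\<bar>"
        unfolding r_def using J j k by (intro ln_gap) auto
      then show ?thesis using False by simp
    qed (use r in simp)
    also have "(c j * cnj (c k)) * of_real (r * of_bool (m j = m k)) = of_real r * (c j * cnj (c k) * of_bool (m j = m k))"
      by (cases "m j = m k") simp_all
    finally show "(LINT t|lborel. of_real (fejer r t) * (c j * cnj (c k) * cis (- t * (ln (m j) - ln (m k)))))
        = of_real r * (c j * cnj (c k) * of_bool (m j = m k))" .
  qed
  also have "\<dots> = of_real r * (\<Sum>j\<in>J. \<Sum>k\<in>J. c j * cnj (c k) * of_bool (m j = m k))"
    by (simp only: sum_distrib_left)
  also have "\<dots> = of_real r * of_real ((L2_seminorm torus (\<lambda>w. \<Sum>j\<in>J. c j * bohr_char (m j) w))\<^sup>2)"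
  proof -
    have "j \<in> J \<Longrightarrow> m j \<in> {0<..}" for j using J(2)[of j] by auto
    then show ?thesis by (subst orthonormal_norm_reindex[OF bohr_orthonormal]) auto
  qed
  finally have "complex_of_real (LINT t|lborel. fejer r t * (cmod (\<Sum>j\<in>J. c j * cis (- t * ln (m j))))\<^sup>2)
      = complex_of_real (r * (L2_seminorm torus (\<lambda>w. \<Sum>j\<in>J. c j * bohr_char (m j) w))\<^sup>2)"
    by (simp only: of_real_mult)
  then show ?thesis unfolding r_def of_real_eq_iff .
qed

text \<open>First-order logarithmic Riesz means, not divided by k: the weight of a_n is the Fourier
  transform of \<open>fejer k\<close> at ln n. Only the terms with n < e^k remain, so all sums are
  finite.\<close>

definition riesz_mean :: "(nat \<Rightarrow> complex) \<Rightarrow> nat \<Rightarrow> nat \<Rightarrow> complex" where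
  "riesz_mean a k n = a n * of_real (max 0 (real k - ln n))"

lemma Hinf_norm_bound:
  assumes "a \<in> Hinf" "Re s > 0"
  shows "cmod (dirichlet_sum a s) \<le> Hinf_norm a"
proof -
  have "bounded (dirichlet_sum a ` {s. Re s > 0})" using assms by (simp add: Hinf_def)
  then obtain B where "\<forall>s\<in>{s. Re s > 0}. cmod (dirichlet_sum a s) \<le> B" by (auto simp: bounded_iff)
  then show ?thesis
    unfolding Hinf_norm_def using assms(2) by (intro cSUP_upper) (auto simp: bdd_above_def)
qed

lemma Hinf_norm_nonneg: "a \<in> Hinf \<Longrightarrow> 0 \<le> Hinf_norm a"
  using order_trans[OF norm_ge_zero Hinf_norm_bound[of a 1]] by simp

lemma riesz_mean_zero:
  assumes "n \<ge> nat \<lceil>exp (real k)\<rceil>" "n \<ge> 1"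
  shows "riesz_mean a k n = 0"
proof -
  have "exp (real k) \<le> real n" using assms by linarith
  then have "real k \<le> ln (real n)" using assms by (simp add: ln_ge_iff)
  then show ?thesis by (simp add: riesz_mean_def)
qed

text \<open>For Re s > 1 square summable coefficients give absolute convergence, through |a_n| / n
  <= |a_n|^2 + 1 / n^2, and the series may be integrated term by term.\<close>

lemma fejer_integral_dirichlet_absolute:
  assumes a: "a \<in> Hinf" and sq: "summable (\<lambda>n. (cmod (a n))\<^sup>2)" and s: "Re s > 1"
    and N: "N \<ge> nat \<lceil>exp (real k)\<rceil>"
  shows "(LINT t|lborel. of_real (fejer (real k) t) * dirichlet_sum a (s + \<i> * of_real t))
    = (\<Sum>n=1..N. riesz_mean a k n * of_nat n powr (- s))"
proof -
  define b where "b n = a n * of_nat n powr (- s)" for n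
  have a0: "a 0 = 0" using a by (simp add: Hinf_def)
  have b0: "b 0 = 0" by (simp add: b_def a0)
  have shift: "a n * of_nat n powr (- (s + \<i> * of_real t)) = b n * cis (- t * ln n)" for n t
  proof (cases "n = 0")
    case False
    have "of_nat n powr (- (s + \<i> * of_real t)) = of_nat n powr (- s) * (of_nat n powr (- \<i> * of_real t) :: complex)"
      using powr_add[of "of_nat n :: complex" "- s" "- \<i> * of_real t"] by simp
    also have "of_nat n powr (- \<i> * of_real t) = cis (- t * ln n)"
      using False by (subst bohr_char_prime_flow[symmetric], subst bohr_char_prime_flow') auto
    finally show ?thesis by (simp add: b_def)
  qed (simp add: b_def a0)
  have sb: "summable (\<lambda>n. cmod (b n))"
  proof (rule summable_comparison_test')
    show "summable (\<lambda>n. (cmod (a n))\<^sup>2 + real n powr (- 2))"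
      using sq by (intro summable_add) (auto simp: summable_real_powr_iff)
    show "norm (cmod (b n)) \<le> (cmod (a n))\<^sup>2 + real n powr (- 2)" if "n \<ge> 1" for n
    proof -
      have "cmod (b n) = cmod (a n) * real n powr (- Re s)"
        using that by (simp add: b_def norm_mult norm_nat_powr)
      also have "\<dots> \<le> cmod (a n) * real n powr (- 1)"
        using that s by (intro mult_left_mono powr_mono) auto
      also have "\<dots> \<le> (cmod (a n))\<^sup>2 + (real n powr (- 1))\<^sup>2"
      proof -
        have "2 * cmod (a n) * (real n powr (- 1)) \<le> (cmod (a n))\<^sup>2 + (real n powr (- 1))\<^sup>2"
          by (rule sum_squares_bound)
        moreover have "0 \<le> cmod (a n) * real n powr (- 1)" by simp
        ultimately show ?thesis by linarith
      qed
      also have "(real n powr (- 1))\<^sup>2 = real n powr (- 2)"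
        using that by (simp add: powr_minus power2_eq_square powr_numeral)
      finally show ?thesis by simp
    qed
  qed
  have ti: "integrable lborel (\<lambda>t. of_real (fejer (real k) t) * (b n * cis (- t * ln n)))" for n
    by (rule fejer_integrable_mult[where C = "cmod (b n)"]) (measurable, simp add: norm_mult)
  have nb: "norm (of_real (fejer (real k) t) * (b n * cis (- t * ln n))) = fejer (real k) t * cmod (b n)" for t n
    by (simp add: norm_mult fejer_nonneg)
  have "(LINT t|lborel. of_real (fejer (real k) t) * dirichlet_sum a (s + \<i> * of_real t))
      = (LINT t|lborel. (\<Sum>n. of_real (fejer (real k) t) * (b n * cis (- t * ln n))))"
  proof (intro Bochner_Integration.integral_cong refl)
    fix t
    have "summable (\<lambda>n. b n * cis (- t * ln n))"
      by (rule summable_norm_cancel) (simp add: norm_mult sb)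
    then show "of_real (fejer (real k) t) * dirichlet_sum a (s + \<i> * of_real t)
        = (\<Sum>n. of_real (fejer (real k) t) * (b n * cis (- t * ln n)))"
      unfolding dirichlet_sum_def shift by (rule suminf_mult[symmetric])
  qed
  also have "\<dots> = (\<Sum>n. (LINT t|lborel. of_real (fejer (real k) t) * (b n * cis (- t * ln n))))"
  proof (rule integral_suminf)
    show "integrable lborel (\<lambda>t. of_real (fejer (real k) t) * (b n * cis (- t * ln n)))" for n by (rule ti)
    show "AE t in lborel. summable (\<lambda>n. norm (of_real (fejer (real k) t) * (b n * cis (- t * ln n))))"
      unfolding nb by (intro AE_I2 summable_mult sb)
    show "summable (\<lambda>n. LINT t|lborel. norm (of_real (fejer (real k) t) * (b n * cis (- t * ln n))))"
      unfolding nb by (simp add: summable_mult sb)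
  qed
  also have "\<dots> = (\<Sum>n. b n * of_real (max 0 (real k - \<bar>ln n\<bar>)))"
  proof (intro suminf_cong)
    fix n
    have "(LINT t|lborel. of_real (fejer (real k) t) * (b n * cis (- t * ln n)))
        = (LINT t|lborel. b n * (of_real (fejer (real k) t) * cis (- t * ln n)))"
      by (intro Bochner_Integration.integral_cong refl) (simp only: mult_ac)
    then show "(LINT t|lborel. of_real (fejer (real k) t) * (b n * cis (- t * ln n)))
        = b n * of_real (max 0 (real k - \<bar>ln n\<bar>))"
      by (simp only: integral_mult_right_zero fejer_fourier[OF of_nat_0_le_iff])
  qed
  also have "\<dots> = (\<Sum>n=1..N. b n * of_real (max 0 (real k - \<bar>ln n\<bar>)))"
  proof (rule suminf_finite)
    fix n assume n: "n \<notin> {1..N}"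
    show "b n * of_real (max 0 (real k - \<bar>ln n\<bar>)) = 0"
    proof (cases "n = 0")
      case False
      then have "riesz_mean (\<lambda>_. 1) k n = 0" using n N by (intro riesz_mean_zero) auto
      then show ?thesis using False by (simp add: riesz_mean_def)
    qed (simp add: b0)
  qed simp
  also have "\<dots> = (\<Sum>n=1..N. riesz_mean a k n * of_nat n powr (- s))"
    by (intro sum.cong refl) (auto simp: b_def riesz_mean_def)
  finally show ?thesis .
qed

lemma fejer_sinc: "t \<noteq> 0 \<Longrightarrow> fejer R t = R\<^sup>2 * (sinc (R * t / 2))\<^sup>2 / (2 * fejer_const)"
proof -
  assume t: "t \<noteq> 0"
  have eq: "1 - cos (R * t) = 2 * (sin (R * t / 2))\<^sup>2"
    using cos_double_sin[of "R * t / 2"] by simp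
  show ?thesis
    unfolding fejer_def eq using t by (auto simp: power2_eq_square)
qed

text \<open>Integrals over [-n, n] are holomorphic by differentiation under the integral sign. They
  converge uniformly in s, because the error is at most the bound of D times the mass of the kernel
  outside [-n, n].\<close>

lemma fejer_integral_dirichlet_holomorphic:
  assumes a: "a \<in> Hinf"
  shows "(\<lambda>s. LINT t|lborel. of_real (fejer R t) * dirichlet_sum a (s + \<i> * of_real t)) holomorphic_on {s. Re s > 0}"
proof -
  define U where "U = {s. Re s > 0}"
  have U: "open U" "convex U" unfolding U_def by (auto simp: open_halfspace_Re_gt convex_halfspace_Re_gt)
  define h where "h = dirichlet_sum a"
  have hol: "h holomorphic_on U" using a by (simp add: Hinf_def h_def U_def)
  define M where "M = Hinf_norm a"
  have M: "cmod (h s) \<le> M" if "s \<in> U" for s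
    unfolding h_def M_def using that by (intro Hinf_norm_bound a) (auto simp: U_def)
  have M0: "0 \<le> M" unfolding M_def by (rule Hinf_norm_nonneg[OF a])
  \<comment> \<open>The continuous version of the Fejer kernel; the Leibniz rule on compact
    intervals needs a jointly continuous integrand.\<close>
  define \<kappa> where "\<kappa> t = R\<^sup>2 * (sinc (R * t / 2))\<^sup>2 / (2 * fejer_const)" for t
  have \<kappa>_cont: "continuous_on S \<kappa>" for S
    unfolding \<kappa>_def using fejer_const_pos by (intro continuous_intros) auto
  have \<kappa>m [measurable]: "\<kappa> \<in> borel_measurable borel"
    using \<kappa>_cont by (rule borel_measurable_continuous_onI)
  have \<kappa>_AE: "AE t in lborel. fejer R t = \<kappa> t"
    using AE_lborel_singleton[of 0] by eventually_elim (simp add: fejer_sinc \<kappa>_def)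
  have \<kappa>_int: "integrable lborel \<kappa>"
    by (rule integrable_cong_AE[OF _ _ \<kappa>_AE, THEN iffD1, OF _ _ fejer_integrable]) auto
  have \<kappa>_pos: "0 \<le> \<kappa> t" for t unfolding \<kappa>_def using fejer_const_pos by simp
  have mem: "s + \<i> * of_real t \<in> U" if "s \<in> U" for s t using that by (simp add: U_def)
  have h_cont: "continuous_on S (\<lambda>t. h (s + \<i> * of_real t))" if "s \<in> U" for s and S :: "real set"
    by (rule continuous_on_compose2[OF holomorphic_on_imp_continuous_on[OF hol]])
      (auto intro!: continuous_intros mem that)
  have hm: "(\<lambda>t. h (s + \<i> * of_real t)) \<in> borel_measurable borel" if "s \<in> U" for s
    using h_cont[OF that] by (rule borel_measurable_continuous_onI)
  define g where "g s t = of_real (\<kappa> t) * h (s + \<i> * of_real t)" for s t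
  have g_le: "norm (g s t) \<le> M * \<kappa> t" if "s \<in> U" for s t
    using mult_left_mono[OF M[OF mem[OF that, of t]] \<kappa>_pos[of t]] \<kappa>_pos[of t]
    by (simp add: g_def norm_mult mult.commute)
  have g_int: "integrable lborel (g s)" if "s \<in> U" for s
  proof (rule Bochner_Integration.integrable_bound)
    show "integrable lborel (\<lambda>t. M * \<kappa> t)" by (intro integrable_mult_right \<kappa>_int)
    note [measurable] = hm[OF that]
    show "g s \<in> borel_measurable lborel" unfolding g_def by measurable
    show "AE t in lborel. norm (g s t) \<le> norm (M * \<kappa> t)"
      using g_le[OF that] \<kappa>_pos M0 by (intro AE_I2) (simp add: abs_mult)
  qed
  have "(\<lambda>s. LINT t|lborel. g s t) holomorphic_on U"
  proof (rule holomorphic_uniform_sequence[OF U(1)])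
    fix n :: nat
    show "(\<lambda>s. integral (cbox (- real n) (real n)) (g s)) holomorphic_on U"
    proof (rule leibniz_rule_holomorphic[where fx = "\<lambda>s t. of_real (\<kappa> t) * deriv h (s + \<i> * of_real t)"])
      fix s t assume s: "s \<in> U"
      have "(h has_field_derivative deriv h (s + \<i> * of_real t)) (at (s + \<i> * of_real t))"
        using hol U(1) mem[OF s] by (rule holomorphic_derivI)
      then have "((\<lambda>s. h (s + \<i> * of_real t)) has_field_derivative deriv h (s + \<i> * of_real t)) (at s)"
        by (simp add: DERIV_shift)
      then have "((\<lambda>s. of_real (\<kappa> t) * h (s + \<i> * of_real t)) has_field_derivative of_real (\<kappa> t) * deriv h (s + \<i> * of_real t)) (at s)"
        by (rule DERIV_cmult)
      then show "((\<lambda>s. g s t) has_field_derivative of_real (\<kappa> t) * deriv h (s + \<i> * of_real t)) (at s within U)"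
        unfolding g_def by (rule has_field_derivative_at_within)
    next
      fix s assume "s \<in> U"
      then show "g s integrable_on cbox (- real n) (real n)"
        unfolding g_def by (intro integrable_continuous continuous_intros h_cont \<kappa>_cont)
    next
      have "continuous_on U (deriv h)"
        using hol U(1) by (intro holomorphic_on_imp_continuous_on holomorphic_deriv)
      then have "continuous_on (U \<times> cbox (- real n) (real n)) (\<lambda>p. deriv h (fst p + \<i> * of_real (snd p)))"
        by (rule continuous_on_compose2) (auto intro!: continuous_intros mem)
      moreover have "continuous_on (U \<times> cbox (- real n) (real n)) (\<lambda>p. \<kappa> (snd p))"
        by (rule continuous_on_compose2[OF \<kappa>_cont[of UNIV]]) (auto intro!: continuous_intros)
      ultimately show "continuous_on (U \<times> cbox (- real n) (real n)) (\<lambda>(s, t). of_real (\<kappa> t) * deriv h (s + \<i> * of_real t))"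
        unfolding case_prod_beta' by (intro continuous_intros)
    qed (rule U)
  next
    fix s assume s: "s \<in> U"
    then obtain d where d: "d > 0" "cball s d \<subseteq> U" using U(1) open_contains_cball by blast
    define tail where "tail n = (LINT t|lborel. \<kappa> t) - (LINT t|lborel. indicator {- real n..real n} t * \<kappa> t)" for n
    have ind_int: "integrable lborel (\<lambda>t. indicator {- real n..real n} t * \<kappa> t)" for n
      using integrable_mult_indicator[OF _ \<kappa>_int, of "{- real n..real n}"] by simp
    have tail_lim: "tail \<longlonglongrightarrow> 0"
    proof -
      have "(\<lambda>n. LINT t|lborel. indicator {- real n..real n} t * \<kappa> t) \<longlonglongrightarrow> (LINT t|lborel. \<kappa> t)"
      proof (rule integral_dominated_convergence[where w = \<kappa>])
        show "AE t in lborel. (\<lambda>n. indicator {- real n..real n} t * \<kappa> t) \<longlonglongrightarrow> \<kappa> t"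
        proof (rule AE_I2)
          fix t :: real
          obtain n0 where n0: "\<bar>t\<bar> \<le> real n0" using real_arch_simple by blast
          have "\<forall>\<^sub>F n in sequentially. indicator {- real n..real n} t * \<kappa> t = \<kappa> t"
            using eventually_ge_at_top[of n0]
          proof eventually_elim
            case (elim n)
            then have "\<bar>t\<bar> \<le> real n" using n0 by linarith
            then show ?case by (auto simp: indicator_def)
          qed
          then show "(\<lambda>n. indicator {- real n..real n} t * \<kappa> t) \<longlonglongrightarrow> \<kappa> t" by (rule tendsto_eventually)
        qed
      qed (auto intro!: AE_I2 \<kappa>_int simp: \<kappa>_pos abs_mult indicator_def)
      from tendsto_diff[OF tendsto_const[of "LINT t|lborel. \<kappa> t"] this] show ?thesis by (simp add: tail_def[abs_def])
    qed
    have close: "cmod (integral (cbox (- real n) (real n)) (g z) - (LINT t|lborel. g z t)) \<le> M * tail n" if z: "z \<in> U" for n z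
    proof -
      have si: "set_integrable lborel {- real n..real n} (g z)"
        unfolding set_integrable_def by (intro integrable_mult_indicator g_int z) auto
      have "integral (cbox (- real n) (real n)) (g z) = (LINT t|lborel. indicator {- real n..real n} t *\<^sub>R g z t)"
        using set_borel_integral_eq_integral(2)[OF si] by (simp add: set_lebesgue_integral_def)
      then have "(LINT t|lborel. g z t) - integral (cbox (- real n) (real n)) (g z)
          = (LINT t|lborel. g z t - indicator {- real n..real n} t *\<^sub>R g z t)"
        using g_int[OF z] si unfolding set_integrable_def by simp
      also have "cmod \<dots> \<le> (LINT t|lborel. M * (\<kappa> t - indicator {- real n..real n} t * \<kappa> t))"
      proof (rule order_trans[OF integral_norm_bound integral_mono])
        show "integrable lborel (\<lambda>t. norm (g z t - indicator {- real n..real n} t *\<^sub>R g z t))"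
          using g_int[OF z] si unfolding set_integrable_def
          by (intro integrable_norm Bochner_Integration.integrable_diff)
        show "integrable lborel (\<lambda>t. M * (\<kappa> t - indicator {- real n..real n} t * \<kappa> t))"
          by (intro integrable_mult_right Bochner_Integration.integrable_diff \<kappa>_int ind_int)
        show "norm (g z t - indicator {- real n..real n} t *\<^sub>R g z t) \<le> M * (\<kappa> t - indicator {- real n..real n} t * \<kappa> t)" for t
          using g_le[OF z, of t] by (simp add: indicator_def)
      qed
      also have "\<dots> = M * tail n"
        using \<kappa>_int ind_int by (simp add: tail_def)
      finally show ?thesis by (simp add: norm_minus_commute)
    qed
    have "uniform_limit (cball s d) (\<lambda>n z. integral (cbox (- real n) (real n)) (g z)) (\<lambda>z. LINT t|lborel. g z t) sequentially"
    proof (rule uniform_limitI)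
      fix e :: real assume e: "e > 0"
      have "(\<lambda>n. M * tail n) \<longlonglongrightarrow> 0" by (rule tendsto_mult_right_zero[OF tail_lim])
      then have "\<forall>\<^sub>F n in sequentially. M * tail n < e" using e by (rule order_tendstoD)
      then show "\<forall>\<^sub>F n in sequentially. \<forall>z\<in>cball s d. dist (integral (cbox (- real n) (real n)) (g z)) (LINT t|lborel. g z t) < e"
      proof eventually_elim
        case (elim n)
        show ?case
        proof
          fix z assume "z \<in> cball s d"
          then have "z \<in> U" using d by blast
          from close[OF this, of n] elim
          show "dist (integral (cbox (- real n) (real n)) (g z)) (LINT t|lborel. g z t) < e"
            by (simp add: dist_norm)
        qed
      qed
    qed
    then show "\<exists>d>0. cball s d \<subseteq> U \<and>
        uniform_limit (cball s d) (\<lambda>n z. integral (cbox (- real n) (real n)) (g z)) (\<lambda>z. LINT t|lborel. g z t) sequentially"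
      using d by blast
  qed
  moreover have "(LINT t|lborel. of_real (fejer R t) * h (s + \<i> * of_real t)) = (LINT t|lborel. g s t)" if "s \<in> U" for s
  proof (rule integral_cong_AE)
    note [measurable] = hm[OF that]
    show "(\<lambda>t. of_real (fejer R t) * h (s + \<i> * of_real t)) \<in> borel_measurable lborel" by measurable
    show "g s \<in> borel_measurable lborel" unfolding g_def by measurable
    show "AE t in lborel. of_real (fejer R t) * h (s + \<i> * of_real t) = g s t"
      using \<kappa>_AE by eventually_elim (simp add: g_def)
  qed
  ultimately show ?thesis
    unfolding U_def[symmetric] h_def[symmetric] by (subst holomorphic_cong[OF refl]) auto
qed

text \<open>The Riesz mean and the Fejer integral of D agree for Re s > 1 and are both holomorphic
  in Re s > 0, so they agree there. The kernel has mass k, which gives the bound in the half plane;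
  the Riesz mean is a finite sum, so the bound extends to the line Re s = 0.\<close>

lemma riesz_mean_bound:
  assumes a: "a \<in> Hinf" and sq: "summable (\<lambda>n. (cmod (a n))\<^sup>2)" and N: "N \<ge> nat \<lceil>exp (real k)\<rceil>"
  shows "cmod (\<Sum>n=1..N. riesz_mean a k n * cis (- t * ln n)) \<le> Hinf_norm a * real k"
proof -
  let ?Q = "\<lambda>s. \<Sum>n=1..N. riesz_mean a k n * of_nat n powr (- s)"
  let ?G = "\<lambda>s. LINT t|lborel. of_real (fejer (real k) t) * dirichlet_sum a (s + \<i> * of_real t)"
  have eq: "?Q s = ?G s" if s: "Re s > 0" for s
  proof (rule analytic_continuation_open[of "{s. Re s > 1}" "{s. Re s > 0}" ?Q ?G])
    show "?Q holomorphic_on {s. Re s > 0}"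
      by (intro holomorphic_on_sum holomorphic_on_mult holomorphic_on_const)
        (auto simp: powr_def intro!: holomorphic_intros)
    show "?G holomorphic_on {s. Re s > 0}" by (rule fejer_integral_dirichlet_holomorphic[OF a])
    show "?Q z = ?G z" if "z \<in> {s. Re s > 1}" for z
      using fejer_integral_dirichlet_absolute[OF a sq _ N, of z] that by simp
    show "{s::complex. Re s > 1} \<noteq> {}" by (auto intro!: exI[of _ 2])
    show "connected {s. Re s > 0}" by (intro convex_connected convex_halfspace_Re_gt)
  qed (use s in \<open>auto simp: open_halfspace_Re_gt\<close>)
  have bound: "cmod (?Q s) \<le> Hinf_norm a * real k" if s: "Re s > 0" for s
  proof -
    have "cmod (?G s) \<le> (LINT t|lborel. Hinf_norm a * fejer (real k) t)"
    proof (rule order_trans[OF integral_norm_bound integral_mono])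
      have hol: "dirichlet_sum a holomorphic_on {s. Re s > 0}" using a by (simp add: Hinf_def)
      have "continuous_on UNIV (\<lambda>t. dirichlet_sum a (s + \<i> * of_real t))"
        by (rule continuous_on_compose2[OF holomorphic_on_imp_continuous_on[OF hol]])
          (use s in \<open>auto intro!: continuous_intros\<close>)
      then have m: "(\<lambda>t. dirichlet_sum a (s + \<i> * of_real t)) \<in> borel_measurable borel"
        by (rule borel_measurable_continuous_onI)
      show "integrable lborel (\<lambda>t. norm (of_real (fejer (real k) t) * dirichlet_sum a (s + \<i> * of_real t)))"
        by (intro integrable_norm fejer_integrable_mult[OF m, where C = "Hinf_norm a"] Hinf_norm_bound a) (use s in auto)
      show "integrable lborel (\<lambda>t. Hinf_norm a * fejer (real k) t)"
        by (intro integrable_mult_right fejer_integrable)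
      show "norm (of_real (fejer (real k) t) * dirichlet_sum a (s + \<i> * of_real t)) \<le> Hinf_norm a * fejer (real k) t" for t
        using mult_right_mono[OF Hinf_norm_bound[OF a, of "s + \<i> * of_real t"] fejer_nonneg[of "real k" t]] s
        by (simp add: norm_mult fejer_nonneg mult.commute)
    qed
    also have "\<dots> = Hinf_norm a * real k" by (simp add: fejer_integral)
    finally show ?thesis using eq[OF s] by simp
  qed
  have "((\<lambda>\<sigma>. ?Q (of_real \<sigma> + \<i> * of_real t)) \<longlongrightarrow> ?Q (of_real 0 + \<i> * of_real t)) (at_right 0)"
    by (intro tendsto_intros) auto
  then have "((\<lambda>\<sigma>. cmod (?Q (of_real \<sigma> + \<i> * of_real t))) \<longlongrightarrow> cmod (?Q (of_real 0 + \<i> * of_real t))) (at_right 0)"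
    by (rule tendsto_norm)
  then have "cmod (?Q (of_real 0 + \<i> * of_real t)) \<le> Hinf_norm a * real k"
  proof (rule tendsto_upperbound)
    show "\<forall>\<^sub>F \<sigma> in at_right 0. cmod (?Q (of_real \<sigma> + \<i> * of_real t)) \<le> Hinf_norm a * real k"
      using eventually_at_right_less[of 0] by eventually_elim (rule bound, simp)
  qed simp
  also have "?Q (of_real 0 + \<i> * of_real t) = (\<Sum>n=1..N. riesz_mean a k n * cis (- t * ln n))"
  proof (intro sum.cong refl)
    fix n assume "n \<in> {1..N}"
    then have "n > 0" by simp
    from bohr_char_prime_flow'[OF this, of t]
    show "riesz_mean a k n * of_nat n powr (- (of_real 0 + \<i> * of_real t)) = riesz_mean a k n * cis (- t * ln n)"
      by (simp add: bohr_char_prime_flow)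
  qed
  finally show ?thesis .
qed

text \<open>On the line Re s = 0 the Riesz mean Q satisfies |Q P|^2 <= B^2 |P|^2 pointwise.
  Averaging both sides with one nonnegative Fejer kernel turns them exactly into norms on the
  torus.\<close>

lemma riesz_mean_multiplier:
  assumes a: "a \<in> Hinf" and sq: "summable (\<lambda>n. (cmod (a n))\<^sup>2)" and K: "K \<ge> nat \<lceil>exp (real k)\<rceil>"
  shows "L2_seminorm torus (\<lambda>w. (\<Sum>n=1..K. riesz_mean a k n * bohr_char n w) * (\<Sum>n=1..N. b n * bohr_char n w))
    \<le> Hinf_norm a * real k * sqrt (\<Sum>n=1..N. (cmod (b n))\<^sup>2)"
proof -
  \<comment> \<open>At least as large as every frequency of P and of the product Q P, so that one
    kernel serves for both; the successors keep it positive even if K or N is 0.\<close>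
  define X where "X = Suc K * Suc N"
  have X1: "X \<ge> 1" by (simp add: X_def)
  then have X: "X \<ge> 1" "real X > 0" by auto
  define J where "J = {1..K} \<times> {1..N}"
  define c where "c j = riesz_mean a k (fst j) * b (snd j)" for j
  define m where "m j = fst j * snd j" for j :: "nat \<times> nat"
  define B where "B = Hinf_norm a * real k"
  have B: "0 \<le> B" unfolding B_def using Hinf_norm_nonneg[OF a] by simp
  let ?P = "\<lambda>t. \<Sum>n=1..N. b n * cis (- t * ln n)"
  let ?Q = "\<lambda>t. \<Sum>n=1..K. riesz_mean a k n * cis (- t * ln n)"
  have J: "finite J" "j \<in> J \<Longrightarrow> 1 \<le> m j" "j \<in> J \<Longrightarrow> m j \<le> X" for j
  proof -
    show "finite J" by (simp add: J_def)
    show "1 \<le> m j" if "j \<in> J" using that by (cases j) (auto simp: J_def m_def Suc_le_eq)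
    show "m j \<le> X" if "j \<in> J"
    proof -
      have "fst j \<le> Suc K" "snd j \<le> Suc N" using that by (auto simp: J_def)
      then show ?thesis unfolding X_def m_def by (rule mult_le_mono)
    qed
  qed
  have prod_t: "(\<Sum>j\<in>J. c j * cis (- t * ln (m j))) = ?Q t * ?P t" for t
  proof -
    have "(\<Sum>j\<in>J. c j * cis (- t * ln (m j))) = (\<Sum>j\<in>J. (riesz_mean a k (fst j) * cis (- t * ln (fst j))) * (b (snd j) * cis (- t * ln (snd j))))"
    proof (intro sum.cong refl)
      fix j assume "j \<in> J"
      then have p: "0 < fst j" "0 < snd j" by (auto simp: J_def)
      have "cis (- t * ln (m j)) = cis (- t * ln (fst j)) * cis (- t * ln (snd j))"
        using p by (simp add: m_def cis_mult ln_mult algebra_simps)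
      then show "c j * cis (- t * ln (m j)) = (riesz_mean a k (fst j) * cis (- t * ln (fst j))) * (b (snd j) * cis (- t * ln (snd j)))"
        by (simp add: c_def)
    qed
    then show ?thesis unfolding J_def sum_product sum.cartesian_product by (simp add: case_prod_beta')
  qed
  have prod_w: "(\<Sum>j\<in>J. c j * bohr_char (m j) w)
      = (\<Sum>n=1..K. riesz_mean a k n * bohr_char n w) * (\<Sum>n=1..N. b n * bohr_char n w)" if "w \<in> space torus" for w
    unfolding J_def sum_product sum.cartesian_product
    using that by (intro sum.cong) (auto simp: c_def m_def bohr_char_mult)
  have mean_P: "(LINT t|lborel. fejer (1 / X) t * (cmod (?P t))\<^sup>2) = (1 / X) * (\<Sum>n=1..N. (cmod (b n))\<^sup>2)"
  proof -
    have "(LINT t|lborel. fejer (1 / X) t * (cmod (?P t))\<^sup>2)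
        = (1 / X) * (L2_seminorm torus (\<lambda>w. \<Sum>n=1..N. b n * bohr_char n w))\<^sup>2"
      by (rule fejer_mean_square) (auto simp: X_def)
    then show ?thesis unfolding bohr_poly_norm by (simp add: sum_nonneg)
  qed
  have int_fin: "integrable lborel (\<lambda>t. fejer (1 / X) t * (cmod (\<Sum>j\<in>I. d j * cis (- t * x j)))\<^sup>2)"
    for I :: "'i set" and d x
  proof (rule Bochner_Integration.integrable_bound)
    define S where "S = (\<Sum>j\<in>I. cmod (d j))"
    show "integrable lborel (\<lambda>t. S\<^sup>2 * fejer (1 / X) t)" by (intro integrable_mult_right fejer_integrable)
    show "(\<lambda>t. fejer (1 / X) t * (cmod (\<Sum>j\<in>I. d j * cis (- t * x j)))\<^sup>2) \<in> borel_measurable lborel" by measurable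
    show "AE t in lborel. norm (fejer (1 / X) t * (cmod (\<Sum>j\<in>I. d j * cis (- t * x j)))\<^sup>2) \<le> norm (S\<^sup>2 * fejer (1 / X) t)"
    proof (rule AE_I2)
      fix t
      have "cmod (\<Sum>j\<in>I. d j * cis (- t * x j)) \<le> S"
        unfolding S_def by (intro sum_norm_le) (simp add: norm_mult)
      then have "(cmod (\<Sum>j\<in>I. d j * cis (- t * x j)))\<^sup>2 \<le> S\<^sup>2" by (intro power_mono) auto
      from mult_left_mono[OF this fejer_nonneg[of "1 / X" t]]
      show "norm (fejer (1 / X) t * (cmod (\<Sum>j\<in>I. d j * cis (- t * x j)))\<^sup>2) \<le> norm (S\<^sup>2 * fejer (1 / X) t)"
        by (simp add: abs_mult fejer_nonneg mult.commute)
    qed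
  qed
  have "(1 / X) * (L2_seminorm torus (\<lambda>w. \<Sum>j\<in>J. c j * bohr_char (m j) w))\<^sup>2
      = (LINT t|lborel. fejer (1 / X) t * (cmod (\<Sum>j\<in>J. c j * cis (- t * ln (m j))))\<^sup>2)"
    by (rule fejer_mean_square[symmetric]) (use J X in auto)
  also have "\<dots> \<le> (LINT t|lborel. B\<^sup>2 * (fejer (1 / X) t * (cmod (?P t))\<^sup>2))"
  proof (rule integral_mono)
    show "integrable lborel (\<lambda>t. fejer (1 / X) t * (cmod (\<Sum>j\<in>J. c j * cis (- t * ln (m j))))\<^sup>2)" by (rule int_fin)
    show "integrable lborel (\<lambda>t. B\<^sup>2 * (fejer (1 / X) t * (cmod (?P t))\<^sup>2))"
      by (intro integrable_mult_right int_fin)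
    fix t
    have "cmod (?Q t) \<le> B" unfolding B_def by (rule riesz_mean_bound[OF a sq K])
    then have "(cmod (?Q t * ?P t))\<^sup>2 \<le> B\<^sup>2 * (cmod (?P t))\<^sup>2"
      unfolding norm_mult power_mult_distrib by (intro mult_right_mono power_mono) auto
    from mult_left_mono[OF this fejer_nonneg[of "1 / X" t]]
    show "fejer (1 / X) t * (cmod (\<Sum>j\<in>J. c j * cis (- t * ln (m j))))\<^sup>2 \<le> B\<^sup>2 * (fejer (1 / X) t * (cmod (?P t))\<^sup>2)"
      unfolding prod_t by (simp add: mult_ac)
  qed
  also have "\<dots> = (1 / X) * (B\<^sup>2 * (\<Sum>n=1..N. (cmod (b n))\<^sup>2))"
    by (simp only: integral_mult_right_zero mean_P mult_ac)
  finally have "(L2_seminorm torus (\<lambda>w. \<Sum>j\<in>J. c j * bohr_char (m j) w))\<^sup>2 \<le> B\<^sup>2 * (\<Sum>n=1..N. (cmod (b n))\<^sup>2)"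
    using X(2) by (simp add: divide_le_cancel)
  also have "\<dots> = (B * sqrt (\<Sum>n=1..N. (cmod (b n))\<^sup>2))\<^sup>2"
    by (simp add: power_mult_distrib sum_nonneg)
  finally have "L2_seminorm torus (\<lambda>w. \<Sum>j\<in>J. c j * bohr_char (m j) w) \<le> B * sqrt (\<Sum>n=1..N. (cmod (b n))\<^sup>2)"
    by (rule power2_le_imp_le) (use B in \<open>auto intro!: mult_nonneg_nonneg sum_nonneg\<close>)
  moreover have "L2_seminorm torus (\<lambda>w. \<Sum>j\<in>J. c j * bohr_char (m j) w)
      = L2_seminorm torus (\<lambda>w. (\<Sum>n=1..K. riesz_mean a k n * bohr_char n w) * (\<Sum>n=1..N. b n * bohr_char n w))"
    by (rule L2_seminorm_cong_AE) (auto intro!: AE_I2 simp: prod_w)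
  ultimately show ?thesis by (simp add: B_def)
qed

lemma bohr_transform_square_summable:
  assumes "f \<in> L2_space torus"
  shows "summable (\<lambda>n. (cmod (bohr_transform f n))\<^sup>2)"
proof (rule bounded_imp_summable)
  fix N
  have "(\<Sum>n=1..N. (cmod (bohr_transform f n))\<^sup>2) \<le> (L2_seminorm torus f)\<^sup>2"
    unfolding bohr_transform_eq_inner by (rule orthonormal_bessel[OF bohr_orthonormal _ _ assms]) auto
  then show "(\<Sum>n\<le>N. (cmod (bohr_transform f n))\<^sup>2) \<le> (L2_seminorm torus f)\<^sup>2"
    by (subst sum_atMost_eq_from_1) simp_all
qed auto

text \<open>The means are compared with the Fourier partial sums up to e^k. The coefficients of the
  difference have modulus |a_n| v with v in [0, 1] tending to 0 for each fixed n, so Tannery's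
  theorem with majorant |a_n|^2 applies.\<close>

lemma riesz_mean_tendsto:
  assumes f: "f \<in> hardy2_torus"
  shows "(\<lambda>k. L2_seminorm torus (\<lambda>w. (\<Sum>n=1..nat \<lceil>exp (real k)\<rceil>. (riesz_mean (bohr_transform f) k n / k) * bohr_char n w) - f w))
    \<longlonglongrightarrow> 0"
proof -
  define a where "a = bohr_transform f"
  have fL: "f \<in> L2_space torus" using f by (simp add: hardy2_torus_def)
  define K where "K k = nat \<lceil>exp (real k)\<rceil>" for k
  have K_top: "filterlim K at_top sequentially"
  proof (rule filterlim_at_top_mono[OF filterlim_ident])
    have "real k \<le> real (K k)" for k
      using exp_ge_add_one_self[of "real k"] unfolding K_def by linarith
    then show "\<forall>\<^sub>F k in sequentially. k \<le> K k" by (intro always_eventually) simp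
  qed
  let ?S = "\<lambda>k w. \<Sum>n=1..K k. a n * bohr_char n w"
  let ?Q = "\<lambda>k w. \<Sum>n=1..K k. (riesz_mean a k n / k) * bohr_char n w"
  have SL: "?S k \<in> L2_space torus" for k by (intro L2_space_sum L2_space_cmult bohr_char_L2)
  have QL: "?Q k \<in> L2_space torus" for k by (intro L2_space_sum L2_space_cmult bohr_char_L2)
  have S_lim: "(\<lambda>k. L2_seminorm torus (\<lambda>w. ?S k w - f w)) \<longlonglongrightarrow> 0"
    unfolding a_def using filterlim_compose[OF hardy2_expansion[OF f] K_top] .
  define v where "v k n = 1 - max 0 (1 - ln (real n) / real k)" for k n :: nat
  define T where "T k = (\<Sum>n. (cmod (a n))\<^sup>2 * (v k n)\<^sup>2)" for k
  have v01: "0 \<le> v k n \<and> v k n \<le> 1" for k n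
    using ln_ge_zero[of "real n"] by (cases "n = 0") (auto simp: v_def max_def)
  have sq: "summable (\<lambda>n. (cmod (a n))\<^sup>2)" unfolding a_def by (rule bohr_transform_square_summable[OF fL])
  have term_le': "(cmod (a n))\<^sup>2 * (v k n)\<^sup>2 \<le> (cmod (a n))\<^sup>2" for k n
    using v01[of k n] by (simp add: mult_left_le power_le_one)
  have term_le: "norm ((cmod (a n))\<^sup>2 * (v k n)\<^sup>2) \<le> (cmod (a n))\<^sup>2" for k n
    using v01[of k n] by (simp add: mult_left_le power_le_one)
  have T_lim: "T \<longlonglongrightarrow> 0"
  proof -
    have lim: "(\<lambda>k. (cmod (a n))\<^sup>2 * (v k n)\<^sup>2) \<longlonglongrightarrow> 0" for n
    proof -
      have "(\<lambda>k. 1 - ln (real n) / real k) \<longlonglongrightarrow> 1 - 0"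
        by (intro tendsto_diff tendsto_const lim_const_over_n)
      then have "(\<lambda>k. v k n) \<longlonglongrightarrow> 1 - max 0 (1 - 0)"
        unfolding v_def by (intro tendsto_diff tendsto_const tendsto_max lim_const_over_n)
      then have "(\<lambda>k. v k n) \<longlonglongrightarrow> 0" by simp
      from tendsto_power[OF this, of 2] have "(\<lambda>k. (v k n)\<^sup>2) \<longlonglongrightarrow> 0" by simp
      then show ?thesis by (rule tendsto_mult_right_zero)
    qed
    have "(\<lambda>k. suminf (\<lambda>n. (cmod (a n))\<^sup>2 * (v k n)\<^sup>2)) \<longlonglongrightarrow> suminf (\<lambda>n::nat. 0::real)"
      by (rule tannerys_theorem[THEN conjunct2, THEN conjunct2, OF lim _ sq])
        (auto intro!: always_eventually term_le')
    then show ?thesis by (simp add: T_def[abs_def])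
  qed
  have QS: "L2_seminorm torus (\<lambda>w. ?Q k w - ?S k w) \<le> sqrt (T k)" if k: "k > 0" for k
  proof -
    have "L2_seminorm torus (\<lambda>w. ?Q k w - ?S k w)
        = L2_seminorm torus (\<lambda>w. \<Sum>n=1..K k. (riesz_mean a k n / k - a n) * bohr_char n w)"
      by (simp add: sum_subtractf left_diff_distrib)
    also have "\<dots> = sqrt (\<Sum>n=1..K k. (cmod (riesz_mean a k n / k - a n))\<^sup>2)"
      by (rule bohr_poly_norm)
    also have "(\<Sum>n=1..K k. (cmod (riesz_mean a k n / k - a n))\<^sup>2) = (\<Sum>n=1..K k. (cmod (a n))\<^sup>2 * (v k n)\<^sup>2)"
    proof (intro sum.cong refl)
      fix n assume n: "n \<in> {1..K k}"
      have m: "max 0 (real k - ln n) / k = 1 - v k n"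
        using k by (simp add: v_def max_def field_simps)
      have "riesz_mean a k n / k = a n * of_real (max 0 (real k - ln n) / k)"
        by (simp add: riesz_mean_def)
      then have "riesz_mean a k n / k - a n = - a n * of_real (v k n)"
        unfolding m by (simp add: right_diff_distrib)
      then show "(cmod (riesz_mean a k n / k - a n))\<^sup>2 = (cmod (a n))\<^sup>2 * (v k n)\<^sup>2"
        by (simp add: norm_mult power_mult_distrib)
    qed
    also have "sqrt (\<Sum>n=1..K k. (cmod (a n))\<^sup>2 * (v k n)\<^sup>2) \<le> sqrt (T k)"
      unfolding T_def
      by (intro real_sqrt_le_mono sum_le_suminf summable_comparison_test'[OF sq term_le]) auto
    finally show ?thesis .
  qed
  have "(\<lambda>k. L2_seminorm torus (\<lambda>w. ?Q k w - f w)) \<longlonglongrightarrow> 0"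
  proof (rule Lim_null_comparison)
    show "\<forall>\<^sub>F k in sequentially. norm (L2_seminorm torus (\<lambda>w. ?Q k w - f w))
        \<le> sqrt (T k) + L2_seminorm torus (\<lambda>w. ?S k w - f w)"
      using eventually_gt_at_top[of 0]
    proof eventually_elim
      case (elim k)
      show ?case
        using L2_seminorm_triangle3[OF QL SL fL, of k k] QS[OF elim] by simp
    qed
    have "(\<lambda>k. sqrt (T k)) \<longlonglongrightarrow> 0" using tendsto_real_sqrt[OF T_lim] by simp
    from tendsto_add[OF this S_lim]
    show "(\<lambda>k. sqrt (T k) + L2_seminorm torus (\<lambda>w. ?S k w - f w)) \<longlonglongrightarrow> 0" by simp
  qed
  then show ?thesis by (simp add: a_def K_def)
qed

text \<open>The normalised Riesz means times P converge in L2 to f P because P is bounded. The bound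
  for the unnormalised mean carries a factor k, which cancels against the normalisation and leaves
  the norm of D as the constant.\<close>

theorem Hinf_multiplier_bound:
  assumes f: "f \<in> hardy2_torus" and D: "bohr_transform f \<in> Hinf"
  shows "L2_seminorm torus (\<lambda>w. f w * (\<Sum>n=1..N. b n * bohr_char n w))
    \<le> Hinf_norm (bohr_transform f) * sqrt (\<Sum>n=1..N. (cmod (b n))\<^sup>2)"
proof -
  define a where "a = bohr_transform f"
  have fL: "f \<in> L2_space torus" using f by (simp add: hardy2_torus_def)
  let ?P = "\<lambda>w. \<Sum>n=1..N. b n * bohr_char n w"
  let ?Q = "\<lambda>k w. \<Sum>n=1..nat \<lceil>exp (real k)\<rceil>. (riesz_mean a k n / k) * bohr_char n w"
  define S where "S = (\<Sum>n=1..N. cmod (b n))"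
  have P_le: "AE w in torus. cmod (?P w) \<le> S"
    unfolding S_def by (intro AE_I2 sum_norm_le) (auto simp: norm_mult norm_bohr_char)
  have S: "0 \<le> S" unfolding S_def by (intro sum_nonneg) auto
  have QL: "?Q k \<in> L2_space torus" for k by (intro L2_space_sum L2_space_cmult bohr_char_L2)
  have lim: "(\<lambda>k. L2_seminorm torus (\<lambda>w. ?Q k w * ?P w - f w * ?P w)) \<longlonglongrightarrow> 0"
  proof (rule Lim_null_comparison)
    show "\<forall>\<^sub>F k in sequentially. norm (L2_seminorm torus (\<lambda>w. ?Q k w * ?P w - f w * ?P w))
        \<le> S * L2_seminorm torus (\<lambda>w. ?Q k w - f w)"
    proof (rule always_eventually, rule allI)
      fix k
      have "L2_seminorm torus (\<lambda>w. ?P w * (?Q k w - f w)) \<le> S * L2_seminorm torus (\<lambda>w. ?Q k w - f w)"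
        by (rule L2_seminorm_le_bounded_mult[OF L2_space_diff[OF QL fL] _ P_le S]) measurable
      then show "norm (L2_seminorm torus (\<lambda>w. ?Q k w * ?P w - f w * ?P w))
        \<le> S * L2_seminorm torus (\<lambda>w. ?Q k w - f w)"
        by (simp only: real_norm_def abs_of_nonneg L2_seminorm_nonneg right_diff_distrib mult.commute[of "?P _"])
    qed
    show "(\<lambda>k. S * L2_seminorm torus (\<lambda>w. ?Q k w - f w)) \<longlonglongrightarrow> 0"
      unfolding a_def by (rule tendsto_mult_right_zero[OF riesz_mean_tendsto[OF f]])
  qed
  have "(\<lambda>k. L2_seminorm torus (\<lambda>w. ?Q k w * ?P w)) \<longlonglongrightarrow> L2_seminorm torus (\<lambda>w. f w * ?P w)"
    by (rule L2_seminorm_tendsto[OF bohr_poly_L2[OF QL] bohr_poly_L2[OF fL] lim])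
  moreover have "L2_seminorm torus (\<lambda>w. ?Q k w * ?P w) \<le> Hinf_norm a * sqrt (\<Sum>n=1..N. (cmod (b n))\<^sup>2)" if k: "k \<ge> 1" for k
  proof -
    let ?R = "\<lambda>w. (\<Sum>n=1..nat \<lceil>exp (real k)\<rceil>. riesz_mean a k n * bohr_char n w) * ?P w"
    have eq: "(\<lambda>w. ?Q k w * ?P w) = (\<lambda>w. of_real (1 / k) * ?R w)"
      by (rule ext) (simp flip: sum_divide_distrib)
    have "L2_seminorm torus (\<lambda>w. ?Q k w * ?P w) = cmod (of_real (1 / k)) * L2_seminorm torus ?R"
      unfolding eq by (rule L2_seminorm_cmult)
    also have "cmod (of_real (1 / k)) = 1 / k" by (simp only: norm_of_real) simp
    also have "(1 / k) * L2_seminorm torus ?R \<le> (1 / k) * (Hinf_norm a * real k * sqrt (\<Sum>n=1..N. (cmod (b n))\<^sup>2))"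
      unfolding a_def
      by (intro mult_left_mono riesz_mean_multiplier D bohr_transform_square_summable fL) auto
    also have "\<dots> = Hinf_norm a * sqrt (\<Sum>n=1..N. (cmod (b n))\<^sup>2)" using k by simp
    finally show ?thesis .
  qed
  ultimately have "L2_seminorm torus (\<lambda>w. f w * ?P w) \<le> Hinf_norm a * sqrt (\<Sum>n=1..N. (cmod (b n))\<^sup>2)"
    by (intro LIMSEQ_le_const2) auto
  then show ?thesis by (simp add: a_def)
qed

corollary Hinf_AE_bound:
  assumes "f \<in> hardy2_torus" "bohr_transform f \<in> Hinf"
  shows "AE w in torus. cmod (f w) \<le> Hinf_norm (bohr_transform f)"
  using assms
  by (intro multiplier_upper_bound Hinf_multiplier_bound Hinf_norm_nonneg) (auto simp: hardy2_torus_def)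

subsection \<open>Boundary values\<close>

lemma bounded_set_integrable:
  fixes g :: "real \<Rightarrow> complex"
  assumes [measurable]: "g \<in> borel_measurable borel" and B: "\<And>t. cmod (g t) \<le> B"
  shows "set_integrable lborel {a..b} g"
  unfolding set_integrable_def
proof (rule Bochner_Integration.integrable_bound)
  show "integrable lborel (\<lambda>t. B * indicator {a..b} t)"
    by (cases "a \<le> b") auto
  have "0 \<le> B" using order_trans[OF norm_ge_zero B] by blast
  then show "AE t in lborel. norm (indicator {a..b} t *\<^sub>R g t) \<le> norm (B * indicator {a..b} t)"
    using B by (intro AE_I2) (simp add: indicator_def)
qed measurable

text \<open>The norm stands outside the integral, so this controls averages of g and not of |g - g
  x|. That suffices because the Poisson kernel will be used as a mixture of interval
  averages.\<close>

lemma right_lebesgue_points: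
  fixes g :: "real \<Rightarrow> complex"
  assumes gm [measurable]: "g \<in> borel_measurable borel" and B: "\<And>t. cmod (g t) \<le> B"
  shows "\<exists>N. negligible N \<and> (\<forall>x e. x \<notin> N \<longrightarrow> e > 0 \<longrightarrow>
      (\<exists>d>0. \<forall>h. 0 < h \<and> h < d \<longrightarrow> cmod (LINT u|lborel. indicator {0..h} u *\<^sub>R (g (x + u) - g x)) \<le> e * h))"
proof -
  have io: "g integrable_on cbox a b" for a b
    using set_borel_integral_eq_integral(1)[OF bounded_set_integrable[OF gm B]] by simp
  show ?thesis
  proof (rule integrable_ccontinuous_explicit[OF io])
    fix N :: "real set" assume N1: "negligible N"
    assume N2: "\<And>(x::real) e. \<lbrakk>x \<notin> N; 0 < e\<rbrakk> \<Longrightarrow>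
      \<exists>d>0. \<forall>h. 0 < h \<and> h < d \<longrightarrow> norm (integral (cbox x (x + h *\<^sub>R One)) g /\<^sub>R h ^ DIM(real) - g x) < e"
    show ?thesis
    proof (intro exI[of _ N] conjI N1 allI impI)
    fix x e :: real assume x: "x \<notin> N" "e > 0"
    obtain d where d: "d > 0" "\<And>h. 0 < h \<Longrightarrow> h < d \<Longrightarrow>
        norm (integral (cbox x (x + h *\<^sub>R One)) g /\<^sub>R h ^ DIM(real) - g x) < e"
      using N2[OF x] by blast
    have "cmod (LINT u|lborel. indicator {0..h} u *\<^sub>R (g (x + u) - g x)) \<le> e * h" if h: "0 < h" "h < d" for h
    proof -
      have i1: "integrable lborel (\<lambda>u. indicator {0..h} u *\<^sub>R g (x + u))"
        using bounded_set_integrable[of "\<lambda>u. g (x + u)" B 0 h] B by (simp add: set_integrable_def)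
      have i2: "integrable lborel (\<lambda>u. indicator {0..h} u *\<^sub>R g x)"
        using h by (intro integrable_scaleR_left) auto
      have "(LINT u|lborel. indicator {0..h} u *\<^sub>R (g (x + u) - g x))
          = (LINT u|lborel. indicator {0..h} u *\<^sub>R g (x + u)) - (LINT u|lborel. indicator {0..h} u *\<^sub>R g x)"
        unfolding scaleR_diff_right by (rule Bochner_Integration.integral_diff[OF i1 i2])
      also have "(LINT u|lborel. indicator {0..h} u *\<^sub>R g x) = h *\<^sub>R g x"
        using h by (subst integral_scaleR_left) auto
      also have "(LINT u|lborel. indicator {0..h} u *\<^sub>R g (x + u)) = (LINT v|lborel. indicator {x..x + h} v *\<^sub>R g v)"
        using lborel_integral_real_affine[of 1 "\<lambda>v. indicator {x..x + h} v *\<^sub>R g v" x]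
        by (simp add: indicator_def)
      also have "\<dots> = integral (cbox x (x + h)) g"
        using set_borel_integral_eq_integral(2)[OF bounded_set_integrable[OF gm B, of x "x + h"]]
        by (simp add: set_lebesgue_integral_def)
      finally have "(LINT u|lborel. indicator {0..h} u *\<^sub>R (g (x + u) - g x))
          = h *\<^sub>R (integral (cbox x (x + h *\<^sub>R One)) g /\<^sub>R h ^ DIM(real) - g x)"
        using h by (simp add: scaleR_diff_right)
      also have "cmod \<dots> \<le> h * e"
        using d(2)[OF h] h by (simp add: mult_left_mono less_imp_le)
      finally show ?thesis by (simp add: mult.commute)
    qed
    then show "\<exists>d>0. \<forall>h. 0 < h \<and> h < d \<longrightarrow> cmod (LINT u|lborel. indicator {0..h} u *\<^sub>R (g (x + u) - g x)) \<le> e * h"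
      using d(1) by blast
    qed
  qed
qed

text \<open>The left half of an interval is the right half for the reflected function t |-> g (- t)
  at the point - x, and reflection preserves null sets.\<close>

lemma symmetric_lebesgue_points:
  fixes g :: "real \<Rightarrow> complex"
  assumes gm [measurable]: "g \<in> borel_measurable borel" and B: "\<And>t. cmod (g t) \<le> B"
  shows "AE x in lborel. \<forall>e>0. \<exists>d>0. \<forall>h. 0 < h \<and> h < d \<longrightarrow>
    cmod (LINT u|lborel. indicator {-h..h} u *\<^sub>R (g (x + u) - g x)) \<le> e * (2 * h)"
proof -
  let ?g' = "\<lambda>t. g (- t)"
  obtain N where N: "negligible N" "\<And>x e. x \<notin> N \<Longrightarrow> e > 0 \<Longrightarrow>
      \<exists>d>0. \<forall>h. 0 < h \<and> h < d \<longrightarrow> cmod (LINT u|lborel. indicator {0..h} u *\<^sub>R (g (x + u) - g x)) \<le> e * h"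
    using right_lebesgue_points[OF gm B] by blast
  have g'm: "?g' \<in> borel_measurable borel" by measurable
  have g'B: "cmod (?g' t) \<le> B" for t by (rule B)
  obtain N' where N': "negligible N'" "\<And>x e. x \<notin> N' \<Longrightarrow> e > 0 \<Longrightarrow>
      \<exists>d>0. \<forall>h. 0 < h \<and> h < d \<longrightarrow> cmod (LINT u|lborel. indicator {0..h} u *\<^sub>R (?g' (x + u) - ?g' x)) \<le> e * h"
    using right_lebesgue_points[OF g'm g'B] by blast
  have AE_N: "AE x in lborel. x \<notin> S" if "negligible S" for S :: "real set"
    using AE_not_in[of S lebesgue] that by (simp add: negligible_iff_null_sets AE_completion_iff)
  have "AE x in distr lborel borel uminus. x \<notin> N'"
    unfolding lborel_distr_uminus by (rule AE_N[OF N'(1)])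
  then have "AE x in lborel. - x \<notin> N'" by (rule AE_distrD[rotated]) simp
  with AE_N[OF N(1)] show ?thesis
  proof eventually_elim
    case (elim x)
    note x = elim
    show ?case
    proof (intro allI impI)
      fix e :: real assume e: "e > 0"
      obtain d where d: "d > 0" "\<And>h. 0 < h \<Longrightarrow> h < d \<Longrightarrow>
          cmod (LINT u|lborel. indicator {0..h} u *\<^sub>R (g (x + u) - g x)) \<le> e * h"
        using N(2)[OF x(1) e] by blast
      obtain d' where d': "d' > 0" "\<And>h. 0 < h \<Longrightarrow> h < d' \<Longrightarrow>
          cmod (LINT u|lborel. indicator {0..h} u *\<^sub>R (?g' (- x + u) - ?g' (- x))) \<le> e * h"
        using N'(2)[OF x(2) e] by blast
      have "cmod (LINT u|lborel. indicator {-h..h} u *\<^sub>R (g (x + u) - g x)) \<le> e * (2 * h)"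
        if h: "0 < h" "h < min d d'" for h
      proof -
        define k where "k u = g (x + u) - g x" for u
        have km [measurable]: "k \<in> borel_measurable borel" unfolding k_def by measurable
        have kB: "cmod (k u) \<le> 2 * B" for u
          unfolding k_def using norm_triangle_ineq4[of "g (x + u)" "g x"] B[of "x + u"] B[of x] by linarith
        have i: "integrable lborel (\<lambda>u. indicator {a..b} u *\<^sub>R k u)" for a b
          using bounded_set_integrable[OF km kB, of a b] by (simp add: set_integrable_def)
        have "(LINT u|lborel. indicator {-h..h} u *\<^sub>R k u)
            = (LINT u|lborel. indicator {-h..0} u *\<^sub>R k u + indicator {0..h} u *\<^sub>R k u)"
        proof (rule integral_cong_AE)
          have "AE u in lborel. u \<noteq> (0::real)" by (rule AE_lborel_singleton)
          then show "AE u in lborel. indicator {-h..h} u *\<^sub>R k u = indicator {-h..0} u *\<^sub>R k u + indicator {0..h} u *\<^sub>R k u"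
            by eventually_elim (use h in \<open>auto simp: indicator_def\<close>)
        qed (use i in auto)
        also have "\<dots> = (LINT u|lborel. indicator {-h..0} u *\<^sub>R k u) + (LINT u|lborel. indicator {0..h} u *\<^sub>R k u)"
          by (rule Bochner_Integration.integral_add[OF i i])
        also have "(LINT u|lborel. indicator {-h..0} u *\<^sub>R k u) = (LINT u|lborel. indicator {0..h} u *\<^sub>R (?g' (- x + u) - ?g' (- x)))"
          using lborel_integral_real_affine[of "-1" "\<lambda>u. indicator {-h..0} u *\<^sub>R k u" 0]
          by (simp add: indicator_def k_def conj_commute)
        finally have "cmod (LINT u|lborel. indicator {-h..h} u *\<^sub>R k u) \<le> e * h + e * h"
          using d(2)[of h] d'(2)[of h] h unfolding k_def[symmetric]
          by (metis (no_types, lifting) add_mono min_less_iff_conj norm_triangle_le)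
        then show ?thesis by (simp add: k_def)
      qed
      then show "\<exists>d>0. \<forall>h. 0 < h \<and> h < d \<longrightarrow> cmod (LINT u|lborel. indicator {-h..h} u *\<^sub>R (g (x + u) - g x)) \<le> e * (2 * h)"
        using d(1) d'(1) by (intro exI[of _ "min d d'"]) auto
    qed
  qed
qed

section \<open>Poisson integrals at points with small symmetric averages\<close>

text \<open>The Poisson kernel as a superposition of normalised indicators of intervals \<open>[-r, r]\<close>:
  averages over symmetric intervals control Poisson integrals.\<close>

definition poisson_density :: "real \<Rightarrow> real \<Rightarrow> real" where
  "poisson_density \<sigma> r = 2 * r * \<sigma> / (fejer_const * (\<sigma>\<^sup>2 + r\<^sup>2)\<^sup>2)"

text \<open>The density is minus the derivative of the kernel in r, and the kernel vanishes at
  infinity.\<close>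

lemma poisson_density_integral:
  assumes \<sigma>: "\<sigma> > 0" and u: "u \<ge> 0"
  shows "has_bochner_integral lborel (\<lambda>r. indicator {u..} r * poisson_density \<sigma> r) (poisson \<sigma> u)"
proof (rule has_bochner_integral_nn_integral)
  have c: "fejer_const > 0" by (rule fejer_const_pos)
  have pos: "\<sigma>\<^sup>2 + r\<^sup>2 > 0" for r using \<sigma> by (simp add: add_pos_nonneg)
  have "(\<integral>\<^sup>+r. ennreal (indicator {u..} r * poisson_density \<sigma> r) \<partial>lborel)
      = (\<integral>\<^sup>+r. ennreal (poisson_density \<sigma> r) * indicator {u..} r \<partial>lborel)"
    by (intro nn_integral_cong) (auto split: split_indicator)
  also have "\<dots> = ennreal (0 - (- poisson \<sigma> u))"
  proof (rule nn_integral_FTC_atLeast[where F = "\<lambda>r. - poisson \<sigma> r" and T = 0])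
    show "poisson_density \<sigma> \<in> borel_measurable borel" unfolding poisson_density_def by measurable
    fix r assume "u \<le> r"
    then have r: "0 \<le> r" using u by simp
    have "((\<lambda>r. - (\<sigma> / fejer_const) * inverse (\<sigma>\<^sup>2 + r\<^sup>2)) has_real_derivative
        - (\<sigma> / fejer_const) * - (inverse ((\<sigma>\<^sup>2 + r\<^sup>2)\<^sup>2) * (2 * r))) (at r)"
      using pos[of r] c by (auto intro!: derivative_eq_intros simp: power2_eq_square)
    moreover have "(\<lambda>r. - (\<sigma> / fejer_const) * inverse (\<sigma>\<^sup>2 + r\<^sup>2)) = (\<lambda>r. - poisson \<sigma> r)"
      by (auto simp: poisson_def divide_inverse)
    moreover have "- (\<sigma> / fejer_const) * - (inverse ((\<sigma>\<^sup>2 + r\<^sup>2)\<^sup>2) * (2 * r)) = poisson_density \<sigma> r"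
      by (simp add: poisson_density_def divide_inverse)
    ultimately show "((\<lambda>r. - poisson \<sigma> r) has_real_derivative poisson_density \<sigma> r) (at r)" by simp
    show "0 \<le> poisson_density \<sigma> r" using \<sigma> r c by (simp add: poisson_density_def)
  next
    show "((\<lambda>r. - poisson \<sigma> r) \<longlongrightarrow> 0) at_top"
      unfolding poisson_def using c \<sigma> by real_asymp
  qed
  finally show "(\<integral>\<^sup>+r. ennreal (indicator {u..} r * poisson_density \<sigma> r) \<partial>lborel) = ennreal (poisson \<sigma> u)"
    by simp
  show "AE r in lborel. 0 \<le> indicator {u..} r * poisson_density \<sigma> r"
    using \<sigma> u c by (intro AE_I2) (auto simp: poisson_density_def indicator_def)
  show "(\<lambda>r. indicator {u..} r * poisson_density \<sigma> r) \<in> borel_measurable lborel"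
    unfolding poisson_density_def by measurable
  show "0 \<le> poisson \<sigma> u" by (rule poisson_nonneg[OF \<sigma>])
qed

text \<open>Fubini on the region |u| <= r: integrating out r recovers the kernel, integrating out u
  gives the interval integrals. Integrability comes from the majorant B times the Poisson
  kernel.\<close>

lemma poisson_layers:
  fixes g :: "real \<Rightarrow> complex"
  assumes gm [measurable]: "g \<in> borel_measurable borel" and B: "\<And>t. cmod (g t) \<le> B" and \<sigma>: "\<sigma> > 0"
  shows "(LINT u|lborel. of_real (poisson \<sigma> u) * g u)
      = (LINT r|lborel. of_real (indicator {0..} r * poisson_density \<sigma> r) * (LINT u|lborel. indicator {-r..r} u *\<^sub>R g u))"
    and "integrable lborel (\<lambda>r. of_real (indicator {0..} r * poisson_density \<sigma> r) * (LINT u|lborel. indicator {-r..r} u *\<^sub>R g u))"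
proof -
  define w where "w r = indicator {0..} r * poisson_density \<sigma> r" for r
  have wm [measurable]: "w \<in> borel_measurable borel" unfolding w_def poisson_density_def by measurable
  have w0: "0 \<le> w r" for r
    using \<sigma> fejer_const_pos by (auto simp: w_def poisson_density_def indicator_def)
  have ind: "indicator {-r..r} u = (if \<bar>u\<bar> \<le> r then 1 else 0 :: real)" for u r :: real
    by (auto simp: indicator_def)
  define H where "H = (\<lambda>p :: real \<times> real. of_real (w (snd p) * (if \<bar>fst p\<bar> \<le> snd p then 1 else 0)) * g (fst p))"
  have Hm [measurable]: "H \<in> borel_measurable (lborel \<Otimes>\<^sub>M lborel)" unfolding H_def by measurable
  have wu: "w r * (if \<bar>u\<bar> \<le> r then 1 else 0) = indicator {\<bar>u\<bar>..} r * poisson_density \<sigma> r" for u r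
    by (auto simp: w_def indicator_def)
  have B0: "0 \<le> B" using order_trans[OF norm_ge_zero B] by blast
  have normH: "norm (H (u, r)) = (indicator {\<bar>u\<bar>..} r * poisson_density \<sigma> r) * cmod (g u)" for u r
    unfolding H_def wu[symmetric] using w0 by (simp add: norm_mult)
  note hb = poisson_density_integral[OF \<sigma> abs_ge_zero]
  have even: "poisson \<sigma> \<bar>u\<bar> = poisson \<sigma> u" for u by (simp add: poisson_def)
  have Hi: "integrable (lborel \<Otimes>\<^sub>M lborel) H"
  proof (rule lborel_pair.Fubini_integrable[OF Hm])
    show "AE u in lborel. integrable lborel (\<lambda>r. H (u, r))"
    proof (rule AE_I2)
      fix u
      have "integrable lborel (\<lambda>r. complex_of_real (indicator {\<bar>u\<bar>..} r * poisson_density \<sigma> r) * g u)"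
        by (intro integrable_mult_left integrable_of_real integrable.intros[OF hb])
      then show "integrable lborel (\<lambda>r. H (u, r))" by (simp only: H_def wu fst_conv snd_conv)
    qed
    have "(\<lambda>u. LINT r|lborel. norm (H (u, r))) = (\<lambda>u. poisson \<sigma> u * cmod (g u))"
      unfolding normH integral_mult_left_zero has_bochner_integral_integral_eq[OF hb] even ..
    moreover have "integrable lborel (\<lambda>u. poisson \<sigma> u * cmod (g u))"
    proof (rule Bochner_Integration.integrable_bound)
      show "integrable lborel (\<lambda>u. B * poisson \<sigma> u)" by (intro integrable_mult_right poisson_integrable \<sigma>)
      show "AE u in lborel. norm (poisson \<sigma> u * cmod (g u)) \<le> norm (B * poisson \<sigma> u)"
        using mult_left_mono[OF B poisson_nonneg[OF \<sigma>]] poisson_nonneg[OF \<sigma>] B0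
        by (intro AE_I2) (simp add: abs_mult mult.commute)
    qed measurable
    ultimately show "integrable lborel (\<lambda>u. LINT r|lborel. norm (H (u, r)))" by simp
  qed
  have inner_u: "(LINT u|lborel. H (u, r)) = of_real (w r) * (LINT u|lborel. indicator {-r..r} u *\<^sub>R g u)" for r
  proof -
    have "(LINT u|lborel. H (u, r)) = (LINT u|lborel. of_real (w r) * (indicator {-r..r} u *\<^sub>R g u))"
      by (intro Bochner_Integration.integral_cong refl) (simp add: H_def ind scaleR_conv_of_real)
    then show ?thesis by (simp only: integral_mult_right_zero)
  qed
  have inner_r: "(LINT r|lborel. H (u, r)) = of_real (poisson \<sigma> u) * g u" for u
  proof -
    have "(LINT r|lborel. H (u, r)) = (LINT r|lborel. complex_of_real (indicator {\<bar>u\<bar>..} r * poisson_density \<sigma> r)) * g u"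
      by (simp only: H_def wu fst_conv snd_conv integral_mult_left_zero)
    also have "(LINT r|lborel. complex_of_real (indicator {\<bar>u\<bar>..} r * poisson_density \<sigma> r)) = of_real (poisson \<sigma> u)"
      by (simp only: integral_complex_of_real has_bochner_integral_integral_eq[OF hb] even)
    finally show ?thesis .
  qed
  have Hi': "integrable (lborel \<Otimes>\<^sub>M lborel) (\<lambda>(u, r). H (u, r))" using Hi by (simp add: case_prod_beta')
  from lborel_pair.Fubini_integral[OF Hi'] show "(LINT u|lborel. of_real (poisson \<sigma> u) * g u)
      = (LINT r|lborel. of_real (indicator {0..} r * poisson_density \<sigma> r) * (LINT u|lborel. indicator {-r..r} u *\<^sub>R g u))"
    by (simp only: inner_u inner_r w_def)
  from lborel_pair.integrable_snd[OF Hi'] show "integrable lborel (\<lambda>r. of_real (indicator {0..} r * poisson_density \<sigma> r) * (LINT u|lborel. indicator {-r..r} u *\<^sub>R g u))"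
    by (simp only: inner_u w_def)
qed

text \<open>The decomposition for the constant function g = 1: as weights for averages over
  intervals of length 2 r, the layers have total mass 1.\<close>

lemma poisson_density_mass:
  assumes \<sigma>: "\<sigma> > 0"
  shows "integrable lborel (\<lambda>r. indicator {0..} r * poisson_density \<sigma> r * (2 * r))"
    and "(LINT r|lborel. indicator {0..} r * poisson_density \<sigma> r * (2 * r)) = 1"
proof -
  have c1: "complex_of_real (indicator {0..} r * poisson_density \<sigma> r) * (LINT u|lborel. indicator {-r..r} u *\<^sub>R 1)
      = complex_of_real (indicator {0..} r * poisson_density \<sigma> r * (2 * r))" for r
    by (cases "r \<ge> 0") (auto simp: integral_scaleR_left[where f = "indicator {-r..r}"] scaleR_conv_of_real mult_ac)
  have "integrable lborel (\<lambda>r. complex_of_real (indicator {0..} r * poisson_density \<sigma> r * (2 * r)))"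
    using poisson_layers(2)[of "\<lambda>_. 1" 1 \<sigma>] \<sigma> by (simp only: c1) simp
  then show "integrable lborel (\<lambda>r. indicator {0..} r * poisson_density \<sigma> r * (2 * r))"
    by (simp only: complex_of_real_integrable_eq)
  have "complex_of_real (LINT r|lborel. indicator {0..} r * poisson_density \<sigma> r * (2 * r))
      = (LINT u|lborel. complex_of_real (poisson \<sigma> u) * 1)"
    using poisson_layers(1)[of "\<lambda>_. 1" 1 \<sigma>] \<sigma> by (simp only: c1 integral_complex_of_real) simp
  also have "\<dots> = of_real 1" by (simp add: poisson_integral[OF \<sigma>])
  finally show "(LINT r|lborel. indicator {0..} r * poisson_density \<sigma> r * (2 * r)) = 1"
    using of_real_eq_iff by blast
qed

text \<open>The layers with r < d contribute at most \<epsilon> / 2, since their weights have mass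
  at most 1. For r >= d the weight is at most 4 \<sigma> / (c r^2), with c the constant of the
  kernel, so these layers contribute a multiple of \<sigma> / d, which vanishes with
  \<sigma>.\<close>

lemma poisson_tendsto_zero:
  fixes g :: "real \<Rightarrow> complex"
  assumes gm [measurable]: "g \<in> borel_measurable borel" and B: "\<And>t. cmod (g t) \<le> B"
    and pt: "\<And>e. e > 0 \<Longrightarrow> \<exists>d>0. \<forall>h. 0 < h \<and> h < d \<longrightarrow> cmod (LINT u|lborel. indicator {-h..h} u *\<^sub>R g u) \<le> e * (2 * h)"
  shows "((\<lambda>\<sigma>. LINT u|lborel. of_real (poisson \<sigma> u) * g u) \<longlongrightarrow> 0) (at_right 0)"
proof (rule tendstoI)
  fix \<epsilon> :: real assume \<epsilon>: "\<epsilon> > 0"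
  obtain d where d: "d > 0" "\<And>h. 0 < h \<Longrightarrow> h < d \<Longrightarrow> cmod (LINT u|lborel. indicator {-h..h} u *\<^sub>R g u) \<le> (\<epsilon> / 2) * (2 * h)"
    using pt[of "\<epsilon> / 2"] \<epsilon> by (meson half_gt_zero)
  have c: "fejer_const > 0" by (rule fejer_const_pos)
  have B0: "0 \<le> B" using order_trans[OF norm_ge_zero B] by blast
  have avg: "cmod (LINT u|lborel. indicator {-h..h} u *\<^sub>R g u) \<le> B * (2 * h)" if h: "h \<ge> 0" for h
  proof -
    have "cmod (LINT u|lborel. indicator {-h..h} u *\<^sub>R g u) \<le> (LINT u|lborel. B * indicator {-h..h} u)"
    proof (rule order_trans[OF integral_norm_bound integral_mono])
      show "integrable lborel (\<lambda>u. norm (indicator {-h..h} u *\<^sub>R g u))"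
        using bounded_set_integrable[OF gm B, of "-h" h] by (intro integrable_norm) (simp add: set_integrable_def)
      show "integrable lborel (\<lambda>u. B * indicator {-h..h} u)" using h by simp
      show "norm (indicator {-h..h} u *\<^sub>R g u) \<le> B * indicator {-h..h} u" for u
        using B[of u] by (simp add: indicator_def)
    qed
    also have "\<dots> = B * (2 * h)" using h by simp
    finally show ?thesis .
  qed
  have bound: "cmod (LINT u|lborel. of_real (poisson \<sigma> u) * g u) \<le> \<epsilon> / 2 + B * (4 * \<sigma> / (fejer_const * d))"
    if \<sigma>: "\<sigma> > 0" for \<sigma>
  proof -
    let ?w = "\<lambda>r. indicator {0..} r * poisson_density \<sigma> r :: real"
    have w0: "0 \<le> ?w r" for r using \<sigma> c by (auto simp: poisson_density_def indicator_def)
    define T where "T r = indicator {d..} r * (4 * \<sigma> / (fejer_const * r\<^sup>2))" for r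
    have T: "has_bochner_integral lborel T (4 * \<sigma> / (fejer_const * d))"
    proof (rule has_bochner_integral_nn_integral)
      have "(\<integral>\<^sup>+r. ennreal (T r) \<partial>lborel) = (\<integral>\<^sup>+r. ennreal (4 * \<sigma> / (fejer_const * r\<^sup>2)) * indicator {d..} r \<partial>lborel)"
        unfolding T_def by (intro nn_integral_cong) (auto split: split_indicator)
      also have "\<dots> = ennreal (0 - (- (4 * \<sigma> / fejer_const) / d))"
      proof (rule nn_integral_FTC_atLeast[where F = "\<lambda>r. - (4 * \<sigma> / fejer_const) / r" and T = 0])
        fix r assume "d \<le> r"
        then have r: "r > 0" using d by simp
        show "((\<lambda>r. - (4 * \<sigma> / fejer_const) / r) has_real_derivative 4 * \<sigma> / (fejer_const * r\<^sup>2)) (at r)"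
          using r c by (auto intro!: derivative_eq_intros simp: power2_eq_square)
        show "0 \<le> 4 * \<sigma> / (fejer_const * r\<^sup>2)" using \<sigma> c by simp
      next
        show "((\<lambda>r. - (4 * \<sigma> / fejer_const) / r) \<longlongrightarrow> 0) at_top" by real_asymp
      qed measurable
      finally show "(\<integral>\<^sup>+r. ennreal (T r) \<partial>lborel) = ennreal (4 * \<sigma> / (fejer_const * d))" by simp
      show "T \<in> borel_measurable lborel" unfolding T_def by measurable
      show "AE r in lborel. 0 \<le> T r" using \<sigma> c by (intro AE_I2) (simp add: T_def)
      show "0 \<le> 4 * \<sigma> / (fejer_const * d)" using \<sigma> c d by simp
    qed
    have ptw: "norm (of_real (?w r) * (LINT u|lborel. indicator {-r..r} u *\<^sub>R g u)) \<le> (\<epsilon> / 2) * (?w r * (2 * r)) + B * T r" for r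
    proof -
      consider "r \<le> 0" | "0 < r" "r < d" | "d \<le> r" by linarith
      then show ?thesis
      proof cases
        case 1
        then show ?thesis using d by (auto simp: indicator_def poisson_density_def T_def)
      next
        case 2
        have "norm (of_real (?w r) * (LINT u|lborel. indicator {-r..r} u *\<^sub>R g u)) \<le> ?w r * ((\<epsilon> / 2) * (2 * r))"
          unfolding norm_mult norm_of_real abs_of_nonneg[OF w0] by (intro mult_left_mono d w0 2)
        then show ?thesis using 2 by (simp add: T_def mult_ac)
      next
        case 3
        then have r: "r > 0" using d by simp
        have "?w r * (2 * r) \<le> 4 * \<sigma> / (fejer_const * r\<^sup>2)"
        proof -
          have "?w r * (2 * r) = 4 * \<sigma> / fejer_const * (r\<^sup>2 / (\<sigma>\<^sup>2 + r\<^sup>2)\<^sup>2)"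
            using r by (simp add: poisson_density_def power2_eq_square)
          also have "\<dots> \<le> 4 * \<sigma> / fejer_const * (1 / r\<^sup>2)"
          proof (rule mult_left_mono)
            have "r\<^sup>2 / (\<sigma>\<^sup>2 + r\<^sup>2)\<^sup>2 \<le> r\<^sup>2 / (r\<^sup>2)\<^sup>2"
              using r by (intro divide_left_mono power_mono mult_pos_pos) (auto simp: add_nonneg_pos)
            then show "r\<^sup>2 / (\<sigma>\<^sup>2 + r\<^sup>2)\<^sup>2 \<le> 1 / r\<^sup>2" using r by (simp add: power2_eq_square)
            show "0 \<le> 4 * \<sigma> / fejer_const" using \<sigma> c by simp
          qed
          also have "\<dots> = 4 * \<sigma> / (fejer_const * r\<^sup>2)" by simp
          finally show ?thesis .
        qed
        then have "B * (?w r * (2 * r)) \<le> B * T r" using 3 B0 by (intro mult_left_mono) (auto simp: T_def)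
        moreover have "norm (of_real (?w r) * (LINT u|lborel. indicator {-r..r} u *\<^sub>R g u)) \<le> ?w r * (B * (2 * r))"
          unfolding norm_mult norm_of_real abs_of_nonneg[OF w0] using r by (intro mult_left_mono avg w0) auto
        moreover have "0 \<le> (\<epsilon> / 2) * (?w r * (2 * r))" using w0[of r] \<epsilon> r by (intro mult_nonneg_nonneg) auto
        ultimately show ?thesis by (simp add: mult_ac)
      qed
    qed
    have "cmod (LINT u|lborel. of_real (poisson \<sigma> u) * g u)
        \<le> (LINT r|lborel. (\<epsilon> / 2) * (?w r * (2 * r)) + B * T r)"
      unfolding poisson_layers(1)[OF gm B \<sigma>]
    proof (rule order_trans[OF integral_norm_bound integral_mono])
      show "integrable lborel (\<lambda>r. norm (of_real (?w r) * (LINT u|lborel. indicator {-r..r} u *\<^sub>R g u)))"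
        by (intro integrable_norm poisson_layers(2)[OF gm B \<sigma>])
      show "integrable lborel (\<lambda>r. (\<epsilon> / 2) * (?w r * (2 * r)) + B * T r)"
        by (intro Bochner_Integration.integrable_add integrable_mult_right poisson_density_mass(1)[OF \<sigma>] integrable.intros[OF T])
    qed (rule ptw)
    also have "\<dots> = (\<epsilon> / 2) * (LINT r|lborel. ?w r * (2 * r)) + B * (LINT r|lborel. T r)"
      by (subst Bochner_Integration.integral_add)
        (auto simp only: integral_mult_right_zero intro!: integrable_mult_right poisson_density_mass(1)[OF \<sigma>] integrable.intros[OF T])
    also have "\<dots> = \<epsilon> / 2 + B * (4 * \<sigma> / (fejer_const * d))"
      by (simp only: poisson_density_mass(2)[OF \<sigma>] has_bochner_integral_integral_eq[OF T] mult_1_right)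
    finally show ?thesis .
  qed
  have "((\<lambda>\<sigma>. \<epsilon> / 2 + B * (4 * \<sigma> / (fejer_const * d))) \<longlongrightarrow> \<epsilon> / 2 + B * (4 * 0 / (fejer_const * d))) (at_right 0)"
    using c d by (intro tendsto_intros) auto
  then have "\<forall>\<^sub>F \<sigma> in at_right 0. \<epsilon> / 2 + B * (4 * \<sigma> / (fejer_const * d)) < \<epsilon>"
    by (rule order_tendstoD) (use \<epsilon> in simp)
  then show "\<forall>\<^sub>F \<sigma> in at_right 0. dist (LINT u|lborel. of_real (poisson \<sigma> u) * g u) 0 < \<epsilon>"
    using eventually_at_right_less[of 0]
    by eventually_elim (use bound in \<open>auto intro: le_less_trans simp: dist_norm\<close>)
qed

section \<open>Almost everywhere statements along the flow\<close>

lemma torus_mult_assoc: "torus_mult u (torus_mult v w) = torus_mult (torus_mult u v) w"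
  by (simp add: torus_mult_def mult.assoc)

lemma prime_flow_add: "torus_mult (prime_flow s) (prime_flow t) = prime_flow (t + s)"
  by (rule ext) (simp add: torus_mult_def prime_flow_cis cis_mult algebra_simps)

lemma AE_torus_rotation_iff:
  assumes v: "v \<in> space torus" and P: "{w\<in>space torus. P w} \<in> sets torus"
  shows "(AE w in torus. P (torus_mult v w)) \<longleftrightarrow> (AE w in torus. P w)"
  using AE_distr_iff[OF torus_mult_measurable[OF v] P] unfolding torus_rotation_invariant[OF v] by simp

lemma flow_pair_sets:
  assumes P: "{w\<in>space torus. P w} \<in> sets torus"
  shows "{p\<in>space (torus \<Otimes>\<^sub>M lborel). P (torus_mult (prime_flow (snd p)) (fst p))} \<in> sets (torus \<Otimes>\<^sub>M lborel)"
proof -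
  have "Measurable.pred torus P" using P by (simp add: pred_def)
  from measurable_compose[OF flow_measurable this] show ?thesis by (simp add: pred_def)
qed

lemma AE_flow_commute:
  assumes P: "{w\<in>space torus. P w} \<in> sets torus"
  shows "(AE w in torus. AE t in lborel. P (torus_mult (prime_flow t) w)) \<longleftrightarrow> (AE w in torus. P w)"
proof -
  have "(AE w in torus. AE t in lborel. P (torus_mult (prime_flow t) w))
      \<longleftrightarrow> (AE t in (lborel :: real measure). AE w in torus. P (torus_mult (prime_flow t) w))"
    using flow_pair_sets[OF P]
    by (intro torus_line.AE_commute) (simp add: space_pair_measure case_prod_beta')
  also have "\<dots> \<longleftrightarrow> (AE t in (lborel :: real measure). AE w in torus. P w)"
    by (simp only: AE_torus_rotation_iff[OF prime_flow_space P])
  \<comment> \<open>Nothing depends on t any more, and Lebesgue measure on the line is not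
    zero.\<close>
  also have "\<dots> \<longleftrightarrow> (AE w in torus. P w)"
    by (simp add: eventually_const ae_filter_eq_bot_iff)
  finally show ?thesis .
qed

lemma AE_flow_pair_iff:
  assumes P: "{w\<in>space torus. P w} \<in> sets torus"
  shows "(AE p in torus \<Otimes>\<^sub>M lborel. P (torus_mult (prime_flow (snd p)) (fst p))) \<longleftrightarrow> (AE w in torus. P w)"
  using torus_line.AE_pair_iff[of "\<lambda>w t. P (torus_mult (prime_flow t) w)", OF flow_pair_sets[OF P]]
    AE_flow_commute[OF P] by simp

text \<open>The exceptional set of \<open>P\<close> is enclosed in a measurable null set, to which
  the equivalence applies; \<open>P\<close> itself is arbitrary.\<close>

lemma AE_flow_pair:
  assumes "AE w in torus. P w"
  shows "AE p in torus \<Otimes>\<^sub>M lborel. P (torus_mult (prime_flow (snd p)) (fst p))"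
proof -
  from assms obtain N where N: "{w\<in>space torus. \<not> P w} \<subseteq> N" "emeasure torus N = 0" "N \<in> sets torus"
    by (rule AE_E)
  have "AE w in torus. w \<notin> N" using N by (intro AE_not_in) auto
  then have "AE p in torus \<Otimes>\<^sub>M lborel. torus_mult (prime_flow (snd p)) (fst p) \<notin> N"
    using N(3) by (subst AE_flow_pair_iff) auto
  then show ?thesis
    using AE_space
  proof eventually_elim
    case (elim p)
    then have "torus_mult (prime_flow (snd p)) (fst p) \<in> space torus"
      by (intro torus_mult_space prime_flow_space) (auto simp: space_pair_measure)
    then show ?case using elim N(1) by blast
  qed
qed

context bounded_hardy
begin

text \<open>On the orbit of w the convolution is the ordinary Poisson integral of g(t) = f(flow by t
  of w), with a change of base point acting as a translation. The limit then exists at every t where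
  the symmetric averages of g converge, and almost every t is such a point.\<close>

lemma flow_conv_poisson_tendsto_AE:
  assumes w: "w \<in> space torus"
  shows "AE t in lborel. ((\<lambda>\<sigma>. flow_conv f (poisson \<sigma>) (torus_mult (prime_flow t) w))
    \<longlongrightarrow> f (torus_mult (prime_flow t) w)) (at_right 0)"
proof -
  define g where "g t = f (torus_mult (prime_flow t) w)" for t
  have [measurable]: "(\<lambda>t. torus_mult (prime_flow t) w) \<in> borel \<rightarrow>\<^sub>M torus" by (rule flow_measurable_time[OF w])
  have gm [measurable]: "g \<in> borel_measurable borel" unfolding g_def by measurable
  have gB: "cmod (g t) \<le> C" for t unfolding g_def by (rule f_bound)
  have conv: "flow_conv f (poisson \<sigma>) (torus_mult (prime_flow t) w) = (LINT u|lborel. of_real (poisson \<sigma> u) * g (t + u))" for \<sigma> t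
    unfolding flow_conv_def g_def torus_mult_assoc prime_flow_add ..
  show ?thesis
    using symmetric_lebesgue_points[OF gm gB]
  proof eventually_elim
    case (elim t)
    define k where "k u = g (t + u) - g t" for u
    have km [measurable]: "k \<in> borel_measurable borel" unfolding k_def by measurable
    have kB: "cmod (k u) \<le> 2 * C" for u
      unfolding k_def using norm_triangle_ineq4[of "g (t + u)" "g t"] gB[of "t + u"] gB[of t] by linarith
    have lim: "((\<lambda>\<sigma>. LINT u|lborel. of_real (poisson \<sigma> u) * k u) \<longlongrightarrow> 0) (at_right 0)"
      by (rule poisson_tendsto_zero[OF km kB]) (use elim in \<open>simp add: k_def\<close>)
    have split: "(LINT u|lborel. of_real (poisson \<sigma> u) * k u) = (LINT u|lborel. of_real (poisson \<sigma> u) * g (t + u)) - g t"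
      if \<sigma>: "\<sigma> > 0" for \<sigma>
    proof -
      have i1: "integrable lborel (\<lambda>u. of_real (poisson \<sigma> u) * g (t + u))"
        using kernel_section_integrable[OF poisson_integrable[OF \<sigma>] torus_mult_space[OF prime_flow_space w], of t]
        unfolding g_def torus_mult_assoc prime_flow_add .
      have i2: "integrable lborel (\<lambda>u. of_real (poisson \<sigma> u) * g t)"
        by (intro integrable_mult_left integrable_of_real poisson_integrable \<sigma>)
      have "(LINT u|lborel. of_real (poisson \<sigma> u) * k u)
          = (LINT u|lborel. of_real (poisson \<sigma> u) * g (t + u)) - (LINT u|lborel. of_real (poisson \<sigma> u) * g t)"
        unfolding k_def right_diff_distrib by (rule Bochner_Integration.integral_diff[OF i1 i2])
      also have "(LINT u|lborel. of_real (poisson \<sigma> u) * g t) = g t"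
        by (simp add: poisson_integral[OF \<sigma>])
      finally show ?thesis .
    qed
    have "((\<lambda>\<sigma>. (LINT u|lborel. of_real (poisson \<sigma> u) * g (t + u)) - g t) \<longlongrightarrow> 0) (at_right 0)"
      by (rule Lim_transform_eventually[OF lim])
        (rule eventually_mono[OF eventually_at_right_less[of 0] split])
    then show ?case
      unfolding conv g_def[symmetric] by (rule LIM_zero_cancel)
  qed
qed

text \<open>The Poisson integrals converge along almost every orbit, hence at almost every w. They
  equal the Dirichlet series only off a null set that depends on \<sigma>, so the comparison is made
  for the countably many rational \<sigma>; continuity of the series in \<sigma> supplies the
  remaining values.\<close>

lemma radial_limit_AE:
  "AE w in torus. ((\<lambda>\<sigma>. vertical w (of_real \<sigma>)) \<longlongrightarrow> f w) (at_right 0)"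
proof -
  \<comment> \<open>For q <= 0 the value \<open>f w\<close> is a filler that makes
    \<open>u q\<close> measurable for every rational q.\<close>
  define u where "u q w = (if 0 < q then flow_conv f (poisson (of_rat q)) w else f w)" for q :: rat and w
  have um [measurable]: "u q \<in> borel_measurable torus" for q
    using flow_conv_measurable[OF poisson_integrable[of "of_rat q"]] f_measurable
    by (cases "0 < q") (auto simp: u_def[abs_def] zero_less_of_rat_iff)
  \<comment> \<open>Convergence along the rationals written with countable quantifiers:
    \<open>AE_flow_commute\<close> requires a measurable set.\<close>
  define Q where "Q w \<longleftrightarrow> (\<forall>k::nat. \<exists>m::nat. \<forall>q::rat. 0 < q \<and> of_rat q < 1 / real (Suc m) \<longrightarrow>
      cmod (u q w - f w) \<le> 1 / real (Suc k))" for w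
  have Qm: "{w\<in>space torus. Q w} \<in> sets torus"
    unfolding Q_def by measurable
  have "AE w in torus. AE t in lborel. Q (torus_mult (prime_flow t) w)"
  proof (rule AE_I2)
    fix w assume w: "w \<in> space torus"
    show "AE t in lborel. Q (torus_mult (prime_flow t) w)"
      using flow_conv_poisson_tendsto_AE[OF w]
    proof eventually_elim
      case (elim t)
      let ?w = "torus_mult (prime_flow t) w"
      show ?case
        unfolding Q_def
      proof
        fix k :: nat
        have "\<forall>\<^sub>F \<sigma> in at_right 0. dist (flow_conv f (poisson \<sigma>) ?w) (f ?w) < 1 / real (Suc k)"
          by (rule tendstoD[OF elim]) simp
        then obtain b where b: "b > 0" "\<And>\<sigma>. 0 < \<sigma> \<Longrightarrow> \<sigma> < b \<Longrightarrow> dist (flow_conv f (poisson \<sigma>) ?w) (f ?w) < 1 / real (Suc k)"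
          unfolding eventually_at_right_field by auto
        obtain m :: nat where m: "1 / real (Suc m) < b"
          using nat_approx_posE[OF b(1)] by blast
        have "cmod (u q ?w - f ?w) \<le> 1 / real (Suc k)" if "0 < q" "of_rat q < 1 / real (Suc m)" for q :: rat
          using b(2)[of "of_rat q"] that m by (simp add: u_def dist_norm zero_less_of_rat_iff less_imp_le)
        then show "\<exists>m. \<forall>q. 0 < q \<and> of_rat q < 1 / real (Suc m) \<longrightarrow> cmod (u q ?w - f ?w) \<le> 1 / real (Suc k)"
          by blast
      qed
    qed
  qed
  then have AE_Q: "AE w in torus. Q w" by (simp only: AE_flow_commute[OF Qm])
  have AE_u: "AE w in torus. \<forall>q::rat. 0 < q \<longrightarrow> vertical w (of_real (of_rat q)) = u q w"
    unfolding AE_all_countable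
  proof
    fix q :: rat
    show "AE w in torus. 0 < q \<longrightarrow> vertical w (of_real (of_rat q)) = u q w"
      using vertical_poisson_AE[of "of_rat q"] by (cases "0 < q") (auto simp: u_def zero_less_of_rat_iff)
  qed
  show ?thesis
    using AE_Q AE_u AE_space
  proof eventually_elim
    case (elim w)
    define v where "v \<sigma> = vertical w (of_real \<sigma>)" for \<sigma> :: real
    have v_cont: "isCont v \<sigma>" if "\<sigma> > 0" for \<sigma>
    proof -
      have "continuous_on {0<..} v"
        unfolding v_def
        by (rule continuous_on_compose2[OF holomorphic_on_imp_continuous_on[OF vertical_holomorphic[OF elim(3)]]])
          (auto intro!: continuous_intros)
      then show ?thesis using that by (simp add: continuous_on_eq_continuous_at)
    qed
    have close: "\<exists>m. \<forall>\<sigma>. 0 < \<sigma> \<and> \<sigma> < 1 / real (Suc m) \<longrightarrow> cmod (v \<sigma> - f w) \<le> 1 / real (Suc k)" for k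
    proof -
      from elim(1) obtain m where m: "\<And>q::rat. 0 < q \<Longrightarrow> of_rat q < 1 / real (Suc m) \<Longrightarrow> cmod (u q w - f w) \<le> 1 / real (Suc k)"
        unfolding Q_def by blast
      have "cmod (v \<sigma> - f w) \<le> 1 / real (Suc k)" if \<sigma>: "0 < \<sigma>" "\<sigma> < 1 / real (Suc m)" for \<sigma>
      \<comment> \<open>By continuity of \<open>v\<close> a violation at a real \<sigma> persists at
        some rational slightly to its right that is still below the threshold, and there
        \<open>v\<close> agrees with \<open>u\<close>.\<close>
      proof (rule ccontr)
        assume "\<not> cmod (v \<sigma> - f w) \<le> 1 / real (Suc k)"
        then have big: "1 / real (Suc k) < cmod (v \<sigma> - f w)" by simp
        have "((\<lambda>x. cmod (v x - f w)) \<longlongrightarrow> cmod (v \<sigma> - f w)) (at \<sigma>)"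
          using v_cont[OF \<sigma>(1)] by (intro tendsto_intros) (simp add: isCont_def)
        then have "\<forall>\<^sub>F x in at \<sigma>. 1 / real (Suc k) < cmod (v x - f w)" using big by (rule order_tendstoD)
        then obtain \<delta> where \<delta>: "\<delta> > 0" "\<And>x. x \<noteq> \<sigma> \<Longrightarrow> dist x \<sigma> < \<delta> \<Longrightarrow> 1 / real (Suc k) < cmod (v x - f w)"
          unfolding eventually_at by auto
        have "\<sigma> < min (\<sigma> + \<delta>) (1 / real (Suc m))" using \<delta>(1) \<sigma>(2) by simp
        then obtain q :: rat where q: "\<sigma> < of_rat q" "of_rat q < min (\<sigma> + \<delta>) (1 / real (Suc m))"
          using of_rat_dense by blast
        have q0: "0 < q" using q(1) \<sigma>(1) by (metis less_trans zero_less_of_rat_iff)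
        have "1 / real (Suc k) < cmod (v (of_rat q) - f w)"
          using q by (intro \<delta>(2)) (auto simp: dist_real_def)
        moreover have "v (of_rat q) = u q w" unfolding v_def using elim(2) q0 by blast
        ultimately show False using m[OF q0] q by simp
      qed
      then show ?thesis by blast
    qed
    have "(v \<longlongrightarrow> f w) (at_right 0)"
    proof (rule tendstoI)
      fix e :: real assume e: "e > 0"
      obtain k :: nat where k: "1 / real (Suc k) < e" using nat_approx_posE[OF e] by blast
      from close[of k] obtain m where m: "\<And>\<sigma>. 0 < \<sigma> \<Longrightarrow> \<sigma> < 1 / real (Suc m) \<Longrightarrow> cmod (v \<sigma> - f w) \<le> 1 / real (Suc k)" by blast
      show "\<forall>\<^sub>F \<sigma> in at_right 0. dist (v \<sigma>) (f w) < e"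
        unfolding eventually_at_right_field
        by (intro exI[of _ "1 / real (Suc m)"]) (use m k in \<open>auto simp: dist_norm intro: le_less_trans\<close>)
    qed
    then show ?case unfolding v_def[abs_def] .
  qed
qed

lemma boundary_value_AE:
  "AE p in torus \<Otimes>\<^sub>M lborel.
    has_boundary_value (\<lambda>n. bohr_transform f n * bohr_char n (fst p)) (snd p) (f (torus_mult (prime_flow (snd p)) (fst p)))"
  using AE_flow_pair[OF radial_limit_AE]
  unfolding has_boundary_value_def bohr_twist_flow_sum .

end

lemma has_boundary_value_unique:
  assumes "has_boundary_value a t L" "has_boundary_value a t L'"
  shows "L = L'"
  using tendsto_unique[OF trivial_limit_at_right_real] assms unfolding has_boundary_value_def by blast

subsection \<open>The measure on the characters\<close>

definition character_of :: "(nat \<Rightarrow> complex) \<Rightarrow> nat \<Rightarrow> complex" where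
  "character_of = the_inv_into characters character_coords"

lemma character_of_eq: "w \<in> space torus \<Longrightarrow> character_of w = (\<lambda>n. bohr_char n w)"
  unfolding character_of_def
proof (rule the_inv_into_f_eq)
  show "inj_on character_coords characters"
  proof (rule inj_onI)
    fix \<gamma> \<delta> assume "\<gamma> \<in> characters" "\<delta> \<in> characters" and eq: "character_coords \<gamma> = character_coords \<delta>"
    then have "\<gamma> n = \<delta> n" for n
      using bohr_char_character_coords[of \<gamma> n] bohr_char_character_coords[of \<delta> n] by simp
    then show "\<gamma> = \<delta>" by blast
  qed
qed (auto simp: character_coords_bohr_char bohr_char_in_characters)

lemma character_of_inj: "inj_on character_of (space torus)"
proof (rule inj_onI)
  fix v w assume "v \<in> space torus" "w \<in> space torus" "character_of v = character_of w"
  then have "character_coords (\<lambda>n. bohr_char n v) = character_coords (\<lambda>n. bohr_char n w)"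
    by (simp only: character_of_eq)
  then show "v = w" by (simp only: character_coords_bohr_char)
qed

lemma character_measure_eq: "character_measure = embed_measure torus character_of"
  by (simp add: character_measure_def character_of_def)

lemma character_measure_distr: "character_measure = distr torus character_measure character_of"
  unfolding character_measure_eq by (rule embed_measure_eq_distr'[OF character_of_inj])

lemma character_of_measurable: "character_of \<in> torus \<rightarrow>\<^sub>M character_measure"
  unfolding character_measure_eq by (rule measurable_embed_measure2'[OF character_of_inj])

lemma character_coords_measurable: "character_coords \<in> character_measure \<rightarrow>\<^sub>M torus"
  unfolding character_measure_eq
proof (rule measurable_embed_measure1)
  have "(\<lambda>w. w) \<in> torus \<rightarrow>\<^sub>M torus" by simp
  then show "(\<lambda>w. character_coords (character_of w)) \<in> torus \<rightarrow>\<^sub>M torus"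
    by (rule measurable_cong[THEN iffD1, rotated]) (simp add: character_of_eq character_coords_bohr_char)
qed

interpretation characters: prob_space character_measure
  by (subst character_measure_distr) (rule torus.prob_space_distr[OF character_of_measurable])

lemma character_coords_distr: "distr character_measure torus character_coords = torus"
proof -
  have "distr character_measure torus character_coords
      = distr (distr torus character_measure character_of) torus character_coords"
    by (simp only: character_measure_distr[symmetric])
  also have "\<dots> = distr torus torus (character_coords \<circ> character_of)"
    by (rule distr_distr[OF character_coords_measurable character_of_measurable])
  also have "\<dots> = distr torus torus (\<lambda>w. w)"
    by (rule distr_cong) (auto simp: character_of_eq character_coords_bohr_char)
  also have "\<dots> = torus" by (rule distr_id)
  finally show ?thesis .
qed

text \<open>\<open>P\<close> is an arbitrary predicate, and an almost everywhere statement for an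
  image measure can be pulled back without any measurability of it. So each product measure is
  written as an image of the other, and each implication is a pullback.\<close>

lemma AE_character_measure_iff:
  fixes P :: "(nat \<Rightarrow> complex) \<Rightarrow> real \<Rightarrow> bool"
  shows "(AE (\<gamma>, t) in character_measure \<Otimes>\<^sub>M lborel. P \<gamma> t)
    \<longleftrightarrow> (AE p in torus \<Otimes>\<^sub>M lborel. P (character_of (fst p)) (snd p))"
proof
  have id: "(\<lambda>t. t) \<in> lborel \<rightarrow>\<^sub>M (lborel :: real measure)" by simp
  have sf: "sigma_finite_measure (distr lborel lborel (\<lambda>t :: real. t))"
    by (simp add: distr_id lborel.sigma_finite_measure_axioms)
  have fwd: "character_measure \<Otimes>\<^sub>M (lborel :: real measure)
      = distr (torus \<Otimes>\<^sub>M lborel) (character_measure \<Otimes>\<^sub>M lborel) (\<lambda>(w, t). (character_of w, t))"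
    using pair_measure_distr[OF character_of_measurable id sf]
    by (simp only: distr_id character_measure_distr[symmetric])
  have bwd: "torus \<Otimes>\<^sub>M (lborel :: real measure)
      = distr (character_measure \<Otimes>\<^sub>M lborel) (torus \<Otimes>\<^sub>M lborel) (\<lambda>(\<gamma>, t). (character_coords \<gamma>, t))"
    using pair_measure_distr[OF character_coords_measurable id sf]
    by (simp only: distr_id character_coords_distr)
  have m1: "(\<lambda>(w, t). (character_of w, t)) \<in> torus \<Otimes>\<^sub>M lborel \<rightarrow>\<^sub>M character_measure \<Otimes>\<^sub>M (lborel :: real measure)"
    using character_of_measurable by measurable
  have m2: "(\<lambda>(\<gamma>, t). (character_coords \<gamma>, t)) \<in> character_measure \<Otimes>\<^sub>M lborel \<rightarrow>\<^sub>M torus \<Otimes>\<^sub>M (lborel :: real measure)"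
    using character_coords_measurable by measurable
  {
    assume "AE (\<gamma>, t) in character_measure \<Otimes>\<^sub>M lborel. P \<gamma> t"
    then have "AE x in character_measure \<Otimes>\<^sub>M lborel. P (fst x) (snd x)"
      by (simp add: case_prod_beta')
    then have "AE x in distr (torus \<Otimes>\<^sub>M lborel) (character_measure \<Otimes>\<^sub>M lborel) (\<lambda>(w, t). (character_of w, t)). P (fst x) (snd x)"
      by (simp only: fwd[symmetric])
    from AE_distrD[OF m1 this] show "AE p in torus \<Otimes>\<^sub>M lborel. P (character_of (fst p)) (snd p)"
      by (simp add: case_prod_beta')
  }
  assume "AE p in torus \<Otimes>\<^sub>M lborel. P (character_of (fst p)) (snd p)"
  then have "AE x in distr (character_measure \<Otimes>\<^sub>M lborel) (torus \<Otimes>\<^sub>M lborel) (\<lambda>(\<gamma>, t). (character_coords \<gamma>, t)).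
      P (character_of (fst x)) (snd x)"
    by (simp only: bwd[symmetric])
  from AE_distrD[OF m2 this]
  have "AE p in character_measure \<Otimes>\<^sub>M lborel. P (character_of (character_coords (fst p))) (snd p)"
    by (simp add: case_prod_beta')
  then show "AE (\<gamma>, t) in character_measure \<Otimes>\<^sub>M lborel. P \<gamma> t"
    using AE_space
  proof eventually_elim
    case (elim p)
    then have "fst p \<in> space character_measure" by (auto simp: space_pair_measure)
    then obtain w where w: "w \<in> space torus" "fst p = character_of w"
      by (auto simp: character_measure_eq space_embed_measure)
    then have "character_of (character_coords (fst p)) = fst p"
      by (simp add: character_of_eq character_coords_bohr_char)
    then show ?case using elim(1) by (simp add: case_prod_beta')
  qed
qed

subsection \<open>The unit interval\<close>

text \<open>Borel sets of the compact interval [0, 1] in place of Lebesgue sets of (0, 1): the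
  approximation results concern Borel measures on compact sets. The endpoints are a null
  set.\<close>

definition unit_measure :: "real measure" where
  "unit_measure = restrict_space lborel {0..1}"

lemma sets_unit_measure: "sets unit_measure = sets (restrict_space borel {0..1})"
  and space_unit_measure [simp]: "space unit_measure = {0..1}"
  unfolding unit_measure_def by (rule sets_restrict_space_cong) (auto simp: space_restrict_space)

lemma prob_space_unit_measure: "prob_space unit_measure"
  unfolding unit_measure_def by (rule prob_spaceI) (simp add: emeasure_restrict_space space_restrict_space)

interpretation unit_measure: prob_space unit_measure
  by (rule prob_space_unit_measure)

lemma unit_measurable_continuous:
  fixes f :: "real \<Rightarrow> 'b::topological_space"
  shows "continuous_on {0..1} f \<Longrightarrow> f \<in> borel_measurable unit_measure"
  using borel_measurable_continuous_on_restrict measurable_cong_sets[OF sets_unit_measure refl] by blast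

lemma AE_unit_measure_iff:
  "(AE x in unit_measure. P x) \<longleftrightarrow> (AE x in lborel. 0 < x \<and> x < 1 \<longrightarrow> P x)"
proof -
  have "(AE x in unit_measure. P x) \<longleftrightarrow> (AE x in lborel. x \<in> {0..1} \<longrightarrow> P x)"
    unfolding unit_measure_def by (rule AE_restrict_space_iff) auto
  also have "\<dots> \<longleftrightarrow> (AE x in lborel. 0 < x \<and> x < 1 \<longrightarrow> P x)"
  proof
    assume "AE x in lborel. 0 < x \<and> x < 1 \<longrightarrow> P x"
    then show "AE x in lborel. x \<in> {0..1} \<longrightarrow> P x"
      using AE_lborel_singleton[of "0::real"] AE_lborel_singleton[of "1::real"]
      by eventually_elim force
  next
    assume "AE x in lborel. x \<in> {0..1} \<longrightarrow> P x"
    then show "AE x in lborel. 0 < x \<and> x < 1 \<longrightarrow> P x" by eventually_elim force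
  qed
  finally show ?thesis .
qed

text \<open>The exchange between a Lebesgue measurable function on (0, 1) and a Borel function equal
  to it almost everywhere, through the completion of Borel-Lebesgue measure.\<close>

lemma lebesgue_unit_interval_cong:
  fixes u v :: "real \<Rightarrow> 'b::euclidean_space"
  assumes v: "v \<in> borel_measurable unit_measure" and eq: "AE x in unit_measure. u x = v x"
  shows "u \<in> borel_measurable (lebesgue_on {0<..<1})"
    and "integrable (lebesgue_on {0<..<1}) u \<longleftrightarrow> integrable unit_measure v"
    and "(LINT x|lebesgue_on {0<..<1}. u x) = (LINT x|unit_measure. v x)"
proof -
  define V where "V x = indicator {0..1} x *\<^sub>R v x" for x
  define U where "U x = indicator {0<..<1} x *\<^sub>R u x" for x
  have V: "V \<in> borel_measurable lborel"
    using v unfolding V_def unit_measure_def by (subst (asm) borel_measurable_restrict_space_iff) auto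
  have V': "V \<in> borel_measurable lebesgue" by (rule measurable_completion[OF V])
  have "AE x in lborel. V x = U x"
    using eq AE_lborel_singleton[of "0::real"] AE_lborel_singleton[of "1::real"]
    unfolding AE_unit_measure_iff U_def V_def by eventually_elim (auto simp: indicator_def)
  then have VU: "AE x in lebesgue. V x = U x" by (rule AE_completion)
  have U: "U \<in> borel_measurable lebesgue" by (rule borel_measurable_AE[OF V' VU])
  show "u \<in> borel_measurable (lebesgue_on {0<..<1})"
    using U unfolding U_def by (subst borel_measurable_restrict_space_iff) auto
  have "integrable (lebesgue_on {0<..<1}) u \<longleftrightarrow> integrable lebesgue U"
    unfolding U_def by (rule integrable_restrict_space) auto
  also have "\<dots> \<longleftrightarrow> integrable lebesgue V"
    using VU by (intro integrable_cong_AE U V') (auto simp: eq_commute)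
  also have "\<dots> \<longleftrightarrow> integrable lborel V" by (rule integrable_completion[OF V])
  also have "\<dots> \<longleftrightarrow> integrable unit_measure v"
    unfolding V_def unit_measure_def by (rule integrable_restrict_space[symmetric]) auto
  finally show "integrable (lebesgue_on {0<..<1}) u \<longleftrightarrow> integrable unit_measure v" .
  have "(LINT x|lebesgue_on {0<..<1}. u x) = (LINT x|lebesgue. U x)"
    unfolding U_def by (rule integral_restrict_space) auto
  also have "\<dots> = (LINT x|lebesgue. V x)"
    using VU by (intro integral_cong_AE U V') (auto simp: eq_commute)
  also have "\<dots> = (LINT x|lborel. V x)" by (rule integral_completion[OF V])
  also have "\<dots> = (LINT x|unit_measure. v x)"
    unfolding V_def unit_measure_def by (rule integral_restrict_space[symmetric]) auto
  finally show "(LINT x|lebesgue_on {0<..<1}. u x) = (LINT x|unit_measure. v x)" .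
qed

lemma lebesgue_unit_interval_L2_cong:
  assumes v: "v \<in> borel_measurable unit_measure" and eq: "AE x in unit_measure. u x = v x"
  shows "u \<in> L2_space (lebesgue_on {0<..<1}) \<longleftrightarrow> v \<in> L2_space unit_measure"
    and "L2_seminorm (lebesgue_on {0<..<1}) u = L2_seminorm unit_measure v"
proof -
  have m: "(\<lambda>x. (cmod (v x))\<^sup>2) \<in> borel_measurable unit_measure" using v by measurable
  have e: "AE x in unit_measure. (cmod (u x))\<^sup>2 = (cmod (v x))\<^sup>2" using eq by eventually_elim simp
  show "u \<in> L2_space (lebesgue_on {0<..<1}) \<longleftrightarrow> v \<in> L2_space unit_measure"
    unfolding L2_space_def using lebesgue_unit_interval_cong(1)[OF v eq] v
      lebesgue_unit_interval_cong(2)[OF m e] by simp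
  show "L2_seminorm (lebesgue_on {0<..<1}) u = L2_seminorm unit_measure v"
    unfolding L2_seminorm_def lebesgue_unit_interval_cong(3)[OF m e] by simp
qed

lemma lebesgue_unit_interval_borel:
  fixes u :: "real \<Rightarrow> complex"
  assumes "u \<in> borel_measurable (lebesgue_on {0<..<1})"
  obtains v where "v \<in> borel_measurable borel" "AE x in unit_measure. u x = v x"
proof -
  define U where "U x = indicator {0<..<1} x *\<^sub>R u x" for x
  have U: "U \<in> borel_measurable lebesgue"
    using assms unfolding U_def by (subst (asm) borel_measurable_restrict_space_iff) auto
  have "(\<lambda>x. Re (U x)) \<in> borel_measurable (completion lborel)" using U by measurable
  from completion_ex_borel_measurable_real[OF this] obtain a where
    a: "a \<in> borel_measurable lborel" "AE x in lborel. Re (U x) = a x" by blast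
  have "(\<lambda>x. Im (U x)) \<in> borel_measurable (completion lborel)" using U by measurable
  from completion_ex_borel_measurable_real[OF this] obtain b where
    b: "b \<in> borel_measurable lborel" "AE x in lborel. Im (U x) = b x" by blast
  show ?thesis
  proof (rule that[of "\<lambda>x. of_real (a x) + \<i> * of_real (b x)"])
    have [measurable]: "a \<in> borel_measurable borel" "b \<in> borel_measurable borel" using a(1) b(1) by auto
    show "(\<lambda>x. of_real (a x) + \<i> * of_real (b x)) \<in> borel_measurable borel" by measurable
    show "AE x in unit_measure. u x = of_real (a x) + \<i> * of_real (b x)"
      unfolding AE_unit_measure_iff using a(2) b(2)
      by eventually_elim (auto simp: U_def complex_eq_iff)
  qed
qed

subsection \<open>Folding odd periodic functions\<close>

text \<open>The triangle wave, that is the distance from y to the nearest even integer. In terms of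
  arccos its continuity is immediate.\<close>

definition fold_unit :: "real \<Rightarrow> real" where
  "fold_unit y = arccos (cos (pi * y)) / pi"

lemma fold_unit_range: "0 \<le> fold_unit y" "fold_unit y \<le> 1"
  using arccos_lbound[of "cos (pi * y)"] arccos_ubound[of "cos (pi * y)"]
  by (auto simp: fold_unit_def)

lemma fold_unit_continuous: "continuous_on A fold_unit"
  unfolding fold_unit_def by (intro continuous_intros) auto

lemma periodic_int_shift:
  fixes g :: "real \<Rightarrow> 'b"
  assumes "\<And>x. g (x + 2) = g x"
  shows "g (x + 2 * of_int m) = g x"
proof -
  have nat: "g (x + 2 * of_nat k) = g x" for k x
  proof (induction k)
    case (Suc k)
    have "g (x + 2 * of_nat (Suc k)) = g ((x + 2 * of_nat k) + 2)" by (simp add: algebra_simps)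
    then show ?case using Suc assms by simp
  qed simp
  show ?thesis
  proof (cases "m \<ge> 0")
    case True
    then show ?thesis using nat[of x "nat m"] by simp
  next
    case False
    then show ?thesis using nat[of "x + 2 * of_int m" "nat (- m)"] by simp
  qed
qed

text \<open>After reduction to [-1, 1] modulo 2, folding is the absolute value and s is the sign
  that it removes. The sign of sin (pi y) equals s except at integers, where it is 0 and the folded
  point is an endpoint.\<close>

lemma fold_unit_decompose:
  obtains s :: real and m :: int where "y = s * fold_unit y + 2 * of_int m"
    "s = 1 \<or> s = - 1" "sgn (sin (pi * y)) = s \<or> (sgn (sin (pi * y)) = 0 \<and> (fold_unit y = 0 \<or> fold_unit y = 1))"
proof -
  define m where "m = \<lfloor>(y + 1) / 2\<rfloor>"
  define z where "z = y - 2 * of_int m"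
  have z: "- 1 \<le> z" "z \<le> 1"
    using floor_correct[of "(y + 1) / 2"] unfolding z_def m_def[symmetric] by (simp_all add: field_simps)
  have "cos (pi * z + 2 * pi * of_int m) = cos (pi * z)" 
    by (subst cos_add) (simp add: cos_int_2pin sin_int_2pin)
  then have c: "cos (pi * y) = cos (pi * z)" by (simp add: z_def algebra_simps)
  have "sin (pi * z + 2 * pi * of_int m) = sin (pi * z)" 
    by (subst sin_add) (simp add: cos_int_2pin sin_int_2pin)
  then have s: "sin (pi * y) = sin (pi * z)" by (simp add: z_def algebra_simps)
  have y: "y = z + 2 * of_int m" by (simp add: z_def)
  show ?thesis
  proof (cases "0 \<le> z")
    case True
    then have f: "fold_unit y = z" using z by (simp add: fold_unit_def c arccos_cos)
    have "z = 0 \<or> z = 1 \<or> sgn (sin (pi * z)) = 1"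
      using z True sin_gt_zero[of "pi * z"]
      by (cases "z = 0"; cases "z = 1") (auto simp: sgn_1_pos zero_less_mult_iff)
    then show ?thesis using that[of 1 m] f s y by auto
  next
    case False
    have "arccos (cos (pi * z)) = pi * (- z)"
    proof -
      have "0 \<le> pi * (- z)" "pi * (- z) \<le> pi * 1"
        using z False by (intro mult_nonneg_nonneg mult_left_mono; simp)+
      then show ?thesis using arccos_cos[of "pi * (- z)"] by simp
    qed
    then have f: "fold_unit y = - z" by (simp add: fold_unit_def c)
    have "z = - 1 \<or> sgn (sin (pi * z)) = - 1"
      using z False mult_strict_left_mono[of "- z" 1 pi] sin_gt_zero[of "pi * (- z)"]
      by (cases "z = -1") (auto simp: sgn_1_neg zero_less_mult_iff mult_less_0_iff)
    then show ?thesis using that[of "-1" m] f s y by auto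
  qed
qed

text \<open>An odd function of period 2 vanishes at 0 and, since g 1 = g (-1) = - g 1, also at 1. So
  the value 0 of the sign at integers is the right one and the formula holds at every point.\<close>

lemma odd_periodic_fold:
  fixes g :: "real \<Rightarrow> complex"
  assumes per: "\<And>x. g (x + 2) = g x" and odd: "\<And>x. g (- x) = - g x"
  shows "g y = of_real (sgn (sin (pi * y))) * g (fold_unit y)"
proof -
  have g0: "g 0 = 0" using odd[of 0] by (simp add: eq_neg_iff_add_eq_0)
  have g1: "g 1 = 0" using odd[of 1] per[of "-1"] by (simp add: eq_neg_iff_add_eq_0)
  obtain s :: real and m :: int where *: "y = s * fold_unit y + 2 * of_int m" "s = 1 \<or> s = - 1"
    "sgn (sin (pi * y)) = s \<or> (sgn (sin (pi * y)) = 0 \<and> (fold_unit y = 0 \<or> fold_unit y = 1))"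
    by (rule fold_unit_decompose)
  have "g y = g (s * fold_unit y + 2 * of_int m)" using *(1) by simp
  also have "\<dots> = g (s * fold_unit y)" by (rule periodic_int_shift[of g, OF per])
  also have "\<dots> = of_real s * g (fold_unit y)" using *(2) odd by auto
  also have "\<dots> = of_real (sgn (sin (pi * y))) * g (fold_unit y)" using *(3) g0 g1 by auto
  finally show ?thesis .
qed

lemma cos_fold_unit: "cos (pi * real k * fold_unit y) = cos (pi * real k * y)"
proof -
  obtain s :: real and m :: int where *: "y = s * fold_unit y + 2 * of_int m" "s = 1 \<or> s = - 1"
    by (rule fold_unit_decompose)
  have per: "cos (pi * real k * (x + 2)) = cos (pi * real k * x)" for x
  proof -
    have "cos (pi * real k * (x + 2)) = cos (pi * real k * x + 2 * pi * of_int (int k))"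
      by (simp add: algebra_simps)
    then show ?thesis by (simp only: cos_add cos_int_2pin sin_int_2pin mult_1_right mult_zero_right diff_0_right)
  qed
  have "cos (pi * real k * y) = cos (pi * real k * (s * fold_unit y + 2 * of_int m))" using *(1) by simp
  also have "\<dots> = cos (pi * real k * (s * fold_unit y))"
    by (rule periodic_int_shift[of "\<lambda>x. cos (pi * real k * x)", OF per])
  also have "\<dots> = cos (pi * real k * fold_unit y)" using *(2) by auto
  finally show ?thesis by simp
qed


section \<open>Cosines on the unit interval and invariance under folding\<close>

lemma unit_cos_integral: "(LINT x|unit_measure. cos (pi * real k * x)) = of_bool (k = 0)"
proof (cases "k = 0")
  case False
  have "(LINT x|unit_measure. cos (pi * real k * x)) = (LINT x|lborel. indicator {0..1} x *\<^sub>R cos (pi * real k * x))"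
    unfolding unit_measure_def by (rule integral_restrict_space) auto
  also have "\<dots> = sin (pi * real k * 1) / (pi * real k) - sin (pi * real k * 0) / (pi * real k)"
  proof (rule integral_FTC_atLeastAtMost)
    fix x :: real
    have "((\<lambda>x. sin (pi * real k * x) / (pi * real k)) has_real_derivative
        cos (pi * real k * x)) (at x within {0..1})"
      using False by (auto intro!: derivative_eq_intros)
    then show "((\<lambda>x. sin (pi * real k * x) / (pi * real k)) has_vector_derivative
        cos (pi * real k * x)) (at x within {0..1})"
      by (simp add: has_real_derivative_iff_has_vector_derivative)
  qed (auto intro!: continuous_intros)
  also have "\<dots> = 0" using sin_npi[of k] by (simp add: mult.commute)
  finally show ?thesis using False by simp
qed (use unit_measure.prob_space in simp)

lemma cos_nat_diff:
  "cos (pi * real (if i \<le> j then j - i else i - j) * x) = cos (pi * real i * x - pi * real j * x)"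
proof (cases "i \<le> j")
  case True
  then have "pi * real (j - i) * x = - (pi * real i * x - pi * real j * x)"
    by (simp add: of_nat_diff algebra_simps)
  then show ?thesis using True by (simp only: cos_minus if_True)
qed (simp add: of_nat_diff algebra_simps)

definition cosine :: "nat \<Rightarrow> real \<Rightarrow> complex" where
  "cosine k x = of_real (cos (pi * real k * x))"

lemma cosine_continuous: "continuous_on A (cosine k)"
  unfolding cosine_def by (intro continuous_intros)

text \<open>Cosines and not sines: they contain 1, are closed under products, and cos (pi x) is
  injective on [0, 1], whereas all the sines vanish at both endpoints.\<close>

lemma cosine_star_algebra: "star_algebra_on (lin_span cosine UNIV) {0..1}"
proof (rule lin_span_star_algebra)
  fix i j :: nat
  define d where "d = (if i \<le> j then j - i else i - j)"
  note c = cos_nat_diff[of i j, folded d_def]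
  define q where "q x = 1/2 * cosine d x + 1/2 * cosine (i + j) x" for x
  have "q \<in> lin_span cosine UNIV"
    unfolding q_def by (intro lin_span_add lin_span_cmult lin_span_base UNIV_I)
  moreover have "q x = cosine i x * cosine j x" for x
  proof -
    have "cos (pi * real i * x) * cos (pi * real j * x) = 1/2 * cos (pi * real d * x) + 1/2 * cos (pi * real (i + j) * x)"
    proof -
      have "pi * real (i + j) * x = pi * real i * x + pi * real j * x" by (simp add: algebra_simps)
      then show ?thesis by (simp only: cos_times_cos c) simp
    qed
    from arg_cong[OF this, of complex_of_real] show ?thesis by (simp add: q_def cosine_def)
  qed
  ultimately show "\<exists>r\<in>lin_span cosine UNIV. \<forall>x\<in>{0..1}. r x = cosine i x * cosine j x" by blast
next
  fix x y :: real assume xy: "x \<in> {0..1}" "y \<in> {0..1}" "x \<noteq> y"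
  have "cos (pi * x) \<noteq> cos (pi * y)"
    using cos_inj_pi[of "pi * x" "pi * y"] xy by auto
  then have "cosine 1 x \<noteq> cosine 1 y" by (simp add: cosine_def)
  then show "\<exists>i\<in>UNIV. cosine i x \<noteq> cosine i y" by blast
next
  show "\<exists>i\<in>UNIV. \<forall>x\<in>{0..1}. cosine i x = 1" by (rule bexI[of _ 0]) (simp_all add: cosine_def)
next
  fix i :: nat
  show "\<exists>k\<in>UNIV. \<forall>x\<in>{0..1}. cosine k x = cnj (cosine i x)"
    by (rule bexI[of _ i]) (simp_all add: cosine_def)
qed (auto intro: cosine_continuous)

lemma unit_star_algebra_measure:
  "finite_measure M \<Longrightarrow> sets M = sets unit_measure \<Longrightarrow> star_algebra_measure (lin_span cosine UNIV) {0..1} M"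
  using cosine_star_algebra
  by (simp add: star_algebra_measure_def star_algebra_measure_axioms_def sets_unit_measure)

lemma fold_dilate_measurable: "(\<lambda>x. fold_unit (real n * x)) \<in> unit_measure \<rightarrow>\<^sub>M unit_measure"
proof -
  have "(\<lambda>x. fold_unit (real n * x)) \<in> borel_measurable borel"
    by (intro borel_measurable_continuous_onI continuous_on_compose2[OF fold_unit_continuous[of UNIV]] continuous_intros) auto
  then have "(\<lambda>x. fold_unit (real n * x)) \<in> borel_measurable unit_measure"
    unfolding unit_measure_def by (intro measurable_restrict_space1) auto
  then have "(\<lambda>x. fold_unit (real n * x)) \<in> unit_measure \<rightarrow>\<^sub>M restrict_space borel {0..1}"
    by (rule measurable_restrict_space2[rotated]) (auto simp: fold_unit_range)
  then show ?thesis using measurable_cong_sets[OF refl sets_unit_measure] by blast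
qed

text \<open>Cosines are even and periodic, hence insensitive to folding, so the map sends the cosine
  of index k to that of index k n. For n > 0 both integrals are 1 if k = 0 and 0 otherwise.\<close>

lemma fold_dilate_invariant:
  assumes n: "n > 0"
  shows "distr unit_measure unit_measure (\<lambda>x. fold_unit (real n * x)) = unit_measure"
proof (rule star_algebra_measure_eqI)
  let ?V = "lin_span cosine UNIV"
  let ?T = "\<lambda>x. fold_unit (real n * x)"
  show N: "star_algebra_measure ?V {0..1} unit_measure"
    by (rule unit_star_algebra_measure) (auto intro: unit_measure.finite_measure_axioms)
  show "star_algebra_measure ?V {0..1} (distr unit_measure unit_measure ?T)"
    by (rule unit_star_algebra_measure)
      (auto intro!: prob_space.finite_measure unit_measure.prob_space_distr fold_dilate_measurable)
  interpret N: star_algebra_measure ?V "{0..1}" unit_measure by (rule N)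
  fix p assume "p \<in> ?V"
  then obtain F c where F: "finite F" "p = (\<lambda>x. \<Sum>k\<in>F. c k * cosine k x)" by (rule lin_spanE)
  have cT: "cosine k (?T x) = cosine (k * n) x" for k x
    unfolding cosine_def cos_fold_unit by (simp add: mult_ac)
  have ci: "integrable unit_measure (cosine k)" for k
    by (rule N.continuous_integrable[OF cosine_continuous])
  have m: "(LINT x|unit_measure. cosine k x) = of_bool (k = 0)" for k
    unfolding cosine_def by (simp add: unit_cos_integral)
  have "(LINT x|distr unit_measure unit_measure ?T. p x) = (LINT x|unit_measure. p (?T x))"
    by (rule integral_distr[OF fold_dilate_measurable])
      (use N.continuous_measurable[OF N.cont[OF \<open>p \<in> ?V\<close>]] in auto)
  also have "\<dots> = (\<Sum>k\<in>F. c k * (LINT x|unit_measure. cosine (k * n) x))"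
    unfolding F(2) cT using ci
    by (subst Bochner_Integration.integral_sum) auto
  also have "\<dots> = (LINT x|unit_measure. p x)"
    unfolding F(2) using ci n
    by (subst Bochner_Integration.integral_sum) (auto simp: m)
  finally show "(LINT x|distr unit_measure unit_measure ?T. p x) = (LINT x|unit_measure. p x)" .
qed


subsection \<open>The sine basis\<close>

definition sine :: "nat \<Rightarrow> real \<Rightarrow> complex" where
  "sine k x = of_real (sine_basis k x)"

lemma sine_continuous: "continuous_on A (sine k)"
  unfolding sine_def sine_basis_def by (intro continuous_intros)

lemma sine_measurable [measurable]: "sine k \<in> borel_measurable unit_measure"
  by (rule unit_measurable_continuous[OF sine_continuous])

lemma sine_L2: "sine k \<in> L2_space unit_measure"
proof (rule unit_measure.L2_space_bounded[OF sine_measurable])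
  show "AE x in unit_measure. cmod (sine k x) \<le> sqrt 2"
    by (rule AE_I2) (simp add: sine_def sine_basis_def abs_mult flip: of_real_mult)
qed

lemma sine_orthonormal: "orthonormal_on unit_measure sine {0<..}"
  unfolding orthonormal_on_def
proof (intro conjI ballI sine_L2)
  fix i j :: nat assume ij: "i \<in> {0<..}" "j \<in> {0<..}"
  define d where "d = (if i \<le> j then j - i else i - j)"
  note c = cos_nat_diff[of i j, folded d_def]
  have "sine i x * cnj (sine j x) = of_real (cos (pi * real d * x) - cos (pi * real (i + j) * x))" for x
  proof -
    have "pi * real (i + j) * x = pi * real i * x + pi * real j * x" by (simp add: algebra_simps)
    then have "2 * (sin (pi * real i * x) * sin (pi * real j * x)) = cos (pi * real d * x) - cos (pi * real (i + j) * x)"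
      by (simp only: sin_times_sin c) simp
    moreover have "sine_basis i x * sine_basis j x = 2 * (sin (pi * real i * x) * sin (pi * real j * x))"
      by (simp add: sine_basis_def)
    ultimately have "sine_basis i x * sine_basis j x = cos (pi * real d * x) - cos (pi * real (i + j) * x)"
      by simp
    from arg_cong[OF this, of complex_of_real] show ?thesis
      by (simp only: sine_def of_real_mult complex_cnj_complex_of_real)
  qed
  then have "L2_inner unit_measure (sine i) (sine j)
      = of_real (LINT x|unit_measure. cos (pi * real d * x) - cos (pi * real (i + j) * x))"
    unfolding L2_inner_def by (simp only: integral_complex_of_real)
  also have "(LINT x|unit_measure. cos (pi * real d * x) - cos (pi * real (i + j) * x))
      = of_bool (d = 0) - of_bool (i + j = 0)"
    by (subst Bochner_Integration.integral_diff)
      (auto simp: unit_cos_integral simp del: of_nat_add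
        intro!: unit_measure.integrable_const_bound[where B = 1] unit_measurable_continuous continuous_intros)
  also have "\<dots> = of_bool (i = j)" using ij by (auto simp: d_def)
  finally show "L2_inner unit_measure (sine i) (sine j) = of_bool (i = j)" by simp
qed

lemma sin_cosine_in_span: "(\<lambda>x. of_real (sin (pi * x)) * cosine k x) \<in> lin_span sine {0<..}"
proof (cases "k = 0")
  case True
  have "(\<lambda>x. of_real (1 / sqrt 2) * sine 1 x) \<in> lin_span sine {0<..}"
    by (intro lin_span_cmult lin_span_base) auto
  then show ?thesis using True by (simp add: sine_def sine_basis_def cosine_def)
next
  case False
  define q where "q x = of_real (1 / (2 * sqrt 2)) * (sine (k + 1) x + (- 1) * sine (k - 1) x)" for x
  \<comment> \<open>For k = 1 the index k - 1 is 0, which is not among the indices of the span; the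
    function belonging to it is zero.\<close>
  have "sine 0 = (\<lambda>x. 0)" by (simp add: sine_def sine_basis_def fun_eq_iff)
  then have "sine 0 \<in> lin_span sine {0<..}" using lin_span_zero[of sine "{0<..}"] by simp
  then have "sine (k - 1) \<in> lin_span sine {0<..}"
    by (cases "k = 1") (use False in \<open>auto intro: lin_span_base\<close>)
  then have "q \<in> lin_span sine {0<..}" unfolding q_def
    by (intro lin_span_cmult lin_span_add) (auto intro: lin_span_base)
  have "q x = of_real (sin (pi * x)) * cosine k x" for x
  proof -
    have 1: "pi * real (k + 1) * x = pi * x + pi * real k * x" by (simp add: algebra_simps)
    have 2: "pi * real (k - 1) * x = - (pi * x - pi * real k * x)" using False by (simp add: algebra_simps of_nat_diff)
    have "1 / (2 * sqrt 2) * (sine_basis (k + 1) x + (- 1) * sine_basis (k - 1) x)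
        = (sin (pi * x + pi * real k * x) + sin (pi * x - pi * real k * x)) / 2"
      unfolding sine_basis_def 1 2 sin_minus by (simp add: field_simps)
    also have "\<dots> = sin (pi * x) * cos (pi * real k * x)" by (rule sin_times_cos[symmetric])
    finally have "1 / (2 * sqrt 2) * (sine_basis (k + 1) x + (- 1) * sine_basis (k - 1) x)
        = sin (pi * x) * cos (pi * real k * x)" .
    from arg_cong[OF this, of complex_of_real] show ?thesis
      by (simp only: q_def sine_def cosine_def of_real_mult of_real_add of_real_minus of_real_1)
  qed
  then have "q = (\<lambda>x. of_real (sin (pi * x)) * cosine k x)" by (rule ext)
  with \<open>q \<in> lin_span sine {0<..}\<close> show ?thesis by simp
qed

text \<open>The quotient g / sin (pi x) lies in L2 of the measure sin^2 (pi x) dx and is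
  approximated there by cosine polynomials q. Multiplication by sin (pi x) turns q into a sine
  polynomial and the weighted error into the plain error for g.\<close>

lemma sine_dense:
  assumes g: "g \<in> L2_space unit_measure" and \<epsilon>: "\<epsilon> > 0"
  shows "\<exists>p\<in>lin_span sine {0<..}. L2_seminorm unit_measure (\<lambda>x. g x - p x) < \<epsilon>"
proof -
  define w where "w x = (sin (pi * x))\<^sup>2" for x
  define M where "M = density unit_measure (\<lambda>x. ennreal (w x))"
  define s where "s x = complex_of_real (sin (pi * x))" for x
  have w [measurable]: "w \<in> borel_measurable unit_measure"
    unfolding w_def by (intro unit_measurable_continuous continuous_intros)
  have s [measurable]: "s \<in> borel_measurable unit_measure"
    unfolding s_def by (intro unit_measurable_continuous continuous_intros)
  have gm [measurable]: "g \<in> borel_measurable unit_measure" using g by auto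
  have nz: "AE x in unit_measure. s x \<noteq> 0"
    unfolding AE_unit_measure_iff
  proof (rule AE_I2, rule impI)
    fix x :: real assume "0 < x \<and> x < 1"
    then show "s x \<noteq> 0" using sin_gt_zero[of "pi * x"] by (auto simp: s_def)
  qed
  have sets: "sets M = sets unit_measure" by (simp add: M_def)
  have "emeasure M (space M) = (\<integral>\<^sup>+ x. ennreal (w x) \<partial>unit_measure)"
    unfolding M_def
    by (subst emeasure_density) (use sets.top[of unit_measure] in \<open>auto intro!: nn_integral_cong simp: indicator_def\<close>)
  also have "\<dots> \<le> (\<integral>\<^sup>+ x. 1 \<partial>unit_measure)"
    by (intro nn_integral_mono) (simp add: w_def abs_square_le_1)
  also have "\<dots> < \<infinity>" by (use unit_measure.emeasure_space_1 in simp)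
  finally have "finite_measure M" by (intro finite_measureI) auto
  then interpret star_algebra_measure "lin_span cosine UNIV" "{0..1}" M
    using sets by (rule unit_star_algebra_measure)
  have sw: "of_real (sqrt (w x)) = complex_of_real \<bar>sin (pi * x)\<bar>" for x by (simp add: w_def)
  define G where "G x = g x / s x" for x
  have Gm [measurable]: "G \<in> borel_measurable unit_measure" unfolding G_def by measurable
  have "integrable unit_measure (\<lambda>x. w x * (cmod (G x))\<^sup>2)"
  proof (rule Bochner_Integration.integrable_bound)
    show "integrable unit_measure (\<lambda>x. (cmod (g x))\<^sup>2)" using g by auto
    show "AE x in unit_measure. norm (w x * (cmod (G x))\<^sup>2) \<le> norm ((cmod (g x))\<^sup>2)"
      using nz
    proof eventually_elim
      case (elim x)
      then show ?case by (simp add: G_def w_def s_def norm_divide power_divide)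
    qed
  qed measurable
  then have "G \<in> L2_space M"
    using w Gm unfolding L2_space_def M_def by (simp add: integrable_density w_def[abs_def])
  from dense[OF this \<epsilon>] obtain q where q: "q \<in> lin_span cosine UNIV" "L2_seminorm M (\<lambda>x. G x - q x) < \<epsilon>" by blast
  from q(1) obtain F c where F: "finite F" "q = (\<lambda>x. \<Sum>k\<in>F. c k * cosine k x)" by (rule lin_spanE)
  have qm [measurable]: "q \<in> borel_measurable unit_measure"
    using cont[OF q(1)] by (rule unit_measurable_continuous)
  define p where "p x = s x * q x" for x
  have "(\<lambda>x. \<Sum>k\<in>F. c k * (of_real (sin (pi * x)) * cosine k x)) \<in> lin_span sine {0<..}"
    by (intro lin_span_sum lin_span_cmult sin_cosine_in_span)
  also have "(\<lambda>x. \<Sum>k\<in>F. c k * (of_real (sin (pi * x)) * cosine k x)) = p"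
    by (rule ext) (simp add: p_def s_def F(2) sum_distrib_left mult_ac)
  finally have "p \<in> lin_span sine {0<..}" .
  moreover have "L2_seminorm M (\<lambda>x. G x - q x) = L2_seminorm unit_measure (\<lambda>x. of_real (sqrt (w x)) * (G x - q x))"
    unfolding M_def by (rule L2_seminorm_density[OF w]) (simp add: w_def, measurable)
  moreover have "\<dots> = L2_seminorm unit_measure (\<lambda>x. g x - p x)"
  proof (rule L2_seminorm_cong_AE)
    show "AE x in unit_measure. cmod (of_real (sqrt (w x)) * (G x - q x)) = cmod (g x - p x)"
      using nz
    proof eventually_elim
      case (elim x)
      then have "g x - p x = s x * (G x - q x)" by (simp add: p_def G_def algebra_simps)
      then show ?case by (simp add: norm_mult s_def w_def)
    qed
  qed (unfold p_def, measurable)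
  ultimately show ?thesis using q(2) by auto
qed

lemma sine_expansion:
  assumes g: "g \<in> L2_space unit_measure"
  shows "(\<lambda>N. L2_seminorm unit_measure (\<lambda>x. (\<Sum>n=1..N. L2_inner unit_measure g (sine n) * sine n x) - g x)) \<longlonglongrightarrow> 0"
proof (rule LIMSEQ_I)
  fix r :: real assume r: "r > 0"
  obtain F where F: "finite F" "F \<subseteq> {0<..}"
    "\<And>F'. finite F' \<Longrightarrow> F \<subseteq> F' \<Longrightarrow> F' \<subseteq> {0<..} \<Longrightarrow>
      L2_seminorm unit_measure (\<lambda>x. g x - (\<Sum>i\<in>F'. L2_inner unit_measure g (sine i) * sine i x)) < r"
    by (rule orthonormal_dense_expansion[OF sine_orthonormal g sine_dense[OF g] r]) (assumption, rule that, assumption, assumption, blast)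
  have "norm (L2_seminorm unit_measure (\<lambda>x. (\<Sum>n=1..N. L2_inner unit_measure g (sine n) * sine n x) - g x) - 0) < r"
    if "N \<ge> Max (insert 0 F)" for N
  proof -
    have "F \<subseteq> {1..N}"
    proof
      fix i assume i: "i \<in> F"
      then have "i \<le> Max (insert 0 F)" using F(1) by simp
      then show "i \<in> {1..N}" using i that F(2) by auto
    qed
    have "{1..N} \<subseteq> {0<..}" by auto
    from F(3)[OF _ \<open>F \<subseteq> {1..N}\<close> this] show ?thesis by (subst L2_seminorm_minus_commute) simp
  qed
  then show "\<exists>no. \<forall>n\<ge>no. norm (L2_seminorm unit_measure (\<lambda>x. (\<Sum>n=1..n. L2_inner unit_measure g (sine n) * sine n x) - g x) - 0) < r"
    by blast
qed


subsection \<open>The norm of combinations of dilates\<close>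

lemma L2_seminorm_sum_le:
  assumes "finite I" "\<And>i. i \<in> I \<Longrightarrow> f i \<in> L2_space M"
  shows "L2_seminorm M (\<lambda>x. \<Sum>i\<in>I. f i x) \<le> (\<Sum>i\<in>I. L2_seminorm M (f i))"
  using assms
proof (induction I)
  case (insert i I)
  have "L2_seminorm M (\<lambda>x. f i x + (\<Sum>i\<in>I. f i x)) \<le> L2_seminorm M (f i) + L2_seminorm M (\<lambda>x. \<Sum>i\<in>I. f i x)"
    by (rule L2_seminorm_triangle) (use insert.prems in auto)
  then show ?case using insert by auto
qed (simp add: L2_seminorm_def)

lemma dilated_series_norm_limit:
  fixes e h :: "nat \<Rightarrow> 'a \<Rightarrow> complex" and a b :: "nat \<Rightarrow> complex"
  assumes e: "orthonormal_on M e {0<..}"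
    and h: "\<And>n. n > 0 \<Longrightarrow> h n \<in> L2_space M"
    and lim: "\<And>n. n > 0 \<Longrightarrow> (\<lambda>N. L2_seminorm M (\<lambda>x. (\<Sum>k=1..N. a k * e (k * n) x) - h n x)) \<longlonglongrightarrow> 0"
  shows "(\<lambda>N. L2_seminorm M (\<lambda>x. \<Sum>j\<in>{1..N} \<times> {1..X}. (a (fst j) * b (snd j)) * e (fst j * snd j) x))
      \<longlonglongrightarrow> L2_seminorm M (\<lambda>x. \<Sum>n=1..X. b n * h n x)"
proof (rule L2_seminorm_tendsto)
  have eL: "e k \<in> L2_space M" if "k > 0" for k using e that by (auto simp: orthonormal_on_def)
  show "(\<lambda>x. \<Sum>j\<in>{1..N} \<times> {1..X}. (a (fst j) * b (snd j)) * e (fst j * snd j) x) \<in> L2_space M" for N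
    by (intro L2_space_sum L2_space_cmult eL) auto
  show "(\<lambda>x. \<Sum>n=1..X. b n * h n x) \<in> L2_space M"
    by (intro L2_space_sum L2_space_cmult h) auto
  define d where "d N n x = (\<Sum>k=1..N. a k * e (k * n) x) - h n x" for N n x
  have dL: "d N n \<in> L2_space M" if "n > 0" for N n
    unfolding d_def using that by (intro L2_space_diff L2_space_sum L2_space_cmult eL h) auto
  have eq: "(\<Sum>j\<in>{1..N} \<times> {1..X}. (a (fst j) * b (snd j)) * e (fst j * snd j) x) - (\<Sum>n=1..X. b n * h n x)
      = (\<Sum>n=1..X. b n * d N n x)" for N x
  proof -
    have "(\<Sum>j\<in>{1..N} \<times> {1..X}. (a (fst j) * b (snd j)) * e (fst j * snd j) x)
        = (\<Sum>k=1..N. \<Sum>n=1..X. (a k * b n) * e (k * n) x)"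
      by (simp add: sum.cartesian_product case_prod_unfold)
    also have "\<dots> = (\<Sum>n=1..X. b n * (\<Sum>k=1..N. a k * e (k * n) x))"
      by (subst sum.swap) (simp add: sum_distrib_left mult_ac)
    finally show ?thesis by (simp add: d_def right_diff_distrib sum_subtractf)
  qed
  have "(\<lambda>N. \<Sum>n=1..X. cmod (b n) * L2_seminorm M (d N n)) \<longlonglongrightarrow> (\<Sum>n=1..X. cmod (b n) * 0)"
    using lim unfolding d_def by (intro tendsto_sum tendsto_mult tendsto_const) auto
  then have lim0: "(\<lambda>N. \<Sum>n=1..X. cmod (b n) * L2_seminorm M (d N n)) \<longlonglongrightarrow> 0" by simp
  show "(\<lambda>N. L2_seminorm M (\<lambda>x. (\<Sum>j\<in>{1..N} \<times> {1..X}. (a (fst j) * b (snd j)) * e (fst j * snd j) x)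
      - (\<Sum>n=1..X. b n * h n x))) \<longlonglongrightarrow> 0"
    unfolding eq
  proof (rule Lim_null_comparison[OF _ lim0], rule always_eventually, rule allI)
    fix N
    have "L2_seminorm M (\<lambda>x. \<Sum>n=1..X. b n * d N n x) \<le> (\<Sum>n=1..X. L2_seminorm M (\<lambda>x. b n * d N n x))"
      by (rule L2_seminorm_sum_le) (auto intro!: dL)
    then show "norm (L2_seminorm M (\<lambda>x. \<Sum>n=1..X. b n * d N n x)) \<le> (\<Sum>n=1..X. cmod (b n) * L2_seminorm M (d N n))"
      by (simp add: L2_seminorm_cmult)
  qed
qed

text \<open>For every N the truncated double sums have equal norms, because their Gram sums involve
  only the coefficients and the coincidences among the products k * n. The limits therefore
  agree.\<close>

lemma dilated_series_norm_eq:
  fixes e h :: "nat \<Rightarrow> 'a \<Rightarrow> complex" and e' h' :: "nat \<Rightarrow> 'b \<Rightarrow> complex" and a b :: "nat \<Rightarrow> complex"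
  assumes e: "orthonormal_on M e {0<..}" "orthonormal_on M' e' {0<..}"
    and h: "\<And>n. n > 0 \<Longrightarrow> h n \<in> L2_space M" "\<And>n. n > 0 \<Longrightarrow> h' n \<in> L2_space M'"
    and lim: "\<And>n. n > 0 \<Longrightarrow> (\<lambda>N. L2_seminorm M (\<lambda>x. (\<Sum>k=1..N. a k * e (k * n) x) - h n x)) \<longlonglongrightarrow> 0"
      "\<And>n. n > 0 \<Longrightarrow> (\<lambda>N. L2_seminorm M' (\<lambda>x. (\<Sum>k=1..N. a k * e' (k * n) x) - h' n x)) \<longlonglongrightarrow> 0"
  shows "L2_seminorm M (\<lambda>x. \<Sum>n=1..X. b n * h n x) = L2_seminorm M' (\<lambda>x. \<Sum>n=1..X. b n * h' n x)"
proof (rule LIMSEQ_unique)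
  have "of_real ((L2_seminorm M (\<lambda>x. \<Sum>j\<in>{1..N} \<times> {1..X}. (a (fst j) * b (snd j)) * e (fst j * snd j) x))\<^sup>2)
      = complex_of_real ((L2_seminorm M' (\<lambda>x. \<Sum>j\<in>{1..N} \<times> {1..X}. (a (fst j) * b (snd j)) * e' (fst j * snd j) x))\<^sup>2)" for N
    by (subst orthonormal_norm_reindex[OF e(1), where m = "\<lambda>j. fst j * snd j"], force,
        subst orthonormal_norm_reindex[OF e(2), where m = "\<lambda>j. fst j * snd j"], force) (rule refl)
  then have eq: "L2_seminorm M (\<lambda>x. \<Sum>j\<in>{1..N} \<times> {1..X}. (a (fst j) * b (snd j)) * e (fst j * snd j) x)
      = L2_seminorm M' (\<lambda>x. \<Sum>j\<in>{1..N} \<times> {1..X}. (a (fst j) * b (snd j)) * e' (fst j * snd j) x)" for N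
    by (simp only: of_real_eq_iff power2_eq_iff_nonneg[OF L2_seminorm_nonneg L2_seminorm_nonneg])
  show "(\<lambda>N. L2_seminorm M (\<lambda>x. \<Sum>j\<in>{1..N} \<times> {1..X}. (a (fst j) * b (snd j)) * e (fst j * snd j) x))
      \<longlonglongrightarrow> L2_seminorm M (\<lambda>x. \<Sum>n=1..X. b n * h n x)"
    by (rule dilated_series_norm_limit[OF e(1) h(1) lim(1)])
  show "(\<lambda>N. L2_seminorm M (\<lambda>x. \<Sum>j\<in>{1..N} \<times> {1..X}. (a (fst j) * b (snd j)) * e (fst j * snd j) x))
      \<longlonglongrightarrow> L2_seminorm M' (\<lambda>x. \<Sum>n=1..X. b n * h' n x)"
    unfolding eq by (rule dilated_series_norm_limit[OF e(2) h(2) lim(2)])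
qed

lemma fold_dilate_L2:
  assumes u: "u \<in> L2_space unit_measure" and n: "n > 0"
  shows "(\<lambda>x. u (fold_unit (real n * x))) \<in> L2_space unit_measure"
    and "L2_seminorm unit_measure (\<lambda>x. u (fold_unit (real n * x))) = L2_seminorm unit_measure u"
proof -
  have m: "u \<in> borel_measurable unit_measure" using u by auto
  then have m2: "(\<lambda>x. (cmod (u x))\<^sup>2) \<in> borel_measurable unit_measure" by measurable
  have "integrable (distr unit_measure unit_measure (\<lambda>x. fold_unit (real n * x))) (\<lambda>x. (cmod (u x))\<^sup>2)"
    using u by (subst fold_dilate_invariant[OF n]) auto
  then have "integrable unit_measure (\<lambda>x. (cmod (u (fold_unit (real n * x))))\<^sup>2)"
    by (subst (asm) integrable_distr_eq[OF fold_dilate_measurable m2])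
  moreover have "(\<lambda>x. u (fold_unit (real n * x))) \<in> borel_measurable unit_measure"
    by (rule measurable_compose[OF fold_dilate_measurable m])
  ultimately show "(\<lambda>x. u (fold_unit (real n * x))) \<in> L2_space unit_measure"
    by (simp add: L2_space_def)
  show "L2_seminorm unit_measure (\<lambda>x. u (fold_unit (real n * x))) = L2_seminorm unit_measure u"
    unfolding L2_seminorm_def using integral_distr[OF fold_dilate_measurable m2, of n]
    by (simp add: fold_dilate_invariant[OF n])
qed

lemma sine_dilate:
  "sine (k * n) x = of_real (sgn (sin (pi * (real n * x)))) * sine k (fold_unit (real n * x))"
proof -
  have per: "sine k (y + 2) = sine k y" for y
  proof -
    have "pi * real k * (y + 2) = pi * real k * y + 2 * pi * of_int (int k)"
      by (simp add: algebra_simps)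
    then have "sin (pi * real k * (y + 2)) = sin (pi * real k * y)"
      by (simp only: sin_add cos_int_2pin sin_int_2pin mult_1_right mult_zero_right add_0_right)
    then show ?thesis by (simp only: sine_def sine_basis_def)
  qed
  have odd: "sine k (- y) = - sine k y" for y by (simp add: sine_def sine_basis_def)
  have "sine (k * n) x = sine k (real n * x)" by (simp add: sine_def sine_basis_def mult_ac)
  also have "\<dots> = of_real (sgn (sin (pi * (real n * x)))) * sine k (fold_unit (real n * x))"
    by (rule odd_periodic_fold[of "sine k", OF per odd])
  finally show ?thesis .
qed

text \<open>The dilate with index n expands in sines, and f times the n-th Bohr character expands in
  Bohr characters, with the same coefficients D k at the index k * n. Equality of norms is then the
  comparison of two orthonormal systems.\<close>

lemma dilates_norm:
  fixes \<phi> :: "real \<Rightarrow> complex"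
  assumes \<phi>: "\<phi> \<in> L2_space (lebesgue_on {0<..<1})"
    and per: "\<And>x. \<phi> (x + 2) = \<phi> x" and odd: "\<And>x. \<phi> (- x) = - \<phi> x"
    and f: "f \<in> hardy2_torus" "bohr_transform f = sine_transform \<phi>"
  shows "n > 0 \<Longrightarrow> (\<lambda>x. \<phi> (real n * x)) \<in> L2_space (lebesgue_on {0<..<1})"
    and "L2_seminorm (lebesgue_on {0<..<1}) (\<lambda>x. \<Sum>n=1..N. b n * \<phi> (real n * x))
       = L2_seminorm torus (\<lambda>w. f w * (\<Sum>n=1..N. b n * bohr_char n w))"
proof -
  \<comment> \<open>A Borel representative is fixed, since it stays measurable under composition
    with the folding maps; these preserve the measure, so the equality almost everywhere survives as
    well.\<close>
  obtain \<psi> where \<psi>b: "\<psi> \<in> borel_measurable borel" and \<phi>\<psi>: "AE x in unit_measure. \<phi> x = \<psi> x"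
    using \<phi> by (auto elim: lebesgue_unit_interval_borel)
  have \<psi>m: "\<psi> \<in> borel_measurable unit_measure"
    unfolding unit_measure_def using \<psi>b by (intro measurable_restrict_space1) auto
  have \<psi>: "\<psi> \<in> L2_space unit_measure"
    using \<phi> lebesgue_unit_interval_L2_cong(1)[OF \<psi>m \<phi>\<psi>] by blast
  define D where "D = sine_transform \<phi>"
  have D: "L2_inner unit_measure \<psi> (sine k) = D k" for k
  proof -
    have "(LINT x|lebesgue_on {0<..<1}. \<phi> x * of_real (sine_basis k x)) = (LINT x|unit_measure. \<psi> x * cnj (sine k x))"
    proof (rule lebesgue_unit_interval_cong(3))
      show "(\<lambda>x. \<psi> x * cnj (sine k x)) \<in> borel_measurable unit_measure" using \<psi>m by measurable
      show "AE x in unit_measure. \<phi> x * of_real (sine_basis k x) = \<psi> x * cnj (sine k x)"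
        using \<phi>\<psi> by eventually_elim (simp add: sine_def)
    qed
    then show ?thesis by (simp add: D_def sine_transform_def L2_inner_def)
  qed
  define \<sigma> where "\<sigma> n x = complex_of_real (sgn (sin (pi * (real n * x))))" for n x
  have \<sigma>m: "\<sigma> n \<in> borel_measurable unit_measure" for n
  proof -
    have [measurable]: "(\<lambda>x. sin (pi * (real n * x))) \<in> borel_measurable unit_measure"
      by (intro unit_measurable_continuous continuous_intros)
    show ?thesis unfolding \<sigma>_def by measurable
  qed
  have \<sigma>1: "AE x in unit_measure. cmod (\<sigma> n x) \<le> 1" for n
    by (rule AE_I2) (simp add: \<sigma>_def sgn_if)
  define h where "h n x = \<sigma> n x * \<psi> (fold_unit (real n * x))" for n x
  have h: "h n \<in> L2_space unit_measure" if "n > 0" for n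
    unfolding h_def using L2_space_bounded_mult[OF fold_dilate_L2(1)[OF \<psi> that] \<sigma>m \<sigma>1]
    by (simp add: mult.commute)
  have \<phi>h: "AE x in unit_measure. \<phi> (real n * x) = h n x" if n: "n > 0" for n
  proof -
    have "AE x in distr unit_measure unit_measure (\<lambda>x. fold_unit (real n * x)). \<phi> x = \<psi> x"
      unfolding fold_dilate_invariant[OF n] by (rule \<phi>\<psi>)
    from AE_distrD[OF fold_dilate_measurable this] show ?thesis
    proof eventually_elim
      case (elim x)
      then show ?case using odd_periodic_fold[of \<phi> "real n * x", OF per odd] by (simp add: h_def \<sigma>_def)
    qed
  qed
  show "(\<lambda>x. \<phi> (real n * x)) \<in> L2_space (lebesgue_on {0<..<1})" if n: "n > 0" for n
    using lebesgue_unit_interval_L2_cong(1)[OF _ \<phi>h[OF n]] h[OF n] by blast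
  have lim: "(\<lambda>N. L2_seminorm unit_measure (\<lambda>x. (\<Sum>k=1..N. D k * sine (k * n) x) - h n x)) \<longlonglongrightarrow> 0"
    if n: "n > 0" for n
  \<comment> \<open>The error at index n is the error of the expansion of \<psi> composed with
    folding and multiplied by a common sign, hence not larger in norm.\<close>
  proof (rule Lim_null_comparison[OF _ sine_expansion[OF \<psi>]], rule always_eventually, rule allI)
    fix N
    define u where "u x = (\<Sum>k=1..N. D k * sine k x) - \<psi> x" for x
    have u: "u \<in> L2_space unit_measure"
      unfolding u_def by (intro L2_space_diff L2_space_sum L2_space_cmult sine_L2 \<psi>)
    have "(\<Sum>k=1..N. D k * sine (k * n) x) - h n x = \<sigma> n x * u (fold_unit (real n * x))" for x
      unfolding u_def h_def sine_dilate \<sigma>_def by (simp add: right_diff_distrib sum_distrib_left mult_ac)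
    then have "L2_seminorm unit_measure (\<lambda>x. (\<Sum>k=1..N. D k * sine (k * n) x) - h n x)
        = L2_seminorm unit_measure (\<lambda>x. \<sigma> n x * u (fold_unit (real n * x)))" by presburger
    also have "\<dots> \<le> 1 * L2_seminorm unit_measure (\<lambda>x. u (fold_unit (real n * x)))"
      by (rule L2_seminorm_le_bounded_mult[OF fold_dilate_L2(1)[OF u n] \<sigma>m \<sigma>1]) simp
    also have "\<dots> = L2_seminorm unit_measure u" using fold_dilate_L2(2)[OF u n] by simp
    finally show "norm (L2_seminorm unit_measure (\<lambda>x. (\<Sum>k=1..N. D k * sine (k * n) x) - h n x))
        \<le> L2_seminorm unit_measure (\<lambda>x. (\<Sum>n=1..N. L2_inner unit_measure \<psi> (sine n) * sine n x) - \<psi> x)"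
      unfolding u_def D by simp
  qed
  have fL: "f \<in> L2_space torus" using f(1) by (simp add: hardy2_torus_def)
  define h' where "h' n w = bohr_char n w * f w" for n w
  have bb: "AE w in torus. cmod (bohr_char n w) \<le> 1" for n
    by (rule AE_I2) (rule norm_bohr_char_le)
  have h'L: "h' n \<in> L2_space torus" for n
    unfolding h'_def using L2_space_bounded_mult[OF fL bohr_char_measurable bb] by (simp add: mult.commute)
  have lim': "(\<lambda>N. L2_seminorm torus (\<lambda>w. (\<Sum>k=1..N. D k * bohr_char (k * n) w) - h' n w)) \<longlonglongrightarrow> 0" for n
  proof (rule Lim_null_comparison[OF _ hardy2_expansion[OF f(1)]], rule always_eventually, rule allI)
    fix N
    define u where "u x = (\<Sum>k=1..N. D k * bohr_char k x) - f x" for x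
    have u: "u \<in> L2_space torus"
      unfolding u_def by (intro L2_space_diff L2_space_sum L2_space_cmult bohr_char_L2 fL)
    have "L2_seminorm torus (\<lambda>x. (\<Sum>k=1..N. D k * bohr_char (k * n) x) - h' n x)
        = L2_seminorm torus (\<lambda>x. bohr_char n x * u x)"
    proof (rule L2_seminorm_cong_AE)
      show "AE w in torus. cmod ((\<Sum>k=1..N. D k * bohr_char (k * n) w) - h' n w) = cmod (bohr_char n w * u w)"
        by (rule AE_I2) (simp add: u_def h'_def bohr_char_mult right_diff_distrib sum_distrib_left mult_ac)
    qed (use u h'L in \<open>auto intro!: borel_measurable_sum borel_measurable_diff borel_measurable_times\<close>)
    also have "\<dots> \<le> 1 * L2_seminorm torus u"
      by (rule L2_seminorm_le_bounded_mult[OF u bohr_char_measurable bb]) simp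
    finally show "norm (L2_seminorm torus (\<lambda>w. (\<Sum>k=1..N. D k * bohr_char (k * n) w) - h' n w))
        \<le> L2_seminorm torus (\<lambda>w. (\<Sum>n=1..N. bohr_transform f n * bohr_char n w) - f w)"
      unfolding u_def f(2) D_def by simp
  qed
  have "L2_seminorm (lebesgue_on {0<..<1}) (\<lambda>x. \<Sum>n=1..N. b n * \<phi> (real n * x))
      = L2_seminorm unit_measure (\<lambda>x. \<Sum>n=1..N. b n * h n x)"
  proof (rule lebesgue_unit_interval_L2_cong(2))
    show "(\<lambda>x. \<Sum>n=1..N. b n * h n x) \<in> borel_measurable unit_measure"
      by (rule L2_space_measurable, intro L2_space_sum L2_space_cmult h) auto
    have "AE x in unit_measure. \<forall>n\<in>{1..N}. \<phi> (real n * x) = h n x"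
      using \<phi>h by (subst AE_finite_all) auto
    then show "AE x in unit_measure. (\<Sum>n=1..N. b n * \<phi> (real n * x)) = (\<Sum>n=1..N. b n * h n x)"
      by eventually_elim (intro sum.cong, auto)
  qed
  also have "\<dots> = L2_seminorm torus (\<lambda>w. \<Sum>n=1..N. b n * h' n w)"
    by (rule dilated_series_norm_eq[OF sine_orthonormal bohr_orthonormal h h'L lim lim'])
  also have "(\<lambda>w. \<Sum>n=1..N. b n * h' n w) = (\<lambda>w. f w * (\<Sum>n=1..N. b n * bohr_char n w))"
    by (simp add: h'_def sum_distrib_left mult_ac)
  finally show "L2_seminorm (lebesgue_on {0<..<1}) (\<lambda>x. \<Sum>n=1..N. b n * \<phi> (real n * x))
       = L2_seminorm torus (\<lambda>w. f w * (\<Sum>n=1..N. b n * bohr_char n w))" .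
qed

subsection \<open>Equivalence of the boundary conditions\<close>

text \<open>Replacing \<open>f\<close> by 0 where it exceeds the bound alters it on a null set, so
  the Fourier coefficients are unchanged, and the result is bounded at every point. The absolute
  value of C keeps the bound valid for the value 0.\<close>

lemma hardy2_truncation:
  assumes f: "f \<in> hardy2_torus" and bound: "AE w in torus. cmod (f w) \<le> C"
  obtains g where "bounded_hardy g \<bar>C\<bar>" "AE w in torus. f w = g w" "bohr_transform g = bohr_transform f"
proof -
  define g where "g w = (if cmod (f w) \<le> \<bar>C\<bar> then f w else 0)" for w
  have fL: "f \<in> L2_space torus" using f by (simp add: hardy2_torus_def)
  then have fm [measurable]: "f \<in> borel_measurable torus" by auto
  have gm [measurable]: "g \<in> borel_measurable torus" unfolding g_def by measurable
  have eq: "AE w in torus. f w = g w" using bound by eventually_elim (auto simp: g_def)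
  have four: "torus_fourier g \<alpha> = torus_fourier f \<alpha>" for \<alpha>
    unfolding torus_fourier_eq_inner L2_inner_def
  proof (rule integral_cong_AE)
    show "AE w in torus. g w * cnj (torus_char \<alpha> w) = f w * cnj (torus_char \<alpha> w)"
      using eq by eventually_elim simp
  qed measurable
  have "g \<in> L2_space torus" by (rule L2_space_cong_AE[OF fL gm eq])
  then have "g \<in> hardy2_torus" using f by (simp add: hardy2_torus_def analytic_spectrum_def four)
  then have "bounded_hardy g \<bar>C\<bar>"
    by unfold_locales (auto simp: g_def)
  moreover have "bohr_transform g = bohr_transform f" by (simp add: bohr_transform_def four fun_eq_iff)
  ultimately show ?thesis using that eq by blast
qed

lemma hardy_inf_torus_iff:
  assumes f: "f \<in> hardy2_torus"
  shows "f \<in> hardy_inf_torus \<longleftrightarrow> (\<exists>C. AE w in torus. cmod (f w) \<le> C)"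
  using f by (auto simp: hardy_inf_torus_def hardy2_torus_def Linf_space_def)

lemma hardy_inf_torus_iff_Hinf:
  assumes f: "f \<in> hardy2_torus"
  shows "f \<in> hardy_inf_torus \<longleftrightarrow> bohr_transform f \<in> Hinf"
proof
  assume "f \<in> hardy_inf_torus"
  then obtain C where "AE w in torus. cmod (f w) \<le> C" using hardy_inf_torus_iff[OF f] by blast
  from hardy2_truncation[OF f this] obtain g where
    g: "bounded_hardy g \<bar>C\<bar>" "bohr_transform g = bohr_transform f" by metis
  from bounded_hardy.bohr_transform_Hinf[OF g(1)] show "bohr_transform f \<in> Hinf" by (simp add: g(2))
next
  assume "bohr_transform f \<in> Hinf"
  from Hinf_AE_bound[OF f this] show "f \<in> hardy_inf_torus" using hardy_inf_torus_iff[OF f] by blast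
qed

text \<open>The boundary value at (\<gamma>, t) is almost everywhere the value of the truncated
  function at the character rotated by \<open>prime_flow t\<close>, and limits are unique. So the
  condition on characters and t becomes one on rotated points, and by the flow equivalence one on
  the torus.\<close>

lemma boundary_lower_bound_iff:
  assumes f: "f \<in> hardy2_torus" and D: "bohr_transform f \<in> Hinf"
  shows "(AE (\<gamma>, t) in character_measure \<Otimes>\<^sub>M lborel.
            \<exists>L. has_boundary_value (twist (bohr_transform f) \<gamma>) t L \<and> cmod L \<ge> \<epsilon>)
     \<longleftrightarrow> (AE w in torus. cmod (f w) \<ge> \<epsilon>)"
proof -
  obtain g where g: "bounded_hardy g \<bar>Hinf_norm (bohr_transform f)\<bar>" "AE w in torus. f w = g w"
      "bohr_transform g = bohr_transform f"
    by (rule hardy2_truncation[OF f Hinf_AE_bound[OF f D]])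
  interpret bounded_hardy g "\<bar>Hinf_norm (bohr_transform f)\<bar>" by (rule g(1))
  let ?F = "\<lambda>p. torus_mult (prime_flow (snd p)) (fst p)"
  have "(AE (\<gamma>, t) in character_measure \<Otimes>\<^sub>M lborel.
            \<exists>L. has_boundary_value (twist (bohr_transform f) \<gamma>) t L \<and> cmod L \<ge> \<epsilon>)
     \<longleftrightarrow> (AE p in torus \<Otimes>\<^sub>M (lborel :: real measure).
            \<exists>L. has_boundary_value (twist (bohr_transform f) (character_of (fst p))) (snd p) L \<and> cmod L \<ge> \<epsilon>)"
    by (rule AE_character_measure_iff)
  also have "\<dots> \<longleftrightarrow> (AE p in torus \<Otimes>\<^sub>M (lborel :: real measure). \<epsilon> \<le> cmod (g (?F p)))"
  proof -
    have "AE p in torus \<Otimes>\<^sub>M (lborel :: real measure).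
      (\<exists>L. has_boundary_value (twist (bohr_transform f) (character_of (fst p))) (snd p) L \<and> cmod L \<ge> \<epsilon>)
       \<longleftrightarrow> \<epsilon> \<le> cmod (g (?F p))"
      using boundary_value_AE AE_space
    proof eventually_elim
      case (elim p)
      then have w: "fst p \<in> space torus" by (auto simp: space_pair_measure)
      have "twist (bohr_transform f) (character_of (fst p)) = (\<lambda>n. bohr_transform g n * bohr_char n (fst p))"
        by (simp add: fun_eq_iff twist_def character_of_eq[OF w] g(3))
      then show ?case using elim(1) has_boundary_value_unique by (metis (no_types, lifting))
    qed
    then show ?thesis
      by (rule eventually_subst)
  qed
  also have "\<dots> \<longleftrightarrow> (AE w in torus. \<epsilon> \<le> cmod (g w))"
    by (rule AE_flow_pair_iff) measurable
  also have "\<dots> \<longleftrightarrow> (AE w in torus. cmod (f w) \<ge> \<epsilon>)"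
  proof -
    have "AE w in torus. \<epsilon> \<le> cmod (g w) \<longleftrightarrow> cmod (f w) \<ge> \<epsilon>" using g(2) by eventually_elim simp
    then show ?thesis by (rule eventually_subst)
  qed
  finally show ?thesis .
qed

lemma total_measure_iff:
  assumes [measurable]: "f \<in> borel_measurable torus"
  shows "(\<exists>B\<in>sets torus. measure torus B = 1 \<and> (\<forall>z\<in>B. cmod (f z) \<ge> \<epsilon>)) \<longleftrightarrow> (AE w in torus. cmod (f w) \<ge> \<epsilon>)"
proof
  assume "\<exists>B\<in>sets torus. measure torus B = 1 \<and> (\<forall>z\<in>B. cmod (f z) \<ge> \<epsilon>)"
  then obtain B where B: "measure torus B = 1" "\<forall>z\<in>B. cmod (f z) \<ge> \<epsilon>" by blast
  from torus.AE_prob_1[OF B(1)] show "AE w in torus. cmod (f w) \<ge> \<epsilon>"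
    by eventually_elim (use B(2) in auto)
next
  assume "AE w in torus. cmod (f w) \<ge> \<epsilon>"
  then have "measure torus {w \<in> space torus. cmod (f w) \<ge> \<epsilon>} = 1"
    by (subst torus.prob_Collect_eq_1) auto
  then show "\<exists>B\<in>sets torus. measure torus B = 1 \<and> (\<forall>z\<in>B. cmod (f z) \<ge> \<epsilon>)"
    by (intro bexI[of _ "{w \<in> space torus. cmod (f w) \<ge> \<epsilon>}"]) auto
qed

text \<open>Multiplication by 1 / f is bounded by 1 / \<epsilon>, and it recovers P from f
  P.\<close>

lemma multiplier_lower_boundI:
  assumes f: "f \<in> L2_space torus" and \<epsilon>: "\<epsilon> > 0" and bound: "AE w in torus. cmod (f w) \<ge> \<epsilon>"
  shows "\<epsilon> * sqrt (\<Sum>n=1..N. (cmod (b n))\<^sup>2)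
    \<le> L2_seminorm torus (\<lambda>w. f w * (\<Sum>n=1..N. b n * bohr_char n w))"
proof -
  let ?P = "\<lambda>w. \<Sum>n=1..N. b n * bohr_char n w"
  have [measurable]: "f \<in> borel_measurable torus" using f by auto
  have fP: "(\<lambda>w. f w * ?P w) \<in> L2_space torus" by (rule bohr_poly_L2[OF f])
  have "sqrt (\<Sum>n=1..N. (cmod (b n))\<^sup>2) = L2_seminorm torus ?P" by (rule bohr_poly_norm[symmetric])
  also have "\<dots> = L2_seminorm torus (\<lambda>w. inverse (f w) * (f w * ?P w))"
  proof (rule L2_seminorm_cong_AE)
    show "AE w in torus. cmod (?P w) = cmod (inverse (f w) * (f w * ?P w))"
      using bound
    proof eventually_elim
      case (elim w)
      then have "f w \<noteq> 0" using \<epsilon> by auto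
      then show ?case by (simp add: field_simps)
    qed
  qed measurable
  also have "\<dots> \<le> inverse \<epsilon> * L2_seminorm torus (\<lambda>w. f w * ?P w)"
  proof (rule L2_seminorm_le_bounded_mult[OF fP])
    show "AE w in torus. cmod (inverse (f w)) \<le> inverse \<epsilon>"
      using bound by eventually_elim (use \<epsilon> in \<open>simp add: norm_inverse le_imp_inverse_le\<close>)
  qed (use \<epsilon> in \<open>auto\<close>)
  finally show ?thesis using \<epsilon> by (simp add: field_simps)
qed

theorem theorem4p4:
  fixes \<phi> :: "real \<Rightarrow> complex"
    and f :: "(nat \<Rightarrow> complex) \<Rightarrow> complex"
    and D :: "nat \<Rightarrow> complex"
    and \<phi>n :: "nat \<Rightarrow> real \<Rightarrow> complex"
  assumes L2: "\<phi> \<in> L2_space (lebesgue_on {0<..<1})"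
    and periodic: "\<And>x. \<phi> (x + 2) = \<phi> x"
    and odd: "\<And>x. \<phi> (- x) = - \<phi> x"
    and dilates: "\<And>n x. \<phi>n n x = \<phi> (real n * x)"
    and D: "D = sine_transform \<phi>"
    and f: "f \<in> hardy2_torus" "bohr_transform f = D"
  shows
    "(riesz_sequence (lebesgue_on {0<..<1}) \<phi>n \<longleftrightarrow>
        f \<in> hardy_inf_torus \<and>
        (\<exists>\<epsilon>>0. \<exists>B\<in>sets torus. measure torus B = 1 \<and> (\<forall>z\<in>B. cmod (f z) \<ge> \<epsilon>))) \<and>
     (riesz_sequence (lebesgue_on {0<..<1}) \<phi>n \<longleftrightarrow>
        D \<in> Hinf \<and>
        (\<exists>\<epsilon>>0. AE (\<gamma>, t) in character_measure \<Otimes>\<^sub>M lborel.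
                  \<exists>L. has_boundary_value (twist D \<gamma>) t L \<and> cmod L \<ge> \<epsilon>)) \<and>
     (\<forall>\<epsilon>>0.
        (f \<in> hardy_inf_torus \<and>
         (\<exists>B\<in>sets torus. measure torus B = 1 \<and> (\<forall>z\<in>B. cmod (f z) \<ge> \<epsilon>))) \<or>
        (D \<in> Hinf \<and>
         (AE (\<gamma>, t) in character_measure \<Otimes>\<^sub>M lborel.
            \<exists>L. has_boundary_value (twist D \<gamma>) t L \<and> cmod L \<ge> \<epsilon>))
        \<longrightarrow> (\<forall>(N::nat) (b :: nat \<Rightarrow> complex).
              \<epsilon> * sqrt (\<Sum>n=1..N. (cmod (b n))\<^sup>2)
                \<le> L2_seminorm (lebesgue_on {0<..<1}) (\<lambda>x. \<Sum>n=1..N. b n * \<phi>n n x) \<and>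
              L2_seminorm (lebesgue_on {0<..<1}) (\<lambda>x. \<Sum>n=1..N. b n * \<phi>n n x)
                \<le> Hinf_norm D * sqrt (\<Sum>n=1..N. (cmod (b n))\<^sup>2)))"
proof -
  let ?\<Lambda> = "lebesgue_on {0<..<1::real}"
  have fD: "bohr_transform f = sine_transform \<phi>" using f(2) D by simp
  have fL: "f \<in> L2_space torus" using f(1) by (simp add: hardy2_torus_def)
  then have fm: "f \<in> borel_measurable torus" by auto
  have mem: "\<phi>n n \<in> L2_space ?\<Lambda>" if "n \<ge> 1" for n
    using dilates_norm(1)[OF L2 periodic odd f(1) fD, of n] that by (simp add: dilates[abs_def])
  have norm: "L2_seminorm ?\<Lambda> (\<lambda>x. \<Sum>n=1..N. b n * \<phi>n n x)
      = L2_seminorm torus (\<lambda>w. f w * (\<Sum>n=1..N. b n * bohr_char n w))" for N b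
    unfolding dilates by (rule dilates_norm(2)[OF L2 periodic odd f(1) fD])
  have Hinf: "f \<in> hardy_inf_torus \<longleftrightarrow> D \<in> Hinf"
    using hardy_inf_torus_iff_Hinf[OF f(1)] by (simp add: f(2))
  have upper: "L2_seminorm torus (\<lambda>w. f w * (\<Sum>n=1..N. b n * bohr_char n w))
      \<le> Hinf_norm D * sqrt (\<Sum>n=1..N. (cmod (b n))\<^sup>2)" if "D \<in> Hinf" for N b
    using Hinf_multiplier_bound[OF f(1), where N = N and b = b] that by (simp add: f(2))
  have bdry: "(AE (\<gamma>, t) in character_measure \<Otimes>\<^sub>M lborel.
      \<exists>L. has_boundary_value (twist D \<gamma>) t L \<and> cmod L \<ge> \<epsilon>) \<longleftrightarrow> (AE w in torus. cmod (f w) \<ge> \<epsilon>)"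
    if "D \<in> Hinf" for \<epsilon>
    using boundary_lower_bound_iff[OF f(1), of \<epsilon>] that by (simp only: f(2))
  \<comment> \<open>The common middle condition to which both characterisations are reduced: a
    bounded Dirichlet series together with |f| >= \<epsilon> almost everywhere.\<close>
  have riesz: "riesz_sequence ?\<Lambda> \<phi>n \<longleftrightarrow> D \<in> Hinf \<and> (\<exists>\<epsilon>>0. AE w in torus. cmod (f w) \<ge> \<epsilon>)"
  proof
    assume "riesz_sequence ?\<Lambda> \<phi>n"
    then obtain A B where AB: "0 < A" "A \<le> B"
      "\<And>N c. A * sqrt (\<Sum>n=1..N. (cmod (c n))\<^sup>2) \<le> L2_seminorm ?\<Lambda> (\<lambda>x. \<Sum>n=1..N. c n * \<phi>n n x)"
      "\<And>N c. L2_seminorm ?\<Lambda> (\<lambda>x. \<Sum>n=1..N. c n * \<phi>n n x) \<le> B * sqrt (\<Sum>n=1..N. (cmod (c n))\<^sup>2)"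
      unfolding riesz_sequence_def by blast
    have "AE w in torus. A \<le> cmod (f w)"
      by (rule multiplier_lower_bound[OF fL _ AB(3)[unfolded norm]]) (use AB(1) in simp)
    moreover have "AE w in torus. cmod (f w) \<le> B"
      by (rule multiplier_upper_bound[OF fL _ AB(4)[unfolded norm]]) (use AB(1,2) in simp)
    then have "f \<in> hardy_inf_torus" using hardy_inf_torus_iff[OF f(1)] by blast
    ultimately show "D \<in> Hinf \<and> (\<exists>\<epsilon>>0. AE w in torus. cmod (f w) \<ge> \<epsilon>)" using Hinf AB(1) by blast
  next
    assume "D \<in> Hinf \<and> (\<exists>\<epsilon>>0. AE w in torus. cmod (f w) \<ge> \<epsilon>)"
    then obtain \<epsilon> where DH: "D \<in> Hinf" and \<epsilon>: "\<epsilon> > 0" "AE w in torus. cmod (f w) \<ge> \<epsilon>" by blast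
    \<comment> \<open>The definition of a Riesz sequence asks for A <= B; the maximum with
      \<epsilon> ensures this for A = \<epsilon>.\<close>
    have "L2_seminorm ?\<Lambda> (\<lambda>x. \<Sum>n=1..N. c n * \<phi>n n x) \<le> max \<epsilon> (Hinf_norm D) * sqrt (\<Sum>n=1..N. (cmod (c n))\<^sup>2)" for N c
    proof -
      have "Hinf_norm D * sqrt (\<Sum>n=1..N. (cmod (c n))\<^sup>2) \<le> max \<epsilon> (Hinf_norm D) * sqrt (\<Sum>n=1..N. (cmod (c n))\<^sup>2)"
        by (intro mult_right_mono) (auto intro: sum_nonneg)
      with upper[OF DH, where N = N and b = c] show ?thesis unfolding norm by linarith
    qed
    then show "riesz_sequence ?\<Lambda> \<phi>n"
      unfolding riesz_sequence_def using mem \<epsilon>(1) multiplier_lower_boundI[OF fL \<epsilon>] norm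
      by (intro conjI exI[of _ \<epsilon>] exI[of _ "max \<epsilon> (Hinf_norm D)"]) auto
  qed
  have ineq: "\<epsilon> * sqrt (\<Sum>n=1..N. (cmod (b n))\<^sup>2)
                \<le> L2_seminorm ?\<Lambda> (\<lambda>x. \<Sum>n=1..N. b n * \<phi>n n x) \<and>
              L2_seminorm ?\<Lambda> (\<lambda>x. \<Sum>n=1..N. b n * \<phi>n n x)
                \<le> Hinf_norm D * sqrt (\<Sum>n=1..N. (cmod (b n))\<^sup>2)"
    if "D \<in> Hinf" "\<epsilon> > 0" "AE w in torus. cmod (f w) \<ge> \<epsilon>" for \<epsilon> N b
    unfolding norm using multiplier_lower_boundI[OF fL that(2,3)] upper[OF that(1)] by blast
  show ?thesis
    unfolding riesz Hinf total_measure_iff[OF fm] using bdry ineq by blast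
qed

end
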